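(* Assume that $T$ has NIP. Let $\mathfrak C$ be a monster model of $T$, $\bar c$ an enumeration of $\mathfrak C$, $EL=EL(S_{\bar c}(\mathfrak C))$, $\mathcal M$ a minimal left ideal of $EL$ and $u\in\mathcal M$ an idempotent. If $\mathcal M$ is of bounded size, then the natural epimorphism $F\colon u\mathcal M\to \mathrm{Gal}_{KP}(T)$ is an isomorphism (in particular, $T$ is G-compact).
   Context: $\mathfrak C$ is $\kappa$-saturated and strongly $\kappa$-homogeneous for a large strong limit $\kappa$; "bounded" means of cardinality $<\kappa$. $S_{\bar c}(\mathfrak C)=\{\mathrm{tp}(\bar a/\mathfrak C):\bar a\equiv\bar c\}$ (realizations taken in a bigger monster model $\mathfrak C'\succ\mathfrak C$), an $\mathrm{Aut}(\mathfrak C)$-flow via $\sigma(p)=\{\varphi(\bar x,\sigma(\bar a)):\varphi(\bar x,\bar a)\in p\}$; $EL$ is the closure in $S_{\bar c}(\mathfrak C)^{S_{\bar c}(\mathfrak C)}$ of the maps induced by automorphisms, with composition. $\mathrm{Autf}_L(\mathfrak C')$ is the subgroup of $\mathrm{Aut}(\mathfrak C')$ generated by automorphisms fixing pointwise some small elementary submodel. $\mathrm{Autf}_{KP}(\mathfrak C')$ is the group of automorphisms of $\mathfrak C'$ preserving every class of every bounded (i.e. with boundedly many classes) $\emptyset$-type-definable equivalence relation on tuples of bounded length; $\mathrm{Gal}_{KP}(T)=\mathrm{Aut}(\mathfrak C')/\mathrm{Autf}_{KP}(\mathfrak C')$. The natural epimorphism: $\hat F\colon EL\to\mathrm{Gal}_{KP}(T)$,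 $\hat F(\eta)=\sigma'/\mathrm{Autf}_{KP}(\mathfrak C')$ where $\sigma'\in\mathrm{Aut}(\mathfrak C')$ is any automorphism with $\sigma'(\bar c)\models\eta(\mathrm{tp}(\bar c/\mathfrak C))$; this is a well-defined semigroup epimorphism, and $F=\hat F|_{u\mathcal M}$ is a group epimorphism. $T$ is G-compact if the Lascar equivalence relation $E_L$ (lying in the same $\mathrm{Autf}_L$-orbit) coincides with $E_{KP}$ (lying in the same $\mathrm{Autf}_{KP}$-orbit), i.e. $\mathrm{Autf}_L(\mathfrak C')=\mathrm{Autf}_{KP}(\mathfrak C')$. *)

theory Defs
  imports "HOL-Analysis.Function_Topology" "HOL-Algebra.Bij" "HOL-Algebra.Generated_Groups"
begin

unbundle cardinal_syntax

section \<open>First-order logic\<close>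

text \<open>A language is a set of function symbols and a set of relation symbols, each paired with
  its arity.\<close>

record ('f, 'r) lang =
  funs :: "('f \<times> nat) set"
  rels :: "('r \<times> nat) set"

text \<open>Locally nameless syntax: free variables and parameters are atoms \<open>FVar\<close>, drawn from an
  arbitrary type, and bound variables are de Bruijn indices. A formula in the variables
  \<open>x\<^sub>i\<close> (\<open>i \<in> I\<close>) with parameters from \<open>A\<close> has its atoms in the disjoint sum \<open>I <+> A\<close>.\<close>

datatype (dead 'f, fv_tm: 'v) tm =
    FVar 'v
  | BVar nat
  | Fn 'f "('f, 'v) tm list"

datatype (dead 'f, dead 'r, fv: 'v) fm =
    Equal "('f, 'v) tm" "('f, 'v) tm"
  | Pred 'r "('f, 'v) tm list"
  | Neg "('f, 'r, 'v) fm"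
  | Conj "('f, 'r, 'v) fm" "('f, 'r, 'v) fm"
  | Exists "('f, 'r, 'v) fm"

fun wf_tm :: "('f, 'r) lang \<Rightarrow> nat \<Rightarrow> ('f, 'v) tm \<Rightarrow> bool" where
  "wf_tm L k (FVar x) = True"
| "wf_tm L k (BVar n) = (n < k)"
| "wf_tm L k (Fn f ts) = ((f, length ts) \<in> funs L \<and> (\<forall>t\<in>set ts. wf_tm L k t))"

fun wf_fm :: "('f, 'r) lang \<Rightarrow> nat \<Rightarrow> ('f, 'r, 'v) fm \<Rightarrow> bool" where
  "wf_fm L k (Equal s t) = (wf_tm L k s \<and> wf_tm L k t)"
| "wf_fm L k (Pred r ts) = ((r, length ts) \<in> rels L \<and> (\<forall>t\<in>set ts. wf_tm L k t))"
| "wf_fm L k (Neg \<phi>) = wf_fm L k \<phi>"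
| "wf_fm L k (Conj \<phi> \<psi>) = (wf_fm L k \<phi> \<and> wf_fm L k \<psi>)"
| "wf_fm L k (Exists \<phi>) = wf_fm L (Suc k) \<phi>"

definition Form :: "('f, 'r) lang \<Rightarrow> 'v set \<Rightarrow> ('f, 'r, 'v) fm set" where
  "Form L V = {\<phi>. wf_fm L 0 \<phi> \<and> fv \<phi> \<subseteq> V}"

record ('f, 'r, 'a) struct =
  Dom :: "'a set"
  fun_in :: "'f \<Rightarrow> 'a list \<Rightarrow> 'a"
  rel_in :: "'r \<Rightarrow> 'a list \<Rightarrow> bool"

definition is_struct :: "('f, 'r) lang \<Rightarrow> ('f, 'r, 'a) struct \<Rightarrow> bool" where
  "is_struct L M \<longleftrightarrow> Dom M \<noteq> {} \<and>
     (\<forall>(f, n)\<in>funs L. \<forall>xs. length xs = n \<and> set xs \<subseteq> Dom M \<longrightarrow> fun_in M f xs \<in> Dom M)"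

fun eval :: "('f, 'r, 'a) struct \<Rightarrow> ('v \<Rightarrow> 'a) \<Rightarrow> 'a list \<Rightarrow> ('f, 'v) tm \<Rightarrow> 'a" where
  "eval M v bs (FVar x) = v x"
| "eval M v bs (BVar n) = bs ! n"
| "eval M v bs (Fn f ts) = fun_in M f (map (eval M v bs) ts)"

fun sat :: "('f, 'r, 'a) struct \<Rightarrow> ('v \<Rightarrow> 'a) \<Rightarrow> 'a list \<Rightarrow> ('f, 'r, 'v) fm \<Rightarrow> bool" where
  "sat M v bs (Equal s t) = (eval M v bs s = eval M v bs t)"
| "sat M v bs (Pred r ts) = rel_in M r (map (eval M v bs) ts)"
| "sat M v bs (Neg \<phi>) = (\<not> sat M v bs \<phi>)"
| "sat M v bs (Conj \<phi> \<psi>) = (sat M v bs \<phi> \<and> sat M v bs \<psi>)"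
| "sat M v bs (Exists \<phi>) = (\<exists>x\<in>Dom M. sat M v (x # bs) \<phi>)"

text \<open>Theories are sets of sentences; the atom type \<open>nat\<close> is immaterial since no atom occurs, and
  so is the valuation \<open>\<lambda>_. undefined\<close>. A complete theory is taken to be deductively closed, so it
  decides every sentence by membership.\<close>

definition complete_theory :: "('f, 'r) lang \<Rightarrow> ('f, 'r, nat) fm set \<Rightarrow> bool" where
  "complete_theory L T \<longleftrightarrow> T \<subseteq> Form L {} \<and> (\<forall>\<phi>\<in>Form L {}. \<phi> \<in> T \<or> Neg \<phi> \<in> T)"

definition is_model ::
    "('f, 'r) lang \<Rightarrow> ('f, 'r, nat) fm set \<Rightarrow> ('f, 'r, 'a) struct \<Rightarrow> bool" where
  "is_model L T M \<longleftrightarrow> is_struct L M \<and> (\<forall>\<phi>\<in>T. sat M (\<lambda>_. undefined) [] \<phi>)"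

definition elementary_sub ::
    "('f, 'r) lang \<Rightarrow> ('f, 'r, 'a) struct \<Rightarrow> ('f, 'r, 'a) struct \<Rightarrow> bool" where
  "elementary_sub L N M \<longleftrightarrow> is_struct L N \<and> is_struct L M \<and> Dom N \<subseteq> Dom M \<and>
     (\<forall>\<phi>\<in>Form L (Dom N). sat N id [] \<phi> \<longleftrightarrow> sat M id [] \<phi>)"

text \<open>\<open>\<phi>(x, y)\<close> has variables \<open>x = (Inl i)\<^sub>i\<close> and \<open>y = (Inr i)\<^sub>i\<close>; only finitely many of them occur,
  so the \<open>a i\<close> and \<open>b S\<close> stand for finite tuples.\<close>

definition has_IP :: "('f, 'r, 'a) struct \<Rightarrow> ('f, 'r, nat + nat) fm \<Rightarrow> bool" where
  "has_IP M \<phi> \<longleftrightarrow> (\<exists>(a :: nat \<Rightarrow> nat \<Rightarrow> 'a) (b :: nat set \<Rightarrow> nat \<Rightarrow> 'a).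
     (\<forall>i. range (a i) \<subseteq> Dom M) \<and> (\<forall>S. range (b S) \<subseteq> Dom M) \<and>
     (\<forall>i S. sat M (case_sum (a i) (b S)) [] \<phi> \<longleftrightarrow> i \<in> S))"

text \<open>NIP is tested on the models of the theory whose universe lies in the type \<open>'a\<close>. This is
  the usual notion as soon as \<open>'a\<close> carries a sufficiently saturated model, in particular a monster
  model.\<close>

definition NIP :: "('f, 'r) lang \<Rightarrow> ('f, 'r, nat) fm set \<Rightarrow> 'a itself \<Rightarrow> bool" where
  "NIP L T _ \<longleftrightarrow>
     (\<forall>M :: ('f, 'r, 'a) struct. is_model L T M \<longrightarrow> (\<forall>\<phi>\<in>Form L UNIV. \<not> has_IP M \<phi>))"


section \<open>Automorphisms and monster models\<close>

definition Aut :: "('f, 'r) lang \<Rightarrow> ('f, 'r, 'a) struct \<Rightarrow> ('a \<Rightarrow> 'a) set" where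
  "Aut L M = {\<sigma> \<in> Bij (Dom M).
     (\<forall>(f, n)\<in>funs L. \<forall>xs. length xs = n \<and> set xs \<subseteq> Dom M \<longrightarrow>
        \<sigma> (fun_in M f xs) = fun_in M f (map \<sigma> xs)) \<and>
     (\<forall>(r, n)\<in>rels L. \<forall>xs. length xs = n \<and> set xs \<subseteq> Dom M \<longrightarrow>
        (rel_in M r (map \<sigma> xs) \<longleftrightarrow> rel_in M r xs))}"

definition AutG :: "('f, 'r) lang \<Rightarrow> ('f, 'r, 'a) struct \<Rightarrow> ('a \<Rightarrow> 'a) monoid" where
  "AutG L M = (BijGroup (Dom M))\<lparr>carrier := Aut L M\<rparr>"

definition saturated ::
    "('f, 'r) lang \<Rightarrow> 'k rel \<Rightarrow> ('f, 'r, 'a) struct \<Rightarrow> bool" where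
  "saturated L \<kappa> M \<longleftrightarrow>
     (\<forall>A p. A \<subseteq> Dom M \<and> |A| <o \<kappa> \<and> p \<subseteq> Form L ((UNIV :: unit set) <+> A) \<and>
        (\<forall>q\<subseteq>p. finite q \<longrightarrow> (\<exists>d\<in>Dom M. \<forall>\<phi>\<in>q. sat M (case_sum (\<lambda>_. d) id) [] \<phi>)) \<longrightarrow>
        (\<exists>d\<in>Dom M. \<forall>\<phi>\<in>p. sat M (case_sum (\<lambda>_. d) id) [] \<phi>))"

definition strongly_homogeneous ::
    "('f, 'r) lang \<Rightarrow> 'k rel \<Rightarrow> ('f, 'r, 'a) struct \<Rightarrow> bool" where
  "strongly_homogeneous L \<kappa> M \<longleftrightarrow>
     (\<forall>A g. A \<subseteq> Dom M \<and> |A| <o \<kappa> \<and> g ` A \<subseteq> Dom M \<and>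
        (\<forall>\<phi>\<in>Form L A. sat M id [] \<phi> \<longleftrightarrow> sat M g [] \<phi>) \<longrightarrow>
        (\<exists>\<sigma>\<in>Aut L M. \<forall>x\<in>A. \<sigma> x = g x))"

definition strong_limit :: "'k rel \<Rightarrow> bool" where
  "strong_limit \<kappa> \<longleftrightarrow> Cinfinite \<kappa> \<and> (\<forall>X\<subseteq>Field \<kappa>. |X| <o \<kappa> \<longrightarrow> |Pow X| <o \<kappa>)"

text \<open>``Large'' is \<open>|T| < \<kappa>\<close>. For a complete \<open>T\<close> this says that \<open>\<kappa>\<close> is uncountable and exceeds the
  number of symbols.\<close>

definition monster ::
    "('f, 'r) lang \<Rightarrow> ('f, 'r, nat) fm set \<Rightarrow> 'k rel \<Rightarrow> ('f, 'r, 'a) struct \<Rightarrow> bool" where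
  "monster L T \<kappa> M \<longleftrightarrow> strong_limit \<kappa> \<and> |T| <o \<kappa> \<and> is_model L T M \<and>
     saturated L \<kappa> M \<and> strongly_homogeneous L \<kappa> M"


section \<open>Lascar and Kim--Pillay strong automorphisms\<close>

definition Autf_L ::
    "('f, 'r) lang \<Rightarrow> 'k rel \<Rightarrow> ('f, 'r, 'a) struct \<Rightarrow> ('a \<Rightarrow> 'a) set" where
  "Autf_L L \<kappa> M = generate (AutG L M)
     {\<sigma> \<in> Aut L M. \<exists>N. |N| <o \<kappa> \<and> elementary_sub L (M\<lparr>Dom := N\<rparr>) M \<and> (\<forall>x\<in>N. \<sigma> x = x)}"

text \<open>Tuples of bounded length are indexed by subsets of \<open>Field \<kappa>\<close> of cardinality below \<open>\<kappa>\<close>; every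
  tuple of length below \<open>\<kappa>\<close> can be so indexed.\<close>

abbreviation tuples :: "'i set \<Rightarrow> ('f, 'r, 'a) struct \<Rightarrow> ('i \<Rightarrow> 'a) set" where
  "tuples I M \<equiv> I \<rightarrow>\<^sub>E Dom M"

definition bounded_index :: "'k rel \<Rightarrow> 'k set \<Rightarrow> bool" where
  "bounded_index \<kappa> I \<longleftrightarrow> I \<subseteq> Field \<kappa> \<and> |I| <o \<kappa>"

definition type_definable_rel ::
    "('f, 'r) lang \<Rightarrow> ('f, 'r, 'a) struct \<Rightarrow> 'i set \<Rightarrow> ('i \<Rightarrow> 'a) rel \<Rightarrow> bool" where
  "type_definable_rel L M I E \<longleftrightarrow> (\<exists>\<pi>\<subseteq>Form L (I <+> I).
     E = {(a, b). a \<in> tuples I M \<and> b \<in> tuples I M \<and> (\<forall>\<phi>\<in>\<pi>. sat M (case_sum a b) [] \<phi>)})"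

definition Autf_KP ::
    "('f, 'r) lang \<Rightarrow> 'k rel \<Rightarrow> ('f, 'r, 'a) struct \<Rightarrow> ('a \<Rightarrow> 'a) set" where
  "Autf_KP L \<kappa> M = {\<sigma> \<in> Aut L M. \<forall>I E. bounded_index \<kappa> I \<and>
     type_definable_rel L M I E \<and> equiv (tuples I M) E \<and> |tuples I M // E| <o \<kappa> \<longrightarrow>
     (\<forall>X \<in> tuples I M // E. compose I \<sigma> ` X = X)}"

definition Gal_KP ::
    "('f, 'r) lang \<Rightarrow> 'k rel \<Rightarrow> ('f, 'r, 'a) struct \<Rightarrow> ('a \<Rightarrow> 'a) set monoid" where
  "Gal_KP L \<kappa> M = AutG L M Mod Autf_KP L \<kappa> M"

definition orbit_rel ::
    "('f, 'r, 'a) struct \<Rightarrow> ('a \<Rightarrow> 'a) set \<Rightarrow> 'i set \<Rightarrow> ('i \<Rightarrow> 'a) rel" where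
  "orbit_rel M H I = {(a, b). a \<in> tuples I M \<and> (\<exists>\<sigma>\<in>H. b = compose I \<sigma> a)}"

definition G_compact :: "('f, 'r) lang \<Rightarrow> 'k rel \<Rightarrow> ('f, 'r, 'a) struct \<Rightarrow> bool" where
  "G_compact L \<kappa> M \<longleftrightarrow> (\<forall>I. bounded_index \<kappa> I \<longrightarrow>
     orbit_rel M (Autf_L L \<kappa> M) I = orbit_rel M (Autf_KP L \<kappa> M) I)"


section \<open>Semigroups\<close>

definition left_ideal :: "('s, 'm) monoid_scheme \<Rightarrow> 's set \<Rightarrow> bool" where
  "left_ideal S I \<longleftrightarrow> I \<noteq> {} \<and> I \<subseteq> carrier S \<and> (\<forall>s\<in>carrier S. \<forall>x\<in>I. s \<otimes>\<^bsub>S\<^esub> x \<in> I)"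

definition minimal_left_ideal :: "('s, 'm) monoid_scheme \<Rightarrow> 's set \<Rightarrow> bool" where
  "minimal_left_ideal S I \<longleftrightarrow> left_ideal S I \<and> (\<forall>J\<subseteq>I. left_ideal S J \<longrightarrow> J = I)"

definition ideal_group :: "('s, 'm) monoid_scheme \<Rightarrow> 's set \<Rightarrow> 's \<Rightarrow> ('s, 'm) monoid_scheme" where
  "ideal_group S I u = S\<lparr>carrier := (\<lambda>x. u \<otimes>\<^bsub>S\<^esub> x) ` I, one := u\<rparr>"


section \<open>The flow of global types and its Ellis semigroup\<close>

definition tp :: "('f, 'r) lang \<Rightarrow> ('f, 'r, 'a) struct \<Rightarrow> 'i set \<Rightarrow> ('i \<Rightarrow> 'a) \<Rightarrow> 'a set \<Rightarrow>
    ('f, 'r, 'i + 'a) fm set" where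
  "tp L M I a A = {\<phi> \<in> Form L (I <+> A). sat M (case_sum a id) [] \<phi>}"

text \<open>In the following \<open>C \<prec> C'\<close> and \<open>c\<close> is a tuple of \<open>C\<close> indexed by \<open>I\<close>.\<close>

definition S_types :: "('f, 'r) lang \<Rightarrow> ('f, 'r, 'a) struct \<Rightarrow> ('f, 'r, 'a) struct \<Rightarrow>
    'i set \<Rightarrow> ('i \<Rightarrow> 'a) \<Rightarrow> ('f, 'r, 'i + 'a) fm set set" where
  "S_types L C C' I c = {tp L C' I a (Dom C) | a. a \<in> tuples I C' \<and> tp L C' I a {} = tp L C' I c {}}"

definition stone_topology :: "('f, 'r) lang \<Rightarrow> ('f, 'r, 'a) struct \<Rightarrow> ('f, 'r, 'a) struct \<Rightarrow>
    'i set \<Rightarrow> ('i \<Rightarrow> 'a) \<Rightarrow> ('f, 'r, 'i + 'a) fm set topology" where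
  "stone_topology L C C' I c = topology_generated_by
     {{p \<in> S_types L C C' I c. \<phi> \<in> p} | \<phi>. \<phi> \<in> Form L (I <+> Dom C)}"

definition type_act ::
    "('a \<Rightarrow> 'a) \<Rightarrow> ('f, 'r, 'i + 'a) fm set \<Rightarrow> ('f, 'r, 'i + 'a) fm set" where
  "type_act \<sigma> p = map_fm (map_sum id \<sigma>) ` p"

definition EL :: "('f, 'r) lang \<Rightarrow> ('f, 'r, 'a) struct \<Rightarrow> ('f, 'r, 'a) struct \<Rightarrow>
    'i set \<Rightarrow> ('i \<Rightarrow> 'a) \<Rightarrow> (('f, 'r, 'i + 'a) fm set \<Rightarrow> ('f, 'r, 'i + 'a) fm set) monoid" where
  "EL L C C' I c = (let S = S_types L C C' I c in
     \<lparr>carrier = product_topology (\<lambda>_. stone_topology L C C' I c) S closure_of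
                  {restrict (type_act \<sigma>) S | \<sigma>. \<sigma> \<in> Aut L C},
      mult = compose S,
      one = restrict id S\<rparr>)"

text \<open>Right cosets, as in \<open>Mod\<close>. The coset does not depend on the choice of \<open>\<sigma>'\<close>, hence \<open>THE\<close>.\<close>

definition F_hat :: "('f, 'r) lang \<Rightarrow> 'k rel \<Rightarrow> ('f, 'r, 'a) struct \<Rightarrow> ('f, 'r, 'a) struct \<Rightarrow>
    'i set \<Rightarrow> ('i \<Rightarrow> 'a) \<Rightarrow> (('f, 'r, 'i + 'a) fm set \<Rightarrow> ('f, 'r, 'i + 'a) fm set) \<Rightarrow>
    ('a \<Rightarrow> 'a) set" where
  "F_hat L \<kappa>' C C' I c \<eta> = (THE X. \<exists>\<sigma>'\<in>Aut L C'.
     tp L C' I (\<sigma>' \<circ> c) (Dom C) = \<eta> (tp L C' I c (Dom C)) \<and>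
     X = Autf_KP L \<kappa>' C' #>\<^bsub>AutG L C'\<^esub> \<sigma>')"

end

theory Submission
  imports Defs
begin

text \<open>The orbit of a type \<open>u q\<close> consists of values at \<open>q\<close> of elements of \<open>\<M>\<close>, so it is bounded when \<open>\<M>\<close>
  is. By a pigeonhole argument on long sequences, a type with a bounded orbit extends to a
  complete type over \<open>C'\<close> that is invariant under Lascar strong automorphisms. With such a type at hand,
  two tuples are Lascar conjugate iff they have the same type over some copy of the model \<open>C\<close>. Hence
  Lascar equivalence is type-definable and bounded, and it coincides with Kim--Pillay equivalence.

  For injectivity, fix for each \<open>q\<close> a Morley sequence of the invariant extension of \<open>u q\<close>. By NIP the
  truth value of a formula \<open>\<theta>\<close> alternates boundedly often along the Lascar conjugates of this sequence,
  and in a longest alternation the last value says whether \<open>\<theta> \<in> u q\<close>. The alternation rank depends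
  on the parameters of \<open>\<theta>\<close> only up to Lascar strong automorphism, and in an upper semicontinuous way.
  So if \<open>\<eta>\<close> is in the kernel and \<open>\<rho>\<close> is an automorphism close to \<open>\<eta>\<close>, then the rank of
  \<open>\<rho>\<^sup>-\<^sup>1\<theta>\<close> is at most that of \<open>\<theta>\<close>. Given finitely many formulas, choose \<open>\<sigma>\<close> to minimize the sum of the
  ranks of their \<open>\<sigma>\<^sup>-\<^sup>1\<close>-translates: then \<open>\<rho>\<close> preserves these ranks, hence the last values, and
  \<open>\<sigma>\<eta>\<close> agrees with \<open>\<sigma>u\<close> on the given formulas. A limit \<open>\<xi>\<close> of such \<open>\<sigma>\<close> satisfies
  \<open>\<xi>\<eta> = \<xi>u\<close>, which in the group \<open>u\<M>\<close> forces \<open>\<eta> = u\<close>.\<close>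

section \<open>Ultrafilters\<close>

text \<open>Two monsters are in play. \<open>\<M>\<close> is bounded with respect to
  \<open>\<kappa>\<close>, so the pigeonhole argument has to run inside \<open>C\<close>, whereas
  the invariant type must live over \<open>C'\<close>. A finite piece of the invariance involves
  only finitely many parameters of \<open>C'\<close>, and these have a copy in \<open>C\<close> that
  fixes the parameters already there. Once the invariant type exists, \<open>Autf_L\<close> and
  \<open>Autf_KP\<close> coincide, and all later computations are made with cosets of
  \<open>Autf_L\<close>.

  The obstacle to injectivity is that an element of the Ellis semigroup is only a pointwise limit of
  automorphisms: an automorphism near \<open>\<eta>\<close> shares with it finitely many membership
  facts and nothing else. Only closed conditions survive such limits. The existence of an
  alternation is one, which bounds the rank from one side; minimality supplies the other side. Ranks
  attached to \<open>u q\<close> say something about \<open>\<eta> q\<close> because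
  \<open>u\<close> is a right identity of the ideal, so that \<open>\<eta> q\<close> is the value of
  \<open>\<eta>\<close> at \<open>u q\<close>.\<close>

definition fip :: "'x set set \<Rightarrow> bool" where
  "fip \<A> \<longleftrightarrow> (\<forall>F\<subseteq>\<A>. finite F \<longrightarrow> \<Inter>F \<noteq> {})"

lemma fipD: "fip \<A> \<Longrightarrow> F \<subseteq> \<A> \<Longrightarrow> finite F \<Longrightarrow> \<exists>x. \<forall>X\<in>F. x \<in> X"
  unfolding fip_def by (metis Inter_iff all_not_in_conv)

text \<open>A maximal family with the finite intersection property decides every set: if neither
  \<open>X\<close> nor \<open>- X\<close> belonged to it, finite subfamilies would be disjoint from
  \<open>X\<close> and from \<open>- X\<close>, and together they would have empty intersection. It
  serves to complete partial types and to take limits of automorphisms.\<close>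

lemma ultrafilter_exists:
  assumes "fip \<A>"
  shows "\<exists>\<U>. \<A> \<subseteq> \<U> \<and> fip \<U> \<and> (\<forall>X. X \<in> \<U> \<or> - X \<in> \<U>)"
proof -
  let ?Z = "{\<F>. \<A> \<subseteq> \<F> \<and> fip \<F>}"
  have "\<exists>\<U>\<in>?Z. \<forall>\<F>\<in>?Z. \<U> \<subseteq> \<F> \<longrightarrow> \<F> = \<U>"
  proof (rule subset_Zorn_nonempty)
    show "?Z \<noteq> {}" using assms by blast
    fix \<C> assume ne: "\<C> \<noteq> {}" and ch: "subset.chain ?Z \<C>"
    have sub: "\<C> \<subseteq> ?Z" using ch by (auto simp: subset.chain_def)
    have "fip (\<Union>\<C>)"
      unfolding fip_def
    proof (intro allI impI)
      fix F assume "F \<subseteq> \<Union>\<C>" "finite F"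
      then obtain \<F> where "\<F> \<in> \<C>" "F \<subseteq> \<F>"
        using finite_subset_Union_chain[OF _ _ ne ch] by metis
      then show "\<Inter>F \<noteq> {}" using sub \<open>finite F\<close> by (auto simp: fip_def)
    qed
    then show "\<Union>\<C> \<in> ?Z" using sub ne by blast
  qed
  then obtain \<U> where "\<U> \<in> ?Z" and mx: "\<forall>\<F>\<in>?Z. \<U> \<subseteq> \<F> \<longrightarrow> \<F> = \<U>" by (elim bexE)
  then have U: "\<A> \<subseteq> \<U>" "fip \<U>" by simp_all
  have max: "\<F> = \<U>" if "\<A> \<subseteq> \<F>" "fip \<F>" "\<U> \<subseteq> \<F>" for \<F> using mx that by simp
  have small: "\<exists>F\<subseteq>\<U>. finite F \<and> X \<inter> \<Inter>F = {}" if "X \<notin> \<U>" for X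
  proof -
    have "\<not> fip (insert X \<U>)"
    proof
      assume "fip (insert X \<U>)"
      from max[OF _ this] U(1) have "insert X \<U> = \<U>" by (simp add: subset_insertI2 subset_insertI)
      then show False using that by blast
    qed
    then obtain G where G: "G \<subseteq> insert X \<U>" "finite G" "\<Inter>G = {}" unfolding fip_def by metis
    then have "X \<inter> \<Inter>(G - {X}) = {}" by blast
    then show ?thesis using G by (intro exI[of _ "G - {X}"]) auto
  qed
  have "X \<in> \<U> \<or> - X \<in> \<U>" for X
  proof (rule ccontr)
    assume "\<not> ?thesis"
    then obtain F G where "F \<subseteq> \<U>" "finite F" "X \<inter> \<Inter>F = {}"
        "G \<subseteq> \<U>" "finite G" "- X \<inter> \<Inter>G = {}" using small[of X] small[of "- X"] by auto
    moreover from this have "\<Inter>(F \<union> G) = {}" by blast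
    ultimately show False using U(2) unfolding fip_def by (metis Un_subset_iff finite_UnI)
  qed
  with U show ?thesis by blast
qed

section \<open>Formulas\<close>

lemma eval_cong: "(\<And>x. x \<in> fv_tm t \<Longrightarrow> v x = w x) \<Longrightarrow> eval M v bs t = eval M w bs t"
proof (induction t)
  case (Fn f ts)
  then have "map (eval M v bs) ts = map (eval M w bs) ts" by (intro map_cong refl) auto
  then show ?case by (simp only: eval.simps)
qed auto

lemma sat_cong: "(\<And>x. x \<in> fv \<phi> \<Longrightarrow> v x = w x) \<Longrightarrow> sat M v bs \<phi> \<longleftrightarrow> sat M w bs \<phi>"
proof (induction \<phi> arbitrary: bs)
  case (Equal s t)
  then have "eval M v bs s = eval M w bs s" "eval M v bs t = eval M w bs t"
    by (auto intro!: eval_cong)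
  then show ?case by (simp only: sat.simps)
next
  case (Pred r ts)
  then have "map (eval M v bs) ts = map (eval M w bs) ts"
    by (intro map_cong refl eval_cong) auto
  then show ?case by (simp only: sat.simps)
qed auto

lemma eval_map_tm: "eval M v bs (map_tm h t) = eval M (v \<circ> h) bs t"
  by (induction t) (auto simp: comp_def cong: map_cong)

lemma sat_map_fm: "sat M v bs (map_fm h \<phi>) \<longleftrightarrow> sat M (v \<circ> h) bs \<phi>"
  by (induction \<phi> arbitrary: bs) (simp_all add: eval_map_tm comp_def)

lemma wf_map_tm: "wf_tm L k (map_tm h t) = wf_tm L k t"
  by (induction t) auto

lemma wf_map_fm: "wf_fm L k (map_fm h \<phi>) = wf_fm L k \<phi>"
  by (induction \<phi> arbitrary: k) (auto simp: wf_map_tm)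

lemma Form_map_fm: "\<phi> \<in> Form L V \<Longrightarrow> h ` V \<subseteq> W \<Longrightarrow> map_fm h \<phi> \<in> Form L W"
  by (auto simp: Form_def wf_map_fm fm.set_map)

lemma Form_mono: "\<phi> \<in> Form L V \<Longrightarrow> V \<subseteq> W \<Longrightarrow> \<phi> \<in> Form L W"
  by (auto simp: Form_def)

lemma finite_fv: "finite (fv \<phi>)"
  by (induction \<phi>) auto

lemma Form_fv: "\<phi> \<in> Form L V \<Longrightarrow> \<phi> \<in> Form L (fv \<phi>)"
  by (auto simp: Form_def)

lemma Form_simps [simp]:
  "Neg \<phi> \<in> Form L V \<longleftrightarrow> \<phi> \<in> Form L V"
  "Conj \<phi> \<psi> \<in> Form L V \<longleftrightarrow> \<phi> \<in> Form L V \<and> \<psi> \<in> Form L V"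
  "Equal (FVar x) (FVar y) \<in> Form L V \<longleftrightarrow> x \<in> V \<and> y \<in> V"
  by (auto simp: Form_def)

definition Iff :: "('f, 'r, 'v) fm \<Rightarrow> ('f, 'r, 'v) fm \<Rightarrow> ('f, 'r, 'v) fm" where
  "Iff \<phi> \<psi> = Conj (Neg (Conj \<phi> (Neg \<psi>))) (Neg (Conj \<psi> (Neg \<phi>)))"

lemma sat_Iff [simp]: "sat M v bs (Iff \<phi> \<psi>) \<longleftrightarrow> (sat M v bs \<phi> \<longleftrightarrow> sat M v bs \<psi>)"
  by (auto simp: Iff_def)

lemma Iff_Form [simp]: "Iff \<phi> \<psi> \<in> Form L V \<longleftrightarrow> \<phi> \<in> Form L V \<and> \<psi> \<in> Form L V"
  by (auto simp: Iff_def)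

lemma sat_Form_cong:
  "\<phi> \<in> Form L V \<Longrightarrow> (\<And>x. x \<in> V \<Longrightarrow> v x = w x) \<Longrightarrow> sat M v bs \<phi> \<longleftrightarrow> sat M w bs \<phi>"
  by (rule sat_cong) (auto simp: Form_def)

text \<open>The index given to the atom is the number of binders crossed, so it refers to a
  quantifier placed outside all of them. In an environment its value therefore stands last, which
  explains \<open>bs @ [d]\<close> below.\<close>

fun bind_tm :: "'v \<Rightarrow> nat \<Rightarrow> ('f, 'v) tm \<Rightarrow> ('f, 'v) tm" where
  "bind_tm x k (FVar y) = (if y = x then BVar k else FVar y)"
| "bind_tm x k (BVar n) = BVar n"
| "bind_tm x k (Fn f ts) = Fn f (map (bind_tm x k) ts)"

fun bind_fm :: "'v \<Rightarrow> nat \<Rightarrow> ('f, 'r, 'v) fm \<Rightarrow> ('f, 'r, 'v) fm" where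
  "bind_fm x k (Equal s t) = Equal (bind_tm x k s) (bind_tm x k t)"
| "bind_fm x k (Pred r ts) = Pred r (map (bind_tm x k) ts)"
| "bind_fm x k (Neg \<phi>) = Neg (bind_fm x k \<phi>)"
| "bind_fm x k (Conj \<phi> \<psi>) = Conj (bind_fm x k \<phi>) (bind_fm x k \<psi>)"
| "bind_fm x k (Exists \<phi>) = Exists (bind_fm x (Suc k) \<phi>)"

lemma wf_bind_tm: "wf_tm L k t \<Longrightarrow> wf_tm L (Suc k) (bind_tm x k t)"
  by (induction t) auto

lemma wf_bind_fm: "wf_fm L k \<phi> \<Longrightarrow> wf_fm L (Suc k) (bind_fm x k \<phi>)"
  by (induction \<phi> arbitrary: k) (auto simp: wf_bind_tm)

lemma fv_bind_tm: "fv_tm (bind_tm x k t) = fv_tm t - {x}"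
  by (induction t) auto

lemma fv_bind_fm: "fv (bind_fm x k \<phi>) = fv \<phi> - {x}"
  by (induction \<phi> arbitrary: k) (auto simp: fv_bind_tm)

lemma eval_bind_tm:
  "wf_tm L (length bs) t \<Longrightarrow> eval M v (bs @ [d]) (bind_tm x (length bs) t) = eval M (v(x := d)) bs t"
  by (induction t) (auto simp: nth_append cong: map_cong)

lemma sat_bind_fm:
  "wf_fm L (length bs) \<phi> \<Longrightarrow>
     sat M v (bs @ [d]) (bind_fm x (length bs) \<phi>) \<longleftrightarrow> sat M (v(x := d)) bs \<phi>"
proof (induction \<phi> arbitrary: bs)
  case (Pred r ts)
  then have "map (eval M v (bs @ [d]) \<circ> bind_tm x (length bs)) ts = map (eval M (v(x := d)) bs) ts"
    by (intro map_cong refl) (auto simp: eval_bind_tm simp del: fun_upd_apply)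
  then show ?case unfolding bind_fm.simps sat.simps map_map by (simp only:)
next
  case (Exists \<phi>)
  have "sat M v ((y # bs) @ [d]) (bind_fm x (length (y # bs)) \<phi>) \<longleftrightarrow> sat M (v(x := d)) (y # bs) \<phi>" for y
    using Exists.prems by (intro Exists.IH) simp
  then show ?case by (simp del: fun_upd_apply)
qed (auto simp: eval_bind_tm)

lemma ex_atom:
  assumes "\<phi> \<in> Form L U"
  shows "Exists (bind_fm x 0 \<phi>) \<in> Form L (U - {x})"
    and "sat M v [] (Exists (bind_fm x 0 \<phi>)) \<longleftrightarrow> (\<exists>d\<in>Dom M. sat M (v(x := d)) [] \<phi>)"
proof -
  show "Exists (bind_fm x 0 \<phi>) \<in> Form L (U - {x})"
    using assms by (auto simp: Form_def wf_bind_fm fv_bind_fm)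
  have "sat M v [d] (bind_fm x 0 \<phi>) \<longleftrightarrow> sat M (v(x := d)) [] \<phi>" for d
    using sat_bind_fm[of L "[]" \<phi> M v d x] assms by (simp add: Form_def)
  then show "sat M v [] (Exists (bind_fm x 0 \<phi>)) \<longleftrightarrow> (\<exists>d\<in>Dom M. sat M (v(x := d)) [] \<phi>)"
    by (simp only: sat.simps)
qed

lemma ex_atoms:
  assumes "finite V" and "\<phi> \<in> Form L U"
  shows "\<exists>\<psi>\<in>Form L (U - V). \<forall>(M :: ('f, 'r, 'a) struct) v. sat M v [] \<psi> \<longleftrightarrow>
    (\<exists>w. (\<forall>x\<in>V. w x \<in> Dom M) \<and> (\<forall>x. x \<notin> V \<longrightarrow> w x = v x) \<and> sat M w [] \<phi>)"
  using assms(1)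
proof (induction V rule: finite_induct)
  case empty
  show ?case
  proof (rule bexI[of _ \<phi>], intro allI)
    fix M :: "('f, 'r, 'a) struct" and v :: "'b \<Rightarrow> 'a"
    have "(\<forall>x. w x = v x) \<longleftrightarrow> w = v" for w by (simp add: fun_eq_iff)
    then show "sat M v [] \<phi> \<longleftrightarrow>
      (\<exists>w. (\<forall>x\<in>{}. w x \<in> Dom M) \<and> (\<forall>x. x \<notin> {} \<longrightarrow> w x = v x) \<and> sat M w [] \<phi>)"
      by simp
  qed (use assms(2) in simp)
next
  case (insert x V)
  from insert(3) obtain \<psi> where \<psi>: "\<psi> \<in> Form L (U - V)" and
    "\<forall>(M :: ('f, 'r, 'a) struct) v. sat M v [] \<psi> \<longleftrightarrow>
    (\<exists>w. (\<forall>x\<in>V. w x \<in> Dom M) \<and> (\<forall>x. x \<notin> V \<longrightarrow> w x = v x) \<and> sat M w [] \<phi>)" by (elim bexE)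
  note \<psi> = \<psi> this(2)[rule_format]
  have "Exists (bind_fm x 0 \<psi>) \<in> Form L (U - insert x V)"
  proof -
    have "U - insert x V = U - V - {x}" by blast
    then show ?thesis using ex_atom(1)[OF \<psi>(1), of x] by simp
  qed
  moreover have "sat M v [] (Exists (bind_fm x 0 \<psi>)) \<longleftrightarrow>
    (\<exists>w. (\<forall>y\<in>insert x V. w y \<in> Dom M) \<and> (\<forall>y. y \<notin> insert x V \<longrightarrow> w y = v y) \<and> sat M w [] \<phi>)"
    (is "_ \<longleftrightarrow> ?R") for M :: "('f, 'r, 'a) struct" and v
  proof
    assume "sat M v [] (Exists (bind_fm x 0 \<psi>))"
    then obtain d where d: "d \<in> Dom M" "sat M (v(x := d)) [] \<psi>"
      unfolding ex_atom(2)[OF \<psi>(1)] ..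
    from iffD1[OF \<psi>(2) d(2)]
    obtain w where "(\<forall>y\<in>V. w y \<in> Dom M) \<and> (\<forall>y. y \<notin> V \<longrightarrow> w y = (v(x := d)) y) \<and> sat M w [] \<phi>" ..
    then have w: "\<forall>y\<in>V. w y \<in> Dom M" "\<forall>y. y \<notin> V \<longrightarrow> w y = (v(x := d)) y" "sat M w [] \<phi>"
      by simp_all
    then have "w x = d" using insert(2) by simp
    with w d(1) show ?R by (intro exI[of _ w]) auto
  next
    assume ?R
    then obtain w where w: "(\<forall>y\<in>insert x V. w y \<in> Dom M) \<and> (\<forall>y. y \<notin> insert x V \<longrightarrow> w y = v y) \<and>
      sat M w [] \<phi>" ..
    then have "(\<forall>y\<in>V. w y \<in> Dom M) \<and> (\<forall>y. y \<notin> V \<longrightarrow> w y = (v(x := w x)) y) \<and> sat M w [] \<phi>" by simp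
    then have "sat M (v(x := w x)) [] \<psi>" by (intro iffD2[OF \<psi>(2)] exI)
    moreover have "w x \<in> Dom M" using w by simp
    ultimately show "sat M v [] (Exists (bind_fm x 0 \<psi>))" unfolding ex_atom(2)[OF \<psi>(1)] ..
  qed
  ultimately show ?case by blast
qed

lemma conj_fm:
  assumes "finite q" and "q \<subseteq> Form L U"
  shows "\<exists>\<psi>\<in>Form L U. \<forall>(M :: ('f, 'r, 'a) struct) v. sat M v [] \<psi> \<longleftrightarrow> (\<forall>\<phi>\<in>q. sat M v [] \<phi>)"
  using assms
proof (induction q rule: finite_induct)
  case empty
  \<comment> \<open>The empty conjunction has to be a tautology without free atoms, since
    \<open>U\<close> may be empty.\<close>
  let ?E = "Exists (Equal (BVar 0) (BVar 0)) :: ('f, 'r, 'b) fm"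
  show ?case by (rule bexI[of _ "Neg (Conj ?E (Neg ?E))"]) (auto simp: Form_def)
next
  case (insert \<phi> q)
  then obtain \<psi> where "\<psi> \<in> Form L U"
    "\<And>(M :: ('f, 'r, 'a) struct) v. sat M v [] \<psi> \<longleftrightarrow> (\<forall>\<phi>\<in>q. sat M v [] \<phi>)" by auto
  with insert(4) show ?case by (intro bexI[of _ "Conj \<phi> \<psi>"]) auto
qed

text \<open>Atoms in \<open>W\<close> act as parameters with values prescribed by \<open>v\<close>,
  the other atoms of \<open>U\<close> as variables. Partial types in any number of variables over
  any parameters thus need no syntax of their own.\<close>

definition realizable ::
    "('f, 'r, 'a) struct \<Rightarrow> 'v set \<Rightarrow> 'v set \<Rightarrow> ('v \<Rightarrow> 'a) \<Rightarrow> ('f, 'r, 'v) fm set \<Rightarrow> bool" where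
  "realizable M U W v q \<longleftrightarrow>
     (\<exists>w. (\<forall>x\<in>U. w x \<in> Dom M) \<and> (\<forall>x\<in>W. w x = v x) \<and> (\<forall>\<phi>\<in>q. sat M w [] \<phi>))"

definition finsat ::
    "('f, 'r, 'a) struct \<Rightarrow> 'v set \<Rightarrow> 'v set \<Rightarrow> ('v \<Rightarrow> 'a) \<Rightarrow> ('f, 'r, 'v) fm set \<Rightarrow> bool" where
  "finsat M U W v \<Gamma> \<longleftrightarrow> (\<forall>q\<subseteq>\<Gamma>. finite q \<longrightarrow> realizable M U W v q)"

lemma realizableI:
  "(\<And>x. x \<in> U \<Longrightarrow> w x \<in> Dom M) \<Longrightarrow> (\<And>x. x \<in> W \<Longrightarrow> w x = v x) \<Longrightarrow> (\<And>\<phi>. \<phi> \<in> q \<Longrightarrow> sat M w [] \<phi>) \<Longrightarrow>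
     realizable M U W v q"
  unfolding realizable_def by blast

lemma realizable_mono: "realizable M U W v q \<Longrightarrow> q' \<subseteq> q \<Longrightarrow> realizable M U W v q'"
  unfolding realizable_def by blast

text \<open>The formula is fixed before the structure and the valuation; this uniformity is what
  carries realizability from one structure to another. Only the atoms that occur in \<open>q\<close>
  are quantified. The remaining ones receive a dummy value, whence the nonempty domain.\<close>

lemma ex_conj:
  assumes "finite q" "q \<subseteq> Form L U" "W \<subseteq> U"
  shows "\<exists>\<psi>\<in>Form L W. \<forall>(M :: ('f, 'r, 'a) struct) v. Dom M \<noteq> {} \<and> (\<forall>x\<in>W. v x \<in> Dom M) \<longrightarrow>
    (sat M v [] \<psi> \<longleftrightarrow> realizable M U W v q)"
proof -
  define V where "V = (\<Union>\<phi>\<in>q. fv \<phi>) - W"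
  obtain \<chi> where \<chi>: "\<chi> \<in> Form L (\<Union>\<phi>\<in>q. fv \<phi>)"
    "\<And>(M :: ('f, 'r, 'a) struct) v. sat M v [] \<chi> \<longleftrightarrow> (\<forall>\<phi>\<in>q. sat M v [] \<phi>)"
  proof -
    have "q \<subseteq> Form L (\<Union>\<phi>\<in>q. fv \<phi>)" using assms by (auto simp: Form_def)
    from conj_fm[OF assms(1) this] show thesis using that by blast
  qed
  have "finite V" using assms(1) by (auto simp: V_def finite_fv)
  obtain \<psi> where \<psi>: "\<psi> \<in> Form L ((\<Union>\<phi>\<in>q. fv \<phi>) - V)"
    "\<And>(M :: ('f, 'r, 'a) struct) v. sat M v [] \<psi> \<longleftrightarrow>
    (\<exists>w. (\<forall>x\<in>V. w x \<in> Dom M) \<and> (\<forall>x. x \<notin> V \<longrightarrow> w x = v x) \<and> sat M w [] \<chi>)"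
    using ex_atoms[OF \<open>finite V\<close> \<chi>(1)] by blast
  have fvU: "(\<Union>\<phi>\<in>q. fv \<phi>) \<subseteq> U" using assms(2) by (auto simp: Form_def)
  have "sat M v [] \<psi> \<longleftrightarrow> realizable M U W v q" if ne: "Dom M \<noteq> {}" and vW: "\<forall>x\<in>W. v x \<in> Dom M"
    for M :: "('f, 'r, 'a) struct" and v
  proof
    assume "sat M v [] \<psi>"
    then obtain w where w: "\<forall>x\<in>V. w x \<in> Dom M" "\<forall>x. x \<notin> V \<longrightarrow> w x = v x" "\<forall>\<phi>\<in>q. sat M w [] \<phi>"
      unfolding \<psi>(2) \<chi>(2) by blast
    obtain d where d: "d \<in> Dom M" using ne by blast
    define w' where "w' x = (if x \<in> V \<or> x \<in> W then w x else d)" for x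
    have "\<forall>\<phi>\<in>q. sat M w' [] \<phi>"
    proof
      fix \<phi> assume "\<phi> \<in> q"
      then have "sat M w' [] \<phi> = sat M w [] \<phi>" by (intro sat_cong) (auto simp: w'_def V_def)
      then show "sat M w' [] \<phi>" using w \<open>\<phi> \<in> q\<close> by blast
    qed
    moreover have "\<forall>x\<in>W. w' x = v x" using w(2) by (auto simp: w'_def V_def)
    moreover have "\<forall>x\<in>U. w' x \<in> Dom M"
    proof
      fix x show "w' x \<in> Dom M" using w(1,2) vW d by (cases "x \<in> V") (auto simp: w'_def V_def)
    qed
    ultimately show "realizable M U W v q" unfolding realizable_def by blast
  next
    assume "realizable M U W v q"
    then obtain w where w: "\<And>x. x \<in> U \<Longrightarrow> w x \<in> Dom M" "\<And>x. x \<in> W \<Longrightarrow> w x = v x" "\<And>\<phi>. \<phi> \<in> q \<Longrightarrow> sat M w [] \<phi>"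
      unfolding realizable_def by blast
    define w' where "w' x = (if x \<in> V then w x else v x)" for x
    have "\<forall>\<phi>\<in>q. sat M w' [] \<phi>"
    proof
      fix \<phi> assume "\<phi> \<in> q"
      then have "sat M w' [] \<phi> = sat M w [] \<phi>" by (intro sat_cong) (auto simp: w'_def V_def w(2))
      then show "sat M w' [] \<phi>" using w \<open>\<phi> \<in> q\<close> by blast
    qed
    then show "sat M v [] \<psi>" unfolding \<psi>(2) \<chi>(2)
      using w(1) fvU by (intro exI[of _ w']) (auto simp: w'_def V_def)
  qed
  moreover have "\<psi> \<in> Form L W" using \<psi>(1) by (auto simp: Form_def V_def)
  ultimately show ?thesis by blast
qed

text \<open>Equality of types of two tuples, possibly in different structures. Elementarity,
  automorphisms and homogeneity are all expressed through it.\<close>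

definition eqt :: "('f, 'r) lang \<Rightarrow> 'v set \<Rightarrow> ('f, 'r, 'a) struct \<Rightarrow> ('v \<Rightarrow> 'a) \<Rightarrow>
    ('f, 'r, 'a) struct \<Rightarrow> ('v \<Rightarrow> 'a) \<Rightarrow> bool" where
  "eqt L V M v N w \<longleftrightarrow> (\<forall>\<phi>\<in>Form L V. sat M v [] \<phi> \<longleftrightarrow> sat N w [] \<phi>)"

lemma eqtD: "eqt L V M v N w \<Longrightarrow> \<phi> \<in> Form L V \<Longrightarrow> sat M v [] \<phi> \<longleftrightarrow> sat N w [] \<phi>"
  unfolding eqt_def by blast

lemma eqt_sym: "eqt L V M v N w \<Longrightarrow> eqt L V N w M v"
  unfolding eqt_def by blast

lemma eqt_trans: "eqt L V M v N w \<Longrightarrow> eqt L V N w K x \<Longrightarrow> eqt L V M v K x"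
  unfolding eqt_def by blast

lemma eqt_mono: "eqt L V M v N w \<Longrightarrow> W \<subseteq> V \<Longrightarrow> eqt L W M v N w"
  unfolding eqt_def by (meson Form_mono)

lemma eqt_cong:
  assumes "\<And>x. x \<in> V \<Longrightarrow> v x = v' x" "\<And>x. x \<in> V \<Longrightarrow> w x = w' x"
  shows "eqt L V M v N w \<longleftrightarrow> eqt L V M v' N w'"
proof -
  have "sat M v [] \<phi> = sat M v' [] \<phi>" "sat N w [] \<phi> = sat N w' [] \<phi>" if "\<phi> \<in> Form L V" for \<phi>
    using that by (auto intro!: sat_Form_cong assms)
  then show ?thesis unfolding eqt_def by simp
qed

lemma eqt_congI:
  "eqt L V M v N w \<Longrightarrow> (\<And>x. x \<in> V \<Longrightarrow> v x = v' x) \<Longrightarrow> (\<And>x. x \<in> V \<Longrightarrow> w x = w' x) \<Longrightarrow> eqt L V M v' N w'"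
  using eqt_cong[of V v v' w w' L M N] by simp

lemma eqt_comp: "eqt L V M v N w \<Longrightarrow> h ` U \<subseteq> V \<Longrightarrow> eqt L U M (v \<circ> h) N (w \<circ> h)"
  unfolding eqt_def using Form_map_fm[of _ L U h V] by (metis sat_map_fm)

lemma eqt_eq: "eqt L V M v N w \<Longrightarrow> x \<in> V \<Longrightarrow> y \<in> V \<Longrightarrow> v x = v y \<Longrightarrow> w x = w y"
  using eqtD[of L V M v N w "Equal (FVar x) (FVar y)"] by simp

text \<open>The formula of \<open>ex_conj\<close> expresses realizability in both structures, and
  its atoms lie in \<open>W\<close>.\<close>

lemma realizable_transfer:
  assumes "eqt L W M v N w" "q \<subseteq> Form L U" "finite q" "W \<subseteq> U" "Dom M \<noteq> {}" "Dom N \<noteq> {}"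
    "\<And>x. x \<in> W \<Longrightarrow> v x \<in> Dom M" "\<And>x. x \<in> W \<Longrightarrow> w x \<in> Dom N" "realizable M U W v q"
  shows "realizable N U W w q"
proof -
  obtain \<psi> where "\<psi> \<in> Form L W" "\<forall>(M :: ('a, 'b, 'd) struct) v. Dom M \<noteq> {} \<and> (\<forall>x\<in>W. v x \<in> Dom M) \<longrightarrow>
    (sat M v [] \<psi> \<longleftrightarrow> realizable M U W v q)"
    using ex_conj[OF assms(3,2,4)] by metis
  then show ?thesis using assms(5-9) eqtD[OF assms(1)] by metis
qed

lemma finsat_transfer:
  assumes "eqt L W M v N w" "\<Gamma> \<subseteq> Form L U" "W \<subseteq> U" "Dom M \<noteq> {}" "Dom N \<noteq> {}"
    "\<And>x. x \<in> W \<Longrightarrow> v x \<in> Dom M" "\<And>x. x \<in> W \<Longrightarrow> w x \<in> Dom N" "finsat M U W v \<Gamma>"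
  shows "finsat N U W w \<Gamma>"
  unfolding finsat_def
proof (intro allI impI)
  fix q assume q: "q \<subseteq> \<Gamma>" "finite q"
  show "realizable N U W w q"
  proof (rule realizable_transfer[OF assms(1) _ q(2) assms(3-5)])
    show "q \<subseteq> Form L U" using q(1) assms(2) by blast
    show "realizable M U W v q" using q assms(8) unfolding finsat_def by simp
  qed (use assms(6,7) in simp_all)
qed

text \<open>The sets of valuations defined by the members of \<open>\<Gamma>\<close>, together with
  the set of admissible valuations, lie in an ultrafilter; \<open>\<Delta>\<close> collects the
  formulas whose sets belong to it.\<close>

lemma complete_extension:
  fixes \<Gamma> :: "('f, 'r, 'v) fm set"
  assumes "finsat M U W v \<Gamma>" "\<Gamma> \<subseteq> Form L U"
  shows "\<exists>\<Delta>. \<Gamma> \<subseteq> \<Delta> \<and> \<Delta> \<subseteq> Form L U \<and> finsat M U W v \<Delta> \<and> (\<forall>\<phi>\<in>Form L U. \<phi> \<in> \<Delta> \<or> Neg \<phi> \<in> \<Delta>)"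
proof -
  define B where "B = {w. (\<forall>x\<in>U. w x \<in> Dom M) \<and> (\<forall>x\<in>W. w x = v x)}"
  define A where "A \<phi> = {w. sat M w [] \<phi>}" for \<phi> :: "('f, 'r, 'v) fm"
  have "fip (insert B (A ` \<Gamma>))"
    unfolding fip_def
  proof (intro allI impI)
    fix F assume F: "F \<subseteq> insert B (A ` \<Gamma>)" "finite F"
    then have "F - {B} \<subseteq> A ` \<Gamma>" "finite (F - {B})" by auto
    from finite_subset_image[OF this(2,1)]
    obtain q where q: "q \<subseteq> \<Gamma>" "finite q" "F - {B} = A ` q" by metis
    then have "realizable M U W v q" using assms(1) unfolding finsat_def by simp
    then obtain w where "(\<forall>x\<in>U. w x \<in> Dom M) \<and> (\<forall>x\<in>W. w x = v x) \<and> (\<forall>\<phi>\<in>q. sat M w [] \<phi>)"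
      unfolding realizable_def ..
    then have w: "w \<in> B" "\<forall>\<phi>\<in>q. sat M w [] \<phi>" by (simp_all add: B_def)
    have "w \<in> X" if "X \<in> F" for X
    proof (cases "X = B")
      case False
      then have "X \<in> A ` q" using q(3) that by blast
      then show ?thesis using w(2) by (auto simp: A_def)
    qed (use w in simp)
    then show "\<Inter>F \<noteq> {}" by auto
  qed
  then obtain \<U> where \<U>: "insert B (A ` \<Gamma>) \<subseteq> \<U>" "fip \<U>" "\<And>X. X \<in> \<U> \<or> - X \<in> \<U>"
    using ultrafilter_exists by metis
  show ?thesis
  proof (intro exI[of _ "{\<phi> \<in> Form L U. A \<phi> \<in> \<U>}"] conjI ballI)
    show "\<Gamma> \<subseteq> {\<phi> \<in> Form L U. A \<phi> \<in> \<U>}" using assms(2) \<U>(1) by blast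
    show "finsat M U W v {\<phi> \<in> Form L U. A \<phi> \<in> \<U>}"
      unfolding finsat_def
    proof (intro allI impI)
      fix q assume "q \<subseteq> {\<phi> \<in> Form L U. A \<phi> \<in> \<U>}" "finite q"
      then have "\<exists>w. \<forall>X\<in>insert B (A ` q). w \<in> X" using \<U>(1) by (intro fipD[OF \<U>(2)]) auto
      then obtain w where "\<forall>X\<in>insert B (A ` q). w \<in> X" ..
      then have "w \<in> B" "\<And>\<phi>. \<phi> \<in> q \<Longrightarrow> w \<in> A \<phi>" by simp_all
      then show "realizable M U W v q" by (intro realizableI[of _ w]) (simp_all add: A_def B_def)
    qed
    fix \<phi> assume "\<phi> \<in> Form L U"
    moreover have "- A \<phi> = A (Neg \<phi>)" by (auto simp: A_def)
    ultimately show "\<phi> \<in> {\<phi> \<in> Form L U. A \<phi> \<in> \<U>} \<or> Neg \<phi> \<in> {\<phi> \<in> Form L U. A \<phi> \<in> \<U>}"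
      using \<U>(3)[of "A \<phi>"] by simp
  qed blast
qed

section \<open>Saturation and homogeneity\<close>

text \<open>The definition of saturation concerns a single variable. By Zorn there is a maximal
  partial assignment that stays finitely consistent with \<open>\<Gamma>\<close>. It is total: at a
  missing atom the projections of the finite parts of \<open>\<Gamma>\<close> form a type in one
  variable over the values already chosen, of which there are fewer than
  \<open>\<kappa>\<close>.\<close>

lemma saturated_realizes:
  fixes v :: "'v \<Rightarrow> 'a" and M :: "('f, 'r, 'a) struct"
  assumes sat: "saturated L \<kappa> M" and U: "|U| <o \<kappa>" and \<Gamma>: "\<Gamma> \<subseteq> Form L U" and "W \<subseteq> U"
    and ne: "Dom M \<noteq> {}" and fs: "finsat M U W v \<Gamma>"
  shows "realizable M U W v \<Gamma>"
proof -
  \<comment> \<open>Partial assignments are sets of pairs, so that a chain has its union as upper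
    bound. That they are single-valued follows from consistency with the empty part of
    \<open>\<Gamma>\<close>.\<close>
  define P where "P f q \<longleftrightarrow> (\<exists>w. (\<forall>x\<in>U. w x \<in> Dom M) \<and> (\<forall>x a. (x, a) \<in> f \<longrightarrow> w x = a) \<and> (\<forall>\<phi>\<in>q. sat M w [] \<phi>))"
    for f and q :: "('f, 'r, 'v) fm set"
  define g where "g = (\<lambda>x. (x, v x)) ` W"
  define \<Z> where "\<Z> = {f. f \<subseteq> U \<times> UNIV \<and> g \<subseteq> f \<and> (\<forall>q\<subseteq>\<Gamma>. finite q \<longrightarrow> P f q)}"
  have PE: "\<exists>w. (\<forall>x\<in>U. w x \<in> Dom M) \<and> (\<forall>x a. (x, a) \<in> f \<longrightarrow> w x = a) \<and> (\<forall>\<phi>\<in>q. sat M w [] \<phi>)"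
    if "f \<in> \<Z>" "q \<subseteq> \<Gamma>" "finite q" for f q using that unfolding \<Z>_def P_def by simp
  have sv: "a = b" if "f \<in> \<Z>" "(x, a) \<in> f" "(x, b) \<in> f" for f x a b
  proof -
    from PE[OF that(1) empty_subsetI finite.emptyI]
    obtain w where "(\<forall>x\<in>U. w x \<in> Dom M) \<and> (\<forall>x a. (x, a) \<in> f \<longrightarrow> w x = a) \<and> (\<forall>\<phi>\<in>{}. sat M w [] \<phi>)" ..
    then have "w x = a" "w x = b" using that(2,3) by metis+
    then show ?thesis by simp
  qed
  have inD: "a \<in> Dom M" if "f \<in> \<Z>" "(x, a) \<in> f" for f x a
  proof -
    have "x \<in> U" using that unfolding \<Z>_def by blast
    then show ?thesis using PE[of f "{}"] that by auto
  qed
  have "\<exists>f\<in>\<Z>. \<forall>h\<in>\<Z>. f \<subseteq> h \<longrightarrow> h = f"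
  proof (rule subset_Zorn_nonempty)
    have "P g q" if "q \<subseteq> \<Gamma>" "finite q" for q
    proof -
      have "realizable M U W v q" using fs that unfolding finsat_def by simp
      then show ?thesis unfolding realizable_def P_def g_def by (auto simp: image_iff)
    qed
    then have "g \<in> \<Z>" using \<open>W \<subseteq> U\<close> unfolding \<Z>_def by (auto simp: g_def)
    then show "\<Z> \<noteq> {}" by blast
    fix \<C> assume ne: "\<C> \<noteq> {}" and ch: "subset.chain \<Z> \<C>"
    have sub: "\<C> \<subseteq> \<Z>" using ch by (auto simp: subset.chain_def)
    have svU: "a = b" if "(x, a) \<in> \<Union>\<C>" "(x, b) \<in> \<Union>\<C>" for x a b
    proof -
      have "{(x, a), (x, b)} \<subseteq> \<Union>\<C>" using that by blast
      then obtain h where h: "h \<in> \<C>" "{(x, a), (x, b)} \<subseteq> h"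
        using finite_subset_Union_chain[of "{(x, a), (x, b)}" \<C> \<Z>] ne ch by (metis finite.emptyI finite.insertI)
      then show ?thesis using sv[of h x a b] sub by auto
    qed
    have "P (\<Union>\<C>) q" if q: "q \<subseteq> \<Gamma>" "finite q" for q
    proof -
      \<comment> \<open>Only finitely many atoms occur in \<open>q\<close>, so a single member of
        the chain contains all relevant pairs. Its witness is then changed at other atoms to match
        the whole union.\<close>
      define X where "X = (\<Union>\<phi>\<in>q. fv \<phi>)"
      define k where "k = \<Union>\<C> \<inter> X \<times> UNIV"
      have "inj_on fst k"
      proof (rule inj_onI)
        fix p p' assume p: "p \<in> k" "p' \<in> k" and eq: "fst p = fst p'"
        have "(fst p, snd p) \<in> \<Union>\<C>" "(fst p', snd p') \<in> \<Union>\<C>"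
          unfolding prod.collapse using p by (simp_all add: k_def)
        then show "p = p'" using svU[of "fst p'" "snd p" "snd p'"] eq by (simp add: prod_eq_iff)
      qed
      moreover have "fst ` k \<subseteq> X" by (auto simp: k_def)
      moreover have "finite X" using q by (auto simp: X_def finite_fv)
      ultimately have "finite k" by (meson finite_subset inj_on_finite)
      then obtain h where h: "h \<in> \<C>" "k \<subseteq> h"
        using finite_subset_Union_chain[of k \<C> \<Z>] ne ch by (auto simp: k_def)
      obtain w where w: "(\<forall>x\<in>U. w x \<in> Dom M) \<and> (\<forall>x a. (x, a) \<in> h \<longrightarrow> w x = a) \<and> (\<forall>\<phi>\<in>q. sat M w [] \<phi>)"
        using PE[OF subsetD[OF sub h(1)] q] by (rule exE)
      define w' where "w' x = (if \<exists>a. (x, a) \<in> \<Union>\<C> then THE a. (x, a) \<in> \<Union>\<C> else w x)" for x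
      have w': "w' x = a" if "(x, a) \<in> \<Union>\<C>" for x a
        unfolding w'_def using that svU by (auto intro!: the_equality)
      have wX: "w' x = w x" if "x \<in> X" for x
      proof (cases "\<exists>a. (x, a) \<in> \<Union>\<C>")
        case True
        then obtain a where a: "(x, a) \<in> \<Union>\<C>" ..
        then have "(x, a) \<in> h" using that h(2) by (auto simp: k_def)
        then show ?thesis using w w'[OF a] by simp
      qed (simp add: w'_def)
      have "\<forall>\<phi>\<in>q. sat M w' [] \<phi>"
      proof
        fix \<phi> assume "\<phi> \<in> q"
        then have "sat M w' [] \<phi> = sat M w [] \<phi>" by (intro sat_cong wX) (auto simp: X_def)
        then show "sat M w' [] \<phi>" using w \<open>\<phi> \<in> q\<close> by simp
      qed
      moreover have "w' x \<in> Dom M" if "x \<in> U" for x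
      proof (cases "\<exists>a. (x, a) \<in> \<Union>\<C>")
        case True
        then obtain a where a: "(x, a) \<in> \<Union>\<C>" ..
        then obtain h' where "h' \<in> \<C>" "(x, a) \<in> h'" by blast
        then show ?thesis using w'[OF a] inD[of h' x a] sub by auto
      next
        case False
        then have "w' x = w x" unfolding w'_def by (rule if_not_P)
        then show ?thesis using w that by simp
      qed
      ultimately show ?thesis using w' unfolding P_def by (intro exI[of _ w']) simp
    qed
    then show "\<Union>\<C> \<in> \<Z>" using sub ne unfolding \<Z>_def by auto
  qed
  then obtain f where f: "f \<in> \<Z>" and max: "\<forall>h\<in>\<Z>. f \<subseteq> h \<longrightarrow> h = f" ..
  define fn where "fn x = (THE a. (x, a) \<in> f)" for x
  have fn: "fn x = a" if "(x, a) \<in> f" for x a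
    unfolding fn_def using sv[OF f] that by blast
  have total: "(x, fn x) \<in> f" if x: "x \<in> U" for x
  proof (rule ccontr)
    assume "(x, fn x) \<notin> f"
    then have nin: "(x, a) \<notin> f" for a using fn[of x a] by auto
    define D where "D = Domain f"
    have DU: "D \<subseteq> U" using f unfolding \<Z>_def D_def by auto
    have fnD: "(y, fn y) \<in> f" if "y \<in> D" for y using that fn unfolding D_def by auto
    have xD: "x \<notin> D" using nin unfolding D_def by auto
    define A where "A = fn ` D"
    have A: "A \<subseteq> Dom M" using inD[OF f fnD] by (auto simp: A_def)
    have "|A| \<le>o |U|" unfolding A_def
      by (rule ordLeq_transitive[OF card_of_image card_of_mono1[OF DU]])
    then have Ak: "|A| <o \<kappa>" using U by (rule ordLeq_ordLess_trans)
    have "\<forall>q. \<exists>\<psi>. q \<subseteq> \<Gamma> \<and> finite q \<longrightarrow> \<psi> \<in> Form L (insert x D) \<and>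
      (\<forall>w. (\<forall>y\<in>insert x D. w y \<in> Dom M) \<longrightarrow> (sat M w [] \<psi> \<longleftrightarrow> realizable M U (insert x D) w q))"
    proof
      fix q
      show "\<exists>\<psi>. q \<subseteq> \<Gamma> \<and> finite q \<longrightarrow> \<psi> \<in> Form L (insert x D) \<and>
        (\<forall>w. (\<forall>y\<in>insert x D. w y \<in> Dom M) \<longrightarrow> (sat M w [] \<psi> \<longleftrightarrow> realizable M U (insert x D) w q))"
      proof (cases "q \<subseteq> \<Gamma> \<and> finite q")
        case True
        then have "finite q" "q \<subseteq> Form L U" "insert x D \<subseteq> U" using \<Gamma> x DU by auto
        from ex_conj[OF this] obtain \<psi> where "\<psi> \<in> Form L (insert x D)"
          "\<forall>(M :: ('f, 'r, 'a) struct) w. Dom M \<noteq> {} \<and> (\<forall>y\<in>insert x D. w y \<in> Dom M) \<longrightarrow>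
            (sat M w [] \<psi> \<longleftrightarrow> realizable M U (insert x D) w q)" by (rule bexE)
        with ne show ?thesis by (intro exI[of _ \<psi>]) simp
      next
        case False
        then show ?thesis by (intro exI) (rule impI, simp only: simp_thms)
      qed
    qed
    from choice[OF this] obtain \<psi> where "\<forall>q. q \<subseteq> \<Gamma> \<and> finite q \<longrightarrow> \<psi> q \<in> Form L (insert x D) \<and>
      (\<forall>w. (\<forall>y\<in>insert x D. w y \<in> Dom M) \<longrightarrow> (sat M w [] (\<psi> q) \<longleftrightarrow> realizable M U (insert x D) w q))" ..
    then have \<psi>F: "\<And>q. q \<subseteq> \<Gamma> \<Longrightarrow> finite q \<Longrightarrow> \<psi> q \<in> Form L (insert x D)"
      and \<psi>s: "\<And>q w. q \<subseteq> \<Gamma> \<Longrightarrow> finite q \<Longrightarrow> (\<forall>y\<in>insert x D. w y \<in> Dom M) \<Longrightarrow>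
         sat M w [] (\<psi> q) \<longleftrightarrow> realizable M U (insert x D) w q" by simp_all
    \<comment> \<open>The assigned atoms become parameters and \<open>x\<close> the only variable;
      all other atoms of \<open>U\<close> have been quantified away in
      \<open>\<psi> q\<close>.\<close>
    define h where "h y = (if y = x then Inl () else Inr (fn y))" for y
    define \<theta> where "\<theta> q = map_fm h (\<psi> q)" for q
    define p where "p = \<theta> ` {q. q \<subseteq> \<Gamma> \<and> finite q}"
    have pF: "p \<subseteq> Form L ((UNIV :: unit set) <+> A)"
    proof -
      have "h ` insert x D \<subseteq> UNIV <+> A" by (auto simp: h_def A_def)
      then have "map_fm h (\<psi> q) \<in> Form L (UNIV <+> A)" if "q \<subseteq> \<Gamma>" "finite q" for q
        using \<psi>F[OF that] by (rule Form_map_fm[rotated])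
      then show ?thesis unfolding p_def \<theta>_def by blast
    qed
    have \<theta>s: "sat M (case_sum (\<lambda>_. d) id) [] (\<theta> q) \<longleftrightarrow> realizable M U (insert x D) (fn(x := d)) q"
      if "q \<subseteq> \<Gamma>" "finite q" "d \<in> Dom M" for q d
    proof -
      have "case_sum (\<lambda>_. d) id \<circ> h = fn(x := d)" by (auto simp: h_def)
      moreover have "\<forall>y\<in>insert x D. (fn(x := d)) y \<in> Dom M" using A that by (auto simp: A_def)
      ultimately show ?thesis using \<psi>s[OF that(1,2)] unfolding \<theta>_def sat_map_fm by simp
    qed
    have fin: "\<exists>d\<in>Dom M. \<forall>\<phi>\<in>r. sat M (case_sum (\<lambda>_. d) id) [] \<phi>" if r: "r \<subseteq> p" "finite r" for r
    proof -
      from finite_subset_image[OF r(2) r(1)[unfolded p_def]]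
      obtain Q where Q: "Q \<subseteq> {q. q \<subseteq> \<Gamma> \<and> finite q}" "finite Q" "r = \<theta> ` Q" by metis
      \<comment> \<open>Finitely many of these formulas come from finitely many finite parts of
        \<open>\<Gamma>\<close>. Their union is again a finite part, and the value at
        \<open>x\<close> in one of its realizations serves them all.\<close>
      then have "\<Union>Q \<subseteq> \<Gamma>" "finite (\<Union>Q)" by auto
      from PE[OF f this] obtain w where w: "(\<forall>x\<in>U. w x \<in> Dom M) \<and> (\<forall>x a. (x, a) \<in> f \<longrightarrow> w x = a) \<and>
        (\<forall>\<phi>\<in>\<Union>Q. sat M w [] \<phi>)" ..
      show ?thesis
      proof (intro bexI ballI)
        show wx: "w x \<in> Dom M" using w x by simp
        fix \<phi> assume "\<phi> \<in> r"
        then obtain q where q: "q \<in> Q" "\<phi> = \<theta> q" using Q(3) by auto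
        have "realizable M U (insert x D) (fn(x := w x)) q"
        proof (rule realizableI[of _ w])
          fix y assume "y \<in> insert x D"
          then show "w y = (fn(x := w x)) y" using fnD[of y] w xD by auto
        qed (use w q in auto)
        then show "sat M (case_sum (\<lambda>_. w x) id) [] \<phi>" using q Q(1) \<theta>s[of q "w x"] wx by auto
      qed
    qed
    obtain d where d: "d \<in> Dom M" "\<forall>\<phi>\<in>p. sat M (case_sum (\<lambda>_. d) id) [] \<phi>"
    proof -
      have "A \<subseteq> Dom M \<and> |A| <o \<kappa> \<and> p \<subseteq> Form L ((UNIV :: unit set) <+> A) \<and>
        (\<forall>q\<subseteq>p. finite q \<longrightarrow> (\<exists>d\<in>Dom M. \<forall>\<phi>\<in>q. sat M (case_sum (\<lambda>_. d) id) [] \<phi>))"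
        using A Ak pF fin by simp
      from sat[unfolded saturated_def, rule_format, OF this] that show thesis by metis
    qed
    have "insert (x, d) f \<in> \<Z>"
    proof -
      have "P (insert (x, d) f) q" if q: "q \<subseteq> \<Gamma>" "finite q" for q
      proof -
        have "\<theta> q \<in> p" using q by (auto simp: p_def)
        then have "realizable M U (insert x D) (fn(x := d)) q" using \<theta>s[OF q d(1)] d(2) by simp
        then obtain w where w: "(\<forall>y\<in>U. w y \<in> Dom M) \<and> (\<forall>y\<in>insert x D. w y = (fn(x := d)) y) \<and>
          (\<forall>\<phi>\<in>q. sat M w [] \<phi>)" unfolding realizable_def ..
        have "w y = a" if "(y, a) \<in> insert (x, d) f" for y a
        proof (cases "y = x")
          case True
          then show ?thesis using w that nin by auto
        next
          case False
          then have ya: "(y, a) \<in> f" using that by simp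
          then have "y \<in> D" by (auto simp: D_def)
          then show ?thesis using w False fn[OF ya] by auto
        qed
        then show ?thesis unfolding P_def using w by (intro exI[of _ w]) simp
      qed
      then show ?thesis using f x unfolding \<Z>_def by auto
    qed
    then have "insert (x, d) f = f" using max by auto
    then show False using nin by blast
  qed
  show ?thesis
  proof (rule realizableI[of _ fn])
    show "fn x \<in> Dom M" if "x \<in> U" for x using inD[OF f total[OF that]] .
    show "fn x = v x" if "x \<in> W" for x using f that by (intro fn) (auto simp: \<Z>_def g_def)
    fix \<phi> assume \<phi>: "\<phi> \<in> \<Gamma>"
    then have "\<exists>w. (\<forall>x\<in>U. w x \<in> Dom M) \<and> (\<forall>x a. (x, a) \<in> f \<longrightarrow> w x = a) \<and> (\<forall>\<phi>\<in>{\<phi>}. sat M w [] \<phi>)"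
      by (intro PE[OF f]) auto
    then obtain w where w: "(\<forall>x\<in>U. w x \<in> Dom M) \<and> (\<forall>x a. (x, a) \<in> f \<longrightarrow> w x = a) \<and> (\<forall>\<phi>\<in>{\<phi>}. sat M w [] \<phi>)" ..
    have "sat M fn [] \<phi> = sat M w [] \<phi>"
    proof (rule sat_Form_cong)
      show "\<phi> \<in> Form L U" using \<phi> \<Gamma> by auto
      show "fn x = w x" if "x \<in> U" for x using w total[OF that] by auto
    qed
    then show "sat M fn [] \<phi>" using w by simp
  qed
qed

text \<open>Homogeneity is about maps on sets, while tuples may repeat entries. A section
  \<open>k\<close> of \<open>v\<close> turns the correspondence of tuples into a map on the set of
  entries; it is correct on all of \<open>V\<close> because equations between entries belong to the
  type.\<close>

lemma strongly_homogeneous_extends: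
  fixes v w :: "'v \<Rightarrow> 'a" and M :: "('f, 'r, 'a) struct"
  assumes hom: "strongly_homogeneous L \<kappa> M" and V: "|V| <o \<kappa>"
    and v: "\<And>x. x \<in> V \<Longrightarrow> v x \<in> Dom M" and w: "\<And>x. x \<in> V \<Longrightarrow> w x \<in> Dom M" and eq: "eqt L V M v M w"
  shows "\<exists>\<sigma>\<in>Aut L M. \<forall>x\<in>V. \<sigma> (v x) = w x"
proof -
  define A where "A = v ` V"
  define k where "k = inv_into V v"
  have kV: "k a \<in> V" "v (k a) = a" if "a \<in> A" for a
    using that by (auto simp: k_def A_def inv_into_into f_inv_into_f)
  have wk: "w (k (v x)) = w x" if "x \<in> V" for x
    using eqt_eq[OF eq, of "k (v x)" x] kV[of "v x"] that by (auto simp: A_def)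
  have Ak: "|A| <o \<kappa>" unfolding A_def by (rule ordLeq_ordLess_trans[OF card_of_image V])
  have "sat M id [] \<phi> \<longleftrightarrow> sat M (w \<circ> k) [] \<phi>" if \<phi>: "\<phi> \<in> Form L A" for \<phi>
  proof -
    have "k ` A \<subseteq> V" using kV(1) by auto
    from eqtD[OF eq Form_map_fm[OF \<phi> this]]
    have "sat M (v \<circ> k) [] \<phi> \<longleftrightarrow> sat M (w \<circ> k) [] \<phi>" by (simp only: sat_map_fm)
    moreover have "sat M (v \<circ> k) [] \<phi> \<longleftrightarrow> sat M id [] \<phi>"
      using kV(2) by (intro sat_Form_cong[OF \<phi>]) simp
    ultimately show ?thesis by simp
  qed
  then have "A \<subseteq> Dom M \<and> |A| <o \<kappa> \<and> (w \<circ> k) ` A \<subseteq> Dom M \<and>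
    (\<forall>\<phi>\<in>Form L A. sat M id [] \<phi> \<longleftrightarrow> sat M (w \<circ> k) [] \<phi>)"
    using Ak v w kV by (auto simp: A_def)
  from hom[unfolded strongly_homogeneous_def, rule_format, OF this]
  obtain \<sigma> where "\<sigma> \<in> Aut L M" "\<forall>x\<in>A. \<sigma> x = (w \<circ> k) x" by metis
  then show ?thesis using wk by (intro bexI[of _ \<sigma>]) (auto simp: A_def)
qed

section \<open>Automorphisms and elementary submodels\<close>

lemma eval_in_Dom:
  assumes "is_struct L M" "\<And>x. x \<in> fv_tm t \<Longrightarrow> v x \<in> Dom M" "set bs \<subseteq> Dom M" "wf_tm L (length bs) t"
  shows "eval M v bs t \<in> Dom M"
  using assms(2,4)
proof (induction t)
  case (BVar n)
  then show ?case using assms(3) by (auto simp: subset_iff)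
next
  case (Fn f ts)
  then have "set (map (eval M v bs) ts) \<subseteq> Dom M" by auto
  then show ?case using assms(1) Fn(3) unfolding is_struct_def by fastforce
qed auto

text \<open>Stated for two structures, since it serves automorphisms, the identity between a
  submodel and the restriction of the big structure, and the image of a submodel under an
  automorphism. Agreement is asked only for symbols of \<open>L\<close> on arguments from the
  domain, as structures are arbitrary elsewhere.\<close>

lemma sat_iso:
  fixes M N :: "('f, 'r, 'a) struct"
  assumes "is_struct L M" and "\<sigma> ` Dom M = Dom N" and inj: "inj_on \<sigma> (Dom M)"
    and fn: "\<And>f xs. (f, length xs) \<in> funs L \<Longrightarrow> set xs \<subseteq> Dom M \<Longrightarrow> \<sigma> (fun_in M f xs) = fun_in N f (map \<sigma> xs)"
    and rl: "\<And>r xs. (r, length xs) \<in> rels L \<Longrightarrow> set xs \<subseteq> Dom M \<Longrightarrow> rel_in N r (map \<sigma> xs) \<longleftrightarrow> rel_in M r xs"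
    and "\<And>x. x \<in> fv \<phi> \<Longrightarrow> v x \<in> Dom M" and "\<And>x. x \<in> fv \<phi> \<Longrightarrow> w x = \<sigma> (v x)"
    and "set bs \<subseteq> Dom M" and "wf_fm L (length bs) \<phi>"
  shows "sat N w (map \<sigma> bs) \<phi> \<longleftrightarrow> sat M v bs \<phi>"
proof -
  have ev: "eval N w (map \<sigma> bs) t = \<sigma> (eval M v bs t)"
    if "\<And>x. x \<in> fv_tm t \<Longrightarrow> v x \<in> Dom M" "\<And>x. x \<in> fv_tm t \<Longrightarrow> w x = \<sigma> (v x)"
      "set bs \<subseteq> Dom M" "wf_tm L (length bs) t" for t bs
    using that(1,2,4)
  proof (induction t)
    case (Fn f ts)
    have "map (eval N w (map \<sigma> bs)) ts = map \<sigma> (map (eval M v bs) ts)"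
      using Fn by auto
    moreover have "eval M v bs t \<in> Dom M" if "t \<in> set ts" for t
      by (rule eval_in_Dom[OF assms(1)]) (use Fn \<open>set bs \<subseteq> Dom M\<close> that in auto)
    then have "set (map (eval M v bs) ts) \<subseteq> Dom M" by auto
    ultimately show ?case using fn[of f "map (eval M v bs) ts"] Fn(4)
      by (simp del: map_map map_eq_conv)
  qed simp_all
  show ?thesis using assms(6-9)
  proof (induction \<phi> arbitrary: bs)
    case (Equal s t)
    have s: "eval M v bs s \<in> Dom M" by (rule eval_in_Dom[OF assms(1)]) (use Equal in auto)
    have t: "eval M v bs t \<in> Dom M" by (rule eval_in_Dom[OF assms(1)]) (use Equal in auto)
    have "eval N w (map \<sigma> bs) s = \<sigma> (eval M v bs s)" by (rule ev) (use Equal in auto)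
    moreover have "eval N w (map \<sigma> bs) t = \<sigma> (eval M v bs t)" by (rule ev) (use Equal in auto)
    ultimately show ?case using inj_onD[OF inj _ s t] by auto
  next
    case (Pred r ts)
    have "eval N w (map \<sigma> bs) t = \<sigma> (eval M v bs t)" if "t \<in> set ts" for t
      by (rule ev) (use Pred that in auto)
    then have "map (eval N w (map \<sigma> bs)) ts = map \<sigma> (map (eval M v bs) ts)" by auto
    moreover have "eval M v bs t \<in> Dom M" if "t \<in> set ts" for t
      by (rule eval_in_Dom[OF assms(1)]) (use Pred that in auto)
    then have "set (map (eval M v bs) ts) \<subseteq> Dom M" by auto
    ultimately show ?case using rl[of r "map (eval M v bs) ts"] Pred(4)
      by (simp del: map_map map_eq_conv)
  next
    case (Exists \<phi>)
    have "sat N w (map \<sigma> (x # bs)) \<phi> \<longleftrightarrow> sat M v (x # bs) \<phi>" if "x \<in> Dom M" for x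
      by (rule Exists.IH) (use Exists.prems that in auto)
    then have "(\<exists>x\<in>Dom M. sat N w (map \<sigma> (x # bs)) \<phi>) \<longleftrightarrow> sat M v bs (Exists \<phi>)" by simp
    then show ?case using assms(2) by (auto simp flip: assms(2))
  qed auto
qed

lemma Aut_D:
  assumes "\<sigma> \<in> Aut L M"
  shows "bij_betw \<sigma> (Dom M) (Dom M)" "\<sigma> ` Dom M = Dom M" "inj_on \<sigma> (Dom M)" "\<sigma> \<in> extensional (Dom M)"
    "\<And>x. x \<in> Dom M \<Longrightarrow> \<sigma> x \<in> Dom M"
    "\<And>f xs. (f, length xs) \<in> funs L \<Longrightarrow> set xs \<subseteq> Dom M \<Longrightarrow> \<sigma> (fun_in M f xs) = fun_in M f (map \<sigma> xs)"
    "\<And>r xs. (r, length xs) \<in> rels L \<Longrightarrow> set xs \<subseteq> Dom M \<Longrightarrow> rel_in M r (map \<sigma> xs) \<longleftrightarrow> rel_in M r xs"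
proof -
  show b: "bij_betw \<sigma> (Dom M) (Dom M)" and "\<sigma> \<in> extensional (Dom M)"
    using assms by (auto simp: Aut_def Bij_def)
  then show i: "\<sigma> ` Dom M = Dom M" "inj_on \<sigma> (Dom M)" by (auto simp: bij_betw_def)
  then show "\<And>x. x \<in> Dom M \<Longrightarrow> \<sigma> x \<in> Dom M" by auto
qed (use assms in \<open>auto simp: Aut_def\<close>)

lemma Aut_I:
  assumes "bij_betw \<sigma> (Dom M) (Dom M)" "\<sigma> \<in> extensional (Dom M)"
    "\<And>f xs. (f, length xs) \<in> funs L \<Longrightarrow> set xs \<subseteq> Dom M \<Longrightarrow> \<sigma> (fun_in M f xs) = fun_in M f (map \<sigma> xs)"
    "\<And>r xs. (r, length xs) \<in> rels L \<Longrightarrow> set xs \<subseteq> Dom M \<Longrightarrow> rel_in M r (map \<sigma> xs) \<longleftrightarrow> rel_in M r xs"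
  shows "\<sigma> \<in> Aut L M"
  using assms unfolding Aut_def Bij_def by auto

lemma eqt_Aut:
  assumes "is_struct L M" "\<sigma> \<in> Aut L M" "\<And>x. x \<in> V \<Longrightarrow> v x \<in> Dom M" "\<And>x. x \<in> V \<Longrightarrow> w x = \<sigma> (v x)"
  shows "eqt L V M v M w"
  unfolding eqt_def
proof
  fix \<phi> assume "\<phi> \<in> Form L V"
  then have "sat M w (map \<sigma> []) \<phi> \<longleftrightarrow> sat M v [] \<phi>"
    using Aut_D[OF assms(2)] assms(3,4) by (intro sat_iso[OF assms(1)]) (auto simp: Form_def)
  then show "sat M v [] \<phi> \<longleftrightarrow> sat M w [] \<phi>" by simp
qed

lemma Aut_compose:
  assumes "is_struct L M" "\<sigma> \<in> Aut L M" "\<tau> \<in> Aut L M"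
  shows "compose (Dom M) \<sigma> \<tau> \<in> Aut L M"
proof (rule Aut_I)
  show "bij_betw (compose (Dom M) \<sigma> \<tau>) (Dom M) (Dom M)"
    using Aut_D(1)[OF assms(2)] Aut_D(1)[OF assms(3)] by (simp add: bij_betw_compose)
  have *: "map (compose (Dom M) \<sigma> \<tau>) xs = map \<sigma> (map \<tau> xs)" "set (map \<tau> xs) \<subseteq> Dom M"
    if "set xs \<subseteq> Dom M" for xs
    using that Aut_D(5)[OF assms(3)] by (auto simp: compose_def)
  show "compose (Dom M) \<sigma> \<tau> (fun_in M f xs) = fun_in M f (map (compose (Dom M) \<sigma> \<tau>) xs)"
    if "(f, length xs) \<in> funs L" "set xs \<subseteq> Dom M" for f xs
  proof -
    have "fun_in M f xs \<in> Dom M" using assms(1) that unfolding is_struct_def by fastforce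
    then have "compose (Dom M) \<sigma> \<tau> (fun_in M f xs) = \<sigma> (\<tau> (fun_in M f xs))" by (simp add: compose_def)
    also have "\<dots> = fun_in M f (map \<sigma> (map \<tau> xs))"
      using Aut_D(6)[OF assms(3) that] Aut_D(6)[OF assms(2) _ *(2)[OF that(2)]] that by simp
    finally show ?thesis by (simp only: *(1)[OF that(2)])
  qed
  show "rel_in M r (map (compose (Dom M) \<sigma> \<tau>) xs) \<longleftrightarrow> rel_in M r xs"
    if "(r, length xs) \<in> rels L" "set xs \<subseteq> Dom M" for r xs
    using Aut_D(7)[OF assms(3) that] Aut_D(7)[OF assms(2) _ *(2)[OF that(2)]] that
    by (simp only: *(1)[OF that(2)] length_map)
qed (simp add: compose_def)

text \<open>The restriction makes the inverse extensional, as every member of \<open>Aut\<close> has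
  to be.\<close>

definition aut_inv :: "('f, 'r, 'a) struct \<Rightarrow> ('a \<Rightarrow> 'a) \<Rightarrow> 'a \<Rightarrow> 'a" where
  "aut_inv M \<sigma> = restrict (inv_into (Dom M) \<sigma>) (Dom M)"

lemma aut_inv:
  assumes "\<sigma> \<in> Aut L M" "x \<in> Dom M"
  shows "aut_inv M \<sigma> (\<sigma> x) = x" "\<sigma> (aut_inv M \<sigma> x) = x" "aut_inv M \<sigma> x \<in> Dom M"
  using Aut_D(1-5)[OF assms(1)] assms(2)
  by (auto simp: aut_inv_def f_inv_into_f inv_into_into)

lemma Aut_inv:
  assumes "is_struct L M" "\<sigma> \<in> Aut L M"
  shows "aut_inv M \<sigma> \<in> Aut L M"
proof (rule Aut_I)
  note D = Aut_D[OF assms(2)] and I = aut_inv[OF assms(2)]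
  show "bij_betw (aut_inv M \<sigma>) (Dom M) (Dom M)"
    using D(1) unfolding aut_inv_def by (simp add: bij_betw_inv_into)
  have *: "map \<sigma> (map (aut_inv M \<sigma>) xs) = xs" "set (map (aut_inv M \<sigma>) xs) \<subseteq> Dom M" if "set xs \<subseteq> Dom M" for xs
    using that I by (auto intro!: map_idI)
  show "aut_inv M \<sigma> (fun_in M f xs) = fun_in M f (map (aut_inv M \<sigma>) xs)"
    if "(f, length xs) \<in> funs L" "set xs \<subseteq> Dom M" for f xs
  proof -
    have "\<sigma> (fun_in M f (map (aut_inv M \<sigma>) xs)) = fun_in M f xs"
      using D(6)[OF _ *(2)[OF that(2)]] that by (simp only: *(1)[OF that(2)] length_map)
    moreover have "fun_in M f (map (aut_inv M \<sigma>) xs) \<in> Dom M"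
      using assms(1) that *(2)[OF that(2)] unfolding is_struct_def by fastforce
    ultimately show ?thesis using I(1) by metis
  qed
  show "rel_in M r (map (aut_inv M \<sigma>) xs) \<longleftrightarrow> rel_in M r xs"
    if "(r, length xs) \<in> rels L" "set xs \<subseteq> Dom M" for r xs
    using D(7)[OF _ *(2)[OF that(2)]] that by (simp only: *(1)[OF that(2)] length_map)
qed (simp add: aut_inv_def)

section \<open>Elementary submodels\<close>

lemma fun_in_Dom:
  "is_struct L M \<Longrightarrow> (f, length xs) \<in> funs L \<Longrightarrow> set xs \<subseteq> Dom M \<Longrightarrow> fun_in M f xs \<in> Dom M"
  by (auto simp: is_struct_def)

lemma elem_structs: "elementary_sub L N M \<Longrightarrow> is_struct L N" "elementary_sub L N M \<Longrightarrow> is_struct L M"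
    "elementary_sub L N M \<Longrightarrow> Dom N \<subseteq> Dom M"
  by (auto simp: elementary_sub_def)

text \<open>Renaming each atom to its value turns a valuation into parameters, to which elementarity
  applies.\<close>

lemma elem_eqt:
  assumes "elementary_sub L N M" "\<And>x. x \<in> V \<Longrightarrow> v x \<in> Dom N"
  shows "eqt L V N v M v"
  unfolding eqt_def
proof
  fix \<phi> assume \<phi>: "\<phi> \<in> Form L V"
  have "map_fm v \<phi> \<in> Form L (Dom N)" using assms(2) by (intro Form_map_fm[OF \<phi>]) auto
  then have "sat N id [] (map_fm v \<phi>) \<longleftrightarrow> sat M id [] (map_fm v \<phi>)"
    using assms(1) unfolding elementary_sub_def by simp
  then show "sat N v [] \<phi> \<longleftrightarrow> sat M v [] \<phi>" by (simp add: sat_map_fm)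
qed

text \<open>The Tarski-Vaught property for finitely many formulas and several variables at
  once.\<close>

lemma elem_realizable:
  assumes el: "elementary_sub L N M" and q: "finite q" "q \<subseteq> Form L U" and WU: "W \<subseteq> U"
    and v: "\<And>x. x \<in> W \<Longrightarrow> v x \<in> Dom N" and r: "realizable M U W v q"
  obtains w where "\<And>x. x \<in> U \<Longrightarrow> w x \<in> Dom N" "\<And>x. x \<in> W \<Longrightarrow> w x = v x" "\<And>\<phi>. \<phi> \<in> q \<Longrightarrow> sat M w [] \<phi>"
proof -
  have ne: "Dom M \<noteq> {}" "Dom N \<noteq> {}" using elem_structs[OF el] by (auto simp: is_struct_def)
  have "realizable N U W v q"
    by (rule realizable_transfer[OF eqt_sym[OF elem_eqt[OF el v]] q(2,1) WU ne _ v r])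
      (use v elem_structs(3)[OF el] in auto)
  then obtain w where w: "(\<forall>x\<in>U. w x \<in> Dom N) \<and> (\<forall>x\<in>W. w x = v x) \<and> (\<forall>\<phi>\<in>q. sat N w [] \<phi>)"
    unfolding realizable_def ..
  then have "sat M w [] \<phi>" if "\<phi> \<in> q" for \<phi>
  proof -
    have "eqt L U N w M w" using w by (intro elem_eqt[OF el]) simp
    then show ?thesis using eqtD[of L U N w M w \<phi>] q(2) that w by auto
  qed
  then show thesis using w that[of w] by metis
qed

text \<open>\<open>elementary_sub\<close> compares only truth values. That the operations agree is
  extracted from the formula saying that \<open>f\<close> applied to \<open>xs\<close> equals a
  given element.\<close>

lemma fun_in_elem:
  assumes el: "elementary_sub L N M" and f: "(f, length xs) \<in> funs L" and xs: "set xs \<subseteq> Dom N"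
  shows "fun_in N f xs = fun_in M f xs" "fun_in N f xs \<in> Dom N"
proof -
  show d: "fun_in N f xs \<in> Dom N" by (rule fun_in_Dom[OF elem_structs(1)[OF el] f xs])
  let ?\<phi> = "Equal (Fn f (map FVar xs)) (FVar (fun_in N f xs))"
  have m: "map (eval K id []) (map FVar xs) = xs" for K :: "('a, 'b, 'c) struct"
    by (induction xs) auto
  have "?\<phi> \<in> Form L (Dom N)" using f xs d by (auto simp: Form_def)
  then have "sat N id [] ?\<phi> \<longleftrightarrow> sat M id [] ?\<phi>" using el unfolding elementary_sub_def by blast
  then show "fun_in N f xs = fun_in M f xs" by (simp only: sat.simps eval.simps m id_apply simp_thms)
qed

lemma rel_in_elem:
  assumes el: "elementary_sub L N M" and r: "(r, length xs) \<in> rels L" and xs: "set xs \<subseteq> Dom N"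
  shows "rel_in N r xs \<longleftrightarrow> rel_in M r xs"
proof -
  let ?\<phi> = "Pred r (map FVar xs)"
  have m: "map (eval K id []) (map FVar xs) = xs" for K :: "('a, 'b, 'c) struct"
    by (induction xs) auto
  have "?\<phi> \<in> Form L (Dom N)" using r xs by (auto simp: Form_def)
  then have "sat N id [] ?\<phi> \<longleftrightarrow> sat M id [] ?\<phi>" using el unfolding elementary_sub_def by blast
  then show ?thesis by (simp only: sat.simps m)
qed

text \<open>\<open>Autf_L\<close> refers to submodels obtained from the big structure by shrinking
  its domain, whereas \<open>C\<close> and \<open>C'\<close> are separate records whose operations
  may differ outside the domain of \<open>C\<close>.\<close>

lemma elem_reduct:
  assumes el: "elementary_sub L N M"
  shows "elementary_sub L (M\<lparr>Dom := Dom N\<rparr>) M"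
proof -
  have st: "is_struct L (M\<lparr>Dom := Dom N\<rparr>)"
    using elem_structs(1)[OF el] fun_in_elem[OF el] unfolding is_struct_def by auto
  have "sat (M\<lparr>Dom := Dom N\<rparr>) id [] \<phi> \<longleftrightarrow> sat M id [] \<phi>" if \<phi>: "\<phi> \<in> Form L (Dom N)" for \<phi>
  proof -
    have "sat (M\<lparr>Dom := Dom N\<rparr>) id (map id []) \<phi> \<longleftrightarrow> sat N id [] \<phi>"
      using \<phi> fun_in_elem[OF el] rel_in_elem[OF el]
      by (intro sat_iso[OF elem_structs(1)[OF el]]) (auto simp: Form_def)
    then show ?thesis using el \<phi> unfolding elementary_sub_def by simp
  qed
  then show ?thesis using st elem_structs[OF el] unfolding elementary_sub_def by simp
qed

lemma is_structI:
  "Dom M \<noteq> {} \<Longrightarrow> (\<And>f xs. (f, length xs) \<in> funs L \<Longrightarrow> set xs \<subseteq> Dom M \<Longrightarrow> fun_in M f xs \<in> Dom M) \<Longrightarrow>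
     is_struct L M"
  by (auto simp: is_struct_def)

lemma elem_image:
  assumes el: "elementary_sub L (M\<lparr>Dom := N\<rparr>) M" and \<sigma>: "\<sigma> \<in> Aut L M"
  shows "elementary_sub L (M\<lparr>Dom := \<sigma> ` N\<rparr>) M"
proof -
  note D = Aut_D[OF \<sigma>] and st = elem_structs(2)[OF el]
  have N: "N \<subseteq> Dom M" "N \<noteq> {}" using elem_structs[OF el] by (auto simp: is_struct_def)
  have stN: "is_struct L (M\<lparr>Dom := N\<rparr>)" by (rule elem_structs(1)[OF el])
  have fN: "fun_in M f xs \<in> N" if "(f, length xs) \<in> funs L" "set xs \<subseteq> N" for f xs
    using fun_in_Dom[OF stN, of f xs] that by simp
  define v where "v = aut_inv M \<sigma>"
  have v: "v x \<in> N" "\<sigma> (v x) = x" if x: "x \<in> \<sigma> ` N" for x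
  proof -
    obtain y where y: "y \<in> N" "x = \<sigma> y" using x by blast
    then have "v x = y" using aut_inv(1)[OF \<sigma>, of y] N by (auto simp: v_def)
    with y show "v x \<in> N" "\<sigma> (v x) = x" by simp_all
  qed
  have "is_struct L (M\<lparr>Dom := \<sigma> ` N\<rparr>)"
  proof (rule is_structI)
    fix f ys assume f: "(f, length ys) \<in> funs L" and "set ys \<subseteq> Dom (M\<lparr>Dom := \<sigma> ` N\<rparr>)"
    then have ys: "set ys \<subseteq> \<sigma> ` N" by simp
    define xs where "xs = map v ys"
    have v': "v y \<in> N" "\<sigma> (v y) = y" if "y \<in> set ys" for y
      using v[of y] that ys by auto
    have "map \<sigma> xs = ys" unfolding xs_def map_map using v'(2) by (intro map_idI) simp
    then have xs: "set xs \<subseteq> N" "ys = map \<sigma> xs" using v'(1) by (auto simp: xs_def)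
    then have "fun_in M f ys = \<sigma> (fun_in M f xs)" using D(6)[of f xs] f N by simp
    then show "fun_in (M\<lparr>Dom := \<sigma> ` N\<rparr>) f ys \<in> Dom (M\<lparr>Dom := \<sigma> ` N\<rparr>)" using fN[of f xs] f xs by simp
  qed (use N in simp)
  moreover have "sat (M\<lparr>Dom := \<sigma> ` N\<rparr>) id [] \<phi> \<longleftrightarrow> sat M id [] \<phi>" if \<phi>: "\<phi> \<in> Form L (\<sigma> ` N)" for \<phi>
  proof -
    have "sat (M\<lparr>Dom := \<sigma> ` N\<rparr>) id (map \<sigma> []) \<phi> \<longleftrightarrow> sat (M\<lparr>Dom := N\<rparr>) v [] \<phi>"
    proof (rule sat_iso[OF stN])
      show "inj_on \<sigma> (Dom (M\<lparr>Dom := N\<rparr>))" using inj_on_subset[OF D(3)] N by simp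
      show "\<sigma> (fun_in (M\<lparr>Dom := N\<rparr>) f xs) = fun_in (M\<lparr>Dom := \<sigma> ` N\<rparr>) f (map \<sigma> xs)"
        if "(f, length xs) \<in> funs L" "set xs \<subseteq> Dom (M\<lparr>Dom := N\<rparr>)" for f xs
        using D(6)[of f xs] that N by simp
      show "rel_in (M\<lparr>Dom := \<sigma> ` N\<rparr>) r (map \<sigma> xs) \<longleftrightarrow> rel_in (M\<lparr>Dom := N\<rparr>) r xs"
        if "(r, length xs) \<in> rels L" "set xs \<subseteq> Dom (M\<lparr>Dom := N\<rparr>)" for r xs
        using D(7)[of r xs] that N by simp
      show "v x \<in> Dom (M\<lparr>Dom := N\<rparr>)" "id x = \<sigma> (v x)" if "x \<in> fv \<phi>" for x
        using v[of x] \<phi> that by (auto simp: Form_def)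
    qed (use \<phi> in \<open>simp_all add: Form_def\<close>)
    also have "\<dots> \<longleftrightarrow> sat M v [] \<phi>"
      using v(1) by (intro eqtD[OF elem_eqt[OF el] \<phi>]) simp
    also have "\<dots> \<longleftrightarrow> sat M id [] \<phi>"
      using v N by (intro eqtD[OF eqt_Aut[OF st \<sigma>] \<phi>]) auto
    finally show ?thesis by simp
  qed
  moreover have "\<sigma> ` N \<subseteq> Dom M" using N D(5) by auto
  ultimately show ?thesis using st unfolding elementary_sub_def by simp
qed

section \<open>The automorphism group\<close>

lemma AutG_simps:
  "carrier (AutG L M) = Aut L M"
  "\<sigma> \<in> Aut L M \<Longrightarrow> \<tau> \<in> Aut L M \<Longrightarrow> \<sigma> \<otimes>\<^bsub>AutG L M\<^esub> \<tau> = compose (Dom M) \<sigma> \<tau>"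
  "\<one>\<^bsub>AutG L M\<^esub> = (\<lambda>x\<in>Dom M. x)"
  by (simp_all add: AutG_def BijGroup_def Aut_def)

lemma id_Aut: "is_struct L M \<Longrightarrow> (\<lambda>x\<in>Dom M. x) \<in> Aut L M"
proof (rule Aut_I)
  assume st: "is_struct L M"
  show "bij_betw (\<lambda>x\<in>Dom M. x) (Dom M) (Dom M)" by (auto simp: bij_betw_def inj_on_def)
  have m: "map (\<lambda>x\<in>Dom M. x) xs = xs" if "set xs \<subseteq> Dom M" for xs
    using that by (auto intro!: map_idI)
  show "(\<lambda>x\<in>Dom M. x) (fun_in M f xs) = fun_in M f (map (\<lambda>x\<in>Dom M. x) xs)"
    if "(f, length xs) \<in> funs L" "set xs \<subseteq> Dom M" for f xs
    using fun_in_Dom[OF st that] unfolding m[OF that(2)] by simp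
  show "rel_in M r (map (\<lambda>x\<in>Dom M. x) xs) \<longleftrightarrow> rel_in M r xs" if "set xs \<subseteq> Dom M" for r xs
    unfolding m[OF that] ..
qed simp

lemma group_AutG:
  assumes "is_struct L M"
  shows "group (AutG L M)"
proof -
  have "subgroup (Aut L M) (BijGroup (Dom M))"
  proof
    show "Aut L M \<subseteq> carrier (BijGroup (Dom M))" by (auto simp: BijGroup_def Aut_def)
    show "\<one>\<^bsub>BijGroup (Dom M)\<^esub> \<in> Aut L M" using id_Aut[OF assms] by (simp add: BijGroup_def)
    fix \<sigma> assume \<sigma>: "\<sigma> \<in> Aut L M"
    then have B: "\<sigma> \<in> Bij (Dom M)" by (simp add: Aut_def)
    show "inv\<^bsub>BijGroup (Dom M)\<^esub> \<sigma> \<in> Aut L M"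
      using Aut_inv[OF assms \<sigma>] unfolding inv_BijGroup[OF B] aut_inv_def .
    fix \<tau> assume \<tau>: "\<tau> \<in> Aut L M"
    then have "\<tau> \<in> Bij (Dom M)" by (simp add: Aut_def)
    then show "\<sigma> \<otimes>\<^bsub>BijGroup (Dom M)\<^esub> \<tau> \<in> Aut L M"
      using Aut_compose[OF assms \<sigma> \<tau>] B by (simp add: BijGroup_def)
  qed
  then show ?thesis unfolding AutG_def by (rule subgroup.subgroup_is_group) (rule group_BijGroup)
qed

lemma inv_AutG:
  assumes "is_struct L M" "\<sigma> \<in> Aut L M"
  shows "inv\<^bsub>AutG L M\<^esub> \<sigma> = aut_inv M \<sigma>"
proof -
  interpret group "AutG L M" by (rule group_AutG[OF assms(1)])
  have "compose (Dom M) (aut_inv M \<sigma>) \<sigma> = (\<lambda>x\<in>Dom M. x)"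
    by (rule ext) (simp add: compose_def aut_inv[OF assms(2)])
  then show ?thesis
    using assms Aut_inv[OF assms] by (intro inv_equality) (simp_all add: AutG_simps)
qed

definition small_fix :: "('f, 'r) lang \<Rightarrow> 'k rel \<Rightarrow> ('f, 'r, 'a) struct \<Rightarrow> ('a \<Rightarrow> 'a) set" where
  "small_fix L \<kappa> M =
     {\<sigma> \<in> Aut L M. \<exists>N. |N| <o \<kappa> \<and> elementary_sub L (M\<lparr>Dom := N\<rparr>) M \<and> (\<forall>x\<in>N. \<sigma> x = x)}"

lemma Autf_L_eq: "Autf_L L \<kappa> M = generate (AutG L M) (small_fix L \<kappa> M)"
  by (simp add: Autf_L_def small_fix_def)

lemma small_fix_Autf_L: "\<sigma> \<in> small_fix L \<kappa> M \<Longrightarrow> \<sigma> \<in> Autf_L L \<kappa> M"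
  unfolding Autf_L_eq by (rule generate.incl)

text \<open>The generators are closed under conjugation: if \<open>h\<close> fixes a small submodel
  \<open>N\<close>, its conjugate by \<open>g\<close> fixes the image of \<open>N\<close> under
  \<open>g\<close>, which is a small submodel by \<open>elem_image\<close>.\<close>

lemma normal_Autf_L:
  assumes "is_struct L M"
  shows "Autf_L L \<kappa> M \<lhd> AutG L M"
proof -
  interpret group "AutG L M" by (rule group_AutG[OF assms(1)])
  show ?thesis unfolding Autf_L_eq
  proof (rule normal_generateI)
    show "small_fix L \<kappa> M \<subseteq> carrier (AutG L M)" by (auto simp: small_fix_def AutG_simps)
    fix h g assume h: "h \<in> small_fix L \<kappa> M" and "g \<in> carrier (AutG L M)"
    then have A: "g \<in> Aut L M" "h \<in> Aut L M" by (simp_all add: AutG_simps small_fix_def)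
    note I = Aut_inv[OF assms A(1)]
    have C: "compose (Dom M) g h \<in> Aut L M" "compose (Dom M) (compose (Dom M) g h) (aut_inv M g) \<in> Aut L M"
      using Aut_compose[OF assms] A I by simp_all
    obtain N where N: "|N| <o \<kappa>" "elementary_sub L (M\<lparr>Dom := N\<rparr>) M" "\<forall>x\<in>N. h x = x"
      using h unfolding small_fix_def by auto
    then have ND: "N \<subseteq> Dom M" using elem_structs(3)[OF N(2)] by simp
    have "compose (Dom M) (compose (Dom M) g h) (aut_inv M g) x = x" if "x \<in> g ` N" for x
      using that ND aut_inv[OF A(1)] N(3) Aut_D(5)[OF A(1)] by (auto simp: compose_def subset_iff)
    moreover have "|g ` N| <o \<kappa>" using card_of_image N(1) by (rule ordLeq_ordLess_trans)
    ultimately have "compose (Dom M) (compose (Dom M) g h) (aut_inv M g) \<in> small_fix L \<kappa> M"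
      using C(2) elem_image[OF N(2) A(1)] unfolding small_fix_def
      by (intro CollectI conjI exI[of _ "g ` N"] ballI) simp_all
    then show "g \<otimes>\<^bsub>AutG L M\<^esub> h \<otimes>\<^bsub>AutG L M\<^esub> inv\<^bsub>AutG L M\<^esub> g \<in> small_fix L \<kappa> M"
      using A I C by (simp add: AutG_simps inv_AutG[OF assms])
  qed
qed

lemma Autf_L_closed:
  assumes "is_struct L M"
  shows "\<sigma> \<in> Autf_L L \<kappa> M \<Longrightarrow> \<sigma> \<in> Aut L M"
    and "\<sigma> \<in> Autf_L L \<kappa> M \<Longrightarrow> \<tau> \<in> Autf_L L \<kappa> M \<Longrightarrow> compose (Dom M) \<sigma> \<tau> \<in> Autf_L L \<kappa> M"
    and "\<sigma> \<in> Autf_L L \<kappa> M \<Longrightarrow> aut_inv M \<sigma> \<in> Autf_L L \<kappa> M"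
proof -
  interpret normal "Autf_L L \<kappa> M" "AutG L M" by (rule normal_Autf_L[OF assms])
  show A: "\<sigma> \<in> Aut L M" if "\<sigma> \<in> Autf_L L \<kappa> M" for \<sigma> using mem_carrier[OF that] by (simp add: AutG_simps)
  show "compose (Dom M) \<sigma> \<tau> \<in> Autf_L L \<kappa> M" if "\<sigma> \<in> Autf_L L \<kappa> M" "\<tau> \<in> Autf_L L \<kappa> M"
    using subgroup.m_closed[OF subgroup_axioms that] A that by (simp add: AutG_simps)
  show "aut_inv M \<sigma> \<in> Autf_L L \<kappa> M" if "\<sigma> \<in> Autf_L L \<kappa> M"
    using m_inv_closed[OF that] A that by (simp add: inv_AutG[OF assms])
qed

section \<open>Cardinalities\<close>

text \<open>\<open>strong_limit\<close> is formulated for subsets of \<open>Field \<kappa>\<close>,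
  so a small set is first copied there.\<close>

lemma strong_limit_Pow:
  assumes "strong_limit \<kappa>" "|X| <o \<kappa>"
  shows "|Pow X| <o \<kappa>"
proof -
  have \<kappa>: "Card_order \<kappa>" using assms(1) by (simp add: strong_limit_def)
  have "|X| \<le>o |Field \<kappa>|"
    using ordLess_imp_ordLeq[OF assms(2)] ordIso_symmetric[OF card_of_Field_ordIso[OF \<kappa>]]
    by (rule ordLeq_ordIso_trans)
  then obtain g where g: "inj_on g X" "g ` X \<subseteq> Field \<kappa>" using card_of_ordLeq by metis
  have "|g ` X| <o \<kappa>" using card_of_image assms(2) by (rule ordLeq_ordLess_trans)
  then have "|Pow (g ` X)| <o \<kappa>" using assms(1) g(2) by (simp add: strong_limit_def)
  moreover have "|Pow X| \<le>o |Pow (g ` X)|"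
    using g(1) by (intro card_of_ordLeqI[of "(`) g"] inj_on_image_Pow) auto
  ultimately show ?thesis by (rule ordLeq_ordLess_trans[rotated])
qed

lemma card_Plus_less:
  "Cinfinite \<kappa> \<Longrightarrow> |A| <o \<kappa> \<Longrightarrow> |B| <o \<kappa> \<Longrightarrow> |A <+> B| <o \<kappa>"
  using card_of_Plus_ordLess_infinite_Field[of \<kappa> A B] by (auto simp: cinfinite_def)

lemma card_finite_less:
  assumes "Cinfinite \<kappa>" "finite A"
  shows "|A| <o \<kappa>"
proof (rule finite_ordLess_infinite)
  show "Well_order \<kappa>" using assms(1) card_order_on_well_order_on by blast
  show "infinite (Field \<kappa>)" using assms(1) by (simp add: cinfinite_def)
qed (simp_all add: card_of_well_order_on Field_card_of assms(2))

lemma card_Un_less: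
  assumes "Cinfinite \<kappa>" "|A| <o \<kappa>" "|B| <o \<kappa>"
  shows "|A \<union> B| <o \<kappa>"
  using card_of_Un_Plus_ordLeq card_Plus_less[OF assms] by (rule ordLeq_ordLess_trans)

lemma card_Times_less:
  assumes "Cinfinite \<kappa>" "|A| <o \<kappa>" "|B| <o \<kappa>"
  shows "|A \<times> B| <o \<kappa>"
proof (cases "finite (A <+> B)")
  case True
  then show ?thesis using assms(1) by (intro card_finite_less) auto
next
  case False
  have "|SIGMA i : A. B| \<le>o |A <+> B|"
    using False card_of_Plus1[of A B] card_of_Plus2[of B A] by (intro card_of_Sigma_ordLeq_infinite) auto
  then show ?thesis using card_Plus_less[OF assms] by (rule ordLeq_ordLess_trans)
qed

section \<open>Counting formulas\<close>

lemma card_nlists: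
  assumes "infinite B" "|V| \<le>o |B|"
  shows "|{xs. set xs \<subseteq> V \<and> length xs = n}| \<le>o |B|"
proof (induction n)
  case 0
  have "{xs. set xs \<subseteq> V \<and> length xs = 0} = {[]}" by auto
  moreover have "B \<noteq> {}" using assms(1) by auto
  ultimately show ?case using card_of_singl_ordLeq by metis
next
  case (Suc n)
  have "{xs. set xs \<subseteq> V \<and> length xs = Suc n} \<subseteq>
      (\<lambda>(x, xs). x # xs) ` (SIGMA x : V. {xs. set xs \<subseteq> V \<and> length xs = n})"
  proof
    fix ys assume "ys \<in> {xs. set xs \<subseteq> V \<and> length xs = Suc n}"
    then show "ys \<in> (\<lambda>(x, xs). x # xs) ` (SIGMA x : V. {xs. set xs \<subseteq> V \<and> length xs = n})"
      by (cases ys) auto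
  qed
  then have "|{xs. set xs \<subseteq> V \<and> length xs = Suc n}| \<le>o |SIGMA x : V. {xs. set xs \<subseteq> V \<and> length xs = n}|"
    by (rule ordLeq_transitive[OF card_of_mono1 card_of_image])
  moreover have "|SIGMA x : V. {xs. set xs \<subseteq> V \<and> length xs = n}| \<le>o |B|"
    using assms Suc by (intro card_of_Sigma_ordLeq_infinite) auto
  ultimately show ?case by (rule ordLeq_transitive)
qed

text \<open>Well-formedness keeps the index \<open>k\<close> out of both terms, so the bound atom
  can be recovered. Formulas are counted below by turning their free atoms into quantified
  variables.\<close>

lemma bind_tm_inj:
  "wf_tm L k s \<Longrightarrow> wf_tm L k t \<Longrightarrow> bind_tm x k s = bind_tm x k t \<Longrightarrow> s = t"
proof (induction s arbitrary: t)
  case (Fn f ss)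
  then obtain ts where ts: "t = Fn f ts" "map (bind_tm x k) ss = map (bind_tm x k) ts"
    by (cases t) (auto split: if_splits)
  have "ss = ts"
  proof (rule nth_equalityI)
    show "length ss = length ts" using ts(2) by (rule map_eq_imp_length_eq)
    fix i assume i: "i < length ss"
    then have i': "i < length ts" using \<open>length ss = length ts\<close> by simp
    have "bind_tm x k (ss ! i) = bind_tm x k (ts ! i)"
      using ts(2) i i' by (metis nth_map)
    then show "ss ! i = ts ! i" using Fn ts(1) i i' by auto
  qed
  then show ?case using ts by simp
next
  case (FVar y)
  then show ?case by (cases t) (auto split: if_splits)
next
  case (BVar n)
  then show ?case by (cases t) (auto split: if_splits)
qed

lemma bind_fm_inj:
  "wf_fm L k \<phi> \<Longrightarrow> wf_fm L k \<psi> \<Longrightarrow> bind_fm x k \<phi> = bind_fm x k \<psi> \<Longrightarrow> \<phi> = \<psi>"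
proof (induction \<phi> arbitrary: \<psi> k)
  case (Equal s t)
  then obtain s' t' where \<psi>: "\<psi> = Equal s' t'" "bind_tm x k s = bind_tm x k s'" "bind_tm x k t = bind_tm x k t'"
    by (cases \<psi>) auto
  then have "s = s'" "t = t'" using Equal bind_tm_inj[of L k _ _ x] by simp_all
  then show ?case using \<psi> by simp
next
  case (Pred r ss)
  then obtain ts where ts: "\<psi> = Pred r ts" "map (bind_tm x k) ss = map (bind_tm x k) ts"
    by (cases \<psi>) auto
  have "ss = ts"
  proof (rule nth_equalityI)
    show "length ss = length ts" using ts(2) by (rule map_eq_imp_length_eq)
    fix i assume i: "i < length ss"
    then have i': "i < length ts" using \<open>length ss = length ts\<close> by simp
    have "bind_tm x k (ss ! i) = bind_tm x k (ts ! i)"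
      using ts(2) i i' by (metis nth_map)
    moreover have "wf_tm L k (ss ! i)" "wf_tm L k (ts ! i)" using Pred ts(1) i i' by auto
    ultimately show "ss ! i = ts ! i" by (rule bind_tm_inj[rotated 2])
  qed
  then show ?case using ts by simp
next
  case (Neg \<phi>)
  then show ?case by (cases \<psi>) auto
next
  case (Conj \<phi>1 \<phi>2)
  then show ?case by (cases \<psi>) auto
next
  case (Exists \<phi>)
  then obtain \<psi>' where "\<psi> = Exists \<psi>'" by (cases \<psi>) auto
  then show ?case using Exists by auto
qed

lemma infinite_sentences: "infinite (Form L {} :: ('f, 'r, 'v) fm set)"
proof -
  define g where "g n = (Neg ^^ n) (Exists (Equal (BVar 0) (BVar 0)) :: ('f, 'r, 'v) fm)" for n
  have "g m = g n \<Longrightarrow> m = n" for m n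
  proof (induction m arbitrary: n)
    case 0
    then show ?case by (cases n) (auto simp: g_def)
  next
    case (Suc m)
    then show ?case by (cases n) (auto simp: g_def)
  qed
  then have "inj g" by (auto simp: inj_def)
  moreover have "g n \<in> Form L {}" for n by (induction n) (auto simp: g_def Form_def)
  then have "range g \<subseteq> Form L {}" by auto
  ultimately show ?thesis using range_inj_infinite infinite_super by blast
qed

text \<open>Each sentence or its negation lies in \<open>T\<close>, and \<open>Neg\<close> is
  injective. In this way \<open>|T| <o \<kappa>\<close> bounds the number of sentences and makes
  \<open>\<kappa>\<close> uncountable.\<close>

lemma complete_theory_card:
  fixes T :: "('f, 'r, nat) fm set"
  assumes "complete_theory L T"
  shows "infinite T" "|Form L {} :: ('f, 'r, nat) fm set| \<le>o |T|"
proof -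
  let ?N = "{\<phi>. Neg \<phi> \<in> T}"
  have sub: "Form L {} \<subseteq> T \<union> ?N" using assms unfolding complete_theory_def by auto
  have N: "|?N| \<le>o |T|" by (rule card_of_ordLeqI[of Neg]) (auto simp: inj_on_def)
  show inf: "infinite T"
  proof
    assume "finite T"
    then have "finite (T \<union> ?N)" using card_of_ordLeq_finite[OF N] by simp
    then show False using infinite_sentences[of L] sub finite_subset by metis
  qed
  have "|T \<union> ?N| \<le>o |T|"
    by (rule card_of_Un_ordLeq_infinite_Field)
      (simp_all add: inf N Field_card_of card_of_Card_order ordIso_imp_ordLeq[OF card_of_refl] card_of_card_order_on)
  then show "|Form L {} :: ('f, 'r, nat) fm set| \<le>o |T|"
    by (rule ordLeq_transitive[OF card_of_mono1[OF sub]])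
qed

text \<open>Quantifying the last atom embeds the formulas in \<open>Suc n\<close> numbered atoms
  into those in \<open>n\<close>, down to sentences. Any formula in \<open>V\<close> arises from one
  in numbered atoms by substituting a finite list of elements of \<open>V\<close>.\<close>

lemma Form_card:
  fixes T :: "('f, 'r, nat) fm set" and V :: "'v set"
  assumes T: "complete_theory L T"
  shows "|Form L V :: ('f, 'r, 'v) fm set| \<le>o |T <+> V|"
proof -
  note inf = complete_theory_card(1)[OF T]
  have infB: "infinite (T <+> V)" using inf by auto
  have n: "|Form L {..<n} :: ('f, 'r, nat) fm set| \<le>o |T|" for n
  proof (induction n)
    case (Suc n)
    have "inj_on (\<lambda>\<phi> :: ('f, 'r, nat) fm. Exists (bind_fm n 0 \<phi>)) (Form L {..<Suc n})"
    proof (rule inj_onI)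
      fix \<phi> \<psi> :: "('f, 'r, nat) fm"
      assume "\<phi> \<in> Form L {..<Suc n}" "\<psi> \<in> Form L {..<Suc n}"
        "Exists (bind_fm n 0 \<phi>) = Exists (bind_fm n 0 \<psi>)"
      then show "\<phi> = \<psi>" using bind_fm_inj[of L 0 \<phi> \<psi> n] by (simp add: Form_def)
    qed
    moreover have "Exists (bind_fm n 0 \<phi>) \<in> Form L {..<n}" if "\<phi> \<in> Form L {..<Suc n}"
      for \<phi> :: "('f, 'r, nat) fm"
    proof -
      have "{..<Suc n} - {n} = {..<n}" by auto
      then show ?thesis using ex_atom(1)[OF that, of n] by simp
    qed
    ultimately have "|Form L {..<Suc n} :: ('f, 'r, nat) fm set| \<le>o |Form L {..<n} :: ('f, 'r, nat) fm set|"
      by (rule card_of_ordLeqI)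
    then show ?case using Suc by (rule ordLeq_transitive)
  qed (use complete_theory_card(2)[OF T] in simp)
  define A where "A n = (\<lambda>(xs, \<phi>). map_fm (\<lambda>i. xs ! i) \<phi>) `
    (SIGMA xs : {xs. set xs \<subseteq> V \<and> length xs = n}. (Form L {..<n} :: ('f, 'r, nat) fm set))" for n
  have "Form L V \<subseteq> (\<Union>n\<in>UNIV. A n)"
  proof
    fix \<phi> :: "('f, 'r, 'v) fm" assume \<phi>: "\<phi> \<in> Form L V"
    from finite_list[OF finite_fv[of \<phi>]] obtain xs where xs: "set xs = fv \<phi>" ..
    define h where "h x = (SOME i. i < length xs \<and> xs ! i = x)" for x
    have h: "h x < length xs \<and> xs ! h x = x" if "x \<in> fv \<phi>" for x
    proof -
      have "x \<in> set xs" using that xs by simp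
      then have "\<exists>i. i < length xs \<and> xs ! i = x" by (simp add: in_set_conv_nth)
      then show ?thesis unfolding h_def by (rule someI_ex)
    qed
    have eq: "map_fm (\<lambda>i. xs ! i) (map_fm h \<phi>) = \<phi>"
      unfolding fm.map_comp by (rule fm.map_ident_strong) (simp add: h)
    have "map_fm h \<phi> \<in> Form L {..<length xs}"
      using h by (intro Form_map_fm[OF Form_fv[OF \<phi>]]) auto
    moreover have "set xs \<subseteq> V" using \<phi> xs by (simp add: Form_def)
    ultimately have "(\<lambda>(xs, \<phi>). map_fm (\<lambda>i. xs ! i) \<phi>) (xs, map_fm h \<phi>) \<in> A (length xs)"
      unfolding A_def by (intro imageI) simp
    then have "\<phi> \<in> A (length xs)" by (simp only: prod.case eq)
    then show "\<phi> \<in> (\<Union>n\<in>UNIV. A n)" by (rule UN_I[OF UNIV_I])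
  qed
  then have "|Form L V :: ('f, 'r, 'v) fm set| \<le>o |\<Union>n\<in>UNIV. A n|" by (rule card_of_mono1)
  moreover have "|\<Union>n\<in>UNIV. A n| \<le>o |T <+> V|"
  proof (rule card_of_UNION_ordLeq_infinite[OF infB])
    show "|UNIV :: nat set| \<le>o |T <+> V|" by (rule iffD1[OF infinite_iff_card_of_nat infB])
    have "|A n| \<le>o |T <+> V|" for n
    proof -
      have "|SIGMA xs : {xs. set xs \<subseteq> V \<and> length xs = n}. (Form L {..<n} :: ('f, 'r, nat) fm set)| \<le>o |T <+> V|"
        by (rule card_of_Sigma_ordLeq_infinite[OF infB card_nlists[OF infB card_of_Plus2]])
          (intro ballI ordLeq_transitive[OF n card_of_Plus1])
      then show ?thesis unfolding A_def by (rule ordLeq_transitive[OF card_of_image])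
    qed
    then show "\<forall>n\<in>UNIV. |A n| \<le>o |T <+> V|" ..
  qed
  ultimately show ?thesis by (rule ordLeq_transitive)
qed

section \<open>Bounded invariant equivalence relations\<close>

text \<open>With \<open>b\<close>, \<open>b'\<close> for the left atoms and \<open>y\<^sub>j\<close> for the atoms \<open>Inr (j, x)\<close>, the formulas of
  \<open>seq_type\<close> say \<open>tp(y\<^sub>j, y\<^sub>i) = tp(b, y\<^sub>i) = tp(b', y\<^sub>i)\<close> for \<open>i < j\<close>.\<close>

definition seq_fm :: "bool \<times> ('f, 'r, 'b + 'b) fm \<times> 'j \<times> 'j \<Rightarrow> ('f, 'r, ('b + 'b) + 'j \<times> 'b) fm" where
  "seq_fm = (\<lambda>(s, \<chi>, i, j). Iff
     (map_fm (case_sum (\<lambda>x. if s then Inr (j, x) else Inl (Inr x)) (\<lambda>x. Inr (i, x))) \<chi>)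
     (map_fm (case_sum (\<lambda>x. Inl (Inl x)) (\<lambda>x. Inr (i, x))) \<chi>))"

definition seq_type :: "('f, 'r) lang \<Rightarrow> 'b set \<Rightarrow> 'j rel \<Rightarrow> ('f, 'r, ('b + 'b) + 'j \<times> 'b) fm set" where
  "seq_type L B r = seq_fm ` {(s, \<chi>, i, j). \<chi> \<in> Form L (B <+> B) \<and> (i, j) \<in> r \<and> i \<noteq> j}"

lemma sat_seq_fm:
  "sat M w [] (seq_fm (s, \<chi>, i, j)) \<longleftrightarrow>
    (sat M (case_sum (\<lambda>x. if s then w (Inr (j, x)) else w (Inl (Inr x))) (\<lambda>x. w (Inr (i, x)))) [] \<chi> \<longleftrightarrow>
     sat M (case_sum (\<lambda>x. w (Inl (Inl x))) (\<lambda>x. w (Inr (i, x)))) [] \<chi>)"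
proof -
  have "w \<circ> case_sum (\<lambda>x. if s then Inr (j, x) else Inl (Inr x)) (\<lambda>x. Inr (i, x)) =
      case_sum (\<lambda>x. if s then w (Inr (j, x)) else w (Inl (Inr x))) (\<lambda>x. w (Inr (i, x)))"
    "w \<circ> case_sum (\<lambda>x. Inl (Inl x)) (\<lambda>x. Inr (i, x)) =
      case_sum (\<lambda>x. w (Inl (Inl x))) (\<lambda>x. w (Inr (i, x)))"
    by (auto simp: fun_eq_iff split: sum.splits)
  then show ?thesis unfolding seq_fm_def by (simp add: sat_map_fm)
qed

lemma seq_type_Form: "r \<subseteq> J \<times> J \<Longrightarrow> seq_type L B r \<subseteq> Form L ((B <+> B) <+> (J \<times> B))"
proof
  fix \<phi> assume r: "r \<subseteq> J \<times> J" and "\<phi> \<in> seq_type L B r"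
  then obtain s \<chi> i j where \<phi>: "\<phi> = seq_fm (s, \<chi>, i, j)" and \<chi>: "\<chi> \<in> Form L (B <+> B)" and ij: "i \<in> J" "j \<in> J"
    unfolding seq_type_def by auto
  have "map_fm (case_sum (\<lambda>x. if s then Inr (j, x) else Inl (Inr x)) (\<lambda>x. Inr (i, x))) \<chi>
      \<in> Form L ((B <+> B) <+> (J \<times> B))"
    using ij by (intro Form_map_fm[OF \<chi>]) auto
  moreover have "map_fm (case_sum (\<lambda>x. Inl (Inl x)) (\<lambda>x. Inr (i, x))) \<chi> \<in> Form L ((B <+> B) <+> (J \<times> B))"
    using ij by (intro Form_map_fm[OF \<chi>]) auto
  ultimately show "\<phi> \<in> Form L ((B <+> B) <+> (J \<times> B))" unfolding \<phi> seq_fm_def by simp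
qed

text \<open>A finite piece of a coheir sequence: the next term exists in \<open>N\<close> by
  elementarity, because \<open>b\<close> itself satisfies the required formulas over the earlier
  terms, which lie in \<open>N\<close>.\<close>

lemma elementary_sequence:
  fixes M :: "('f, 'r, 'a) struct" and b :: "'b \<Rightarrow> 'a"
  assumes el: "elementary_sub L N M" and b: "\<And>x. x \<in> B \<Longrightarrow> b x \<in> Dom M"
    and \<Delta>: "finite \<Delta>" "\<Delta> \<subseteq> Form L (B <+> B)"
  shows "\<exists>m :: nat \<Rightarrow> 'b \<Rightarrow> 'a. \<forall>j<n. (\<forall>x\<in>B. m j x \<in> Dom N) \<and>
    (\<forall>\<chi>\<in>\<Delta>. \<forall>i<j. sat M (case_sum (m j) (m i)) [] \<chi> \<longleftrightarrow> sat M (case_sum b (m i)) [] \<chi>)"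
proof (induction n)
  case (Suc n)
  then obtain m where m: "\<And>j. j < n \<Longrightarrow> (\<forall>x\<in>B. m j x \<in> Dom N) \<and>
    (\<forall>\<chi>\<in>\<Delta>. \<forall>i<j. sat M (case_sum (m j) (m i)) [] \<chi> \<longleftrightarrow> sat M (case_sum b (m i)) [] \<chi>)"
    by metis
  define U where "U = B <+> {..<n} \<times> B"
  define W :: "('b + nat \<times> 'b) set" where "W = Inr ` ({..<n} \<times> B)"
  define v where "v = case_sum b (\<lambda>(i, x). m i x)"
  define h where "h i \<chi> = map_fm (case_sum Inl (\<lambda>x. Inr (i, x))) \<chi>" for i :: nat and \<chi> :: "('f, 'r, 'b + 'b) fm"
  \<comment> \<open>Each formula is taken with the sign that it has at \<open>b\<close>, so that
    \<open>v\<close> realizes \<open>q\<close> in \<open>M\<close>.\<close>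
  define g where "g = (\<lambda>(i, \<chi>). if sat M v [] (h i \<chi>) then h i \<chi> else Neg (h i \<chi>))"
  define q where "q = g ` ({..<n} \<times> \<Delta>)"
  have hs: "sat M w [] (h i \<chi>) \<longleftrightarrow> sat M (case_sum (\<lambda>x. w (Inl x)) (\<lambda>x. w (Inr (i, x)))) [] \<chi>" for w i \<chi>
  proof -
    have "w \<circ> case_sum Inl (\<lambda>x. Inr (i, x)) = case_sum (\<lambda>x. w (Inl x)) (\<lambda>x. w (Inr (i, x)))"
      by (auto simp: fun_eq_iff split: sum.splits)
    then show ?thesis unfolding h_def by (simp add: sat_map_fm)
  qed
  have hF: "h i \<chi> \<in> Form L U" if "i < n" "\<chi> \<in> \<Delta>" for i \<chi>
    unfolding h_def using that by (intro Form_map_fm[OF subsetD[OF \<Delta>(2)]]) (auto simp: U_def)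
  have q: "finite q" "q \<subseteq> Form L U" using \<Delta>(1) hF by (auto simp: q_def g_def)
  have "realizable M U W v q"
  proof (rule realizableI[of _ v])
    fix x assume "x \<in> U"
    then show "v x \<in> Dom M" using b m elem_structs(3)[OF el] by (auto simp: U_def v_def)
  qed (auto simp: q_def g_def)
  moreover have "W \<subseteq> U" by (auto simp: W_def U_def)
  moreover have "v x \<in> Dom N" if "x \<in> W" for x using that m by (auto simp: W_def v_def)
  ultimately obtain w where w: "\<And>x. x \<in> U \<Longrightarrow> w x \<in> Dom N" "\<And>x. x \<in> W \<Longrightarrow> w x = v x"
      "\<And>\<phi>. \<phi> \<in> q \<Longrightarrow> sat M w [] \<phi>"
    using elem_realizable[OF el q] by metis
  define m' where "m' = m(n := \<lambda>x. w (Inl x))"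
  have ws: "sat M w [] (h i \<chi>) \<longleftrightarrow> sat M v [] (h i \<chi>)" if "i < n" "\<chi> \<in> \<Delta>" for i \<chi>
  proof -
    have "g (i, \<chi>) \<in> q" using that by (auto simp: q_def)
    from w(3)[OF this] show ?thesis by (auto simp: g_def split: if_splits)
  qed
  have new: "sat M (case_sum (m' n) (m' i)) [] \<chi> \<longleftrightarrow> sat M (case_sum b (m' i)) [] \<chi>"
    if i: "i < n" and \<chi>: "\<chi> \<in> \<Delta>" for i \<chi>
  proof -
    have "sat M (case_sum (m' n) (m' i)) [] \<chi> \<longleftrightarrow> sat M w [] (h i \<chi>)"
      unfolding hs
    proof (rule sat_Form_cong[OF subsetD[OF \<Delta>(2) \<chi>]])
      fix x assume "x \<in> B <+> B"
      then show "case_sum (m' n) (m' i) x = case_sum (\<lambda>x. w (Inl x)) (\<lambda>x. w (Inr (i, x))) x"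
        using i w(2) by (auto simp: m'_def W_def v_def)
    qed
    also have "\<dots> \<longleftrightarrow> sat M v [] (h i \<chi>)" by (rule ws[OF i \<chi>])
    also have "\<dots> \<longleftrightarrow> sat M (case_sum b (m' i)) [] \<chi>"
    proof -
      have "case_sum (\<lambda>x. v (Inl x)) (\<lambda>x. v (Inr (i, x))) = case_sum b (m' i)"
        using i by (auto simp: fun_eq_iff v_def m'_def split: sum.splits)
      then show ?thesis unfolding hs by simp
    qed
    finally show ?thesis .
  qed
  have old: "m' j = m j" if "j < n" for j using that by (simp add: m'_def)
  show ?case
  proof (intro exI[of _ m'] allI impI)
    fix j assume j: "j < Suc n"
    show "(\<forall>x\<in>B. m' j x \<in> Dom N) \<and>
      (\<forall>\<chi>\<in>\<Delta>. \<forall>i<j. sat M (case_sum (m' j) (m' i)) [] \<chi> \<longleftrightarrow> sat M (case_sum b (m' i)) [] \<chi>)"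
    proof (cases "j = n")
      case True
      then show ?thesis using new w(1) by (auto simp: m'_def U_def)
    next
      case False
      then have "j < n" using j by simp
      then show ?thesis using m[of j] old by simp
    qed
  qed
qed simp

text \<open>A finite part mentions finitely many indices. Numbered by their rank \<open>k\<close>
  among these, they are interpreted by the terms of a finite sequence in \<open>N\<close>, and over
  \<open>N\<close> the tuples \<open>b\<close> and \<open>b'\<close> have the same type.\<close>

lemma seq_type_finsat:
  fixes M :: "('f, 'r, 'a) struct" and b b' :: "'b \<Rightarrow> 'a" and r :: "'j rel"
  assumes el: "elementary_sub L N M" and b: "\<And>x. x \<in> B \<Longrightarrow> b x \<in> Dom M" "\<And>x. x \<in> B \<Longrightarrow> b' x \<in> Dom M"
    and eq: "\<And>n. (\<And>x. x \<in> B \<Longrightarrow> n x \<in> Dom N) \<Longrightarrow> eqt L (B <+> B) M (case_sum b n) M (case_sum b' n)"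
    and r: "well_order_on J r"
  shows "finsat M ((B <+> B) <+> (J \<times> B)) (Inl ` (B <+> B)) (case_sum (case_sum b b') u) (seq_type L B r)"
  unfolding finsat_def
proof (intro allI impI)
  fix q assume q: "q \<subseteq> seq_type L B r" "finite q"
  from finite_subset_image[OF q(2) q(1)[unfolded seq_type_def]]
  obtain p where p': "p \<subseteq> {(s, \<chi>, i, j). \<chi> \<in> Form L (B <+> B) \<and> (i, j) \<in> r \<and> i \<noteq> j} \<and> finite p \<and> q = seq_fm ` p"
    ..
  note p = p'[THEN conjunct1] p'[THEN conjunct2, THEN conjunct1] p'[THEN conjunct2, THEN conjunct2]
  define \<Delta> where "\<Delta> = (\<lambda>(s, \<chi>, i, j). \<chi>) ` p"
  define F where "F = (\<lambda>(s, \<chi>, i, j). i) ` p \<union> (\<lambda>(s, \<chi>, i, j). j) ` p"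
  define k where "k j = card {i \<in> F. (i, j) \<in> r \<and> i \<noteq> j}" for j
  have fin: "finite F" "finite \<Delta>" using p(2) by (simp_all add: F_def \<Delta>_def)
  have \<Delta>: "\<Delta> \<subseteq> Form L (B <+> B)"
    unfolding \<Delta>_def
  proof (rule image_subsetI)
    fix t assume "t \<in> p"
    from subsetD[OF p(1) this] show "(case t of (s, \<chi>, i, j) \<Rightarrow> \<chi>) \<in> Form L (B <+> B)"
      by (cases t) simp
  qed
  have kF: "k j < Suc (card F)" for j
    unfolding k_def less_Suc_eq_le by (rule card_mono[OF fin(1)]) simp
  have kmono: "k i < k j" if "(i, j) \<in> r" "i \<noteq> j" "i \<in> F" for i j
  proof -
    have tr: "trans r" "antisym r" using r
      by (auto simp: well_order_on_def linear_order_on_def partial_order_on_def preorder_on_def)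
    have "{l \<in> F. (l, i) \<in> r \<and> l \<noteq> i} \<subset> {l \<in> F. (l, j) \<in> r \<and> l \<noteq> j}"
    proof
      show "{l \<in> F. (l, i) \<in> r \<and> l \<noteq> i} \<subseteq> {l \<in> F. (l, j) \<in> r \<and> l \<noteq> j}"
      proof
        fix l assume "l \<in> {l \<in> F. (l, i) \<in> r \<and> l \<noteq> i}"
        then have l: "l \<in> F" "(l, i) \<in> r" "l \<noteq> i" by simp_all
        have "(l, j) \<in> r" by (rule transD[OF tr(1) l(2) that(1)])
        moreover have "l \<noteq> j" using antisymD[OF tr(2) l(2)] that(1) l(3) by metis
        ultimately show "l \<in> {l \<in> F. (l, j) \<in> r \<and> l \<noteq> j}" using l(1) by simp
      qed
      have "i \<in> {l \<in> F. (l, j) \<in> r \<and> l \<noteq> j}" using that by simp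
      then show "{l \<in> F. (l, i) \<in> r \<and> l \<noteq> i} \<noteq> {l \<in> F. (l, j) \<in> r \<and> l \<noteq> j}" by blast
    qed
    then show ?thesis unfolding k_def using fin(1) by (intro psubset_card_mono) auto
  qed
  from elementary_sequence[OF el b(1) fin(2) \<Delta>, where n = "Suc (card F)"]
  obtain m where "\<forall>j<Suc (card F). (\<forall>x\<in>B. m j x \<in> Dom N) \<and>
    (\<forall>\<chi>\<in>\<Delta>. \<forall>i<j. sat M (case_sum (m j) (m i)) [] \<chi> \<longleftrightarrow> sat M (case_sum b (m i)) [] \<chi>)" ..
  note m = this[rule_format]
  define w where "w = case_sum (case_sum b b') (\<lambda>(j, x). m (k j) x)"
  show "realizable M ((B <+> B) <+> (J \<times> B)) (Inl ` (B <+> B)) (case_sum (case_sum b b') u) q"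
  proof (rule realizableI[of _ w])
    fix x assume x: "x \<in> (B <+> B) <+> (J \<times> B)"
    have "m (k j) y \<in> Dom M" if "y \<in> B" for j y
      using m[OF kF, of j] elem_structs(3)[OF el] that by auto
    then show "w x \<in> Dom M" using b x by (auto simp: w_def)
  next
    fix x :: "('b + 'b) + 'j \<times> 'b" assume "x \<in> Inl ` (B <+> B)"
    then show "w x = case_sum (case_sum b b') u x" by (auto simp: w_def)
  next
    fix \<phi> assume "\<phi> \<in> q"
    then obtain s \<chi> i j where t: "(s, \<chi>, i, j) \<in> p" and \<phi>: "\<phi> = seq_fm (s, \<chi>, i, j)"
      using p(3) by auto
    have ij: "(i, j) \<in> r" "i \<noteq> j" using subsetD[OF p(1) t] by simp_all
    have "i \<in> F" unfolding F_def by (rule UnI1, rule image_eqI[OF _ t]) simp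
    moreover have "\<chi> \<in> \<Delta>" unfolding \<Delta>_def by (rule image_eqI[OF _ t]) simp
    ultimately have iF: "i \<in> F" "\<chi> \<in> \<Delta>" by simp_all
    then have "sat M (case_sum (m (k j)) (m (k i))) [] \<chi> \<longleftrightarrow> sat M (case_sum b (m (k i))) [] \<chi>"
      using m[OF kF, of j] kmono[OF ij] by simp
    moreover have "sat M (case_sum b (m (k i))) [] \<chi> \<longleftrightarrow> sat M (case_sum b' (m (k i))) [] \<chi>"
    proof (rule eqtD)
      show "eqt L (B <+> B) M (case_sum b (m (k i))) M (case_sum b' (m (k i)))"
        using m[OF kF, of i] by (intro eq) simp
      show "\<chi> \<in> Form L (B <+> B)" using \<Delta> iF(2) by (rule subsetD)
    qed
    ultimately show "sat M w [] \<phi>" unfolding \<phi> sat_seq_fm by (cases s) (simp_all add: w_def)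
  qed
qed

text \<open>Two members \<open>y\<^sub>i\<close>, \<open>y\<^sub>j\<close> of a sequence longer than the number of classes are equivalent, and then
  so are \<open>b\<close> and \<open>b'\<close>, since \<open>(b, y\<^sub>i)\<close> and \<open>(b', y\<^sub>i)\<close> have the type of \<open>(y\<^sub>j, y\<^sub>i)\<close>.\<close>

lemma bounded_invariant:
  fixes b b' :: "'b \<Rightarrow> 'a" and M :: "('f, 'r, 'a) struct" and K :: "'k set"
  assumes st: "is_struct L M" and sat: "saturated L \<kappa> M" and hom: "strongly_homogeneous L \<kappa> M"
    and sl: "strong_limit \<kappa>" and B: "|B| <o \<kappa>" and K: "|K| <o \<kappa>"
    and cl: "\<And>f. (\<And>x. x \<in> B \<Longrightarrow> f x \<in> Dom M) \<Longrightarrow> cl f \<in> K"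
    and inv: "\<And>\<sigma> f g f' g'. \<sigma> \<in> Aut L M \<Longrightarrow> (\<And>x. x \<in> B \<Longrightarrow> f x \<in> Dom M) \<Longrightarrow> (\<And>x. x \<in> B \<Longrightarrow> g x \<in> Dom M) \<Longrightarrow>
       (\<And>x. x \<in> B \<Longrightarrow> f' x = \<sigma> (f x)) \<Longrightarrow> (\<And>x. x \<in> B \<Longrightarrow> g' x = \<sigma> (g x)) \<Longrightarrow> cl f = cl g \<Longrightarrow> cl f' = cl g'"
    and b: "\<And>x. x \<in> B \<Longrightarrow> b x \<in> Dom M" "\<And>x. x \<in> B \<Longrightarrow> b' x \<in> Dom M"
    and fs: "finsat M ((B <+> B) <+> (Pow K \<times> B)) (Inl ` (B <+> B)) (case_sum (case_sum b b') u) (seq_type L B |Pow K| )"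
  shows "cl b = cl b'"
proof -
  have ci: "Cinfinite \<kappa>" using sl by (simp add: strong_limit_def)
  have r: "well_order_on (Pow K) |Pow K|" by (rule card_of_well_order_on)
  have r2: "|Pow K| \<subseteq> Pow K \<times> Pow K" "total_on (Pow K) |Pow K|"
    using well_order_on_domain[OF r] r by (auto simp: well_order_on_def linear_order_on_def)
  have BB: "|B <+> B| <o \<kappa>" by (rule card_Plus_less[OF ci B B])
  have U: "|(B <+> B) <+> (Pow K \<times> B)| <o \<kappa>"
    by (rule card_Plus_less[OF ci BB card_Times_less[OF ci strong_limit_Pow[OF sl K] B]])
  have ne: "Dom M \<noteq> {}" using st by (simp add: is_struct_def)
  have "Inl ` (B <+> B) \<subseteq> (B <+> B) <+> (Pow K \<times> B)" by auto
  from saturated_realizes[OF sat U seq_type_Form[OF r2(1)] this ne fs]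
  obtain w where w: "(\<forall>x\<in>(B <+> B) <+> (Pow K \<times> B). w x \<in> Dom M) \<and>
      (\<forall>x\<in>Inl ` (B <+> B). w x = case_sum (case_sum b b') u x) \<and> (\<forall>\<phi>\<in>seq_type L B |Pow K|. sat M w [] \<phi>)"
    unfolding realizable_def ..
  define y where "y j x = w (Inr (j, x))" for j x
  have y: "y j x \<in> Dom M" if "j \<in> Pow K" "x \<in> B" for j x using w that unfolding y_def by blast
  have wb: "w (Inl (Inl x)) = b x" "w (Inl (Inr x)) = b' x" if "x \<in> B" for x
  proof -
    have "w (Inl y) = case_sum b b' y" if "y \<in> B <+> B" for y using w that by auto
    from this[of "Inl x"] this[of "Inr x"] that
    show "w (Inl (Inl x)) = b x" "w (Inl (Inr x)) = b' x" by auto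
  qed
  \<comment> \<open>The sequence is indexed by \<open>Pow K\<close>, which outnumbers the possible
    values in \<open>K\<close>.\<close>
  have "\<not> inj_on (\<lambda>j. cl (y j)) (Pow K)"
  proof
    assume "inj_on (\<lambda>j. cl (y j)) (Pow K)"
    moreover have "(\<lambda>j. cl (y j)) ` Pow K \<subseteq> K" using cl y by (intro image_subsetI) simp
    ultimately have "|Pow K| \<le>o |K|" by (metis card_of_ordLeq)
    then show False using card_of_Pow[of K] not_ordLess_ordLeq by metis
  qed
  then obtain i j where "i \<in> Pow K" "j \<in> Pow K" "i \<noteq> j" "cl (y j) = cl (y i)"
    unfolding inj_on_def by metis
  \<comment> \<open>The equation is symmetric in \<open>i\<close> and \<open>j\<close>, so the pair
    can be put in the order of the index set.\<close>
  then have "\<exists>i j. i \<in> Pow K \<and> j \<in> Pow K \<and> i \<noteq> j \<and> cl (y j) = cl (y i) \<and> (i, j) \<in> |Pow K|"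
    using r2(2) unfolding total_on_def by metis
  then obtain i j where ij: "i \<in> Pow K" "j \<in> Pow K" "i \<noteq> j" and E: "cl (y j) = cl (y i)" and rij: "(i, j) \<in> |Pow K|"
    by metis
  have sq: "sat M w [] (seq_fm (s, \<chi>, i, j))" if "\<chi> \<in> Form L (B <+> B)" for s \<chi>
  proof -
    have "seq_fm (s, \<chi>, i, j) \<in> seq_type L B |Pow K|" unfolding seq_type_def using that rij ij(3) by (intro imageI) simp
    then show ?thesis using w by simp
  qed
  have e0: "eqt L (B <+> B) M (case_sum (\<lambda>x. if s then y j x else w (Inl (Inr x))) (y i))
      M (case_sum (\<lambda>x. w (Inl (Inl x))) (y i))" for s
    unfolding eqt_def using sq[unfolded sat_seq_fm, folded y_def] by blast
  have e1: "eqt L (B <+> B) M (case_sum (y j) (y i)) M (case_sum b (y i))"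
    by (rule eqt_congI[OF e0[of True]]) (use wb in auto)
  have e2: "eqt L (B <+> B) M (case_sum b' (y i)) M (case_sum b (y i))"
    by (rule eqt_congI[OF e0[of False]]) (use wb in auto)
  \<comment> \<open>Equality of types yields an automorphism that fixes the entries of
    \<open>y i\<close> and carries \<open>f\<close> to \<open>g\<close>; it respects equality of
    \<open>cl\<close>.\<close>
  have move: "cl g = cl (y i)" if eq: "eqt L (B <+> B) M (case_sum f (y i)) M (case_sum g (y i))"
    and f: "\<And>x. x \<in> B \<Longrightarrow> f x \<in> Dom M" and g: "\<And>x. x \<in> B \<Longrightarrow> g x \<in> Dom M" and E: "cl f = cl (y i)" for f g
  proof -
    have "\<exists>\<sigma>\<in>Aut L M. \<forall>x\<in>B <+> B. \<sigma> (case_sum f (y i) x) = case_sum g (y i) x"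
      by (rule strongly_homogeneous_extends[OF hom BB _ _ eq]) (use f g y ij in auto)
    then obtain \<sigma> where \<sigma>: "\<sigma> \<in> Aut L M" and s: "\<forall>x\<in>B <+> B. \<sigma> (case_sum f (y i) x) = case_sum g (y i) x" ..
    have "\<sigma> (f x) = g x" "\<sigma> (y i x) = y i x" if "x \<in> B" for x
      using s[rule_format, of "Inl x"] s[rule_format, of "Inr x"] that by auto
    then show ?thesis using y[OF ij(1)] f by (intro inv[OF \<sigma> _ _ _ _ E]) simp_all
  qed
  have c1: "cl b = cl (y i)" by (rule move[OF e1 y[OF ij(2)] b(1) E])
  have "cl b' = cl (y i)" by (rule move[OF eqt_sym[OF e2] b(1) b(2) c1])
  with c1 show ?thesis by simp
qed

lemma monsterD:
  assumes "monster L T \<kappa> M"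
  shows "strong_limit \<kappa>" "Cinfinite \<kappa>" "is_struct L M" "saturated L \<kappa> M" "strongly_homogeneous L \<kappa> M"
    "|T| <o \<kappa>" "is_model L T M"
  using assms by (simp_all add: monster_def is_model_def strong_limit_def)

section \<open>Lascar strong automorphisms are Kim--Pillay strong\<close>

lemma compose_id_tuple:
  assumes "a \<in> I \<rightarrow>\<^sub>E A" "\<And>x. x \<in> I \<Longrightarrow> f (a x) = a x"
  shows "compose I f a = a"
proof
  fix x show "compose I f a x = a x"
    using assms(2)[of x] PiE_arb[OF assms(1), of x] by (simp add: compose_def)
qed

lemma compose_compose_tuple: "compose I f (compose I g a) = compose I (\<lambda>x. f (g x)) a"
  by (rule ext) (simp add: compose_def)

lemma compose_cong_tuple: "(\<And>x. x \<in> I \<Longrightarrow> f (a x) = g (a x)) \<Longrightarrow> compose I f a = compose I g a"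
  by (rule ext) (simp add: compose_def)

lemma compose_Aut_tuples:
  "\<sigma> \<in> Aut L M \<Longrightarrow> a \<in> tuples I M \<Longrightarrow> compose I \<sigma> a \<in> tuples I M"
  by (auto simp: compose_def dest: Aut_D(5) intro!: restrict_PiE_iff[THEN iffD2])

lemma type_definable_Aut:
  assumes st: "is_struct L M" and td: "type_definable_rel L M I E" and \<sigma>: "\<sigma> \<in> Aut L M" and ab: "(a, b) \<in> E"
  shows "(compose I \<sigma> a, compose I \<sigma> b) \<in> E"
proof -
  from td[unfolded type_definable_rel_def] obtain \<pi> where \<pi>': "\<pi> \<subseteq> Form L (I <+> I) \<and>
    E = {(a, b). a \<in> tuples I M \<and> b \<in> tuples I M \<and> (\<forall>\<phi>\<in>\<pi>. sat M (case_sum a b) [] \<phi>)}" ..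
  note \<pi> = \<pi>'[THEN conjunct1] \<pi>'[THEN conjunct2]
  have t: "a \<in> tuples I M" "b \<in> tuples I M" using ab unfolding \<pi>(2) by simp_all
  have "eqt L (I <+> I) M (case_sum a b) M (case_sum (compose I \<sigma> a) (compose I \<sigma> b))"
  proof (rule eqt_Aut[OF st \<sigma>])
    fix x assume "x \<in> I <+> I"
    then show "case_sum a b x \<in> Dom M"
      "case_sum (compose I \<sigma> a) (compose I \<sigma> b) x = \<sigma> (case_sum a b x)"
      using PiE_mem[OF t(1)] PiE_mem[OF t(2)] by (auto simp: compose_eq)
  qed
  moreover have "\<forall>\<phi>\<in>\<pi>. sat M (case_sum a b) [] \<phi>" using ab unfolding \<pi>(2) by simp
  ultimately have "sat M (case_sum (compose I \<sigma> a) (compose I \<sigma> b)) [] \<phi>" if "\<phi> \<in> \<pi>" for \<phi>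
    using eqtD[OF _ subsetD[OF \<pi>(1) that]] that by metis
  then show ?thesis using t compose_Aut_tuples[OF \<sigma> t(1)] compose_Aut_tuples[OF \<sigma> t(2)] unfolding \<pi>(2) by simp
qed

lemma small_fix_inv:
  assumes "is_struct L M" "\<sigma> \<in> small_fix L \<kappa> M"
  shows "aut_inv M \<sigma> \<in> small_fix L \<kappa> M"
proof -
  obtain N where N: "|N| <o \<kappa>" "elementary_sub L (M\<lparr>Dom := N\<rparr>) M" "\<forall>x\<in>N. \<sigma> x = x" and \<sigma>: "\<sigma> \<in> Aut L M"
    using assms(2) unfolding small_fix_def by auto
  have "aut_inv M \<sigma> x = x" if "x \<in> N" for x
    using aut_inv(1)[OF \<sigma>, of x] N(3) that elem_structs(3)[OF N(2)] by auto
  then show ?thesis using N Aut_inv[OF assms(1) \<sigma>] unfolding small_fix_def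
    by (intro CollectI conjI exI[of _ N]) simp_all
qed

text \<open>\<open>bounded_invariant\<close> for the class map of \<open>E\<close>: since
  \<open>\<sigma>\<close> fixes the submodel \<open>N\<close>, the tuple \<open>a\<close> and its
  image have the same type over \<open>N\<close>.\<close>

lemma small_fix_KP_class:
  fixes M :: "('f, 'r, 'a) struct" and I :: "'i set"
  assumes mon: "monster L T \<kappa> M" and \<sigma>: "\<sigma> \<in> small_fix L \<kappa> M"
    and I: "|I| <o \<kappa>" and td: "type_definable_rel L M I E" and eqv: "equiv (tuples I M) E"
    and bd: "|tuples I M // E| <o \<kappa>" and a: "a \<in> tuples I M"
  shows "(a, compose I \<sigma> a) \<in> E"
proof -
  note m = monsterD[OF mon]
  have \<sigma>A: "\<sigma> \<in> Aut L M" using \<sigma> by (simp add: small_fix_def)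
  obtain N where N: "elementary_sub L (M\<lparr>Dom := N\<rparr>) M" "\<forall>x\<in>N. \<sigma> x = x"
    using \<sigma> unfolding small_fix_def by auto
  define cl where "cl f = E `` {restrict f I}" for f
  have res: "restrict f I \<in> tuples I M" if "\<And>x. x \<in> I \<Longrightarrow> f x \<in> Dom M" for f :: "'i \<Rightarrow> 'a"
    using that by auto
  have a': "a x \<in> Dom M" "\<sigma> (a x) \<in> Dom M" if "x \<in> I" for x using a that Aut_D(5)[OF \<sigma>A] by auto
  have "cl a = cl (\<lambda>x. \<sigma> (a x))"
  proof (rule bounded_invariant[OF m(3,4,5,1) I bd])
    show "cl f \<in> tuples I M // E" if "\<And>x. x \<in> I \<Longrightarrow> f x \<in> Dom M" for f
      unfolding cl_def using res[OF that] by (rule quotientI)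
    show "cl f' = cl g'" if \<tau>: "\<tau> \<in> Aut L M" and f: "\<And>x. x \<in> I \<Longrightarrow> f x \<in> Dom M" and g: "\<And>x. x \<in> I \<Longrightarrow> g x \<in> Dom M"
      and f': "\<And>x. x \<in> I \<Longrightarrow> f' x = \<tau> (f x)" and g': "\<And>x. x \<in> I \<Longrightarrow> g' x = \<tau> (g x)" and eq: "cl f = cl g" for \<tau> f g f' g'
    proof -
      have "(restrict f I, restrict g I) \<in> E"
        by (rule eq_equiv_class[OF eq[unfolded cl_def] eqv res[OF g]])
      from type_definable_Aut[OF m(3) td \<tau> this]
      have "(compose I \<tau> (restrict f I), compose I \<tau> (restrict g I)) \<in> E" .
      moreover have "compose I \<tau> (restrict f I) = restrict f' I" "compose I \<tau> (restrict g I) = restrict g' I"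
        using f' g' by (auto simp: compose_def fun_eq_iff)
      ultimately show ?thesis unfolding cl_def by (simp add: equiv_class_eq[OF eqv])
    qed
    show "finsat M ((I <+> I) <+> (Pow (tuples I M // E) \<times> I)) (Inl ` (I <+> I))
        (case_sum (case_sum a (\<lambda>x. \<sigma> (a x))) undefined) (seq_type L I |Pow (tuples I M // E)| )"
    proof (rule seq_type_finsat[OF N(1) a' _ card_of_well_order_on])
      fix n assume n: "\<And>x. x \<in> I \<Longrightarrow> n x \<in> Dom (M\<lparr>Dom := N\<rparr>)"
      show "eqt L (I <+> I) M (case_sum a n) M (case_sum (\<lambda>x. \<sigma> (a x)) n)"
        using a' n N elem_structs(3)[OF N(1)] by (intro eqt_Aut[OF m(3) \<sigma>A]) auto
    qed
  qed (use a' in simp_all)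
  moreover have "restrict a I = a" "restrict (\<lambda>x. \<sigma> (a x)) I = compose I \<sigma> a"
    using a by (auto simp: compose_def)
  ultimately have "E `` {a} = E `` {compose I \<sigma> a}" unfolding cl_def by simp
  then show ?thesis using eq_equiv_class[OF _ eqv compose_Aut_tuples[OF \<sigma>A a]] by simp
qed

lemma Autf_KP_iff:
  "\<sigma> \<in> Autf_KP L \<kappa> M \<longleftrightarrow> \<sigma> \<in> Aut L M \<and> (\<forall>I E. bounded_index \<kappa> I \<and>
     type_definable_rel L M I E \<and> equiv (tuples I M) E \<and> |tuples I M // E| <o \<kappa> \<longrightarrow>
     (\<forall>X \<in> tuples I M // E. compose I \<sigma> ` X = X))"
  unfolding Autf_KP_def by (rule mem_Collect_eq)

lemmas Autf_KP_class = Autf_KP_iff[THEN iffD1, THEN conjunct2, rule_format]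

lemma subgroup_Autf_KP:
  assumes st: "is_struct L M"
  shows "subgroup (Autf_KP L \<kappa> M) (AutG L M)"
proof -
  interpret group "AutG L M" by (rule group_AutG[OF st])
  have class_sub: "X \<subseteq> tuples I M" if "equiv (tuples I M) E" "X \<in> tuples I M // E" for I X and E :: "('k \<Rightarrow> 'c) rel"
    using that by (rule in_quotient_imp_subset)
  show ?thesis
  proof
    show "Autf_KP L \<kappa> M \<subseteq> carrier (AutG L M)" by (auto simp: Autf_KP_iff AutG_simps)
    show "\<one>\<^bsub>AutG L M\<^esub> \<in> Autf_KP L \<kappa> M"
      unfolding Autf_KP_iff
    proof (intro conjI allI impI ballI)
      show "\<one>\<^bsub>AutG L M\<^esub> \<in> Aut L M" using id_Aut[OF st] by (simp add: AutG_simps)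
      fix I E X assume "bounded_index \<kappa> I \<and> type_definable_rel L M I E \<and> equiv (tuples I M) E \<and> |tuples I M // E| <o \<kappa>"
        and X: "X \<in> tuples I M // E"
      then have "X \<subseteq> tuples I M" using class_sub by metis
      then have "compose I \<one>\<^bsub>AutG L M\<^esub> a = a" if "a \<in> X" for a
        using PiE_mem[OF subsetD[OF \<open>X \<subseteq> tuples I M\<close> that]]
        by (intro compose_id_tuple[OF subsetD[OF \<open>X \<subseteq> tuples I M\<close> that]]) (simp add: AutG_simps)
      then show "compose I \<one>\<^bsub>AutG L M\<^esub> ` X = X" by simp
    qed
    fix \<sigma> assume \<sigma>: "\<sigma> \<in> Autf_KP L \<kappa> M"
    then have \<sigma>A: "\<sigma> \<in> Aut L M" by (simp add: Autf_KP_iff)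
    show "inv\<^bsub>AutG L M\<^esub> \<sigma> \<in> Autf_KP L \<kappa> M"
      unfolding inv_AutG[OF st \<sigma>A] Autf_KP_iff
    proof (intro conjI allI impI ballI)
      show "aut_inv M \<sigma> \<in> Aut L M" by (rule Aut_inv[OF st \<sigma>A])
      fix I E X assume h: "bounded_index \<kappa> I \<and> type_definable_rel L M I E \<and> equiv (tuples I M) E \<and> |tuples I M // E| <o \<kappa>"
        and X: "X \<in> tuples I M // E"
      then have sub: "X \<subseteq> tuples I M" using class_sub by metis
      have "compose I \<sigma> ` X = X" by (rule Autf_KP_class[OF \<sigma> h X])
      then have "compose I (aut_inv M \<sigma>) ` X = compose I (aut_inv M \<sigma>) ` (compose I \<sigma> ` X)" by simp
      also have "\<dots> = X"
      proof -
        have "compose I (aut_inv M \<sigma>) (compose I \<sigma> a) = a" if "a \<in> X" for a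
          unfolding compose_compose_tuple using PiE_mem[OF subsetD[OF sub that]]
          by (intro compose_id_tuple[OF subsetD[OF sub that]]) (simp add: aut_inv[OF \<sigma>A])
        then show ?thesis by (simp add: image_image)
      qed
      finally show "compose I (aut_inv M \<sigma>) ` X = X" .
    qed
    fix \<tau> assume \<tau>: "\<tau> \<in> Autf_KP L \<kappa> M"
    then have \<tau>A: "\<tau> \<in> Aut L M" by (simp add: Autf_KP_iff)
    have "compose (Dom M) \<sigma> \<tau> \<in> Autf_KP L \<kappa> M"
      unfolding Autf_KP_iff
    proof (intro conjI allI impI ballI)
      show "compose (Dom M) \<sigma> \<tau> \<in> Aut L M" by (rule Aut_compose[OF st \<sigma>A \<tau>A])
      fix I E X assume h: "bounded_index \<kappa> I \<and> type_definable_rel L M I E \<and> equiv (tuples I M) E \<and> |tuples I M // E| <o \<kappa>"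
        and X: "X \<in> tuples I M // E"
      then have sub: "X \<subseteq> tuples I M" using class_sub by metis
      have "compose I \<sigma> ` X = X" "compose I \<tau> ` X = X"
        by (rule Autf_KP_class[OF \<sigma> h X], rule Autf_KP_class[OF \<tau> h X])
      moreover have "compose I (compose (Dom M) \<sigma> \<tau>) a = compose I \<sigma> (compose I \<tau> a)" if "a \<in> X" for a
        unfolding compose_compose_tuple using PiE_mem[OF subsetD[OF sub that]]
        by (intro compose_cong_tuple) (simp add: compose_eq)
      then have "compose I (compose (Dom M) \<sigma> \<tau>) ` X = compose I \<sigma> ` (compose I \<tau> ` X)" by (simp add: image_image)
      ultimately show "compose I (compose (Dom M) \<sigma> \<tau>) ` X = X" by simp
    qed
    then show "\<sigma> \<otimes>\<^bsub>AutG L M\<^esub> \<tau> \<in> Autf_KP L \<kappa> M" using \<sigma>A \<tau>A by (simp add: AutG_simps)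
  qed
qed

lemma Autf_L_subset_KP:
  assumes mon: "monster L T \<kappa> M"
  shows "Autf_L L \<kappa> M \<subseteq> Autf_KP L \<kappa> M"
  unfolding Autf_L_eq
proof (rule group.generate_subgroup_incl[OF group_AutG _ subgroup_Autf_KP])
  note m = monsterD[OF mon]
  show "is_struct L M" "is_struct L M" by (rule m(3))+
  show "small_fix L \<kappa> M \<subseteq> Autf_KP L \<kappa> M"
  proof
    fix \<sigma> assume \<sigma>: "\<sigma> \<in> small_fix L \<kappa> M"
    then have \<sigma>A: "\<sigma> \<in> Aut L M" by (simp add: small_fix_def)
    show "\<sigma> \<in> Autf_KP L \<kappa> M"
      unfolding Autf_KP_iff
    proof (intro conjI allI impI ballI)
      fix I E X assume h: "bounded_index \<kappa> I \<and> type_definable_rel L M I E \<and> equiv (tuples I M) E \<and> |tuples I M // E| <o \<kappa>"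
        and X: "X \<in> tuples I M // E"
      then have eqv: "equiv (tuples I M) E" and I: "|I| <o \<kappa>" by (auto simp: bounded_index_def)
      have sub: "X \<subseteq> tuples I M" by (rule in_quotient_imp_subset[OF eqv X])
      have st: "compose I \<tau> a \<in> X" if "\<tau> \<in> small_fix L \<kappa> M" "a \<in> X" for \<tau> a
        using small_fix_KP_class[OF mon that(1) I] h that(2) sub
        by (intro in_quotient_imp_closed[OF eqv X that(2)]) auto
      show "compose I \<sigma> ` X = X"
      proof
        show "compose I \<sigma> ` X \<subseteq> X" using st[OF \<sigma>] by (intro image_subsetI)
        \<comment> \<open>The inverse of \<open>\<sigma>\<close> fixes the same submodel, hence
          preimages also stay in the class.\<close>
        show "X \<subseteq> compose I \<sigma> ` X"
        proof
          fix a assume a: "a \<in> X"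
          have "compose I \<sigma> (compose I (aut_inv M \<sigma>) a) = a"
            unfolding compose_compose_tuple using PiE_mem[OF subsetD[OF sub a]]
            by (intro compose_id_tuple[OF subsetD[OF sub a]]) (simp add: aut_inv[OF \<sigma>A])
          then show "a \<in> compose I \<sigma> ` X"
            using st[OF small_fix_inv[OF m(3) \<sigma>] a] by (metis imageI)
        qed
      qed
    qed (rule \<sigma>A)
  qed
qed

section \<open>Global types and their invariant extensions\<close>

abbreviation act :: "('a \<Rightarrow> 'b) \<Rightarrow> ('f, 'r, 'i + 'a) fm \<Rightarrow> ('f, 'r, 'i + 'b) fm" where
  "act \<sigma> \<equiv> map_fm (map_sum id \<sigma>)"

text \<open>The valuation of parameters by themselves. It is used as a prescription on atoms
  \<open>Inr x\<close> only, so its value at the variables is a dummy.\<close>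

abbreviation pv :: "'i + 'a \<Rightarrow> 'a" where
  "pv \<equiv> case_sum undefined id"

lemma act_act: "act \<sigma> (act \<tau> \<phi>) = act (\<lambda>x. \<sigma> (\<tau> x)) \<phi>"
  unfolding fm.map_comp by (rule fm.map_cong0) (simp add: sum.map_comp comp_def id_def)

lemma act_cong:
  assumes "\<phi> \<in> Form L (I <+> A)" "\<And>x. x \<in> A \<Longrightarrow> \<sigma> x = \<tau> x"
  shows "act \<sigma> \<phi> = act \<tau> \<phi>"
proof (rule fm.map_cong0)
  fix z assume "z \<in> fv \<phi>"
  then have "z \<in> I <+> A" using assms(1) by (auto simp: Form_def)
  then show "map_sum id \<sigma> z = map_sum id \<tau> z" using assms(2) by auto
qed

lemma act_id:
  assumes "\<phi> \<in> Form L (I <+> A)" "\<And>x. x \<in> A \<Longrightarrow> \<sigma> x = x"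
  shows "act \<sigma> \<phi> = \<phi>"
proof -
  have "act \<sigma> \<phi> = act id \<phi>" using assms by (intro act_cong[OF assms(1)]) simp
  then show ?thesis by (simp add: sum.map_id0 fm.map_id0)
qed

lemma act_Form: "\<phi> \<in> Form L (I <+> A) \<Longrightarrow> (\<And>x. x \<in> A \<Longrightarrow> \<sigma> x \<in> B) \<Longrightarrow> act \<sigma> \<phi> \<in> Form L (I <+> B)"
  by (erule Form_map_fm) auto

lemma sat_act: "sat M (case_sum a v) bs (act \<sigma> \<phi>) \<longleftrightarrow> sat M (case_sum a (\<lambda>x. v (\<sigma> x))) bs \<phi>"
proof -
  have "case_sum a v \<circ> map_sum id \<sigma> = case_sum a (\<lambda>x. v (\<sigma> x))" by (auto simp: fun_eq_iff split: sum.splits)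
  then show ?thesis by (simp add: sat_map_fm)
qed

lemma mem_tp: "\<phi> \<in> tp L M I a A \<longleftrightarrow> \<phi> \<in> Form L (I <+> A) \<and> sat M (case_sum a id) [] \<phi>"
  by (simp add: tp_def)

lemma tp_eq_iff: "tp L M I a A = tp L M I b A \<longleftrightarrow> eqt L (I <+> A) M (case_sum a id) M (case_sum b id)"
  unfolding tp_def eqt_def by (simp add: set_eq_iff) metis

lemma tp_empty_eq_iff: "tp L M I a {} = tp L M I b {} \<longleftrightarrow> eqt L I M a M b"
proof
  assume "tp L M I a {} = tp L M I b {}"
  then have "eqt L (I <+> {}) M (case_sum a id) M (case_sum b id)" by (simp add: tp_eq_iff)
  then have "eqt L I M (case_sum a id \<circ> Inl) M (case_sum b id \<circ> Inl)" by (rule eqt_comp) auto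
  then show "eqt L I M a M b" by (simp add: comp_def)
next
  assume "eqt L I M a M b"
  then have "eqt L (I <+> {}) M (a \<circ> projl) M (b \<circ> projl)" by (rule eqt_comp) auto
  then have "eqt L (I <+> {}) M (case_sum a id) M (case_sum b id)" by (rule eqt_congI) auto
  then show "tp L M I a {} = tp L M I b {}" by (simp add: tp_eq_iff)
qed

lemma tp_cong: "(\<And>x. x \<in> I \<Longrightarrow> a x = b x) \<Longrightarrow> tp L M I a A = tp L M I b A"
  unfolding tp_eq_iff eqt_def by (intro ballI sat_Form_cong) auto

text \<open>Since \<open>Dom C\<close> is smaller than \<open>\<kappa>'\<close>, the monster
  \<open>C\<close> is itself a small submodel of \<open>C'\<close>. Automorphisms of
  \<open>C'\<close> that fix it pointwise are therefore Lascar strong.\<close>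

locale monster_pair =
  fixes L :: "('f, 'r) lang" and T :: "('f, 'r, nat) fm set"
    and C C' :: "('f, 'r, 'a) struct" and \<kappa> :: "'k rel" and \<kappa>' :: "'l rel"
    and I :: "'i set" and c :: "'i \<Rightarrow> 'a"
  assumes T: "complete_theory L T" and C: "monster L T \<kappa> C" and C': "monster L T \<kappa>' C'"
    and el: "elementary_sub L C C'" and small: "|Dom C| <o \<kappa>'" and c: "bij_betw c I (Dom C)"
begin

lemmas mC = monsterD[OF C] and mC' = monsterD[OF C']

abbreviation "S \<equiv> S_types L C C' I c"

lemma sub: "x \<in> Dom C \<Longrightarrow> x \<in> Dom C'"
  using elem_structs(3)[OF el] by auto

lemma nonempty: "Dom C \<noteq> {}" "Dom C' \<noteq> {}"
  using mC(3) mC'(3) by (auto simp: is_struct_def)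

lemma c_Dom: "x \<in> I \<Longrightarrow> c x \<in> Dom C" "x \<in> I \<Longrightarrow> c x \<in> Dom C'" "c ` I = Dom C"
  using c sub by (auto simp: bij_betw_def)

lemma card_I: "|I| <o \<kappa>'"
  using card_of_ordIsoI[OF c] small by (rule ordIso_ordLess_trans)

lemma elC: "elementary_sub L (C'\<lparr>Dom := Dom C\<rparr>) C'"
  by (rule elem_reduct[OF el])

lemma Aut_extend:
  assumes "\<sigma> \<in> Aut L C"
  shows "\<exists>\<sigma>'\<in>Aut L C'. \<forall>x\<in>Dom C. \<sigma>' x = \<sigma> x"
proof -
  have "eqt L (Dom C) C id C \<sigma>" by (rule eqt_Aut[OF mC(3) assms]) auto
  moreover have "eqt L (Dom C) C id C' id" by (rule elem_eqt[OF el]) simp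
  moreover have "eqt L (Dom C) C \<sigma> C' \<sigma>" by (rule elem_eqt[OF el]) (rule Aut_D(5)[OF assms])
  ultimately have "eqt L (Dom C) C' id C' \<sigma>" using eqt_trans eqt_sym by metis
  from strongly_homogeneous_extends[OF mC'(5) small _ _ this]
  show ?thesis using sub Aut_D(5)[OF assms] by simp
qed

lemma S_E:
  assumes "p \<in> S"
  obtains a where "a \<in> tuples I C'" "p = tp L C' I a (Dom C)" "eqt L I C' a C' c"
proof -
  from assms[unfolded S_types_def mem_Collect_eq]
  obtain a where "p = tp L C' I a (Dom C) \<and> a \<in> tuples I C' \<and> tp L C' I a {} = tp L C' I c {}" ..
  then show thesis by (intro that[of a]) (simp_all add: tp_empty_eq_iff)
qed

lemma S_I:
  assumes "\<And>x. x \<in> I \<Longrightarrow> a x \<in> Dom C'" "eqt L I C' a C' c"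
  shows "tp L C' I a (Dom C) \<in> S"
proof -
  have 1: "tp L C' I a A = tp L C' I (restrict a I) A" for A by (rule tp_cong) simp
  have 2: "restrict a I \<in> tuples I C'" using assms(1) by auto
  have 3: "tp L C' I (restrict a I) {} = tp L C' I c {}" using assms(2) by (simp flip: 1 add: tp_empty_eq_iff)
  show ?thesis unfolding S_types_def using 1[of "Dom C"] 2 3 by blast
qed

lemma S_Form: "p \<in> S \<Longrightarrow> \<phi> \<in> p \<Longrightarrow> \<phi> \<in> Form L (I <+> Dom C)"
  by (elim S_E) (simp add: mem_tp)

lemma S_Neg: "p \<in> S \<Longrightarrow> \<phi> \<in> Form L (I <+> Dom C) \<Longrightarrow> Neg \<phi> \<in> p \<longleftrightarrow> \<phi> \<notin> p"
  by (elim S_E) (simp add: mem_tp)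

lemma S_ext:
  assumes "p \<in> S" "q \<in> S" "\<And>\<phi>. \<phi> \<in> Form L (I <+> Dom C) \<Longrightarrow> \<phi> \<in> p \<longleftrightarrow> \<phi> \<in> q"
  shows "p = q"
proof (rule Set.set_eqI)
  fix \<phi>
  show "\<phi> \<in> p \<longleftrightarrow> \<phi> \<in> q"
    using S_Form[OF assms(1), of \<phi>] S_Form[OF assms(2), of \<phi>] assms(3)[of \<phi>] by argo
qed

lemma act_FormC: "\<sigma> \<in> Aut L C \<Longrightarrow> \<phi> \<in> Form L (I <+> Dom C) \<Longrightarrow> act \<sigma> \<phi> \<in> Form L (I <+> Dom C)"
  using Aut_D(5) by (intro act_Form) auto

lemma act_inv:
  assumes "\<sigma> \<in> Aut L C" "\<phi> \<in> Form L (I <+> Dom C)"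
  shows "act (aut_inv C \<sigma>) (act \<sigma> \<phi>) = \<phi>" "act \<sigma> (act (aut_inv C \<sigma>) \<phi>) = \<phi>"
  unfolding act_act using aut_inv[OF assms(1)] by (auto intro!: act_id[OF assms(2)])

lemma type_act_mem:
  assumes "\<sigma> \<in> Aut L C" "p \<in> S" "\<phi> \<in> Form L (I <+> Dom C)"
  shows "\<phi> \<in> type_act \<sigma> p \<longleftrightarrow> act (aut_inv C \<sigma>) \<phi> \<in> p"
proof
  assume "\<phi> \<in> type_act \<sigma> p"
  then obtain \<psi> where "\<psi> \<in> p" "\<phi> = act \<sigma> \<psi>" unfolding type_act_def by auto
  then show "act (aut_inv C \<sigma>) \<phi> \<in> p" using act_inv(1)[OF assms(1) S_Form[OF assms(2)]] by simp
next
  assume "act (aut_inv C \<sigma>) \<phi> \<in> p"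
  then have "act \<sigma> (act (aut_inv C \<sigma>) \<phi>) \<in> type_act \<sigma> p" unfolding type_act_def by (rule imageI)
  then show "\<phi> \<in> type_act \<sigma> p" using act_inv(2)[OF assms(1,3)] by simp
qed

lemma type_act_act_mem:
  assumes "\<sigma> \<in> Aut L C" "p \<in> S" "\<phi> \<in> Form L (I <+> Dom C)"
  shows "act \<sigma> \<phi> \<in> type_act \<sigma> p \<longleftrightarrow> \<phi> \<in> p"
  using type_act_mem[OF assms(1,2) act_FormC[OF assms(1,3)]] act_inv(1)[OF assms(1,3)] by simp

lemma type_act_tp:
  assumes \<sigma>: "\<sigma> \<in> Aut L C" and \<sigma>': "\<sigma>' \<in> Aut L C'" "\<And>x. x \<in> Dom C \<Longrightarrow> \<sigma>' x = \<sigma> x"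
    and a: "\<And>x. x \<in> I \<Longrightarrow> a x \<in> Dom C'" "eqt L I C' a C' c"
  shows "type_act \<sigma> (tp L C' I a (Dom C)) = tp L C' I (\<lambda>x. \<sigma>' (a x)) (Dom C)"
proof (rule Set.set_eqI)
  fix \<phi> :: "('f, 'r, 'i + 'a) fm"
  show "\<phi> \<in> type_act \<sigma> (tp L C' I a (Dom C)) \<longleftrightarrow> \<phi> \<in> tp L C' I (\<lambda>x. \<sigma>' (a x)) (Dom C)"
  proof (cases "\<phi> \<in> Form L (I <+> Dom C)")
    case True
    have "\<phi> \<in> type_act \<sigma> (tp L C' I a (Dom C)) \<longleftrightarrow> act (aut_inv C \<sigma>) \<phi> \<in> tp L C' I a (Dom C)"
      by (rule type_act_mem[OF \<sigma> S_I[OF a] True])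
    also have "\<dots> \<longleftrightarrow> sat C' (case_sum a (aut_inv C \<sigma>)) [] \<phi>"
      using act_FormC[OF Aut_inv[OF mC(3) \<sigma>] True] by (simp add: mem_tp sat_act)
    also have "\<dots> \<longleftrightarrow> sat C' (case_sum (\<lambda>x. \<sigma>' (a x)) id) [] \<phi>"
    proof (rule eqtD[OF eqt_Aut[OF mC'(3) \<sigma>'(1)] True])
      fix z assume "z \<in> I <+> Dom C"
      then show "case_sum a (aut_inv C \<sigma>) z \<in> Dom C'"
          "case_sum (\<lambda>x. \<sigma>' (a x)) id z = \<sigma>' (case_sum a (aut_inv C \<sigma>) z)"
        using a(1) aut_inv[OF \<sigma>] \<sigma>'(2) sub by auto
    qed
    finally show ?thesis using True by (simp add: mem_tp)
  next
    case False
    have "\<phi> \<notin> type_act \<sigma> (tp L C' I a (Dom C))"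
    proof
      assume "\<phi> \<in> type_act \<sigma> (tp L C' I a (Dom C))"
      then obtain \<psi> where "\<psi> \<in> tp L C' I a (Dom C)" "\<phi> = act \<sigma> \<psi>" unfolding type_act_def by auto
      then show False using False act_FormC[OF \<sigma>, of \<psi>] by (simp add: mem_tp)
    qed
    then show ?thesis using False by (simp add: mem_tp)
  qed
qed

lemma type_act_S:
  assumes \<sigma>: "\<sigma> \<in> Aut L C" and p: "p \<in> S"
  shows "type_act \<sigma> p \<in> S"
proof -
  from Aut_extend[OF \<sigma>] obtain \<sigma>' where \<sigma>': "\<sigma>' \<in> Aut L C'" and "\<forall>x\<in>Dom C. \<sigma>' x = \<sigma> x" ..
  note \<sigma>' = \<sigma>' this(2)[rule_format]
  obtain a where a: "a \<in> tuples I C'" "p = tp L C' I a (Dom C)" "eqt L I C' a C' c" by (rule S_E[OF p])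
  have aD: "a x \<in> Dom C'" if "x \<in> I" for x using PiE_mem[OF a(1) that] .
  have "eqt L I C' (\<lambda>x. \<sigma>' (a x)) C' a"
    by (rule eqt_sym, rule eqt_Aut[OF mC'(3) \<sigma>'(1) aD]) simp_all
  then have e: "eqt L I C' (\<lambda>x. \<sigma>' (a x)) C' c" using a(3) by (rule eqt_trans)
  have "type_act \<sigma> p = tp L C' I (\<lambda>x. \<sigma>' (a x)) (Dom C)"
    unfolding a(2) by (rule type_act_tp[OF \<sigma> \<sigma>' aD a(3)])
  also have "\<dots> \<in> S" by (rule S_I[OF _ e]) (rule Aut_D(5)[OF \<sigma>'(1) aD])
  finally show ?thesis .
qed

lemma type_act_compose:
  assumes \<sigma>: "\<sigma> \<in> Aut L C" and \<tau>: "\<tau> \<in> Aut L C" and p: "p \<in> S"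
  shows "type_act \<sigma> (type_act \<tau> p) = type_act (compose (Dom C) \<sigma> \<tau>) p"
  unfolding type_act_def image_image
proof (rule image_cong[OF refl])
  fix \<phi> assume "\<phi> \<in> p"
  then show "act \<sigma> (act \<tau> \<phi>) = act (compose (Dom C) \<sigma> \<tau>) \<phi>"
    unfolding act_act using S_Form[OF p] by (intro act_cong[of \<phi> L I "Dom C"]) (simp_all add: compose_eq)
qed

lemma type_act_one: "p \<in> S \<Longrightarrow> type_act (\<lambda>x\<in>Dom C. x) p = p"
proof -
  assume p: "p \<in> S"
  have "act (\<lambda>x\<in>Dom C. x) \<phi> = \<phi>" if "\<phi> \<in> p" for \<phi>
    by (rule act_id[OF S_Form[OF p that]]) simp
  then show ?thesis unfolding type_act_def by simp
qed

section \<open>Types with a bounded orbit\<close>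

definition orbit :: "('f, 'r, 'i + 'a) fm set \<Rightarrow> ('f, 'r, 'i + 'a) fm set set" where
  "orbit p = (\<lambda>\<sigma>. type_act \<sigma> p) ` Aut L C"

text \<open>The class of a parameter tuple is the set of types in the orbit that contain the
  corresponding instance of \<open>\<phi>\<close>. There are at most as many classes as subsets of
  the orbit, fewer than the strong limit \<open>\<kappa>\<close>, and automorphisms of
  \<open>C\<close> permute the orbit. The submodel \<open>N\<close> lies in \<open>C'\<close> and
  has no counterpart in \<open>C\<close>, but the consistency of the long sequence depends only on
  the type of \<open>(d, d')\<close>, which \<open>(b, b')\<close> shares.\<close>

lemma bounded_orbit_invariant:
  fixes b b' d d' :: "'b \<Rightarrow> 'a" and \<phi> :: "('f, 'r, 'i + 'b) fm"
  assumes p: "p \<in> S" and bd: "|orbit p| <o \<kappa>" and B: "finite B" and \<phi>: "\<phi> \<in> Form L (I <+> B)"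
    and b: "\<And>x. x \<in> B \<Longrightarrow> b x \<in> Dom C" "\<And>x. x \<in> B \<Longrightarrow> b' x \<in> Dom C"
    and d: "\<And>x. x \<in> B \<Longrightarrow> d x \<in> Dom C'" "\<And>x. x \<in> B \<Longrightarrow> d' x \<in> Dom C'"
    and N: "elementary_sub L N C'"
    and dn: "\<And>n. (\<And>x. x \<in> B \<Longrightarrow> n x \<in> Dom N) \<Longrightarrow> eqt L (B <+> B) C' (case_sum d n) C' (case_sum d' n)"
    and eq: "eqt L (B <+> B) C' (case_sum d d') C (case_sum b b')"
  shows "act b \<phi> \<in> p \<longleftrightarrow> act b' \<phi> \<in> p"
proof -
  define cl where "cl f = {s \<in> orbit p. act f \<phi> \<in> s}" for f
  have actF: "act f \<phi> \<in> Form L (I <+> Dom C)" if "\<And>x. x \<in> B \<Longrightarrow> f x \<in> Dom C" for f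
    by (rule act_Form[OF \<phi> that])
  have step: "cl f' \<subseteq> cl g'" if \<sigma>: "\<sigma> \<in> Aut L C" and f: "\<And>x. x \<in> B \<Longrightarrow> f x \<in> Dom C" and g: "\<And>x. x \<in> B \<Longrightarrow> g x \<in> Dom C"
      and f': "\<And>x. x \<in> B \<Longrightarrow> f' x = \<sigma> (f x)" and g': "\<And>x. x \<in> B \<Longrightarrow> g' x = \<sigma> (g x)" and eq: "cl f = cl g" for \<sigma> f g f' g'
  proof
    fix s assume "s \<in> cl f'"
    then have s: "s \<in> orbit p" "act f' \<phi> \<in> s" by (simp_all add: cl_def)
    then obtain \<tau> where \<tau>: "\<tau> \<in> Aut L C" "s = type_act \<tau> p" unfolding orbit_def by auto
    define t where "t = type_act (compose (Dom C) (aut_inv C \<sigma>) \<tau>) p"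
    have \<sigma>i: "aut_inv C \<sigma> \<in> Aut L C" by (rule Aut_inv[OF mC(3) \<sigma>])
    have comp: "compose (Dom C) (aut_inv C \<sigma>) \<tau> \<in> Aut L C" by (rule Aut_compose[OF mC(3) \<sigma>i \<tau>(1)])
    have tS: "t \<in> S" unfolding t_def by (rule type_act_S[OF comp p])
    have torb: "t \<in> orbit p" unfolding t_def orbit_def using comp by (rule imageI)
    have st: "s = type_act \<sigma> t"
    proof -
      have t: "t = type_act (aut_inv C \<sigma>) s"
        unfolding t_def \<tau>(2) by (rule type_act_compose[OF \<sigma>i \<tau>(1) p, symmetric])
      have sS: "s \<in> S" unfolding \<tau>(2) by (rule type_act_S[OF \<tau>(1) p])
      have c1: "compose (Dom C) \<sigma> (aut_inv C \<sigma>) = (\<lambda>x\<in>Dom C. x)"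
        by (rule ext) (simp add: compose_def aut_inv[OF \<sigma>])
      show ?thesis unfolding t type_act_compose[OF \<sigma> \<sigma>i sS] c1 by (rule type_act_one[OF sS, symmetric])
    qed
    have af: "act f' \<phi> = act \<sigma> (act f \<phi>)" "act g' \<phi> = act \<sigma> (act g \<phi>)"
      unfolding act_act by (rule act_cong[OF \<phi> f'], assumption, rule act_cong[OF \<phi> g'])
    have "act f \<phi> \<in> t" using s(2) type_act_act_mem[OF \<sigma> tS actF[OF f]] by (simp add: af st)
    then have "t \<in> cl g" using torb by (simp flip: eq) (simp add: cl_def)
    then have "act g \<phi> \<in> t" by (simp add: cl_def)
    then have "act g' \<phi> \<in> s" using type_act_act_mem[OF \<sigma> tS actF[OF g]] by (simp add: af st)
    then show "s \<in> cl g'" using s(1) by (simp add: cl_def)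
  qed
  have K: "|Pow (orbit p)| <o \<kappa>" by (rule strong_limit_Pow[OF mC(1) bd])
  \<comment> \<open>One power set above the set of classes, which is itself the power set of the
    orbit.\<close>
  let ?J = "Pow (Pow (orbit p))"
  have fs': "finsat C' ((B <+> B) <+> (?J \<times> B)) (Inl ` (B <+> B)) (case_sum (case_sum d d') undefined) (seq_type L B |?J| )"
    by (rule seq_type_finsat[OF N d dn card_of_well_order_on])
  have "eqt L (Inl ` (B <+> B) :: (('b + 'b) + _) set) C' (case_sum d d' \<circ> projl) C (case_sum b b' \<circ> projl)"
    by (rule eqt_comp[OF eq]) auto
  then have eq': "eqt L (Inl ` (B <+> B)) C' (case_sum (case_sum d d') undefined) C (case_sum (case_sum b b') undefined)"
    by (rule eqt_congI) auto
  have fs: "finsat C ((B <+> B) <+> (?J \<times> B)) (Inl ` (B <+> B)) (case_sum (case_sum b b') undefined) (seq_type L B |?J| )"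
  proof (rule finsat_transfer[OF eq' seq_type_Form _ nonempty(2,1) _ _ fs'])
    show "|?J| \<subseteq> ?J \<times> ?J"
    proof (rule subrelI)
      fix x y assume "(x, y) \<in> |?J|"
      from well_order_on_domain[OF card_of_well_order_on this] show "(x, y) \<in> ?J \<times> ?J" by (simp only: mem_Sigma_iff)
    qed
  qed (use b d in auto)
  have "cl b = cl b'"
  proof (rule bounded_invariant[OF mC(3,4,5,1) card_finite_less[OF mC(2) B] K _ _ b fs])
    show "cl f \<in> Pow (orbit p)" for f unfolding cl_def by (simp add: subset_iff)
    show "cl f' = cl g'" if "\<sigma> \<in> Aut L C" "\<And>x. x \<in> B \<Longrightarrow> f x \<in> Dom C" "\<And>x. x \<in> B \<Longrightarrow> g x \<in> Dom C"
      "\<And>x. x \<in> B \<Longrightarrow> f' x = \<sigma> (f x)" "\<And>x. x \<in> B \<Longrightarrow> g' x = \<sigma> (g x)" "cl f = cl g" for \<sigma> f g f' g'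
      by (rule subset_antisym[OF step[OF that] step[OF that(1,3,2,5,4) that(6)[symmetric]]])
  qed
  moreover have "p \<in> orbit p"
    unfolding orbit_def using type_act_one[OF p] id_Aut[OF mC(3)] by (intro image_eqI[of _ _ "\<lambda>x\<in>Dom C. x"]) simp_all
  ultimately show ?thesis unfolding cl_def by blast
qed

text \<open>A complete type over all of \<open>C'\<close> need not be realized in \<open>C'\<close>,
  so it is kept as a finitely satisfiable set of formulas rather than as the type of a
  tuple.\<close>

definition global_ext :: "('f, 'r, 'i + 'a) fm set \<Rightarrow> ('f, 'r, 'i + 'a) fm set \<Rightarrow> bool" where
  "global_ext p R \<longleftrightarrow> p \<in> S \<and> p \<subseteq> R \<and> R \<subseteq> Form L (I <+> Dom C') \<and>
     finsat C' (I <+> Dom C') (Inr ` Dom C') pv R \<and>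
     (\<forall>\<phi>\<in>Form L (I <+> Dom C'). \<phi> \<in> R \<or> Neg \<phi> \<in> R) \<and>
     (\<forall>\<tau>\<in>Autf_L L \<kappa>' C'. \<forall>\<phi>\<in>Form L (I <+> Dom C'). \<phi> \<in> R \<longleftrightarrow> act \<tau> \<phi> \<in> R)"

lemma params_Form:
  assumes "\<phi> \<in> Form L (I <+> A)"
  shows "\<phi> \<in> Form L (I <+> {x. Inr x \<in> fv \<phi>})" "{x. Inr x \<in> fv \<phi>} \<subseteq> A" "finite {x. Inr x \<in> fv \<phi>}"
proof -
  show "\<phi> \<in> Form L (I <+> {x. Inr x \<in> fv \<phi>})" "{x. Inr x \<in> fv \<phi>} \<subseteq> A" using assms by (auto simp: Form_def)
  have "finite (Inr -` fv \<phi>)" by (rule finite_vimageI[OF finite_fv]) simp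
  then show "finite {x. Inr x \<in> fv \<phi>}" by (simp add: vimage_def)
qed

text \<open>By elementarity the full type of \<open>D\<close> over its part in \<open>C\<close> is
  finitely satisfiable in \<open>C\<close>, and saturation of \<open>C\<close> realizes it. This is
  the bridge from \<open>C'\<close> back to \<open>C\<close>.\<close>

lemma pull_parameters:
  assumes D: "finite D" "D \<subseteq> Dom C'"
  shows "\<exists>g. (\<forall>x\<in>D. g x \<in> Dom C) \<and> (\<forall>x\<in>D \<inter> Dom C. g x = x) \<and> eqt L D C' id C g"
proof -
  define \<Gamma> where "\<Gamma> = {\<phi> \<in> Form L D. sat C' id [] \<phi>}"
  have \<Gamma>: "\<Gamma> \<subseteq> Form L D" by (auto simp: \<Gamma>_def)
  have "finsat C' D (D \<inter> Dom C) id \<Gamma>"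
    unfolding finsat_def
  proof (intro allI impI)
    fix q assume "q \<subseteq> \<Gamma>"
    then show "realizable C' D (D \<inter> Dom C) id q" using D(2) by (intro realizableI[of _ id]) (auto simp: \<Gamma>_def)
  qed
  moreover have e: "eqt L (D \<inter> Dom C) C' id C id" by (rule eqt_sym, rule elem_eqt[OF el]) simp
  ultimately have "finsat C D (D \<inter> Dom C) id \<Gamma>"
    using sub by (intro finsat_transfer[OF e \<Gamma> Int_lower1 nonempty(2,1)]) auto
  from saturated_realizes[OF mC(4) card_finite_less[OF mC(2) D(1)] \<Gamma> Int_lower1 nonempty(1) this]
  obtain g where g: "(\<forall>x\<in>D. g x \<in> Dom C) \<and> (\<forall>x\<in>D \<inter> Dom C. g x = id x) \<and> (\<forall>\<phi>\<in>\<Gamma>. sat C g [] \<phi>)"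
    unfolding realizable_def ..
  have "sat C' id [] \<phi> \<longleftrightarrow> sat C g [] \<phi>" if "\<phi> \<in> Form L D" for \<phi>
  proof (cases "sat C' id [] \<phi>")
    case True
    then show ?thesis using g that by (simp add: \<Gamma>_def)
  next
    case False
    then have "Neg \<phi> \<in> \<Gamma>" using that by (simp add: \<Gamma>_def)
    then have "sat C g [] (Neg \<phi>)" using g by blast
    then show ?thesis using False by simp
  qed
  then have "eqt L D C' id C g" by (simp add: eqt_def)
  then show ?thesis using g by (intro exI[of _ g]) simp
qed

text \<open>Invariance under the generators of \<open>Autf_L\<close> is expressed by the set
  \<open>\<Delta>\<close>. It is consistent with \<open>p\<close>, and any completion of the union
  is invariant under the whole generated group.\<close>

lemma global_ext_exists:
  assumes p: "p \<in> S" and bd: "|orbit p| <o \<kappa>"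
  shows "\<exists>R. global_ext p R"
proof -
  obtain a where a: "a \<in> tuples I C'" "p = tp L C' I a (Dom C)" "eqt L I C' a C' c" by (rule S_E[OF p])
  have aD: "a x \<in> Dom C'" if "x \<in> I" for x using PiE_mem[OF a(1) that] .
  define \<Delta> where "\<Delta> = (\<lambda>(\<phi>, \<tau>). Iff \<phi> (act \<tau> \<phi>)) ` (Form L (I <+> Dom C') \<times> small_fix L \<kappa>' C')"
  have fixA: "\<tau> \<in> Aut L C'" if "\<tau> \<in> small_fix L \<kappa>' C'" for \<tau> using that by (simp add: small_fix_def)
  have \<Delta>F: "\<Delta> \<subseteq> Form L (I <+> Dom C')"
    unfolding \<Delta>_def
  proof (rule image_subsetI)
    fix t assume t: "t \<in> Form L (I <+> Dom C') \<times> small_fix L \<kappa>' C'"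
    then have "fst t \<in> Form L (I <+> Dom C')" "snd t \<in> Aut L C'" using fixA by auto
    then have "act (snd t) (fst t) \<in> Form L (I <+> Dom C')" using Aut_D(5) by (intro act_Form[of "fst t" L I "Dom C'"]) auto
    then show "(case t of (\<phi>, \<tau>) \<Rightarrow> Iff \<phi> (act \<tau> \<phi>)) \<in> Form L (I <+> Dom C')"
      using \<open>fst t \<in> Form L (I <+> Dom C')\<close> by (simp add: split_beta)
  qed
  have pF: "p \<subseteq> Form L (I <+> Dom C')"
  proof
    fix \<phi> assume "\<phi> \<in> p"
    from S_Form[OF p this] show "\<phi> \<in> Form L (I <+> Dom C')" by (rule Form_mono) (use sub in auto)
  qed
  have fs: "finsat C' (I <+> Dom C') (Inr ` Dom C') pv (p \<union> \<Delta>)"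
    unfolding finsat_def
  proof (intro allI impI)
    fix q assume q: "q \<subseteq> p \<union> \<Delta>" "finite q"
    define D where "D = (\<Union>\<phi>\<in>q. {x. Inr x \<in> fv \<phi>})"
    have qF: "\<phi> \<in> Form L (I <+> Dom C')" if "\<phi> \<in> q" for \<phi> using that q(1) pF \<Delta>F by blast
    have D: "finite D" "D \<subseteq> Dom C'" unfolding D_def using q(2) params_Form(2,3)[OF qF] by auto
    have qD: "\<phi> \<in> Form L (I <+> D)" if "\<phi> \<in> q" for \<phi>
      using params_Form(1)[OF qF[OF that]] by (rule Form_mono) (use that in \<open>auto simp: D_def\<close>)
    from pull_parameters[OF D] obtain g where
      g: "(\<forall>x\<in>D. g x \<in> Dom C) \<and> (\<forall>x\<in>D \<inter> Dom C. g x = x) \<and> eqt L D C' id C g" ..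
    have gD: "g x \<in> Dom C" if "x \<in> D" for x using g that by simp
    have ge: "eqt L D C' id C g" using g by simp
    \<comment> \<open>With the parameters replaced by their copies in \<open>C\<close>, a
      realization \<open>a\<close> of \<open>p\<close> satisfies all of \<open>q\<close>: formulas
      of \<open>p\<close> do not change because \<open>g\<close> fixes their parameters, and the
      invariance formulas become statements about \<open>p\<close> to which
      \<open>bounded_orbit_invariant\<close> applies.\<close>
    have key: "sat C' (case_sum a g) [] \<phi>" if "\<phi> \<in> q" for \<phi>
    proof (cases "\<phi> \<in> p")
      case True
      have "sat C' (case_sum a g) [] \<phi> \<longleftrightarrow> sat C' (case_sum a id) [] \<phi>"
      proof (rule sat_cong)
        fix z assume z: "z \<in> fv \<phi>"
        show "case_sum a g z = case_sum a id z"
        proof (cases z)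
          case (Inr x)
          then have "x \<in> Dom C" using S_Form[OF p True] z by (auto simp: Form_def)
          moreover have "x \<in> D" using z Inr \<open>\<phi> \<in> q\<close> by (auto simp: D_def)
          ultimately show ?thesis using g Inr by simp
        qed simp
      qed
      then show ?thesis using True by (simp add: a(2) mem_tp)
    next
      case False
      then have "\<phi> \<in> \<Delta>" using q(1) \<open>\<phi> \<in> q\<close> by blast
      then obtain \<psi> \<tau> where \<psi>: "\<psi> \<in> Form L (I <+> Dom C')" and \<tau>: "\<tau> \<in> small_fix L \<kappa>' C'"
        and \<phi>: "\<phi> = Iff \<psi> (act \<tau> \<psi>)" unfolding \<Delta>_def by auto
      define B where "B = {x. Inr x \<in> fv \<psi>}"
      note B = params_Form[OF \<psi>, folded B_def]
      have fvI: "fv \<phi> = fv \<psi> \<union> fv (act \<tau> \<psi>)" unfolding \<phi> Iff_def by auto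
      have BD: "B \<subseteq> D" using \<open>\<phi> \<in> q\<close> fvI by (auto simp: B_def D_def)
      have \<tau>D: "\<tau> x \<in> D" if "x \<in> B" for x
      proof -
        have "map_sum id \<tau> (Inr x) \<in> fv (act \<tau> \<psi>)" using that unfolding fm.set_map B_def by (intro imageI) simp
        then have "Inr (\<tau> x) \<in> fv \<phi>" using fvI by simp
        then show ?thesis using \<open>\<phi> \<in> q\<close> by (auto simp: D_def)
      qed
      note \<tau>A = fixA[OF \<tau>]
      from \<tau> obtain N where "|N| <o \<kappa>' \<and> elementary_sub L (C'\<lparr>Dom := N\<rparr>) C' \<and> (\<forall>x\<in>N. \<tau> x = x)"
        unfolding small_fix_def by auto
      then have N: "elementary_sub L (C'\<lparr>Dom := N\<rparr>) C'" "\<And>x. x \<in> N \<Longrightarrow> \<tau> x = x" by simp_all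
      have ND: "N \<subseteq> Dom C'" using elem_structs(3)[OF N(1)] by simp
      have "eqt L (B <+> B) C' (id \<circ> case_sum id \<tau>) C (g \<circ> case_sum id \<tau>)"
        by (rule eqt_comp[OF ge]) (use BD \<tau>D in auto)
      then have e: "eqt L (B <+> B) C' (case_sum (\<lambda>x. x) \<tau>) C (case_sum g (\<lambda>x. g (\<tau> x)))"
        by (rule eqt_congI) auto
      have "act g \<psi> \<in> p \<longleftrightarrow> act (\<lambda>x. g (\<tau> x)) \<psi> \<in> p"
      proof (rule bounded_orbit_invariant[OF p bd B(3,1) _ _ _ _ N(1) _ e])
        fix n assume n: "\<And>x. x \<in> B \<Longrightarrow> n x \<in> Dom (C'\<lparr>Dom := N\<rparr>)"
        show "eqt L (B <+> B) C' (case_sum (\<lambda>x. x) n) C' (case_sum \<tau> n)"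
        proof (rule eqt_Aut[OF mC'(3) \<tau>A])
          fix z assume z: "z \<in> B <+> B"
          then show "case_sum (\<lambda>x. x) n z \<in> Dom C'" using BD D(2) n ND by auto
          show "case_sum \<tau> n z = \<tau> (case_sum (\<lambda>x. x) n z)" using z n N(2) by auto
        qed
      qed (use BD D(2) \<tau>D gD in auto)
      moreover have "act g \<psi> \<in> p \<longleftrightarrow> sat C' (case_sum a g) [] \<psi>"
        using act_Form[OF B(1), of g "Dom C"] gD BD by (auto simp: a(2) mem_tp sat_act)
      moreover have "act (\<lambda>x. g (\<tau> x)) \<psi> \<in> p \<longleftrightarrow> sat C' (case_sum a g) [] (act \<tau> \<psi>)"
        using act_Form[OF B(1), of "\<lambda>x. g (\<tau> x)" "Dom C"] gD \<tau>D by (auto simp: a(2) mem_tp sat_act)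
      ultimately show ?thesis unfolding \<phi> by simp
    qed
    have r1: "realizable C' (I <+> D) (Inr ` D) (case_sum undefined g) q"
      by (rule realizableI[of _ "case_sum a g"]) (use aD gD sub key in auto)
    \<comment> \<open>The copies have the same type as the original parameters, so realizability
      passes back to the latter.\<close>
    have "eqt L D C g C' g" by (rule elem_eqt[OF el gD])
    then have "eqt L D C' id C' g" by (rule eqt_trans[OF ge])
    then have "eqt L (Inr ` D :: ('i + 'a) set) C' (id \<circ> projr) C' (g \<circ> projr)" by (rule eqt_comp) auto
    then have "eqt L (Inr ` D) C' (pv :: 'i + 'a \<Rightarrow> 'a) C' (case_sum undefined g)" by (rule eqt_congI) auto
    then have e: "eqt L (Inr ` D) C' (case_sum undefined g :: 'i + 'a \<Rightarrow> 'a) C' pv" by (rule eqt_sym)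
    have "realizable C' (I <+> D) (Inr ` D) pv q"
      by (rule realizable_transfer[OF e _ q(2) _ nonempty(2,2) _ _ r1]) (use qD D(2) gD sub in auto)
    then obtain w where w: "(\<forall>x\<in>I <+> D. w x \<in> Dom C') \<and> (\<forall>x\<in>Inr ` D. w x = pv x) \<and> (\<forall>\<phi>\<in>q. sat C' w [] \<phi>)"
      unfolding realizable_def ..
    show "realizable C' (I <+> Dom C') (Inr ` Dom C') pv q"
    proof (rule realizableI[of _ "case_sum (\<lambda>x. w (Inl x)) id"])
      fix \<phi> assume \<phi>: "\<phi> \<in> q"
      have "sat C' (case_sum (\<lambda>x. w (Inl x)) id) [] \<phi> \<longleftrightarrow> sat C' w [] \<phi>"
        using w by (intro sat_Form_cong[OF qD[OF \<phi>]]) auto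
      then show "sat C' (case_sum (\<lambda>x. w (Inl x)) id) [] \<phi>" using w \<phi> by blast
    qed (use w in auto)
  qed
  have "p \<union> \<Delta> \<subseteq> Form L (I <+> Dom C')" using pF \<Delta>F by simp
  from complete_extension[OF fs this] obtain R where R: "p \<union> \<Delta> \<subseteq> R \<and> R \<subseteq> Form L (I <+> Dom C') \<and>
    finsat C' (I <+> Dom C') (Inr ` Dom C') pv R \<and> (\<forall>\<phi>\<in>Form L (I <+> Dom C'). \<phi> \<in> R \<or> Neg \<phi> \<in> R)" ..
  note cpl = R[THEN conjunct2, THEN conjunct2, THEN conjunct2, rule_format]
  note R = R[THEN conjunct1] R[THEN conjunct2, THEN conjunct1] R[THEN conjunct2, THEN conjunct2, THEN conjunct1]
  \<comment> \<open>Completeness and finite satisfiability make \<open>R\<close> closed under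
    consequences of finitely many of its members.\<close>
  have closed: "\<phi> \<in> R" if "\<phi> \<in> Form L (I <+> Dom C')" "q \<subseteq> R" "finite q"
    "\<And>w. (\<And>\<psi>. \<psi> \<in> q \<Longrightarrow> sat C' w [] \<psi>) \<Longrightarrow> sat C' w [] \<phi>" for q \<phi>
  proof (rule ccontr)
    assume "\<phi> \<notin> R"
    then have "insert (Neg \<phi>) q \<subseteq> R" "finite (insert (Neg \<phi>) q)" using cpl[OF that(1)] that by simp_all
    then have "realizable C' (I <+> Dom C') (Inr ` Dom C') pv (insert (Neg \<phi>) q)"
      using R(3) unfolding finsat_def by simp
    then obtain w where w: "\<forall>\<psi>\<in>insert (Neg \<phi>) q. sat C' w [] \<psi>" unfolding realizable_def by auto
    then have "sat C' w [] \<phi>" by (intro that(4)) simp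
    then show False using w by simp
  qed
  have fixinv: "\<phi> \<in> R \<longleftrightarrow> act \<tau> \<phi> \<in> R" if \<tau>: "\<tau> \<in> small_fix L \<kappa>' C'" and \<phi>: "\<phi> \<in> Form L (I <+> Dom C')" for \<tau> \<phi>
  proof -
    have "Iff \<phi> (act \<tau> \<phi>) \<in> \<Delta>" unfolding \<Delta>_def using that by (intro image_eqI[of _ _ "(\<phi>, \<tau>)"]) simp_all
    then have i: "Iff \<phi> (act \<tau> \<phi>) \<in> R" using R(1) by blast
    have a\<phi>: "act \<tau> \<phi> \<in> Form L (I <+> Dom C')" by (rule act_Form[OF \<phi> Aut_D(5)[OF fixA[OF \<tau>]]])
    show ?thesis
    proof
      assume "\<phi> \<in> R"
      then show "act \<tau> \<phi> \<in> R" using i by (intro closed[OF a\<phi>, of "{\<phi>, Iff \<phi> (act \<tau> \<phi>)}"]) (simp_all, metis sat_Iff)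
    next
      assume "act \<tau> \<phi> \<in> R"
      then show "\<phi> \<in> R" using i by (intro closed[OF \<phi>, of "{act \<tau> \<phi>, Iff \<phi> (act \<tau> \<phi>)}"]) (simp_all, metis sat_Iff)
    qed
  qed
  interpret group "AutG L C'" by (rule group_AutG[OF mC'(3)])
  have "\<forall>\<phi>\<in>Form L (I <+> Dom C'). \<phi> \<in> R \<longleftrightarrow> act \<tau> \<phi> \<in> R" if "\<tau> \<in> Autf_L L \<kappa>' C'" for \<tau>
    using that[unfolded Autf_L_eq]
  proof (induction \<tau> rule: generate.induct)
    case one
    have "act \<one>\<^bsub>AutG L C'\<^esub> \<phi> = \<phi>" if "\<phi> \<in> Form L (I <+> Dom C')" for \<phi>
      by (rule act_id[OF that]) (simp add: AutG_simps)
    then show ?case by (intro ballI) (simp only:)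
  next
    case (incl h)
    then show ?case by (intro ballI fixinv)
  next
    case (inv h)
    show ?case unfolding inv_AutG[OF mC'(3) fixA[OF inv]]
      by (intro ballI fixinv[OF small_fix_inv[OF mC'(3) inv]])
  next
    case (eng h1 h2)
    have h: "h1 \<in> Aut L C'" "h2 \<in> Aut L C'"
      using eng(1,2) Autf_L_closed(1)[OF mC'(3), of _ \<kappa>'] unfolding Autf_L_eq by simp_all
    show ?case
    proof
      fix \<phi> assume \<phi>: "\<phi> \<in> Form L (I <+> Dom C')"
      have F: "act h2 \<phi> \<in> Form L (I <+> Dom C')" by (rule act_Form[OF \<phi> Aut_D(5)[OF h(2)]])
      have "\<phi> \<in> R \<longleftrightarrow> act h2 \<phi> \<in> R" by (rule bspec[OF eng.IH(2) \<phi>])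
      also have "\<dots> \<longleftrightarrow> act h1 (act h2 \<phi>) \<in> R" by (rule bspec[OF eng.IH(1) F])
      also have "act h1 (act h2 \<phi>) = act (h1 \<otimes>\<^bsub>AutG L C'\<^esub> h2) \<phi>"
        unfolding act_act by (rule act_cong[OF \<phi>]) (simp add: AutG_simps h compose_eq)
      finally show "\<phi> \<in> R \<longleftrightarrow> act (h1 \<otimes>\<^bsub>AutG L C'\<^esub> h2) \<phi> \<in> R" .
    qed
  qed
  then have "global_ext p R" unfolding global_ext_def using p R cpl by simp
  then show ?thesis by (rule exI)
qed

section \<open>Realizations of the invariant type over small sets\<close>

definition realizes :: "('f, 'r, 'i + 'a) fm set \<Rightarrow> 'a set \<Rightarrow> ('i \<Rightarrow> 'a) \<Rightarrow> bool" where
  "realizes R A z \<longleftrightarrow> z \<in> tuples I C' \<and> (\<forall>\<phi>\<in>Form L (I <+> A). \<phi> \<in> R \<longleftrightarrow> sat C' (case_sum z id) [] \<phi>)"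

lemma realizes_Dom: "realizes R A z \<Longrightarrow> x \<in> I \<Longrightarrow> z x \<in> Dom C'"
  unfolding realizes_def by (auto dest: PiE_mem)

lemma realizes_mono: "realizes R A z \<Longrightarrow> B \<subseteq> A \<Longrightarrow> realizes R B z"
  unfolding realizes_def using Form_mono[of _ L "I <+> B" "I <+> A"] by blast

lemma realizes_eqt: "realizes R A z \<Longrightarrow> realizes R A z' \<Longrightarrow> eqt L (I <+> A) C' (case_sum z id) C' (case_sum z' id)"
  unfolding realizes_def eqt_def by simp

lemma realizes_exists:
  assumes R: "global_ext p R" and A: "A \<subseteq> Dom C'" "|A| <o \<kappa>'"
  shows "\<exists>z. realizes R A z"
proof -
  define \<Gamma> where "\<Gamma> = R \<inter> Form L (I <+> A)"
  have U: "|I <+> A| <o \<kappa>'" by (rule card_Plus_less[OF mC'(2) card_I A(2)])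
  have \<Gamma>: "\<Gamma> \<subseteq> Form L (I <+> A)" "(Inr ` A :: ('i + 'a) set) \<subseteq> I <+> A" by (auto simp: \<Gamma>_def)
  have "finsat C' (I <+> A) (Inr ` A) pv \<Gamma>"
    unfolding finsat_def
  proof (intro allI impI)
    fix q assume q: "q \<subseteq> \<Gamma>" "finite q"
    then have "realizable C' (I <+> Dom C') (Inr ` Dom C') pv q"
      using R unfolding global_ext_def finsat_def \<Gamma>_def by simp
    then obtain w where w: "(\<forall>x\<in>I <+> Dom C'. w x \<in> Dom C') \<and> (\<forall>x\<in>Inr ` Dom C'. w x = pv x) \<and> (\<forall>\<phi>\<in>q. sat C' w [] \<phi>)"
      unfolding realizable_def ..
    show "realizable C' (I <+> A) (Inr ` A) pv q"
      by (rule realizableI[of _ w]) (use w A(1) in auto)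
  qed
  from saturated_realizes[OF mC'(4) U \<Gamma> nonempty(2) this]
  obtain w where w: "(\<forall>x\<in>I <+> A. w x \<in> Dom C') \<and> (\<forall>x\<in>Inr ` A. w x = pv x) \<and> (\<forall>\<phi>\<in>\<Gamma>. sat C' w [] \<phi>)"
    unfolding realizable_def ..
  define z where "z = restrict (\<lambda>x. w (Inl x)) I"
  have zw: "sat C' (case_sum z id) [] \<phi> \<longleftrightarrow> sat C' w [] \<phi>" if "\<phi> \<in> Form L (I <+> A)" for \<phi>
    using w by (intro sat_Form_cong[OF that]) (auto simp: z_def)
  have "\<phi> \<in> R \<longleftrightarrow> sat C' (case_sum z id) [] \<phi>" if \<phi>: "\<phi> \<in> Form L (I <+> A)" for \<phi>
  proof
    assume "\<phi> \<in> R"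
    then show "sat C' (case_sum z id) [] \<phi>" using zw[OF \<phi>] w \<phi> by (simp add: \<Gamma>_def)
  next
    assume s: "sat C' (case_sum z id) [] \<phi>"
    have "\<phi> \<in> Form L (I <+> Dom C')" using \<phi> by (rule Form_mono) (use A in auto)
    then have "\<phi> \<in> R \<or> Neg \<phi> \<in> R" using R unfolding global_ext_def by simp
    moreover have "Neg \<phi> \<notin> R"
    proof
      assume "Neg \<phi> \<in> R"
      then have "sat C' w [] (Neg \<phi>)" using w \<phi> by (simp only: \<Gamma>_def Int_iff Form_simps)
      then show False using s zw[OF \<phi>] by simp
    qed
    ultimately show "\<phi> \<in> R" by simp
  qed
  moreover have "z \<in> tuples I C'" using w by (auto simp: z_def)
  ultimately show ?thesis unfolding realizes_def by (intro exI[of _ z]) simp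
qed

lemma realizes_c:
  assumes R: "global_ext p R" and z: "realizes R A z"
  shows "eqt L I C' z C' c"
proof -
  have p: "p \<in> S" "p \<subseteq> R" using R unfolding global_ext_def by simp_all
  obtain a where a: "a \<in> tuples I C'" "p = tp L C' I a (Dom C)" "eqt L I C' a C' c" by (rule S_E[OF p(1)])
  have imp: "sat C' z [] \<phi>" if \<phi>: "\<phi> \<in> Form L I" and s: "sat C' a [] \<phi>" for \<phi>
  proof -
    have F: "map_fm Inl \<phi> \<in> Form L (I <+> A)" for A :: "'a set" by (rule Form_map_fm[OF \<phi>]) auto
    have "map_fm Inl \<phi> \<in> p" using F s by (simp add: a(2) mem_tp sat_map_fm comp_def)
    then have "map_fm Inl \<phi> \<in> R" using p(2) by blast
    then have "sat C' (case_sum z id) [] (map_fm Inl \<phi>)" using z F unfolding realizes_def by simp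
    then show ?thesis by (simp add: sat_map_fm comp_def)
  qed
  have "sat C' a [] \<phi> \<longleftrightarrow> sat C' z [] \<phi>" if \<phi>: "\<phi> \<in> Form L I" for \<phi>
    using imp[OF \<phi>] imp[of "Neg \<phi>"] \<phi> by auto
  then have "eqt L I C' z C' a" by (simp add: eqt_def)
  then show ?thesis using a(3) by (rule eqt_trans)
qed

lemma realizes_Autf_L:
  assumes R: "global_ext p R" and A: "A \<subseteq> Dom C'" and z: "realizes R A z" and \<tau>: "\<tau> \<in> Autf_L L \<kappa>' C'"
  shows "realizes R (\<tau> ` A) (compose I \<tau> z)"
  unfolding realizes_def
proof (intro conjI ballI)
  have \<tau>A: "\<tau> \<in> Aut L C'" by (rule Autf_L_closed(1)[OF mC'(3) \<tau>])
  show "compose I \<tau> z \<in> tuples I C'" using z unfolding realizes_def by (intro compose_Aut_tuples[OF \<tau>A]) simp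
  fix \<phi> assume \<phi>: "\<phi> \<in> Form L (I <+> \<tau> ` A)"
  define \<psi> where "\<psi> = act (aut_inv C' \<tau>) \<phi>"
  have "aut_inv C' \<tau> x \<in> A" if "x \<in> \<tau> ` A" for x
    using that A aut_inv(1)[OF \<tau>A] by auto
  then have \<psi>: "\<psi> \<in> Form L (I <+> A)" unfolding \<psi>_def by (rule act_Form[OF \<phi>])
  then have \<psi>': "\<psi> \<in> Form L (I <+> Dom C')" by (rule Form_mono) (use A in auto)
  have \<phi>\<psi>: "\<phi> = act \<tau> \<psi>"
    unfolding \<psi>_def act_act using A aut_inv[OF \<tau>A] Aut_D(5)[OF \<tau>A] by (intro act_id[OF \<phi>, symmetric]) auto
  have "\<phi> \<in> R \<longleftrightarrow> \<psi> \<in> R" using R \<psi>' \<tau> unfolding global_ext_def \<phi>\<psi> by blast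
  also have "\<dots> \<longleftrightarrow> sat C' (case_sum z id) [] \<psi>" using z \<psi> unfolding realizes_def by simp
  also have "\<dots> \<longleftrightarrow> sat C' (case_sum (compose I \<tau> z) \<tau>) [] \<psi>"
    by (rule eqtD[OF eqt_Aut[OF mC'(3) \<tau>A] \<psi>]) (use A realizes_Dom[OF z] in \<open>auto simp: compose_eq\<close>)
  also have "\<dots> \<longleftrightarrow> sat C' (case_sum (compose I \<tau> z) id) [] \<phi>" unfolding \<phi>\<psi> by (simp add: sat_act)
  finally show "\<phi> \<in> R \<longleftrightarrow> sat C' (case_sum (compose I \<tau> z) id) [] \<phi>" .
qed

lemma elementary_fix_Autf_L:
  assumes "\<rho> \<in> Aut L C'" "|N| <o \<kappa>'" "elementary_sub L (C'\<lparr>Dom := N\<rparr>) C'" "\<And>x. x \<in> N \<Longrightarrow> \<rho> x = x"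
  shows "\<rho> \<in> Autf_L L \<kappa>' C'"
  using assms by (intro small_fix_Autf_L) (auto simp: small_fix_def)

text \<open>Two realizations over \<open>B\<close> are conjugate over \<open>B\<close> by
  homogeneity; because \<open>B\<close> contains a model, the conjugating automorphism is Lascar
  strong.\<close>

lemma move_realization:
  assumes N: "elementary_sub L (C'\<lparr>Dom := N\<rparr>) C'" "N \<subseteq> B" and B: "B \<subseteq> Dom C'" "|B| <o \<kappa>'"
    and z: "realizes R B z" "realizes R B z'"
  shows "\<exists>\<rho>\<in>Autf_L L \<kappa>' C'. (\<forall>x\<in>B. \<rho> x = x) \<and> (\<forall>i\<in>I. \<rho> (z i) = z' i)"
proof -
  have "\<exists>\<rho>\<in>Aut L C'. \<forall>x\<in>I <+> B. \<rho> (case_sum z id x) = case_sum z' id x"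
    using realizes_Dom[OF z(1)] realizes_Dom[OF z(2)] B(1)
    by (intro strongly_homogeneous_extends[OF mC'(5) card_Plus_less[OF mC'(2) card_I B(2)] _ _ realizes_eqt[OF z]]) auto
  then obtain \<rho> where \<rho>: "\<rho> \<in> Aut L C'" and e: "\<forall>x\<in>I <+> B. \<rho> (case_sum z id x) = case_sum z' id x" ..
  have fx: "\<rho> x = x" if "x \<in> B" for x using bspec[OF e InrI[OF that]] by simp
  have mv: "\<rho> (z i) = z' i" if "i \<in> I" for i using bspec[OF e InlI[OF that]] by simp
  have "\<rho> \<in> Autf_L L \<kappa>' C'"
  proof (rule elementary_fix_Autf_L[OF \<rho> _ N(1)])
    show "|N| <o \<kappa>'" using card_of_mono1[OF N(2)] B(2) by (rule ordLeq_ordLess_trans)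
  qed (use fx N(2) in auto)
  then show ?thesis using fx mv by (intro bexI[of _ \<rho>]) simp_all
qed

end

section \<open>Lascar equivalence is type-definable\<close>

context monster_pair
begin

text \<open>A tuple with the type of \<open>c\<close> is the image of \<open>c\<close> under an
  automorphism, so it enumerates a copy of the model \<open>C\<close>.\<close>

lemma model_image_elementary:
  assumes z: "\<And>x. x \<in> I \<Longrightarrow> z x \<in> Dom C'" "eqt L I C' z C' c"
  shows "elementary_sub L (C'\<lparr>Dom := z ` I\<rparr>) C'" "|z ` I| <o \<kappa>'"
proof -
  have "\<exists>\<alpha>\<in>Aut L C'. \<forall>x\<in>I. \<alpha> (c x) = z x"
    by (rule strongly_homogeneous_extends[OF mC'(5) card_I c_Dom(2) z(1) eqt_sym[OF z(2)]])
  then obtain \<alpha> where \<alpha>: "\<alpha> \<in> Aut L C'" "\<forall>x\<in>I. \<alpha> (c x) = z x" ..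
  have "\<alpha> ` Dom C = z ` I" unfolding c_Dom(3)[symmetric] image_image using \<alpha>(2) by (intro image_cong refl) simp
  then show "elementary_sub L (C'\<lparr>Dom := z ` I\<rparr>) C'" using elem_image[OF elC \<alpha>(1)] by simp
  show "|z ` I| <o \<kappa>'" by (rule ordLeq_ordLess_trans[OF card_of_image card_I])
qed

text \<open>The automorphism provided by homogeneity fixes the copy of \<open>C\<close> enumerated
  by \<open>z\<close>, so it is one of the generators of \<open>Autf_L\<close>.\<close>

lemma Autf_L_of_model:
  assumes J: "|J| <o \<kappa>'" and y: "\<And>j. j \<in> J \<Longrightarrow> y j \<in> Dom C'" "\<And>j. j \<in> J \<Longrightarrow> y' j \<in> Dom C'"
    and z: "\<And>x. x \<in> I \<Longrightarrow> z x \<in> Dom C'" "eqt L I C' z C' c"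
    and eq: "eqt L (I <+> J) C' (case_sum z y) C' (case_sum z y')"
  shows "\<exists>\<tau>\<in>Autf_L L \<kappa>' C'. \<forall>j\<in>J. \<tau> (y j) = y' j"
proof -
  have "\<exists>\<tau>\<in>Aut L C'. \<forall>x\<in>I <+> J. \<tau> (case_sum z y x) = case_sum z y' x"
    by (rule strongly_homogeneous_extends[OF mC'(5) card_Plus_less[OF mC'(2) card_I J] _ _ eq]) (use y z(1) in auto)
  then obtain \<tau> where \<tau>: "\<tau> \<in> Aut L C'" and e: "\<forall>x\<in>I <+> J. \<tau> (case_sum z y x) = case_sum z y' x" ..
  have fx: "\<tau> x = x" if x: "x \<in> z ` I" for x
  proof -
    obtain i where "i \<in> I" "x = z i" using x by blast
    then show ?thesis using bspec[OF e InlI[of i I J]] by simp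
  qed
  have "\<tau> \<in> Autf_L L \<kappa>' C'"
    by (rule elementary_fix_Autf_L[OF \<tau> model_image_elementary(2,1)[OF z] fx])
  moreover have "\<tau> (y j) = y' j" if "j \<in> J" for j using bspec[OF e InrI[OF that]] by simp
  ultimately show ?thesis by (intro bexI[of _ \<tau>]) simp_all
qed

text \<open>The witness is a realization of \<open>R\<close> over the entries of \<open>y\<close>
  and \<open>y'\<close>; invariance of \<open>R\<close> under \<open>\<tau>\<close> gives both
  tuples the same type over it. Here the invariant type pays off: one copy of the model replaces the
  several models fixed by the factors of \<open>\<tau>\<close>.\<close>

lemma model_of_Autf_L:
  assumes R: "global_ext p R" and J: "|J| <o \<kappa>'" and y: "\<And>j. j \<in> J \<Longrightarrow> y j \<in> Dom C'" "\<And>j. j \<in> J \<Longrightarrow> y' j \<in> Dom C'"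
    and \<tau>: "\<tau> \<in> Autf_L L \<kappa>' C'" "\<And>j. j \<in> J \<Longrightarrow> \<tau> (y j) = y' j"
  shows "\<exists>z. (\<forall>x\<in>I. z x \<in> Dom C') \<and> eqt L I C' z C' c \<and> eqt L (I <+> J) C' (case_sum z y) C' (case_sum z y')"
proof -
  let ?A = "y ` J \<union> y' ` J"
  have A: "?A \<subseteq> Dom C'" using y by auto
  have "|?A| <o \<kappa>'"
    by (rule card_Un_less[OF mC'(2) ordLeq_ordLess_trans[OF card_of_image J] ordLeq_ordLess_trans[OF card_of_image J]])
  from realizes_exists[OF R A this] obtain z where z: "realizes R ?A z" ..
  have "sat C' (case_sum z y) [] \<phi> \<longleftrightarrow> sat C' (case_sum z y') [] \<phi>" if \<phi>: "\<phi> \<in> Form L (I <+> J)" for \<phi>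
  proof -
    have F: "act y \<phi> \<in> Form L (I <+> ?A)" "act y' \<phi> \<in> Form L (I <+> ?A)"
      by (rule act_Form[OF \<phi>], simp)+
    have "act y \<phi> \<in> Form L (I <+> Dom C')" by (rule act_Form[OF \<phi> y(1)])
    then have "act y \<phi> \<in> R \<longleftrightarrow> act \<tau> (act y \<phi>) \<in> R" using R \<tau>(1) unfolding global_ext_def by blast
    also have "act \<tau> (act y \<phi>) = act y' \<phi>" unfolding act_act by (rule act_cong[OF \<phi> \<tau>(2)])
    finally have "act y \<phi> \<in> R \<longleftrightarrow> act y' \<phi> \<in> R" .
    moreover have "act y \<phi> \<in> R \<longleftrightarrow> sat C' (case_sum z y) [] \<phi>" "act y' \<phi> \<in> R \<longleftrightarrow> sat C' (case_sum z y') [] \<phi>"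
      using z F unfolding realizes_def by (simp_all add: sat_act)
    ultimately show ?thesis by simp
  qed
  then have "eqt L (I <+> J) C' (case_sum z y) C' (case_sum z y')" unfolding eqt_def by simp
  moreover have "\<forall>x\<in>I. z x \<in> Dom C'" using realizes_Dom[OF z] by simp
  ultimately show ?thesis using realizes_c[OF R z] by (intro exI[of _ z]) simp
qed

section \<open>The Lascar equivalence relation\<close>

definition Lascar_rel :: "'j set \<Rightarrow> ('j \<Rightarrow> 'a) rel" where
  "Lascar_rel J = {(a, b). a \<in> tuples J C' \<and> (\<exists>\<tau>\<in>Autf_L L \<kappa>' C'. b = compose J \<tau> a)}"

lemma Lascar_rel_tuples:
  assumes "(a, b) \<in> Lascar_rel J"
  shows "a \<in> tuples J C'" "b \<in> tuples J C'"
proof -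
  show a: "a \<in> tuples J C'" using assms by (simp add: Lascar_rel_def)
  obtain \<tau> where "\<tau> \<in> Autf_L L \<kappa>' C'" "b = compose J \<tau> a" using assms by (auto simp: Lascar_rel_def)
  then show "b \<in> tuples J C'" using compose_Aut_tuples[OF Autf_L_closed(1)[OF mC'(3)] a] by simp
qed

lemma equiv_Lascar_rel: "equiv (tuples J C') (Lascar_rel J)"
proof (rule equivI)
  show "Lascar_rel J \<subseteq> tuples J C' \<times> tuples J C'" by (intro subrelI SigmaI; erule Lascar_rel_tuples)
  interpret normal "Autf_L L \<kappa>' C'" "AutG L C'" by (rule normal_Autf_L[OF mC'(3)])
  show "refl_on (tuples J C') (Lascar_rel J)"
  proof (rule refl_onI)
    fix a assume a: "a \<in> tuples J C'"
    have "compose J \<one>\<^bsub>AutG L C'\<^esub> a = a"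
      by (rule compose_id_tuple[OF a]) (simp add: AutG_simps PiE_mem[OF a])
    then show "(a, a) \<in> Lascar_rel J" using a one_closed
      unfolding Lascar_rel_def by (intro CollectI case_prodI conjI bexI[of _ "\<one>\<^bsub>AutG L C'\<^esub>"]) simp_all
  qed
  show "sym (Lascar_rel J)"
  proof (rule symI)
    fix a b assume ab: "(a, b) \<in> Lascar_rel J"
    then obtain \<tau> where \<tau>: "\<tau> \<in> Autf_L L \<kappa>' C'" "b = compose J \<tau> a" by (auto simp: Lascar_rel_def)
    have a: "a \<in> tuples J C'" by (rule Lascar_rel_tuples(1)[OF ab])
    have "compose J (aut_inv C' \<tau>) b = a"
      unfolding \<tau>(2) compose_compose_tuple
      by (rule compose_id_tuple[OF a]) (simp add: aut_inv[OF Autf_L_closed(1)[OF mC'(3) \<tau>(1)]] PiE_mem[OF a])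
    then show "(b, a) \<in> Lascar_rel J" using Lascar_rel_tuples(2)[OF ab] Autf_L_closed(3)[OF mC'(3) \<tau>(1)]
      unfolding Lascar_rel_def by (intro CollectI case_prodI conjI bexI[of _ "aut_inv C' \<tau>"]) simp_all
  qed
  show "trans (Lascar_rel J)"
  proof (rule transI)
    fix a b d assume ab: "(a, b) \<in> Lascar_rel J" and bd: "(b, d) \<in> Lascar_rel J"
    obtain \<tau> where \<tau>: "\<tau> \<in> Autf_L L \<kappa>' C'" "b = compose J \<tau> a" using ab by (auto simp: Lascar_rel_def)
    obtain \<sigma> where \<sigma>: "\<sigma> \<in> Autf_L L \<kappa>' C'" "d = compose J \<sigma> b" using bd by (auto simp: Lascar_rel_def)
    have a: "a \<in> tuples J C'" by (rule Lascar_rel_tuples(1)[OF ab])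
    have "d = compose J (compose (Dom C') \<sigma> \<tau>) a"
      unfolding \<sigma>(2) \<tau>(2) compose_compose_tuple
      by (rule compose_cong_tuple) (simp add: compose_eq PiE_mem[OF a])
    then show "(a, d) \<in> Lascar_rel J" using a Autf_L_closed(2)[OF mC'(3) \<sigma>(1) \<tau>(1)]
      unfolding Lascar_rel_def by (intro CollectI case_prodI conjI bexI[of _ "compose (Dom C') \<sigma> \<tau>"]) simp_all
  qed
qed

lemma Lascar_rel_of_model:
  assumes J: "|J| <o \<kappa>'" and a: "a \<in> tuples J C'" and b: "b \<in> tuples J C'"
    and z: "\<And>x. x \<in> I \<Longrightarrow> z x \<in> Dom C'" "eqt L I C' z C' c" "eqt L (I <+> J) C' (case_sum z a) C' (case_sum z b)"
  shows "(a, b) \<in> Lascar_rel J"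
proof -
  from Autf_L_of_model[OF J PiE_mem[OF a] PiE_mem[OF b] z]
  obtain \<tau> where \<tau>: "\<tau> \<in> Autf_L L \<kappa>' C'" "\<forall>j\<in>J. \<tau> (a j) = b j" ..
  have "b = compose J \<tau> a"
  proof
    fix j show "b j = compose J \<tau> a j" using \<tau>(2) PiE_arb[OF b, of j] by (simp add: compose_def)
  qed
  then show ?thesis using a \<tau>(1) unfolding Lascar_rel_def by (intro CollectI case_prodI conjI bexI[of _ \<tau>]) simp_all
qed

text \<open>By the two preceding criteria the relation is the projection of the type-definable
  condition \<open>\<Gamma>\<close> on a copy \<open>z\<close> of \<open>c\<close>. Saturation shows
  that such a projection is defined by the set \<open>\<pi>\<close> of all formulas that hold on
  it.\<close>

lemma type_definable_Lascar_rel: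
  fixes J :: "'j set"
  assumes R: "global_ext p R" and J: "|J| <o \<kappa>'"
  shows "type_definable_rel L C' J (Lascar_rel J)"
proof -
  define \<pi> where "\<pi> = {\<phi> \<in> Form L (J <+> J). \<forall>(a, b)\<in>Lascar_rel J. sat C' (case_sum a b) [] \<phi>}"
  define l where "l = (case_sum Inl (\<lambda>x. Inr (Inl x)) :: 'i + 'j \<Rightarrow> 'i + ('j + 'j))"
  define r where "r = (case_sum Inl (\<lambda>x. Inr (Inr x)) :: 'i + 'j \<Rightarrow> 'i + ('j + 'j))"
  define \<Gamma> where "\<Gamma> = map_fm Inl ` {\<phi> \<in> Form L I. sat C' c [] \<phi>} \<union> (\<lambda>\<chi>. Iff (map_fm l \<chi>) (map_fm r \<chi>)) ` Form L (I <+> J)"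
  let ?U = "I <+> (J <+> J)" and ?W = "Inr ` (J <+> J) :: ('i + ('j + 'j)) set"
  have lr: "map_fm l \<chi> \<in> Form L ?U" "map_fm r \<chi> \<in> Form L ?U" if "\<chi> \<in> Form L (I <+> J)" for \<chi>
    by (rule Form_map_fm[OF that], auto simp: l_def r_def)+
  have \<Gamma>: "\<Gamma> \<subseteq> Form L ?U"
  proof -
    have "map_fm Inl \<phi> \<in> Form L ?U" if "\<phi> \<in> Form L I" for \<phi> by (rule Form_map_fm[OF that]) auto
    then show ?thesis unfolding \<Gamma>_def using lr by auto
  qed
  have U: "|?U| <o \<kappa>'" by (rule card_Plus_less[OF mC'(2) card_I card_Plus_less[OF mC'(2) J J]])
  have WU: "?W \<subseteq> ?U" by auto
  have sl: "sat C' w [] (map_fm l \<chi>) \<longleftrightarrow> sat C' (case_sum (\<lambda>x. w (Inl x)) (\<lambda>x. w (Inr (Inl x)))) [] \<chi>"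
    and sr: "sat C' w [] (map_fm r \<chi>) \<longleftrightarrow> sat C' (case_sum (\<lambda>x. w (Inl x)) (\<lambda>x. w (Inr (Inr x)))) [] \<chi>" for w \<chi>
  proof -
    have "w \<circ> l = case_sum (\<lambda>x. w (Inl x)) (\<lambda>x. w (Inr (Inl x)))" "w \<circ> r = case_sum (\<lambda>x. w (Inl x)) (\<lambda>x. w (Inr (Inr x)))"
      by (auto simp: fun_eq_iff l_def r_def split: sum.splits)
    then show "sat C' w [] (map_fm l \<chi>) \<longleftrightarrow> sat C' (case_sum (\<lambda>x. w (Inl x)) (\<lambda>x. w (Inr (Inl x)))) [] \<chi>"
      "sat C' w [] (map_fm r \<chi>) \<longleftrightarrow> sat C' (case_sum (\<lambda>x. w (Inl x)) (\<lambda>x. w (Inr (Inr x)))) [] \<chi>"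
      by (simp_all add: sat_map_fm)
  qed
  have real: "realizable C' ?U ?W (case_sum undefined (case_sum a b)) \<Gamma>" if ab: "(a, b) \<in> Lascar_rel J" for a b
  proof -
    note t = Lascar_rel_tuples[OF ab]
    obtain \<tau> where \<tau>: "\<tau> \<in> Autf_L L \<kappa>' C'" "b = compose J \<tau> a" using ab by (auto simp: Lascar_rel_def)
    have "\<tau> (a j) = b j" if "j \<in> J" for j using that by (simp add: \<tau>(2) compose_eq)
    from model_of_Autf_L[OF R J PiE_mem[OF t(1)] PiE_mem[OF t(2)] \<tau>(1) this]
    obtain z where z: "(\<forall>x\<in>I. z x \<in> Dom C') \<and> eqt L I C' z C' c \<and> eqt L (I <+> J) C' (case_sum z a) C' (case_sum z b)" ..
    show ?thesis
    proof (rule realizableI[of _ "case_sum z (case_sum a b)"])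
      fix \<phi> assume "\<phi> \<in> \<Gamma>"
      then consider \<psi> where "\<psi> \<in> Form L I" "sat C' c [] \<psi>" "\<phi> = map_fm Inl \<psi>"
        | \<chi> where "\<chi> \<in> Form L (I <+> J)" "\<phi> = Iff (map_fm l \<chi>) (map_fm r \<chi>)" unfolding \<Gamma>_def by auto
      then show "sat C' (case_sum z (case_sum a b)) [] \<phi>"
      proof cases
        case 1
        then show ?thesis using z eqtD[of L I C' z C' c \<psi>] by (simp add: sat_map_fm comp_def)
      next
        case 2
        then show ?thesis using z eqtD[of L "I <+> J" C' "case_sum z a" C' "case_sum z b" \<chi>] by (simp add: sl sr)
      qed
    qed (use z PiE_mem[OF t(1)] PiE_mem[OF t(2)] in auto)
  qed
  have "(a, b) \<in> Lascar_rel J" if a: "a \<in> tuples J C'" and b: "b \<in> tuples J C'" and \<pi>: "\<forall>\<phi>\<in>\<pi>. sat C' (case_sum a b) [] \<phi>" for a b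
  proof -
    have "finsat C' ?U ?W (case_sum undefined (case_sum a b)) \<Gamma>"
      unfolding finsat_def
    proof (intro allI impI)
      fix q assume q: "q \<subseteq> \<Gamma>" "finite q"
      have qF: "q \<subseteq> Form L ?U" using q(1) \<Gamma> by (rule subset_trans)
      \<comment> \<open>The formula saying that this finite part of \<open>\<Gamma>\<close> can be
        realized holds on the whole relation, so up to renaming of atoms it belongs to
        \<open>\<pi>\<close>.\<close>
      from ex_conj[OF q(2) qF WU] obtain \<psi> where \<psi>: "\<psi> \<in> Form L ?W" and
        "\<forall>(M :: ('f, 'r, 'a) struct) v. Dom M \<noteq> {} \<and> (\<forall>x\<in>?W. v x \<in> Dom M) \<longrightarrow>
          (sat M v [] \<psi> \<longleftrightarrow> realizable M ?U ?W v q)" ..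
      note \<psi>s = this(2)[rule_format, of C']
      have s\<psi>: "sat C' (case_sum a b) [] (map_fm projr \<psi>) \<longleftrightarrow> realizable C' ?U ?W (case_sum undefined (case_sum a b)) q"
        if a: "a \<in> tuples J C'" and b: "b \<in> tuples J C'" for a b
      proof -
        have "sat C' (case_sum a b) [] (map_fm projr \<psi>) \<longleftrightarrow> sat C' (case_sum undefined (case_sum a b)) [] \<psi>"
          unfolding sat_map_fm by (rule sat_Form_cong[OF \<psi>]) auto
        also have "\<dots> \<longleftrightarrow> realizable C' ?U ?W (case_sum undefined (case_sum a b)) q"
          by (rule \<psi>s) (use nonempty(2) PiE_mem[OF a] PiE_mem[OF b] in auto)
        finally show ?thesis .
      qed
      have "map_fm projr \<psi> \<in> Form L (J <+> J)" by (rule Form_map_fm[OF \<psi>]) auto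
      moreover have "sat C' (case_sum a' b') [] (map_fm projr \<psi>)" if ab': "(a', b') \<in> Lascar_rel J" for a' b'
        using s\<psi>[OF Lascar_rel_tuples[OF ab']] realizable_mono[OF real[OF ab'] q(1)] by simp
      ultimately have "map_fm projr \<psi> \<in> \<pi>" unfolding \<pi>_def by auto
      then have "sat C' (case_sum a b) [] (map_fm projr \<psi>)" using \<pi> by (rule bspec[rotated])
      then show "realizable C' ?U ?W (case_sum undefined (case_sum a b)) q" using s\<psi>[OF a b] by simp
    qed
    from saturated_realizes[OF mC'(4) U \<Gamma> WU nonempty(2) this]
    obtain w where w: "(\<forall>x\<in>?U. w x \<in> Dom C') \<and> (\<forall>x\<in>?W. w x = case_sum undefined (case_sum a b) x) \<and> (\<forall>\<phi>\<in>\<Gamma>. sat C' w [] \<phi>)"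
      unfolding realizable_def ..
    have wJ: "w (Inr (Inl y)) = a y" "w (Inr (Inr y)) = b y" if "y \<in> J" for y
    proof -
      have "w (Inr u) = case_sum a b u" if "u \<in> J <+> J" for u using w that by auto
      from this[OF InlI[OF that]] this[OF InrI[OF that]]
      show "w (Inr (Inl y)) = a y" "w (Inr (Inr y)) = b y" by simp_all
    qed
    define z where "z x = w (Inl x)" for x
    have zD: "z x \<in> Dom C'" if "x \<in> I" for x using w that by (auto simp: z_def)
    have imp: "sat C' z [] \<phi>" if "\<phi> \<in> Form L I" "sat C' c [] \<phi>" for \<phi>
    proof -
      have "map_fm Inl \<phi> \<in> \<Gamma>" unfolding \<Gamma>_def using that by (intro UnI1 imageI) simp
      then have "sat C' w [] (map_fm Inl \<phi>)" using w by blast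
      then show ?thesis by (simp add: sat_map_fm comp_def z_def[abs_def])
    qed
    have zc: "eqt L I C' z C' c"
      unfolding eqt_def
    proof
      fix \<phi> assume \<phi>: "\<phi> \<in> Form L I"
      show "sat C' z [] \<phi> \<longleftrightarrow> sat C' c [] \<phi>" using imp[OF \<phi>] imp[of "Neg \<phi>"] \<phi> by auto
    qed
    have ze: "eqt L (I <+> J) C' (case_sum z a) C' (case_sum z b)"
      unfolding eqt_def
    proof
      fix \<chi> assume \<chi>: "\<chi> \<in> Form L (I <+> J)"
      then have "Iff (map_fm l \<chi>) (map_fm r \<chi>) \<in> \<Gamma>" unfolding \<Gamma>_def by (intro UnI2 imageI)
      then have "sat C' w [] (Iff (map_fm l \<chi>) (map_fm r \<chi>))" using w by blast
      moreover have "sat C' w [] (map_fm l \<chi>) \<longleftrightarrow> sat C' (case_sum z a) [] \<chi>"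
        unfolding sl by (rule sat_Form_cong[OF \<chi>]) (use wJ in \<open>auto simp: z_def\<close>)
      moreover have "sat C' w [] (map_fm r \<chi>) \<longleftrightarrow> sat C' (case_sum z b) [] \<chi>"
        unfolding sr by (rule sat_Form_cong[OF \<chi>]) (use wJ in \<open>auto simp: z_def\<close>)
      ultimately show "sat C' (case_sum z a) [] \<chi> \<longleftrightarrow> sat C' (case_sum z b) [] \<chi>" by simp
    qed
    show ?thesis by (rule Lascar_rel_of_model[OF J a b zD zc ze])
  qed
  note imp' = this
  have imp: "sat C' (case_sum a b) [] \<phi>" if "(a, b) \<in> Lascar_rel J" "\<phi> \<in> \<pi>" for a b \<phi>
    using that unfolding \<pi>_def by auto
  have "Lascar_rel J = {(a, b). a \<in> tuples J C' \<and> b \<in> tuples J C' \<and> (\<forall>\<phi>\<in>\<pi>. sat C' (case_sum a b) [] \<phi>)}"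
  proof (intro subset_antisym subrelI)
    fix a b assume ab: "(a, b) \<in> Lascar_rel J"
    show "(a, b) \<in> {(a, b). a \<in> tuples J C' \<and> b \<in> tuples J C' \<and> (\<forall>\<phi>\<in>\<pi>. sat C' (case_sum a b) [] \<phi>)}"
      using Lascar_rel_tuples[OF ab] imp[OF ab] by simp
  next
    fix a b assume "(a, b) \<in> {(a, b). a \<in> tuples J C' \<and> b \<in> tuples J C' \<and> (\<forall>\<phi>\<in>\<pi>. sat C' (case_sum a b) [] \<phi>)}"
    then show "(a, b) \<in> Lascar_rel J" by (intro imp') simp_all
  qed
  moreover have "\<pi> \<subseteq> Form L (J <+> J)" by (auto simp: \<pi>_def)
  ultimately show ?thesis unfolding type_definable_rel_def by (intro exI[of _ \<pi>]) simp
qed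

lemma card_Form: "|V| <o \<kappa>' \<Longrightarrow> |Form L V| <o \<kappa>'"
  by (rule ordLeq_ordLess_trans[OF Form_card[OF T] card_Plus_less[OF mC'(2,6)]])

text \<open>Tuples with the same type over the model \<open>C\<close> are Lascar equivalent, with
  \<open>c\<close> itself as the witness \<open>z\<close>; hence there are no more classes than
  types over \<open>C\<close>.\<close>

lemma bounded_Lascar_rel:
  fixes J :: "'j set"
  assumes J: "|J| <o \<kappa>'"
  shows "|tuples J C' // Lascar_rel J| <o \<kappa>'"
proof -
  define F where "F = (Form L (J <+> Dom C) :: ('f, 'r, 'j + 'a) fm set)"
  define t where "t X = tp L C' J (SOME a. a \<in> X) (Dom C)" for X
  have some: "(SOME a. a \<in> X) \<in> X" if "X \<in> tuples J C' // Lascar_rel J" for X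
    using in_quotient_imp_non_empty[OF equiv_Lascar_rel that] some_in_eq by blast
  have "inj_on t (tuples J C' // Lascar_rel J)"
  proof (rule inj_onI)
    fix X Y assume X: "X \<in> tuples J C' // Lascar_rel J" and Y: "Y \<in> tuples J C' // Lascar_rel J" and eq: "t X = t Y"
    define a where "a = (SOME a. a \<in> X)"
    define b where "b = (SOME a. a \<in> Y)"
    have aX: "a \<in> X" "b \<in> Y" unfolding a_def b_def by (rule some[OF X], rule some[OF Y])
    have ab: "a \<in> tuples J C'" "b \<in> tuples J C'"
      using aX in_quotient_imp_subset[OF equiv_Lascar_rel X] in_quotient_imp_subset[OF equiv_Lascar_rel Y] by blast+
    have e: "eqt L (J <+> Dom C) C' (case_sum a id) C' (case_sum b id)"
      using eq unfolding t_def a_def b_def by (simp only: tp_eq_iff)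
    define h where "h = (case_sum (\<lambda>i. Inr (c i)) Inl :: 'i + 'j \<Rightarrow> 'j + 'a)"
    have "eqt L (I <+> J) C' (case_sum a id \<circ> h) C' (case_sum b id \<circ> h)"
      by (rule eqt_comp[OF e]) (use c_Dom in \<open>auto simp: h_def\<close>)
    then have "eqt L (I <+> J) C' (case_sum c a) C' (case_sum c b)"
      by (rule eqt_congI) (auto simp: h_def)
    moreover have "eqt L I C' c C' c" by (simp add: eqt_def)
    ultimately have "(a, b) \<in> Lascar_rel J" by (intro Lascar_rel_of_model[OF J ab c_Dom(2)])
    then show "X = Y" using quotient_eqI[OF equiv_Lascar_rel X Y aX] by blast
  qed
  moreover have "t ` (tuples J C' // Lascar_rel J) \<subseteq> Pow F"
    unfolding t_def tp_def F_def by blast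
  ultimately have "|tuples J C' // Lascar_rel J| \<le>o |Pow F|" by (metis card_of_ordLeq)
  moreover have "|Pow F| <o \<kappa>'"
    unfolding F_def by (rule strong_limit_Pow[OF mC'(1) card_Form[OF card_Plus_less[OF mC'(2) J small]]])
  ultimately show ?thesis by (rule ordLeq_ordLess_trans)
qed

text \<open>A Kim--Pillay strong automorphism preserves the Lascar class of a tuple enumerating
  \<open>C\<close>. So it agrees on \<open>C\<close> with some Lascar strong \<open>\<tau>\<close>,
  and the quotient of the two fixes \<open>C\<close> and is Lascar strong as well.\<close>

lemma Autf_KP_eq:
  assumes R: "global_ext p R"
  shows "Autf_KP L \<kappa>' C' = Autf_L L \<kappa>' C'"
proof
  show "Autf_L L \<kappa>' C' \<subseteq> Autf_KP L \<kappa>' C'" by (rule Autf_L_subset_KP[OF C'])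
  show "Autf_KP L \<kappa>' C' \<subseteq> Autf_L L \<kappa>' C'"
  proof
    fix \<sigma> assume \<sigma>: "\<sigma> \<in> Autf_KP L \<kappa>' C'"
    then have \<sigma>A: "\<sigma> \<in> Aut L C'" by (simp add: Autf_KP_iff)
    have "Card_order \<kappa>'" using mC'(2) by simp
    from ordLess_imp_ordLeq[OF small] ordIso_symmetric[OF card_of_Field_ordIso[OF this]]
    have "|Dom C| \<le>o |Field \<kappa>'|" by (rule ordLeq_ordIso_trans)
    then obtain g where g: "inj_on g (Dom C)" "g ` Dom C \<subseteq> Field \<kappa>'" using card_of_ordLeq by metis
    \<comment> \<open>\<open>Autf_KP\<close> only considers index sets inside
      \<open>Field \<kappa>'\<close>, so the elements of \<open>C\<close> are re-indexed through
      \<open>g\<close>.\<close>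
    define J where "J = g ` Dom C"
    define a where "a = restrict (inv_into (Dom C) g) J"
    have J: "|J| <o \<kappa>'" unfolding J_def by (rule ordLeq_ordLess_trans[OF card_of_image small])
    have bi: "bounded_index \<kappa>' J" using J g(2) by (simp add: bounded_index_def J_def)
    have ag: "a (g x) = x" if "x \<in> Dom C" for x using that g(1) by (simp add: a_def J_def)
    have a: "a \<in> tuples J C'"
      unfolding a_def using inv_into_into[of _ g "Dom C"] sub by (auto simp: J_def)
    let ?X = "Lascar_rel J `` {a}"
    have X: "?X \<in> tuples J C' // Lascar_rel J" by (rule quotientI[OF a])
    have "compose J \<sigma> ` ?X = ?X"
      by (rule Autf_KP_class[OF \<sigma> _ X])
        (intro conjI bi type_definable_Lascar_rel[OF R J] equiv_Lascar_rel bounded_Lascar_rel[OF J])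
    moreover have "a \<in> ?X" by (rule equiv_class_self[OF equiv_Lascar_rel a])
    ultimately have "compose J \<sigma> a \<in> ?X" by blast
    then have "(a, compose J \<sigma> a) \<in> Lascar_rel J" by simp
    then obtain \<tau> where \<tau>: "\<tau> \<in> Autf_L L \<kappa>' C'" and eq: "compose J \<sigma> a = compose J \<tau> a"
      by (auto simp: Lascar_rel_def)
    have \<tau>A: "\<tau> \<in> Aut L C'" by (rule Autf_L_closed(1)[OF mC'(3) \<tau>])
    have st: "\<sigma> x = \<tau> x" if "x \<in> Dom C" for x
      using fun_cong[OF eq, of "g x"] that ag[OF that] by (simp add: compose_def J_def)
    define \<rho> where "\<rho> = compose (Dom C') (aut_inv C' \<tau>) \<sigma>"
    have "\<rho> \<in> Aut L C'" unfolding \<rho>_def by (rule Aut_compose[OF mC'(3) Aut_inv[OF mC'(3) \<tau>A] \<sigma>A])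
    then have "\<rho> \<in> Autf_L L \<kappa>' C'"
    proof (rule elementary_fix_Autf_L[OF _ small elC])
      fix x assume "x \<in> Dom C"
      then show "\<rho> x = x" using st[of x] sub[of x] aut_inv(1)[OF \<tau>A, of x] by (simp add: \<rho>_def compose_eq)
    qed
    from Autf_L_closed(2)[OF mC'(3) \<tau> this] have "compose (Dom C') \<tau> \<rho> \<in> Autf_L L \<kappa>' C'" .
    moreover have "compose (Dom C') \<tau> \<rho> = \<sigma>"
    proof
      fix x show "compose (Dom C') \<tau> \<rho> x = \<sigma> x"
      proof (cases "x \<in> Dom C'")
        case True
        then show ?thesis using aut_inv(2)[OF \<tau>A Aut_D(5)[OF \<sigma>A True]] by (simp add: compose_eq \<rho>_def)
      next
        case False
        then show ?thesis using extensional_arb[OF Aut_D(4)[OF \<sigma>A] False] by (simp add: compose_def)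
      qed
    qed
    ultimately show "\<sigma> \<in> Autf_L L \<kappa>' C'" by simp
  qed
qed

end

section \<open>The Ellis semigroup\<close>

context monster_pair
begin

text \<open>With finite \<open>F\<close> this says that the map induced by \<open>\<sigma>\<close>
  lies in a basic neighbourhood of \<open>\<eta>\<close> in the product of the type spaces.\<close>

definition agree where
  "agree \<eta> \<sigma> F \<longleftrightarrow> (\<forall>q \<phi>. (q, \<phi>) \<in> F \<longrightarrow> (\<phi> \<in> \<eta> q \<longleftrightarrow> \<phi> \<in> type_act \<sigma> q))"

lemma agreeD: "agree \<eta> \<sigma> F \<Longrightarrow> (q, \<phi>) \<in> F \<Longrightarrow> \<phi> \<in> \<eta> q \<longleftrightarrow> \<phi> \<in> type_act \<sigma> q"
  unfolding agree_def by blast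

abbreviation "E \<equiv> carrier (EL L C C' I c)"

abbreviation "FS \<equiv> {F. finite F \<and> F \<subseteq> S \<times> Form L (I <+> Dom C)}"

lemma S_Conj: "p \<in> S \<Longrightarrow> Conj \<phi> \<psi> \<in> p \<longleftrightarrow> \<phi> \<in> p \<and> \<psi> \<in> p"
  by (elim S_E) (auto simp: mem_tp)

lemma topspace_stone: "topspace (stone_topology L C C' I c) = S"
proof -
  have "\<exists>X\<in>{{p \<in> S. \<phi> \<in> p} |\<phi>. \<phi> \<in> Form L (I <+> Dom C)}. p \<in> X" if p: "p \<in> S" for p
  proof -
    define \<phi> :: "('f, 'r, 'i + 'a) fm" where "\<phi> = Exists (Equal (BVar 0) (BVar 0))"
    have F: "\<phi> \<in> Form L (I <+> Dom C)" "Neg \<phi> \<in> Form L (I <+> Dom C)" by (auto simp: \<phi>_def Form_def)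
    then have "\<phi> \<in> p \<or> Neg \<phi> \<in> p" using S_Neg[OF p F(1)] by blast
    then obtain \<psi> where \<psi>: "\<psi> \<in> Form L (I <+> Dom C)" "\<psi> \<in> p" using F by metis
    show ?thesis
    proof (rule bexI)
      show "p \<in> {p \<in> S. \<psi> \<in> p}" using p \<psi>(2) by simp
      show "{p \<in> S. \<psi> \<in> p} \<in> {{p \<in> S. \<phi> \<in> p} |\<phi>. \<phi> \<in> Form L (I <+> Dom C)}"
        using \<psi>(1) by (intro CollectI exI[of _ \<psi>]) simp
    qed
  qed
  then have "S \<subseteq> \<Union>{{p \<in> S. \<phi> \<in> p} |\<phi>. \<phi> \<in> Form L (I <+> Dom C)}"
    unfolding Union_iff subset_iff by (intro allI impI)
  moreover have "\<Union>{{p \<in> S. \<phi> \<in> p} |\<phi>. \<phi> \<in> Form L (I <+> Dom C)} \<subseteq> S" by auto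
  ultimately show ?thesis unfolding stone_topology_def topology_generated_by_topspace by (rule subset_antisym[rotated])
qed

lemma openin_stone_basic: "\<phi> \<in> Form L (I <+> Dom C) \<Longrightarrow> openin (stone_topology L C C' I c) {p \<in> S. \<phi> \<in> p}"
  unfolding stone_topology_def by (rule topology_generated_by_Basis) blast

text \<open>Closure under \<open>Conj\<close> turns the generating sets into a base.\<close>

lemma openin_stone_nbhd:
  assumes "openin (stone_topology L C C' I c) V" "p \<in> V"
  shows "\<exists>\<phi>\<in>Form L (I <+> Dom C). \<phi> \<in> p \<and> {s \<in> S. \<phi> \<in> s} \<subseteq> V"
  using openin_topology_generated_by[OF assms(1)[unfolded stone_topology_def]] assms(2)
proof (induction V rule: generate_topology_on.induct)
  case (Int a b)
  then have "\<exists>\<phi>\<in>Form L (I <+> Dom C). \<phi> \<in> p \<and> {s \<in> S. \<phi> \<in> s} \<subseteq> a" by simp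
  then obtain \<phi> where \<phi>: "\<phi> \<in> Form L (I <+> Dom C)" "\<phi> \<in> p \<and> {s \<in> S. \<phi> \<in> s} \<subseteq> a" ..
  have "\<exists>\<phi>\<in>Form L (I <+> Dom C). \<phi> \<in> p \<and> {s \<in> S. \<phi> \<in> s} \<subseteq> b" using Int by simp
  then obtain \<psi> where \<psi>: "\<psi> \<in> Form L (I <+> Dom C)" "\<psi> \<in> p \<and> {s \<in> S. \<psi> \<in> s} \<subseteq> b" ..
  have "p \<in> \<Union>{{p \<in> S. \<phi> \<in> p} |\<phi>. \<phi> \<in> Form L (I <+> Dom C)}"
    using openin_subset[OF assms(1)] assms(2) topspace_stone
    unfolding stone_topology_def topology_generated_by_topspace by blast
  then have p: "p \<in> S" by blast
  show ?case
    by (rule bexI[of _ "Conj \<phi> \<psi>"]) (use \<phi> \<psi> S_Conj p in auto)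
next
  case (UN K)
  then obtain k where k: "k \<in> K" "p \<in> k" by blast
  from UN(2)[OF this] obtain \<phi> where "\<phi> \<in> Form L (I <+> Dom C)" "\<phi> \<in> p \<and> {s \<in> S. \<phi> \<in> s} \<subseteq> k" ..
  then show ?case using k by (intro bexI[of _ \<phi>]) auto
next
  case (Basis s)
  then obtain \<phi> where "\<phi> \<in> Form L (I <+> Dom C)" "s = {p \<in> S. \<phi> \<in> p}" by blast
  then show ?case using Basis(2) by (intro bexI[of _ \<phi>]) auto
qed simp

lemma EL_carrier:
  "E = product_topology (\<lambda>_. stone_topology L C C' I c) S closure_of {restrict (type_act \<sigma>) S |\<sigma>. \<sigma> \<in> Aut L C}"
  by (simp add: EL_def Let_def)

lemma EL_mult: "f \<otimes>\<^bsub>EL L C C' I c\<^esub> g = compose S f g"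
  by (simp add: EL_def Let_def)

text \<open>Membership in the closure, tested on finitely many pairs of a type and a formula. The
  topology enters the rest of the argument only in this form.\<close>

lemma EL_iff: "\<eta> \<in> E \<longleftrightarrow> \<eta> \<in> S \<rightarrow>\<^sub>E S \<and> (\<forall>F\<in>FS. \<exists>\<sigma>\<in>Aut L C. agree \<eta> \<sigma> F)"
proof -
  let ?X = "\<lambda>_ :: ('f, 'r, 'i + 'a) fm set. stone_topology L C C' I c"
  let ?P = "product_topology ?X S"
  have top: "topspace ?P = S \<rightarrow>\<^sub>E S" by (simp add: topspace_stone)
  show ?thesis
  proof
    assume \<eta>: "\<eta> \<in> E"
    then have \<eta>S: "\<eta> \<in> S \<rightarrow>\<^sub>E S" and cl: "\<And>T. \<eta> \<in> T \<Longrightarrow> openin ?P T \<Longrightarrow> \<exists>y. y \<in> {restrict (type_act \<sigma>) S |\<sigma>. \<sigma> \<in> Aut L C} \<and> y \<in> T"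
      unfolding EL_carrier in_closure_of top by simp_all
    have "\<exists>\<sigma>\<in>Aut L C. agree \<eta> \<sigma> F" if F: "F \<in> FS" for F
    proof -
      have fin: "finite F" and FS: "F \<subseteq> S \<times> Form L (I <+> Dom C)" using F by simp_all
      define W where "W F = {f \<in> S \<rightarrow>\<^sub>E S. \<forall>q \<phi>. (q, \<phi>) \<in> F \<longrightarrow> (\<phi> \<in> f q \<longleftrightarrow> \<phi> \<in> \<eta> q)}" for F
      have "openin ?P (W F)"
        using fin FS
      proof (induction F rule: finite_induct)
        case empty
        have "W {} = topspace ?P" unfolding W_def top by simp
        then show ?case by (simp only: openin_topspace)
      next
        case (insert t F)
        obtain q \<phi> where t: "t = (q, \<phi>)" by (cases t)
        then have q: "q \<in> S" and \<phi>: "\<phi> \<in> Form L (I <+> Dom C)" using insert.prems by auto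
        define \<psi> where "\<psi> = (if \<phi> \<in> \<eta> q then \<phi> else Neg \<phi>)"
        have \<psi>F: "\<psi> \<in> Form L (I <+> Dom C)" using \<phi> by (simp add: \<psi>_def)
        have o: "openin ?P {f \<in> topspace ?P. f q \<in> {p \<in> S. \<psi> \<in> p}}"
          by (rule openin_continuous_map_preimage[OF continuous_map_product_projection[OF q] openin_stone_basic[OF \<psi>F]])
        have "W (insert t F) = W F \<inter> {f \<in> topspace ?P. f q \<in> {p \<in> S. \<psi> \<in> p}}"
        proof -
          have "\<psi> \<in> f q \<longleftrightarrow> (\<phi> \<in> f q \<longleftrightarrow> \<phi> \<in> \<eta> q)" if "f q \<in> S" for f
            using S_Neg[OF that \<phi>] by (simp add: \<psi>_def)
          moreover have "f q \<in> S" if "f \<in> S \<rightarrow>\<^sub>E S" for f using PiE_mem[OF that q] .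
          ultimately show ?thesis unfolding W_def top t by auto
        qed
        moreover have "openin ?P (W F)" using insert by simp
        ultimately show ?case using o by (simp only: openin_Int)
      qed
      moreover have "\<eta> \<in> W F" using \<eta>S by (simp add: W_def)
      ultimately have "\<exists>y. y \<in> {restrict (type_act \<sigma>) S |\<sigma>. \<sigma> \<in> Aut L C} \<and> y \<in> W F" by (rule cl[rotated])
      then obtain y where y: "y \<in> {restrict (type_act \<sigma>) S |\<sigma>. \<sigma> \<in> Aut L C} \<and> y \<in> W F" ..
      then obtain \<sigma> where \<sigma>: "\<sigma> \<in> Aut L C" "y = restrict (type_act \<sigma>) S" by auto
      have "agree \<eta> \<sigma> F" unfolding agree_def
      proof (intro allI impI)
        fix q \<phi> assume qf: "(q, \<phi>) \<in> F"
        then have "q \<in> S" using FS by auto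
        moreover have "\<phi> \<in> y q \<longleftrightarrow> \<phi> \<in> \<eta> q" using y qf by (simp add: W_def)
        ultimately show "\<phi> \<in> \<eta> q \<longleftrightarrow> \<phi> \<in> type_act \<sigma> q" by (simp add: \<sigma>(2))
      qed
      with \<sigma>(1) show ?thesis by (intro bexI[of _ \<sigma>])
    qed
    with \<eta>S show "\<eta> \<in> S \<rightarrow>\<^sub>E S \<and> (\<forall>F\<in>FS. \<exists>\<sigma>\<in>Aut L C. agree \<eta> \<sigma> F)" by simp
  next
    assume R: "\<eta> \<in> S \<rightarrow>\<^sub>E S \<and> (\<forall>F\<in>FS. \<exists>\<sigma>\<in>Aut L C. agree \<eta> \<sigma> F)"
    have "\<exists>y. y \<in> {restrict (type_act \<sigma>) S |\<sigma>. \<sigma> \<in> Aut L C} \<and> y \<in> T" if T: "\<eta> \<in> T" "openin ?P T" for T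
    proof -
      from T(2)[unfolded openin_product_topology_alt, rule_format, OF T(1)]
      obtain U where U: "finite {i \<in> S. U i \<noteq> topspace (?X i)} \<and> (\<forall>i\<in>S. openin (?X i) (U i)) \<and> \<eta> \<in> Pi\<^sub>E S U \<and> Pi\<^sub>E S U \<subseteq> T" ..
      define Q where "Q = {i \<in> S. U i \<noteq> S}"
      have Q: "finite Q" using U by (simp add: Q_def topspace_stone)
      have "\<forall>q\<in>S. \<exists>\<phi>. \<phi> \<in> Form L (I <+> Dom C) \<and> \<phi> \<in> \<eta> q \<and> {s \<in> S. \<phi> \<in> s} \<subseteq> U q"
      proof
        fix q assume q: "q \<in> S"
        have "openin (stone_topology L C C' I c) (U q)" using U q by simp
        moreover have "\<eta> q \<in> U q" using U q by (auto dest: PiE_mem)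
        ultimately show "\<exists>\<phi>. \<phi> \<in> Form L (I <+> Dom C) \<and> \<phi> \<in> \<eta> q \<and> {s \<in> S. \<phi> \<in> s} \<subseteq> U q"
          using openin_stone_nbhd[of "U q" "\<eta> q"] by (simp add: Bex_def)
      qed
      from bchoice[OF this] obtain f where f: "\<forall>q\<in>S. f q \<in> Form L (I <+> Dom C) \<and> f q \<in> \<eta> q \<and> {s \<in> S. f q \<in> s} \<subseteq> U q" ..
      have "(\<lambda>q. (q, f q)) ` Q \<in> FS" using Q f by (auto simp: Q_def)
      then have "\<exists>\<sigma>\<in>Aut L C. agree \<eta> \<sigma> ((\<lambda>q. (q, f q)) ` Q)" using R by blast
      then obtain \<sigma> where \<sigma>: "\<sigma> \<in> Aut L C" "agree \<eta> \<sigma> ((\<lambda>q. (q, f q)) ` Q)" ..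
      have rU: "restrict (type_act \<sigma>) S \<in> Pi\<^sub>E S U"
      proof (rule restrict_PiE_iff[THEN iffD2], rule ballI)
        fix q assume q: "q \<in> S"
        have tS: "type_act \<sigma> q \<in> S" by (rule type_act_S[OF \<sigma>(1) q])
        show "type_act \<sigma> q \<in> U q"
        proof (cases "q \<in> Q")
          case True
          then have "f q \<in> \<eta> q \<longleftrightarrow> f q \<in> type_act \<sigma> q" by (intro agreeD[OF \<sigma>(2)]) simp
          then show ?thesis using f q tS by auto
        qed (use q tS in \<open>simp add: Q_def\<close>)
      qed
      have "Pi\<^sub>E S U \<subseteq> T" using U by simp
      from subsetD[OF this rU] have "restrict (type_act \<sigma>) S \<in> T" .
      moreover have "restrict (type_act \<sigma>) S \<in> {restrict (type_act \<sigma>) S |\<sigma>. \<sigma> \<in> Aut L C}"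
        by (intro CollectI exI[of _ \<sigma>] conjI refl \<sigma>(1))
      ultimately show ?thesis by (intro exI conjI)
    qed
    with R show "\<eta> \<in> E" unfolding EL_carrier in_closure_of top by simp
  qed
qed

section \<open>Composition and compactness of the Ellis semigroup\<close>

lemma EL_S: "\<eta> \<in> E \<Longrightarrow> q \<in> S \<Longrightarrow> \<eta> q \<in> S"
  unfolding EL_iff by (auto dest: PiE_mem)

lemma EL_approx: "\<eta> \<in> E \<Longrightarrow> finite F \<Longrightarrow> F \<subseteq> S \<times> Form L (I <+> Dom C) \<Longrightarrow> \<exists>\<sigma>\<in>Aut L C. agree \<eta> \<sigma> F"
  unfolding EL_iff by simp

lemma EL_Aut:
  assumes \<sigma>: "\<sigma> \<in> Aut L C"
  shows "restrict (type_act \<sigma>) S \<in> E"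
  unfolding EL_iff
proof (intro conjI ballI)
  show "restrict (type_act \<sigma>) S \<in> S \<rightarrow>\<^sub>E S" using type_act_S[OF \<sigma>] by simp
  fix F assume "F \<in> FS"
  then have "agree (restrict (type_act \<sigma>) S) \<sigma> F" unfolding agree_def by auto
  with \<sigma> show "\<exists>\<tau>\<in>Aut L C. agree (restrict (type_act \<sigma>) S) \<tau> F" by (intro bexI[of _ "\<sigma>"])
qed

text \<open>The outer map is approximated first, at the points \<open>g q\<close>. The inner map
  then has to be approximated at the formulas pulled back by the automorphism just found.\<close>

lemma EL_compose:
  assumes f: "f \<in> E" and g: "g \<in> E"
  shows "compose S f g \<in> E"
  unfolding EL_iff
proof (intro conjI ballI)
  show "compose S f g \<in> S \<rightarrow>\<^sub>E S" using EL_S[OF f] EL_S[OF g] by (simp add: compose_def)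
  fix F assume F: "F \<in> FS"
  define F1 where "F1 = (\<lambda>(q, \<phi>). (g q, \<phi>)) ` F"
  have "finite F1" "F1 \<subseteq> S \<times> Form L (I <+> Dom C)" using F EL_S[OF g] by (auto simp: F1_def)
  from EL_approx[OF f this] obtain \<sigma> where \<sigma>: "\<sigma> \<in> Aut L C" "agree f \<sigma> F1" ..
  define F2 where "F2 = (\<lambda>(q, \<phi>). (q, act (aut_inv C \<sigma>) \<phi>)) ` F"
  have "finite F2" "F2 \<subseteq> S \<times> Form L (I <+> Dom C)"
    using F act_FormC[OF Aut_inv[OF mC(3) \<sigma>(1)]] by (auto simp: F2_def)
  from EL_approx[OF g this] obtain \<tau> where \<tau>: "\<tau> \<in> Aut L C" "agree g \<tau> F2" ..
  have \<sigma>\<tau>: "compose (Dom C) \<sigma> \<tau> \<in> Aut L C" by (rule Aut_compose[OF mC(3) \<sigma>(1) \<tau>(1)])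
  have "agree (compose S f g) (compose (Dom C) \<sigma> \<tau>) F" unfolding agree_def
  proof (intro allI impI)
    fix q \<phi> assume qf: "(q, \<phi>) \<in> F"
    then have q: "q \<in> S" and \<phi>: "\<phi> \<in> Form L (I <+> Dom C)" using F by auto
    have "(g q, \<phi>) \<in> F1" unfolding F1_def by (rule image_eqI[OF _ qf]) simp
    then have "\<phi> \<in> f (g q) \<longleftrightarrow> \<phi> \<in> type_act \<sigma> (g q)" by (rule agreeD[OF \<sigma>(2)])
    also have "\<dots> \<longleftrightarrow> act (aut_inv C \<sigma>) \<phi> \<in> g q" by (rule type_act_mem[OF \<sigma>(1) EL_S[OF g q] \<phi>])
    also have "\<dots> \<longleftrightarrow> act (aut_inv C \<sigma>) \<phi> \<in> type_act \<tau> q"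
    proof (rule agreeD[OF \<tau>(2)])
      show "(q, act (aut_inv C \<sigma>) \<phi>) \<in> F2" unfolding F2_def by (rule image_eqI[OF _ qf]) simp
    qed
    also have "\<dots> \<longleftrightarrow> \<phi> \<in> type_act \<sigma> (type_act \<tau> q)"
      by (rule type_act_mem[OF \<sigma>(1) type_act_S[OF \<tau>(1) q] \<phi>, symmetric])
    also have "type_act \<sigma> (type_act \<tau> q) = type_act (compose (Dom C) \<sigma> \<tau>) q"
      by (rule type_act_compose[OF \<sigma>(1) \<tau>(1) q])
    finally show "\<phi> \<in> compose S f g q \<longleftrightarrow> \<phi> \<in> type_act (compose (Dom C) \<sigma> \<tau>) q"
      using q by (simp add: compose_eq)
  qed
  with \<sigma>\<tau> show "\<exists>\<sigma>\<in>Aut L C. agree (compose S f g) \<sigma> F" by (intro bexI[of _ "compose (Dom C) \<sigma> \<tau>"])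
qed

lemma EL_assoc: "h \<in> E \<Longrightarrow> compose S f (compose S g h) = compose S (compose S f g) h"
  by (rule compose_assoc) (auto dest: EL_S)

text \<open>Compactness of the type space, from saturation of \<open>C'\<close>. The realization has
  the type of \<open>c\<close> because each formula without parameters is decided by
  \<open>P\<close> as in some member of \<open>S\<close>.\<close>

lemma S_limit:
  assumes P: "P \<subseteq> Form L (I <+> Dom C)"
    and fin: "\<And>Q. finite Q \<Longrightarrow> Q \<subseteq> Form L (I <+> Dom C) \<Longrightarrow> \<exists>s\<in>S. \<forall>\<phi>\<in>Q. \<phi> \<in> P \<longleftrightarrow> \<phi> \<in> s"
  shows "P \<in> S"
proof -
  let ?U = "I <+> Dom C" and ?W = "Inr ` Dom C :: ('i + 'a) set"
  have "finsat C' ?U ?W pv P"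
    unfolding finsat_def
  proof (intro allI impI)
    fix q assume q: "q \<subseteq> P" "finite q"
    from fin[OF q(2) subset_trans[OF q(1) P]] obtain s where s: "s \<in> S" "\<forall>\<phi>\<in>q. \<phi> \<in> P \<longleftrightarrow> \<phi> \<in> s" ..
    obtain a where a: "a \<in> tuples I C'" "s = tp L C' I a (Dom C)" "eqt L I C' a C' c" by (rule S_E[OF s(1)])
    show "realizable C' ?U ?W pv q"
    proof (rule realizableI[of _ "case_sum a id"])
      fix \<phi> assume "\<phi> \<in> q"
      then have "\<phi> \<in> s" using s(2) q(1) by blast
      then show "sat C' (case_sum a id) [] \<phi>" by (simp add: a(2) mem_tp)
    qed (use PiE_mem[OF a(1)] sub in auto)
  qed
  moreover have "|?U| <o \<kappa>'" by (rule card_Plus_less[OF mC'(2) card_I small])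
  moreover have "?W \<subseteq> ?U" by auto
  ultimately have "realizable C' ?U ?W pv P"
    using saturated_realizes[OF mC'(4) _ P _ nonempty(2)] by simp
  then obtain w where w: "(\<forall>x\<in>?U. w x \<in> Dom C') \<and> (\<forall>x\<in>?W. w x = pv x) \<and> (\<forall>\<phi>\<in>P. sat C' w [] \<phi>)"
    unfolding realizable_def ..
  define a where "a x = w (Inl x)" for x
  have aw: "sat C' (case_sum a id) [] \<phi> \<longleftrightarrow> sat C' w [] \<phi>" if "\<phi> \<in> Form L ?U" for \<phi>
    using w by (intro sat_Form_cong[OF that]) (auto simp: a_def)
  have Pa: "\<phi> \<in> P \<longleftrightarrow> sat C' (case_sum a id) [] \<phi>" if \<phi>: "\<phi> \<in> Form L ?U" for \<phi>
  proof
    assume "\<phi> \<in> P"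
    then show "sat C' (case_sum a id) [] \<phi>" using w aw[OF \<phi>] by simp
  next
    assume s: "sat C' (case_sum a id) [] \<phi>"
    have "finite {\<phi>, Neg \<phi>}" "{\<phi>, Neg \<phi>} \<subseteq> Form L ?U" using \<phi> by simp_all
    from fin[OF this] obtain t where t: "t \<in> S" "\<forall>\<psi>\<in>{\<phi>, Neg \<phi>}. \<psi> \<in> P \<longleftrightarrow> \<psi> \<in> t" ..
    have "Neg \<phi> \<notin> P"
    proof
      assume "Neg \<phi> \<in> P"
      then have "sat C' w [] (Neg \<phi>)" using w by blast
      then show False using s aw[OF \<phi>] by simp
    qed
    then show "\<phi> \<in> P" using t S_Neg[OF t(1) \<phi>] by simp
  qed
  have imp: "sat C' a [] \<phi>" if \<phi>: "\<phi> \<in> Form L I" and s: "sat C' c [] \<phi>" for \<phi>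
  proof -
    have F: "map_fm Inl \<phi> \<in> Form L ?U" by (rule Form_map_fm[OF \<phi>]) auto
    have "finite {map_fm Inl \<phi>}" "{map_fm Inl \<phi>} \<subseteq> Form L ?U" using F by simp_all
    from fin[OF this] obtain t where t: "t \<in> S" "\<forall>\<psi>\<in>{map_fm Inl \<phi>}. \<psi> \<in> P \<longleftrightarrow> \<psi> \<in> t" ..
    obtain b where b: "b \<in> tuples I C'" "t = tp L C' I b (Dom C)" "eqt L I C' b C' c" by (rule S_E[OF t(1)])
    have "map_fm Inl \<phi> \<in> t" using F s eqtD[OF b(3) \<phi>] by (simp add: b(2) mem_tp sat_map_fm comp_def)
    then have "sat C' (case_sum a id) [] (map_fm Inl \<phi>)" using t(2) Pa[OF F] by simp
    then show ?thesis by (simp add: sat_map_fm comp_def)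
  qed
  have ac: "eqt L I C' a C' c"
    unfolding eqt_def
  proof
    fix \<phi> assume \<phi>: "\<phi> \<in> Form L I"
    show "sat C' a [] \<phi> \<longleftrightarrow> sat C' c [] \<phi>" using imp[OF \<phi>] imp[of "Neg \<phi>"] \<phi> by auto
  qed
  have "P = tp L C' I a (Dom C)" using Pa P by (intro Set.set_eqI) (auto simp: mem_tp)
  moreover have "a x \<in> Dom C'" if "x \<in> I" for x using w that by (auto simp: a_def)
  ultimately show ?thesis using S_I[OF _ ac] by simp
qed

text \<open>An ultrafilter containing \<open>\<A>\<close> converges pointwise. The conclusion keeps
  the sets of \<open>\<A>\<close> in view: each neighbourhood of the limit meets every one of them,
  and so conditions imposed on automorphisms can be read off the limit.\<close>

lemma EL_limit:
  assumes fip: "\<And>G. finite G \<Longrightarrow> G \<subseteq> \<A> \<Longrightarrow> \<exists>\<sigma>\<in>Aut L C. \<forall>A\<in>G. \<sigma> \<in> A"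
  shows "\<exists>\<eta>\<in>E. \<forall>A\<in>\<A>. \<forall>F\<in>FS. \<exists>\<sigma>\<in>Aut L C. \<sigma> \<in> A \<and> agree \<eta> \<sigma> F"
proof -
  have "fip (insert (Aut L C) \<A>)"
    unfolding fip_def
  proof (intro allI impI)
    fix G assume "G \<subseteq> insert (Aut L C) \<A>" "finite G"
    then have "finite (G - {Aut L C})" "G - {Aut L C} \<subseteq> \<A>" by auto
    from fip[OF this] obtain \<sigma> where "\<sigma> \<in> Aut L C" "\<forall>A\<in>G - {Aut L C}. \<sigma> \<in> A" ..
    then have "\<sigma> \<in> A" if "A \<in> G" for A using that by (cases "A = Aut L C") simp_all
    then show "\<Inter>G \<noteq> {}" by auto
  qed
  from ultrafilter_exists[OF this]
  obtain \<U> where \<U>: "insert (Aut L C) \<A> \<subseteq> \<U> \<and> fip \<U> \<and> (\<forall>X. X \<in> \<U> \<or> - X \<in> \<U>)" ..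
  define \<eta> where "\<eta> = (\<lambda>q\<in>S. {\<phi> \<in> Form L (I <+> Dom C). {\<sigma>. \<phi> \<in> type_act \<sigma> q} \<in> \<U>})"
  have approx: "\<exists>\<sigma>\<in>Aut L C. \<sigma> \<in> A \<and> agree \<eta> \<sigma> F" if A: "A \<in> insert (Aut L C) \<A>" and F: "F \<in> FS" for A F
  proof -
    define B where "B = (\<lambda>(q, \<phi>). {\<sigma>. \<phi> \<in> \<eta> q \<longleftrightarrow> \<phi> \<in> type_act \<sigma> q})"
    have BU: "B t \<in> \<U>" if t: "t \<in> F" for t
    proof -
      obtain q \<phi> where tq: "t = (q, \<phi>)" by (cases t)
      then have q: "q \<in> S" and \<phi>: "\<phi> \<in> Form L (I <+> Dom C)" using t F by auto
      show ?thesis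
      proof (cases "\<phi> \<in> \<eta> q")
        case True
        then have "{\<sigma>. \<phi> \<in> type_act \<sigma> q} \<in> \<U>" using q by (simp add: \<eta>_def)
        moreover have "B t = {\<sigma>. \<phi> \<in> type_act \<sigma> q}" using True by (simp add: B_def tq)
        ultimately show ?thesis by simp
      next
        case False
        then have "{\<sigma>. \<phi> \<in> type_act \<sigma> q} \<notin> \<U>" using q \<phi> by (simp add: \<eta>_def)
        then have "- {\<sigma>. \<phi> \<in> type_act \<sigma> q} \<in> \<U>" using \<U> by blast
        moreover have "B t = - {\<sigma>. \<phi> \<in> type_act \<sigma> q}" using False by (auto simp: B_def tq)
        ultimately show ?thesis by simp
      qed
    qed
    have "insert A (insert (Aut L C) (B ` F)) \<subseteq> \<U>" using A BU \<U> by blast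
    moreover have "finite (insert A (insert (Aut L C) (B ` F)))" using F by simp
    ultimately have "\<exists>\<sigma>. \<forall>X\<in>insert A (insert (Aut L C) (B ` F)). \<sigma> \<in> X"
      using \<U> by (intro fipD[of \<U>]) simp_all
    then obtain \<sigma> where \<sigma>: "\<forall>X\<in>insert A (insert (Aut L C) (B ` F)). \<sigma> \<in> X" ..
    have "agree \<eta> \<sigma> F" unfolding agree_def
    proof (intro allI impI)
      fix q \<phi> assume "(q, \<phi>) \<in> F"
      then have "\<sigma> \<in> B (q, \<phi>)" using \<sigma> by simp
      then show "\<phi> \<in> \<eta> q \<longleftrightarrow> \<phi> \<in> type_act \<sigma> q" by (simp add: B_def)
    qed
    with \<sigma> show ?thesis by (intro bexI[of _ \<sigma>]) simp_all
  qed
  have \<eta>S: "\<eta> q \<in> S" if q: "q \<in> S" for q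
  proof (rule S_limit)
    show "\<eta> q \<subseteq> Form L (I <+> Dom C)" using q by (auto simp: \<eta>_def)
    fix Q assume "finite Q" "Q \<subseteq> Form L (I <+> Dom C)"
    then have "Pair q ` Q \<in> FS" using q by auto
    from approx[OF insertI1 this] obtain \<sigma> where \<sigma>: "\<sigma> \<in> Aut L C" "\<sigma> \<in> Aut L C \<and> agree \<eta> \<sigma> (Pair q ` Q)" ..
    then show "\<exists>s\<in>S. \<forall>\<phi>\<in>Q. \<phi> \<in> \<eta> q \<longleftrightarrow> \<phi> \<in> s"
      using type_act_S[OF \<sigma>(1) q] by (intro bexI[of _ "type_act \<sigma> q"]) (auto simp: agree_def)
  qed
  have "\<eta> \<in> E"
    unfolding EL_iff
  proof (intro conjI ballI)
    show "\<eta> \<in> S \<rightarrow>\<^sub>E S"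
    proof (rule PiE_I[OF \<eta>S])
      show "\<eta> q = undefined" if "q \<notin> S" for q using that by (simp add: \<eta>_def)
    qed
    fix F assume "F \<in> FS"
    from approx[OF insertI1 this] show "\<exists>\<sigma>\<in>Aut L C. agree \<eta> \<sigma> F" by (auto simp: Bex_def)
  qed
  moreover have "\<forall>A\<in>\<A>. \<forall>F\<in>FS. \<exists>\<sigma>\<in>Aut L C. \<sigma> \<in> A \<and> agree \<eta> \<sigma> F"
    by (intro ballI approx) simp_all
  ultimately show ?thesis by (intro bexI[of _ "\<eta>"])
qed

text \<open>The type realized by \<open>c\<close> itself, the point of the flow at which
  \<open>F_hat\<close> evaluates.\<close>

abbreviation "p0 \<equiv> tp L C' I c (Dom C)"

lemma p0_S: "p0 \<in> S"
  by (rule S_I[OF c_Dom(2)]) (simp_all add: eqt_def)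

lemma S_realized:
  assumes "s \<in> S"
  shows "\<exists>\<gamma>\<in>Aut L C'. tp L C' I (\<lambda>x. \<gamma> (c x)) (Dom C) = s"
proof -
  obtain a where a: "a \<in> tuples I C'" "s = tp L C' I a (Dom C)" "eqt L I C' a C' c" by (rule S_E[OF assms])
  have "\<exists>\<gamma>\<in>Aut L C'. \<forall>x\<in>I. \<gamma> (c x) = a x"
    by (rule strongly_homogeneous_extends[OF mC'(5) card_I c_Dom(2) PiE_mem[OF a(1)] eqt_sym[OF a(3)]])
  then obtain \<gamma> where \<gamma>: "\<gamma> \<in> Aut L C'" "\<forall>x\<in>I. \<gamma> (c x) = a x" ..
  have "tp L C' I (\<lambda>x. \<gamma> (c x)) (Dom C) = s" unfolding a(2) using \<gamma>(2) by (intro tp_cong) simp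
  with \<gamma>(1) show ?thesis by (intro bexI[of _ "\<gamma>"])
qed

lemma eqt_Aut_c: "\<gamma> \<in> Aut L C' \<Longrightarrow> eqt L I C' (\<lambda>x. \<gamma> (c x)) C' c"
  by (rule eqt_sym, rule eqt_Aut[OF mC'(3) _ c_Dom(2)]) simp_all

lemma tp_Aut_S: "\<gamma> \<in> Aut L C' \<Longrightarrow> tp L C' I (\<lambda>x. \<gamma> (c x)) (Dom C) \<in> S"
  by (rule S_I[OF Aut_D(5)[OF _ c_Dom(2)] eqt_Aut_c])

text \<open>The formulas in \<open>Q\<close> concern finitely many entries of a realization of
  \<open>s\<close>. These are copied into \<open>C\<close> over the parameters of \<open>Q\<close>,
  and homogeneity of \<open>C\<close> moves the corresponding entries of \<open>c\<close> to the
  copies.\<close>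

lemma orbit_dense:
  assumes s: "s \<in> S" and Q: "finite Q" "Q \<subseteq> s"
  shows "\<exists>\<sigma>\<in>Aut L C. Q \<subseteq> type_act \<sigma> p0"
proof -
  from S_realized[OF s] obtain \<gamma> where \<gamma>: "\<gamma> \<in> Aut L C'" "tp L C' I (\<lambda>x. \<gamma> (c x)) (Dom C) = s" ..
  define V where "V = (\<Union>\<phi>\<in>Q. fv \<phi>)"
  define J where "J = {i. Inl i \<in> V}"
  define P where "P = {x. Inr x \<in> V}"
  have QF: "\<phi> \<in> Form L (I <+> Dom C)" if "\<phi> \<in> Q" for \<phi> using S_Form[OF s] Q(2) that by blast
  have finV: "finite V" using Q(1) by (simp add: V_def finite_fv)
  have VI: "V \<subseteq> I <+> Dom C" using QF by (auto simp: V_def Form_def)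
  have "finite (Inl -` V)" "finite (Inr -` V)" by (rule finite_vimageI[OF finV], simp)+
  then have fin: "finite J" "finite P" by (simp_all add: J_def P_def vimage_def)
  have JI: "J \<subseteq> I" and PC: "P \<subseteq> Dom C" using VI by (auto simp: J_def P_def)
  define D where "D = P \<union> (\<lambda>i. \<gamma> (c i)) ` J"
  have D: "finite D" "D \<subseteq> Dom C'" using fin PC JI sub Aut_D(5)[OF \<gamma>(1)] c_Dom(2) by (auto simp: D_def)
  from pull_parameters[OF D] obtain g where
    g: "(\<forall>x\<in>D. g x \<in> Dom C) \<and> (\<forall>x\<in>D \<inter> Dom C. g x = x) \<and> eqt L D C' id C g" ..
  have ge: "eqt L D C' id C g" and gD: "\<And>x. x \<in> D \<Longrightarrow> g x \<in> Dom C" using g by simp_all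
  have gP: "g x = x" if "x \<in> P" for x using g that PC by (auto simp: D_def)
  have gJ: "g (\<gamma> (c i)) \<in> Dom C" if "i \<in> J" for i using gD that by (simp add: D_def)
  have e1: "eqt L J C' (\<lambda>i. \<gamma> (c i)) C (\<lambda>i. g (\<gamma> (c i)))"
  proof -
    have "eqt L J C' (id \<circ> (\<lambda>i. \<gamma> (c i))) C (g \<circ> (\<lambda>i. \<gamma> (c i)))"
      by (rule eqt_comp[OF ge]) (simp add: D_def)
    then show ?thesis by (rule eqt_congI) simp_all
  qed
  have e2: "eqt L J C' c C' (\<lambda>i. \<gamma> (c i))" by (rule eqt_mono[OF eqt_sym[OF eqt_Aut_c[OF \<gamma>(1)]] JI])
  have e3: "eqt L J C c C' c" by (rule elem_eqt[OF el]) (use c_Dom(1) JI in auto)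
  have e: "eqt L J C c C (\<lambda>i. g (\<gamma> (c i)))" by (rule eqt_trans[OF e3 eqt_trans[OF e2 e1]])
  have "\<exists>\<sigma>\<in>Aut L C. \<forall>i\<in>J. \<sigma> (c i) = g (\<gamma> (c i))"
    by (rule strongly_homogeneous_extends[OF mC(5) card_finite_less[OF mC(2) fin(1)] _ gJ e]) (use c_Dom(1) JI in auto)
  then obtain \<sigma> where \<sigma>: "\<sigma> \<in> Aut L C" "\<forall>i\<in>J. \<sigma> (c i) = g (\<gamma> (c i))" ..
  from Aut_extend[OF \<sigma>(1)] obtain \<sigma>' where \<sigma>': "\<sigma>' \<in> Aut L C'" "\<forall>x\<in>Dom C. \<sigma>' x = \<sigma> x" ..
  have t: "type_act \<sigma> p0 = tp L C' I (\<lambda>x. \<sigma>' (c x)) (Dom C)"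
    by (rule type_act_tp[OF \<sigma>(1) \<sigma>'(1) _ c_Dom(2)]) (use \<sigma>'(2) in \<open>simp_all add: eqt_def\<close>)
  have "\<phi> \<in> type_act \<sigma> p0" if \<phi>: "\<phi> \<in> Q" for \<phi>
  proof -
    have fvV: "fv \<phi> \<subseteq> V" using \<phi> by (auto simp: V_def)
    have "\<phi> \<in> tp L C' I (\<lambda>x. \<gamma> (c x)) (Dom C)" using \<phi> Q(2) \<gamma>(2) by blast
    then have s1: "sat C' (case_sum (\<lambda>x. \<gamma> (c x)) id) [] \<phi>" by (simp add: mem_tp)
    define h where "h = (case_sum (\<lambda>x. \<gamma> (c x)) id :: 'i + 'a \<Rightarrow> 'a)"
    have hV: "h ` V \<subseteq> D" by (auto simp: h_def D_def J_def P_def split: sum.split)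
    have "eqt L V C' (id \<circ> h) C (g \<circ> h)" by (rule eqt_comp[OF ge hV])
    moreover have "\<phi> \<in> Form L V" by (rule Form_mono[OF Form_fv[OF QF[OF \<phi>]] fvV])
    ultimately have "sat C (g \<circ> h) [] \<phi>" using s1 eqtD[of L V C' "id \<circ> h" C "g \<circ> h" \<phi>] by (simp add: h_def)
    moreover have "eqt L V C (g \<circ> h) C' (g \<circ> h)" by (rule elem_eqt[OF el]) (use gD hV in auto)
    ultimately have "sat C' (g \<circ> h) [] \<phi>" using eqtD[of L V C "g \<circ> h" C' "g \<circ> h" \<phi>] \<open>\<phi> \<in> Form L V\<close> by simp
    moreover have "sat C' (g \<circ> h) [] \<phi> \<longleftrightarrow> sat C' (case_sum (\<lambda>x. \<sigma>' (c x)) id) [] \<phi>"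
    proof (rule sat_Form_cong[OF \<open>\<phi> \<in> Form L V\<close>])
      fix z assume z: "z \<in> V"
      show "(g \<circ> h) z = case_sum (\<lambda>x. \<sigma>' (c x)) id z"
      proof (cases z)
        case (Inl i)
        then have "i \<in> J" using z by (simp add: J_def)
        then show ?thesis using Inl \<sigma>(2) \<sigma>'(2) c_Dom(1)[of i] JI by (auto simp: h_def)
      next
        case (Inr x)
        then show ?thesis using z gP by (simp add: h_def P_def)
      qed
    qed
    ultimately show ?thesis using QF[OF \<phi>] by (simp add: t mem_tp)
  qed
  with \<sigma>(1) show ?thesis by (intro bexI[of _ \<sigma>]) auto
qed

text \<open>Density of the orbit of \<open>p0\<close> combined with compactness. Surjectivity of
  \<open>F_hat\<close> rests on this.\<close>

lemma EL_transitive: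
  assumes s: "s \<in> S"
  shows "\<exists>\<eta>\<in>E. \<eta> p0 = s"
proof -
  define B where "B \<phi> = {\<sigma>. \<phi> \<in> type_act \<sigma> p0}" for \<phi>
  have "\<exists>\<eta>\<in>E. \<forall>A\<in>B ` s. \<forall>F\<in>FS. \<exists>\<sigma>\<in>Aut L C. \<sigma> \<in> A \<and> agree \<eta> \<sigma> F"
  proof (rule EL_limit)
    fix G assume G: "finite G" "G \<subseteq> B ` s"
    from finite_subset_image[OF G] obtain Q where Q: "Q \<subseteq> s \<and> finite Q \<and> G = B ` Q" ..
    then have "finite Q" "Q \<subseteq> s" by simp_all
    from orbit_dense[OF s this] obtain \<sigma> where \<sigma>: "\<sigma> \<in> Aut L C" "Q \<subseteq> type_act \<sigma> p0" ..
    then show "\<exists>\<sigma>\<in>Aut L C. \<forall>A\<in>G. \<sigma> \<in> A" using Q by (intro bexI[of _ \<sigma>]) (auto simp: B_def)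
  qed
  then obtain \<eta> where \<eta>: "\<eta> \<in> E" "\<forall>A\<in>B ` s. \<forall>F\<in>FS. \<exists>\<sigma>\<in>Aut L C. \<sigma> \<in> A \<and> agree \<eta> \<sigma> F" ..
  have sub: "\<phi> \<in> \<eta> p0" if \<phi>: "\<phi> \<in> s" for \<phi>
  proof -
    have "{(p0, \<phi>)} \<in> FS" using p0_S S_Form[OF s \<phi>] by simp
    moreover have "B \<phi> \<in> B ` s" using \<phi> by (rule imageI)
    ultimately have "\<exists>\<sigma>\<in>Aut L C. \<sigma> \<in> B \<phi> \<and> agree \<eta> \<sigma> {(p0, \<phi>)}" using \<eta>(2) by blast
    then obtain \<sigma> where "\<sigma> \<in> Aut L C" "\<sigma> \<in> B \<phi> \<and> agree \<eta> \<sigma> {(p0, \<phi>)}" ..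
    then show ?thesis by (simp add: B_def agree_def)
  qed
  have "\<eta> p0 = s"
  proof (rule S_ext[OF EL_S[OF \<eta>(1) p0_S] s])
    fix \<phi> assume \<phi>: "\<phi> \<in> Form L (I <+> Dom C)"
    show "\<phi> \<in> \<eta> p0 \<longleftrightarrow> \<phi> \<in> s"
      using sub[of \<phi>] sub[of "Neg \<phi>"] S_Neg[OF s \<phi>] S_Neg[OF EL_S[OF \<eta>(1) p0_S] \<phi>] by blast
  qed
  with \<eta>(1) show ?thesis by (intro bexI[of _ "\<eta>"])
qed

end

section \<open>The natural epimorphism\<close>

context monster_pair
begin

interpretation H: normal "Autf_L L \<kappa>' C'" "AutG L C'"
  by (rule normal_Autf_L[OF mC'(3)])

text \<open>Cosets of \<open>Autf_L\<close>; they become values of \<open>F_hat\<close> once the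
  Lascar and Kim--Pillay groups are identified.\<close>

definition cls :: "('a \<Rightarrow> 'a) \<Rightarrow> ('a \<Rightarrow> 'a) set" where
  "cls \<sigma> = Autf_L L \<kappa>' C' #>\<^bsub>AutG L C'\<^esub> \<sigma>"

abbreviation "Gal \<equiv> AutG L C' Mod Autf_L L \<kappa>' C'"

lemma group_Gal: "group Gal"
  by (rule H.factorgroup_is_group)

lemma carrier_Gal: "carrier Gal = cls ` Aut L C'"
  by (auto simp: FactGroup_def RCOSETS_def cls_def AutG_simps)

lemma one_Gal: "\<one>\<^bsub>Gal\<^esub> = Autf_L L \<kappa>' C'"
  by (simp add: FactGroup_def)

lemma cls_carrier: "\<sigma> \<in> Aut L C' \<Longrightarrow> cls \<sigma> \<in> carrier Gal"
  by (simp add: carrier_Gal)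

lemma cls_mult:
  assumes "\<sigma> \<in> Aut L C'" "\<tau> \<in> Aut L C'"
  shows "cls (compose (Dom C') \<sigma> \<tau>) = cls \<sigma> \<otimes>\<^bsub>Gal\<^esub> cls \<tau>"
  using H.rcos_sum[of \<sigma> \<tau>] assms by (simp add: cls_def AutG_simps FactGroup_def)

lemma cls_Autf_L: "\<sigma> \<in> Autf_L L \<kappa>' C' \<Longrightarrow> cls \<sigma> = \<one>\<^bsub>Gal\<^esub>"
  unfolding cls_def one_Gal by (rule H.rcos_const[OF H.is_group])

lemma cls_one_iff:
  assumes "\<sigma> \<in> Aut L C'" "cls \<sigma> = \<one>\<^bsub>Gal\<^esub>"
  shows "\<sigma> \<in> Autf_L L \<kappa>' C'"
  using H.coset_join1[of "Autf_L L \<kappa>' C'" \<sigma>] assms H.subgroup_axioms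
  by (simp add: cls_def one_Gal AutG_simps)

lemma fix_C_Autf_L: "\<rho> \<in> Aut L C' \<Longrightarrow> (\<And>x. x \<in> Dom C \<Longrightarrow> \<rho> x = x) \<Longrightarrow> \<rho> \<in> Autf_L L \<kappa>' C'"
  by (rule elementary_fix_Autf_L[OF _ small elC])

lemma cls_eq_on_C:
  assumes \<sigma>: "\<sigma> \<in> Aut L C'" and \<beta>: "\<beta> \<in> Aut L C'" and eq: "\<And>x. x \<in> Dom C \<Longrightarrow> \<sigma> x = \<beta> x"
  shows "cls \<sigma> = cls \<beta>"
proof -
  interpret Gal: group Gal by (rule group_Gal)
  define \<delta> where "\<delta> = compose (Dom C') (aut_inv C' \<beta>) \<sigma>"
  have \<delta>: "\<delta> \<in> Aut L C'" unfolding \<delta>_def by (rule Aut_compose[OF mC'(3) Aut_inv[OF mC'(3) \<beta>] \<sigma>])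
  have "\<delta> \<in> Autf_L L \<kappa>' C'"
  proof (rule fix_C_Autf_L[OF \<delta>])
    fix x assume "x \<in> Dom C"
    then show "\<delta> x = x" using eq[of x] sub[of x] aut_inv(1)[OF \<beta>, of x] by (simp add: \<delta>_def compose_eq)
  qed
  moreover have "compose (Dom C') \<beta> \<delta> = \<sigma>"
  proof
    fix x show "compose (Dom C') \<beta> \<delta> x = \<sigma> x"
    proof (cases "x \<in> Dom C'")
      case True
      then show ?thesis using aut_inv(2)[OF \<beta> Aut_D(5)[OF \<sigma> True]] by (simp add: compose_eq \<delta>_def)
    next
      case False
      then show ?thesis using extensional_arb[OF Aut_D(4)[OF \<sigma>] False] by (simp add: compose_def)
    qed
  qed
  ultimately have "cls \<sigma> = cls \<beta> \<otimes>\<^bsub>Gal\<^esub> \<one>\<^bsub>Gal\<^esub>" using cls_mult[OF \<beta> \<delta>] cls_Autf_L[of \<delta>] by simp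
  then show ?thesis using Gal.r_one[OF cls_carrier[OF \<beta>]] by simp
qed

text \<open>Tuples with the same type over \<open>C\<close> are conjugate by an automorphism fixing
  \<open>C\<close>, which is Lascar strong. This makes the coset in \<open>F_hat\<close> independent
  of the chosen automorphism.\<close>

lemma cls_eq_tp:
  assumes \<sigma>: "\<sigma> \<in> Aut L C'" and \<beta>: "\<beta> \<in> Aut L C'"
    and eq: "tp L C' I (\<lambda>x. \<sigma> (c x)) (Dom C) = tp L C' I (\<lambda>x. \<beta> (c x)) (Dom C)"
  shows "cls \<sigma> = cls \<beta>"
proof -
  interpret Gal: group Gal by (rule group_Gal)
  note e = eq[unfolded tp_eq_iff]
  have "\<exists>\<rho>\<in>Aut L C'. \<forall>x\<in>I <+> Dom C. \<rho> (case_sum (\<lambda>x. \<sigma> (c x)) id x) = case_sum (\<lambda>x. \<beta> (c x)) id x"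
    by (rule strongly_homogeneous_extends[OF mC'(5) card_Plus_less[OF mC'(2) card_I small] _ _ e])
      (use Aut_D(5)[OF \<sigma>] Aut_D(5)[OF \<beta>] c_Dom(2) sub in auto)
  then obtain \<rho> where \<rho>: "\<rho> \<in> Aut L C'"
    and r: "\<forall>x\<in>I <+> Dom C. \<rho> (case_sum (\<lambda>x. \<sigma> (c x)) id x) = case_sum (\<lambda>x. \<beta> (c x)) id x" ..
  have \<rho>H: "\<rho> \<in> Autf_L L \<kappa>' C'"
    by (rule fix_C_Autf_L[OF \<rho>]) (use bspec[OF r InrI] in simp)
  have "compose (Dom C') \<rho> \<sigma> x = \<beta> x" if x: "x \<in> Dom C" for x
  proof -
    obtain i where "i \<in> I" "x = c i" using x c_Dom(3) by blast
    then show ?thesis using bspec[OF r InlI[of i I "Dom C"]] sub[OF x] by (simp add: compose_eq)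
  qed
  then have "cls (compose (Dom C') \<rho> \<sigma>) = cls \<beta>" by (rule cls_eq_on_C[OF Aut_compose[OF mC'(3) \<rho> \<sigma>] \<beta>])
  moreover have "cls (compose (Dom C') \<rho> \<sigma>) = \<one>\<^bsub>Gal\<^esub> \<otimes>\<^bsub>Gal\<^esub> cls \<sigma>"
    using cls_mult[OF \<rho> \<sigma>] cls_Autf_L[OF \<rho>H] by simp
  ultimately show ?thesis using Gal.l_one[OF cls_carrier[OF \<sigma>]] by simp
qed

text \<open>The point is to find one automorphism \<open>\<beta>\<close> for which
  \<open>\<beta> c\<close> realizes \<open>\<eta> p0\<close> and, at the same time,
  \<open>\<beta> (\<alpha> c)\<close> realizes the value of \<open>\<eta>\<close> at the type of
  \<open>\<alpha> c\<close>. Any automorphism near \<open>\<eta>\<close>, extended to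
  \<open>C'\<close>, does this for finitely many formulas, and saturation gives the exact
  statement.\<close>

lemma cls_EL:
  assumes \<eta>: "\<eta> \<in> E" and \<alpha>: "\<alpha> \<in> Aut L C'" and \<gamma>: "\<gamma> \<in> Aut L C'" and \<sigma>: "\<sigma> \<in> Aut L C'"
    and q: "\<eta> (tp L C' I (\<lambda>x. \<alpha> (c x)) (Dom C)) = tp L C' I (\<lambda>x. \<gamma> (c x)) (Dom C)"
    and p: "\<eta> p0 = tp L C' I (\<lambda>x. \<sigma> (c x)) (Dom C)"
  shows "cls \<gamma> = cls \<sigma> \<otimes>\<^bsub>Gal\<^esub> cls \<alpha>"
proof -
  let ?U = "I <+> (I <+> Dom C)" and ?W = "Inr ` Inr ` Dom C :: ('i + ('i + 'a)) set"
  let ?q = "tp L C' I (\<lambda>x. \<alpha> (c x)) (Dom C)"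
  \<comment> \<open>The atoms in \<open>Inl\<close> stand for \<open>\<beta> c\<close>, those in
    \<open>Inr (Inl i)\<close> for \<open>\<beta> (\<alpha> c)\<close>, and the rest for elements of
    \<open>C\<close>. The translations \<open>f1\<close> and \<open>f2\<close> impose the two types
    over \<open>C\<close>, and \<open>f3\<close> the type of the pair.\<close>
  define f1 where "f1 = (map_fm (case_sum Inl (\<lambda>x. Inr (Inr x))) :: ('f, 'r, 'i + 'a) fm \<Rightarrow> ('f, 'r, 'i + ('i + 'a)) fm)"
  define f2 where "f2 = (map_fm Inr :: ('f, 'r, 'i + 'a) fm \<Rightarrow> ('f, 'r, 'i + ('i + 'a)) fm)"
  define f3 where "f3 = (map_fm (case_sum Inl (\<lambda>x. Inr (Inl x))) :: ('f, 'r, 'i + 'i) fm \<Rightarrow> ('f, 'r, 'i + ('i + 'a)) fm)"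
  define \<Theta> where "\<Theta> = {\<theta> \<in> Form L (I <+> I). sat C' (case_sum c (\<lambda>x. \<alpha> (c x))) [] \<theta>}"
  define \<Gamma> where "\<Gamma> = f1 ` (\<eta> p0) \<union> f2 ` (\<eta> ?q) \<union> f3 ` \<Theta>"
  have qS: "?q \<in> S" by (rule tp_Aut_S[OF \<alpha>])
  have F: "\<phi> \<in> Form L (I <+> Dom C)" if "\<phi> \<in> \<eta> p0 \<or> \<phi> \<in> \<eta> ?q" for \<phi>
    using that S_Form[OF EL_S[OF \<eta> p0_S]] S_Form[OF EL_S[OF \<eta> qS]] by blast
  have fF: "f1 \<phi> \<in> Form L ?U" "f2 \<phi> \<in> Form L ?U" if "\<phi> \<in> Form L (I <+> Dom C)" for \<phi>
    unfolding f1_def f2_def by (rule Form_map_fm[OF that], auto)+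
  have f3F: "f3 \<theta> \<in> Form L ?U" if "\<theta> \<in> Form L (I <+> I)" for \<theta>
    unfolding f3_def by (rule Form_map_fm[OF that]) auto
  have \<Gamma>F: "\<Gamma> \<subseteq> Form L ?U"
    unfolding \<Gamma>_def using fF F f3F by (auto simp: \<Theta>_def)
  have s1: "sat C' w [] (f1 \<phi>) \<longleftrightarrow> sat C' (case_sum (\<lambda>x. w (Inl x)) (\<lambda>x. w (Inr (Inr x)))) [] \<phi>" for w \<phi>
  proof -
    have "w \<circ> case_sum Inl (\<lambda>x. Inr (Inr x)) = case_sum (\<lambda>x. w (Inl x)) (\<lambda>x. w (Inr (Inr x)))"
      by (auto simp: fun_eq_iff split: sum.splits)
    then show ?thesis by (simp add: f1_def sat_map_fm)
  qed
  have s2: "sat C' w [] (f2 \<phi>) \<longleftrightarrow> sat C' (case_sum (\<lambda>x. w (Inr (Inl x))) (\<lambda>x. w (Inr (Inr x)))) [] \<phi>" for w \<phi>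
  proof -
    have "w \<circ> Inr = case_sum (\<lambda>x. w (Inr (Inl x))) (\<lambda>x. w (Inr (Inr x)))"
      by (auto simp: fun_eq_iff split: sum.splits)
    then show ?thesis by (simp add: f2_def sat_map_fm)
  qed
  have s3: "sat C' w [] (f3 \<theta>) \<longleftrightarrow> sat C' (case_sum (\<lambda>x. w (Inl x)) (\<lambda>x. w (Inr (Inl x)))) [] \<theta>" for w \<theta>
  proof -
    have "w \<circ> case_sum Inl (\<lambda>x. Inr (Inl x)) = case_sum (\<lambda>x. w (Inl x)) (\<lambda>x. w (Inr (Inl x)))"
      by (auto simp: fun_eq_iff split: sum.splits)
    then show ?thesis by (simp add: f3_def sat_map_fm)
  qed
  have fs: "finsat C' ?U ?W (case_sum undefined pv) \<Gamma>"
    unfolding finsat_def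
  proof (intro allI impI)
    fix Q assume Q: "Q \<subseteq> \<Gamma>" "finite Q"
    have "finite (Q \<inter> f1 ` (\<eta> p0))" "Q \<inter> f1 ` (\<eta> p0) \<subseteq> f1 ` (\<eta> p0)" using Q(2) by auto
    from finite_subset_image[OF this] obtain Q1 where Q1: "Q1 \<subseteq> \<eta> p0 \<and> finite Q1 \<and> Q \<inter> f1 ` (\<eta> p0) = f1 ` Q1" ..
    have "finite (Q \<inter> f2 ` (\<eta> ?q))" "Q \<inter> f2 ` (\<eta> ?q) \<subseteq> f2 ` (\<eta> ?q)" using Q(2) by auto
    from finite_subset_image[OF this] obtain Q2 where Q2: "Q2 \<subseteq> \<eta> ?q \<and> finite Q2 \<and> Q \<inter> f2 ` (\<eta> ?q) = f2 ` Q2" ..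
    have "finite (Pair p0 ` Q1 \<union> Pair ?q ` Q2)" using Q1 Q2 by simp
    moreover have "Pair p0 ` Q1 \<union> Pair ?q ` Q2 \<subseteq> S \<times> Form L (I <+> Dom C)"
      using Q1 Q2 F p0_S qS by auto
    ultimately have "\<exists>\<tau>\<in>Aut L C. agree \<eta> \<tau> (Pair p0 ` Q1 \<union> Pair ?q ` Q2)" by (rule EL_approx[OF \<eta>])
    then obtain \<tau> where \<tau>: "\<tau> \<in> Aut L C" "agree \<eta> \<tau> (Pair p0 ` Q1 \<union> Pair ?q ` Q2)" ..
    from Aut_extend[OF \<tau>(1)] obtain \<tau>' where \<tau>': "\<tau>' \<in> Aut L C'" "\<forall>x\<in>Dom C. \<tau>' x = \<tau> x" ..
    have t0: "type_act \<tau> p0 = tp L C' I (\<lambda>x. \<tau>' (c x)) (Dom C)"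
      by (rule type_act_tp[OF \<tau>(1) \<tau>'(1) _ c_Dom(2)]) (use \<tau>'(2) in \<open>simp_all add: eqt_def\<close>)
    have tq: "type_act \<tau> ?q = tp L C' I (\<lambda>x. \<tau>' (\<alpha> (c x))) (Dom C)"
      by (rule type_act_tp[OF \<tau>(1) \<tau>'(1) _ Aut_D(5)[OF \<alpha> c_Dom(2)] eqt_Aut_c[OF \<alpha>]]) (use \<tau>'(2) in simp)
    define w where "w = case_sum (\<lambda>x. \<tau>' (c x)) (case_sum (\<lambda>x. \<tau>' (\<alpha> (c x))) id)"
    show "realizable C' ?U ?W (case_sum undefined pv) Q"
    proof (rule realizableI[of _ w])
      fix x assume "x \<in> ?U"
      then show "w x \<in> Dom C'"
        using Aut_D(5)[OF \<tau>'(1)] Aut_D(5)[OF \<alpha>] c_Dom(2) sub by (auto simp: w_def)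
    next
      fix x assume "x \<in> ?W"
      then show "w x = case_sum undefined pv x" by (auto simp: w_def)
    next
      fix \<phi> assume \<phi>: "\<phi> \<in> Q"
      then consider "\<phi> \<in> f1 ` Q1" | "\<phi> \<in> f2 ` Q2" | "\<phi> \<in> f3 ` \<Theta>"
      proof -
        have "\<phi> \<in> f1 ` (\<eta> p0) \<or> \<phi> \<in> f2 ` (\<eta> ?q) \<or> \<phi> \<in> f3 ` \<Theta>" using subsetD[OF Q(1) \<phi>] by (simp add: \<Gamma>_def)
        moreover have "\<phi> \<in> f1 ` Q1" if "\<phi> \<in> f1 ` (\<eta> p0)"
          using Q1[THEN conjunct2, THEN conjunct2] \<phi> that by (simp flip: Q1[THEN conjunct2, THEN conjunct2])
        moreover have "\<phi> \<in> f2 ` Q2" if "\<phi> \<in> f2 ` (\<eta> ?q)"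
          using Q2[THEN conjunct2, THEN conjunct2] \<phi> that by (simp flip: Q2[THEN conjunct2, THEN conjunct2])
        ultimately show thesis using that by metis
      qed
      then show "sat C' w [] \<phi>"
      proof cases
        case 1
        then obtain \<psi> where \<psi>: "\<psi> \<in> Q1" "\<phi> = f1 \<psi>" by blast
        then have "\<psi> \<in> \<eta> p0 \<longleftrightarrow> \<psi> \<in> type_act \<tau> p0" by (intro agreeD[OF \<tau>(2)]) simp
        then have "sat C' (case_sum (\<lambda>x. \<tau>' (c x)) id) [] \<psi>" using \<psi>(1) Q1 by (auto simp: t0 mem_tp)
        then show ?thesis by (simp add: \<psi>(2) s1 w_def id_def)
      next
        case 2
        then obtain \<psi> where \<psi>: "\<psi> \<in> Q2" "\<phi> = f2 \<psi>" by blast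
        then have "\<psi> \<in> \<eta> ?q \<longleftrightarrow> \<psi> \<in> type_act \<tau> ?q" by (intro agreeD[OF \<tau>(2)]) simp
        then have "sat C' (case_sum (\<lambda>x. \<tau>' (\<alpha> (c x))) id) [] \<psi>" using \<psi>(1) Q2 by (auto simp: tq mem_tp)
        then show ?thesis by (simp add: \<psi>(2) s2 w_def id_def)
      next
        case 3
        then obtain \<theta> where \<theta>: "\<theta> \<in> \<Theta>" "\<phi> = f3 \<theta>" by blast
        have "eqt L (I <+> I) C' (case_sum c (\<lambda>x. \<alpha> (c x))) C' (case_sum (\<lambda>x. \<tau>' (c x)) (\<lambda>x. \<tau>' (\<alpha> (c x))))"
          by (rule eqt_Aut[OF mC'(3) \<tau>'(1)]) (use c_Dom(2) Aut_D(5)[OF \<alpha>] in auto)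
        then have "sat C' (case_sum (\<lambda>x. \<tau>' (c x)) (\<lambda>x. \<tau>' (\<alpha> (c x)))) [] \<theta>"
          using eqtD[of L "I <+> I" C' "case_sum c (\<lambda>x. \<alpha> (c x))" C' _ \<theta>] \<theta>(1) by (simp add: \<Theta>_def)
        then show ?thesis by (simp add: \<theta>(2) s3 w_def)
      qed
    qed
  qed
  have U: "|?U| <o \<kappa>'"
    by (rule card_Plus_less[OF mC'(2) card_I card_Plus_less[OF mC'(2) card_I small]])
  have WU: "?W \<subseteq> ?U" by auto
  from saturated_realizes[OF mC'(4) U \<Gamma>F WU nonempty(2) fs]
  obtain w where w: "(\<forall>x\<in>?U. w x \<in> Dom C') \<and> (\<forall>x\<in>?W. w x = case_sum undefined pv x) \<and> (\<forall>\<phi>\<in>\<Gamma>. sat C' w [] \<phi>)"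
    unfolding realizable_def ..
  define a where "a x = w (Inl x)" for x
  define b where "b x = w (Inr (Inl x))" for x
  have ab: "a x \<in> Dom C'" "b x \<in> Dom C'" if "x \<in> I" for x using w that by (auto simp: a_def b_def)
  have wC: "w (Inr (Inr x)) = x" if "x \<in> Dom C" for x
  proof -
    have "Inr (Inr x) \<in> ?W" using that by simp
    then show ?thesis using w by (metis id_apply sum.case(2))
  qed
  have w\<Gamma>: "sat C' w [] \<phi>" if "\<phi> \<in> \<Gamma>" for \<phi> using w that by blast
  have ra: "sat C' (case_sum a id) [] \<phi>" if \<phi>: "\<phi> \<in> \<eta> p0" for \<phi>
  proof -
    have "sat C' w [] (f1 \<phi>)" by (rule w\<Gamma>) (use \<phi> in \<open>simp add: \<Gamma>_def\<close>)
    moreover have "sat C' w [] (f1 \<phi>) \<longleftrightarrow> sat C' (case_sum a id) [] \<phi>"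
      unfolding s1 by (rule sat_Form_cong[OF F]) (use \<phi> wC in \<open>auto simp: a_def\<close>)
    ultimately show ?thesis by simp
  qed
  have rb: "sat C' (case_sum b id) [] \<phi>" if \<phi>: "\<phi> \<in> \<eta> ?q" for \<phi>
  proof -
    have "sat C' w [] (f2 \<phi>)" by (rule w\<Gamma>) (use \<phi> in \<open>simp add: \<Gamma>_def\<close>)
    moreover have "sat C' w [] (f2 \<phi>) \<longleftrightarrow> sat C' (case_sum b id) [] \<phi>"
      unfolding s2 by (rule sat_Form_cong[OF F]) (use \<phi> wC in \<open>auto simp: b_def\<close>)
    ultimately show ?thesis by simp
  qed
  have imp: "sat C' (case_sum a b) [] \<theta>" if "\<theta> \<in> Form L (I <+> I)" "sat C' (case_sum c (\<lambda>x. \<alpha> (c x))) [] \<theta>" for \<theta>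
  proof -
    have "sat C' w [] (f3 \<theta>)" by (rule w\<Gamma>) (use that in \<open>simp add: \<Gamma>_def \<Theta>_def\<close>)
    then show ?thesis by (simp add: s3 a_def[abs_def] b_def[abs_def])
  qed
  have e: "eqt L (I <+> I) C' (case_sum c (\<lambda>x. \<alpha> (c x))) C' (case_sum a b)"
    unfolding eqt_def
  proof
    fix \<theta> assume \<theta>: "\<theta> \<in> Form L (I <+> I)"
    show "sat C' (case_sum c (\<lambda>x. \<alpha> (c x))) [] \<theta> \<longleftrightarrow> sat C' (case_sum a b) [] \<theta>"
      using imp[OF \<theta>] imp[of "Neg \<theta>"] \<theta> by auto
  qed
  have "\<exists>\<beta>\<in>Aut L C'. \<forall>x\<in>I <+> I. \<beta> (case_sum c (\<lambda>x. \<alpha> (c x)) x) = case_sum a b x"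
    by (rule strongly_homogeneous_extends[OF mC'(5) card_Plus_less[OF mC'(2) card_I card_I] _ _ e])
      (use ab c_Dom(2) Aut_D(5)[OF \<alpha>] in auto)
  then obtain \<beta> where \<beta>: "\<beta> \<in> Aut L C'" and \<beta>e: "\<forall>x\<in>I <+> I. \<beta> (case_sum c (\<lambda>x. \<alpha> (c x)) x) = case_sum a b x" ..
  have \<beta>a: "\<beta> (c i) = a i" "\<beta> (\<alpha> (c i)) = b i" if "i \<in> I" for i
    using bspec[OF \<beta>e InlI[OF that]] bspec[OF \<beta>e InrI[OF that]] by simp_all
  have \<beta>\<alpha>: "compose (Dom C') \<beta> \<alpha> \<in> Aut L C'" by (rule Aut_compose[OF mC'(3) \<beta> \<alpha>])
  have t1: "tp L C' I (\<lambda>x. \<beta> (c x)) (Dom C) = \<eta> p0"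
  proof (rule S_ext[OF tp_Aut_S[OF \<beta>] EL_S[OF \<eta> p0_S]])
    fix \<phi> assume \<phi>: "\<phi> \<in> Form L (I <+> Dom C)"
    have "tp L C' I (\<lambda>x. \<beta> (c x)) (Dom C) = tp L C' I a (Dom C)" by (rule tp_cong) (rule \<beta>a(1))
    then show "\<phi> \<in> tp L C' I (\<lambda>x. \<beta> (c x)) (Dom C) \<longleftrightarrow> \<phi> \<in> \<eta> p0"
      using ra[of \<phi>] ra[of "Neg \<phi>"] S_Neg[OF EL_S[OF \<eta> p0_S] \<phi>] \<phi> by (auto simp: mem_tp)
  qed
  have t2: "tp L C' I (\<lambda>x. compose (Dom C') \<beta> \<alpha> (c x)) (Dom C) = \<eta> ?q"
  proof (rule S_ext[OF tp_Aut_S[OF \<beta>\<alpha>] EL_S[OF \<eta> qS]])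
    fix \<phi> assume \<phi>: "\<phi> \<in> Form L (I <+> Dom C)"
    have "tp L C' I (\<lambda>x. compose (Dom C') \<beta> \<alpha> (c x)) (Dom C) = tp L C' I b (Dom C)"
      by (rule tp_cong) (simp add: compose_eq c_Dom(2) \<beta>a(2))
    then show "\<phi> \<in> tp L C' I (\<lambda>x. compose (Dom C') \<beta> \<alpha> (c x)) (Dom C) \<longleftrightarrow> \<phi> \<in> \<eta> ?q"
      using rb[of \<phi>] rb[of "Neg \<phi>"] S_Neg[OF EL_S[OF \<eta> qS] \<phi>] \<phi> by (auto simp: mem_tp)
  qed
  have "cls \<beta> = cls \<sigma>" by (rule cls_eq_tp[OF \<beta> \<sigma>]) (simp add: t1 p)
  moreover have "cls (compose (Dom C') \<beta> \<alpha>) = cls \<gamma>" by (rule cls_eq_tp[OF \<beta>\<alpha> \<gamma>]) (simp add: t2 q)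
  ultimately show ?thesis using cls_mult[OF \<beta> \<alpha>] by simp
qed

section \<open>Homomorphism property and surjectivity of \<open>F_hat\<close>\<close>

abbreviation "Fh \<equiv> F_hat L \<kappa>' C C' I c"

lemma F_hat_eq:
  assumes KP: "Autf_KP L \<kappa>' C' = Autf_L L \<kappa>' C'" and \<sigma>: "\<sigma> \<in> Aut L C'"
    and eq: "\<eta> p0 = tp L C' I (\<lambda>x. \<sigma> (c x)) (Dom C)"
  shows "Fh \<eta> = cls \<sigma>"
  unfolding F_hat_def KP cls_def[symmetric] comp_def
proof (rule the_equality)
  show "\<exists>\<sigma>'\<in>Aut L C'. tp L C' I (\<lambda>x. \<sigma>' (c x)) (Dom C) = \<eta> p0 \<and> cls \<sigma> = cls \<sigma>'"
    using \<sigma> eq by (intro bexI[of _ \<sigma>]) simp_all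
  fix X assume "\<exists>\<sigma>'\<in>Aut L C'. tp L C' I (\<lambda>x. \<sigma>' (c x)) (Dom C) = \<eta> p0 \<and> X = cls \<sigma>'"
  then obtain \<sigma>' where "\<sigma>' \<in> Aut L C'" "tp L C' I (\<lambda>x. \<sigma>' (c x)) (Dom C) = \<eta> p0 \<and> X = cls \<sigma>'" ..
  then show "X = cls \<sigma>" using cls_eq_tp[of \<sigma>' \<sigma>] \<sigma> eq by simp
qed

lemma EL_realized: "\<eta> \<in> E \<Longrightarrow> q \<in> S \<Longrightarrow> \<exists>\<sigma>\<in>Aut L C'. tp L C' I (\<lambda>x. \<sigma> (c x)) (Dom C) = \<eta> q"
  by (rule S_realized[OF EL_S])

lemma F_hat_carrier:
  assumes KP: "Autf_KP L \<kappa>' C' = Autf_L L \<kappa>' C'" and \<eta>: "\<eta> \<in> E"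
  shows "Fh \<eta> \<in> carrier Gal"
proof -
  from EL_realized[OF \<eta> p0_S] obtain \<sigma> where \<sigma>: "\<sigma> \<in> Aut L C'" "tp L C' I (\<lambda>x. \<sigma> (c x)) (Dom C) = \<eta> p0" ..
  show ?thesis using F_hat_eq[OF KP \<sigma>(1), of \<eta>] \<sigma>(2) cls_carrier[OF \<sigma>(1)] by simp
qed

lemma F_hat_mult:
  assumes KP: "Autf_KP L \<kappa>' C' = Autf_L L \<kappa>' C'" and f: "f \<in> E" and g: "g \<in> E"
  shows "Fh (compose S f g) = Fh f \<otimes>\<^bsub>Gal\<^esub> Fh g"
proof -
  from EL_realized[OF g p0_S] obtain \<alpha> where \<alpha>: "\<alpha> \<in> Aut L C'" "tp L C' I (\<lambda>x. \<alpha> (c x)) (Dom C) = g p0" ..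
  from EL_realized[OF f p0_S] obtain \<sigma> where \<sigma>: "\<sigma> \<in> Aut L C'" "tp L C' I (\<lambda>x. \<sigma> (c x)) (Dom C) = f p0" ..
  from EL_realized[OF f EL_S[OF g p0_S]]
  obtain \<gamma> where \<gamma>: "\<gamma> \<in> Aut L C'" "tp L C' I (\<lambda>x. \<gamma> (c x)) (Dom C) = f (g p0)" ..
  have "cls \<gamma> = cls \<sigma> \<otimes>\<^bsub>Gal\<^esub> cls \<alpha>"
    by (rule cls_EL[OF f \<alpha>(1) \<gamma>(1) \<sigma>(1)]) (simp_all add: \<alpha>(2) \<gamma>(2) \<sigma>(2))
  moreover have "compose S f g p0 = f (g p0)" using p0_S by (simp add: compose_eq)
  ultimately show ?thesis
    using F_hat_eq[OF KP \<gamma>(1), of "compose S f g"] F_hat_eq[OF KP \<sigma>(1), of f] F_hat_eq[OF KP \<alpha>(1), of g]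
    by (simp add: \<alpha>(2) \<gamma>(2) \<sigma>(2))
qed

lemma F_hat_surj:
  assumes KP: "Autf_KP L \<kappa>' C' = Autf_L L \<kappa>' C'" and X: "X \<in> carrier Gal"
  shows "\<exists>\<eta>\<in>E. Fh \<eta> = X"
proof -
  obtain \<sigma> where \<sigma>: "\<sigma> \<in> Aut L C'" "X = cls \<sigma>" using X unfolding carrier_Gal by blast
  from EL_transitive[OF tp_Aut_S[OF \<sigma>(1)]]
  obtain \<eta> where \<eta>: "\<eta> \<in> E" "\<eta> p0 = tp L C' I (\<lambda>x. \<sigma> (c x)) (Dom C)" ..
  then have "Fh \<eta> = X" using F_hat_eq[OF KP \<sigma>(1), of \<eta>] \<sigma>(2) by simp
  with \<eta>(1) show ?thesis by (intro bexI[of _ \<eta>])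
qed

end

locale bounded_ideal = monster_pair L T C C' \<kappa> \<kappa>' I c
  for L :: "('f, 'r) lang" and T :: "('f, 'r, nat) fm set"
    and C C' :: "('f, 'r, 'a) struct" and \<kappa> :: "'k rel" and \<kappa>' :: "'l rel"
    and I :: "'i set" and c :: "'i \<Rightarrow> 'a" +
  fixes M :: "(('f, 'r, 'i + 'a) fm set \<Rightarrow> ('f, 'r, 'i + 'a) fm set) set"
    and u :: "('f, 'r, 'i + 'a) fm set \<Rightarrow> ('f, 'r, 'i + 'a) fm set"
  assumes M: "minimal_left_ideal (EL L C C' I c) M" and u: "u \<in> M"
    and uu: "u \<otimes>\<^bsub>EL L C C' I c\<^esub> u = u" and M_small: "|M| <o \<kappa>"
begin

lemma M_E: "m \<in> M \<Longrightarrow> m \<in> E"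
  using M by (auto simp: minimal_left_ideal_def left_ideal_def)

lemma M_ideal: "f \<in> E \<Longrightarrow> m \<in> M \<Longrightarrow> compose S f m \<in> M"
  using M by (auto simp: minimal_left_ideal_def left_ideal_def EL_mult)

text \<open>The set of products with \<open>x\<close> on the right is again a left ideal inside
  \<open>M\<close>, so minimality applies.\<close>

lemma M_right:
  assumes x: "x \<in> M"
  shows "(\<lambda>m. compose S m x) ` M = M"
proof -
  have sub: "(\<lambda>m. compose S m x) ` M \<subseteq> M" using M_ideal[OF M_E x] by auto
  have "left_ideal (EL L C C' I c) ((\<lambda>m. compose S m x) ` M)"
    unfolding left_ideal_def
  proof (intro conjI ballI)
    show "(\<lambda>m. compose S m x) ` M \<noteq> {}" using x by blast
    show "(\<lambda>m. compose S m x) ` M \<subseteq> E" using sub M_E by auto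
    fix f y assume f: "f \<in> E" and "y \<in> (\<lambda>m. compose S m x) ` M"
    then obtain m where m: "m \<in> M" "y = compose S m x" by blast
    have "f \<otimes>\<^bsub>EL L C C' I c\<^esub> y = compose S (compose S f m) x"
      unfolding EL_mult m(2) by (rule EL_assoc[OF M_E[OF x]])
    then show "f \<otimes>\<^bsub>EL L C C' I c\<^esub> y \<in> (\<lambda>m. compose S m x) ` M" using M_ideal[OF f m(1)] by simp
  qed
  then show ?thesis using M sub unfolding minimal_left_ideal_def by blast
qed

lemma uu': "compose S u u = u"
  using uu by (simp add: EL_mult)

text \<open>Every element of \<open>M\<close> has the form \<open>m u\<close>, and \<open>u\<close>
  is idempotent.\<close>

lemma M_u: "x \<in> M \<Longrightarrow> compose S x u = x"
proof -
  assume "x \<in> M"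
  then obtain m where m: "m \<in> M" "x = compose S m u" using M_right[OF u] by blast
  then show ?thesis using EL_assoc[OF M_E[OF u], of m u] uu' by simp
qed

section \<open>The group inside the minimal ideal\<close>

definition "uM = (\<lambda>x. compose S u x) ` M"

lemma uM_M: "x \<in> uM \<Longrightarrow> x \<in> M"
  unfolding uM_def using M_ideal[OF M_E[OF u]] by auto

lemma uM_E: "x \<in> uM \<Longrightarrow> x \<in> E"
  by (rule M_E[OF uM_M])

lemma uM_u: "x \<in> uM \<Longrightarrow> compose S u x = x"
proof -
  assume "x \<in> uM"
  then obtain m where m: "m \<in> M" "x = compose S u m" unfolding uM_def by blast
  then show ?thesis using EL_assoc[OF M_E[OF m(1)], of u u] uu' by simp
qed

lemma uM_mult:
  assumes x: "x \<in> uM" and y: "y \<in> uM"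
  shows "compose S x y \<in> uM"
proof -
  have "compose S u (compose S x y) = compose S x y"
    using EL_assoc[OF uM_E[OF y], of u x] uM_u[OF x] by simp
  then show ?thesis unfolding uM_def
    using M_ideal[OF uM_E[OF x] uM_M[OF y]] by (intro image_eqI[of _ _ "compose S x y"]) simp_all
qed

lemma uM_left_inverse:
  assumes x: "x \<in> uM"
  shows "\<exists>y\<in>uM. compose S y x = u"
proof -
  have "u \<in> (\<lambda>m. compose S m x) ` M" using M_right[OF uM_M[OF x]] u by simp
  then obtain m where m: "m \<in> M" "u = compose S m x" by blast
  have "compose S (compose S u m) x = u"
    using EL_assoc[OF uM_E[OF x], of u m] m(2) uu' by simp
  moreover have "compose S u m \<in> uM" unfolding uM_def using m(1) by (rule imageI)
  ultimately show ?thesis by (intro bexI[of _ "compose S u m"])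
qed

text \<open>The usual group argument: the left inverse \<open>y\<close> has a left inverse
  \<open>z\<close> of its own.\<close>

lemma uM_right_cancel:
  assumes x: "x \<in> uM" and y: "y \<in> uM" and yx: "compose S y x = u"
  shows "compose S x y = u"
proof -
  from uM_left_inverse[OF y] obtain z where z: "z \<in> uM" "compose S z y = u" ..
  have yE: "y \<in> E" and xE: "x \<in> E" by (rule uM_E[OF y], rule uM_E[OF x])
  have "compose S x y = compose S u (compose S x y)" by (rule uM_u[OF uM_mult[OF x y], symmetric])
  also have "\<dots> = compose S (compose S z y) (compose S x y)" by (simp only: z(2))
  also have "\<dots> = compose S z (compose S y (compose S x y))"
    by (rule EL_assoc[OF EL_compose[OF xE yE], symmetric])
  also have "compose S y (compose S x y) = compose S (compose S y x) y" by (rule EL_assoc[OF yE])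
  also have "\<dots> = y" by (simp only: yx uM_u[OF y])
  finally show ?thesis by (simp only: z(2))
qed

lemma bounded_orbit:
  assumes m: "m \<in> M" and q: "q \<in> S"
  shows "|orbit (m q)| <o \<kappa>"
proof -
  have "orbit (m q) \<subseteq> (\<lambda>m. m q) ` M"
    unfolding orbit_def
  proof (rule image_subsetI)
    fix \<sigma> assume \<sigma>: "\<sigma> \<in> Aut L C"
    have "compose S (restrict (type_act \<sigma>) S) m \<in> M" by (rule M_ideal[OF EL_Aut[OF \<sigma>] m])
    moreover have "type_act \<sigma> (m q) = compose S (restrict (type_act \<sigma>) S) m q"
      using q EL_S[OF M_E[OF m] q] by (simp add: compose_eq)
    ultimately show "type_act \<sigma> (m q) \<in> (\<lambda>m. m q) ` M"
      by (intro image_eqI[of _ _ "compose S (restrict (type_act \<sigma>) S) m"])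
  qed
  then have "|orbit (m q)| \<le>o |M|" by (rule ordLeq_transitive[OF card_of_mono1 card_of_image])
  then show ?thesis using M_small by (rule ordLeq_ordLess_trans)
qed

lemma ideal_global_ext: "m \<in> M \<Longrightarrow> q \<in> S \<Longrightarrow> \<exists>R. global_ext (m q) R"
  by (rule global_ext_exists[OF EL_S[OF M_E] bounded_orbit])

lemma KP_eq: "Autf_KP L \<kappa>' C' = Autf_L L \<kappa>' C'"
proof -
  from ideal_global_ext[OF u p0_S] obtain R where "global_ext (u p0) R" ..
  then show ?thesis by (rule Autf_KP_eq)
qed

lemma F_hat_u: "Fh u = \<one>\<^bsub>Gal\<^esub>"
proof -
  interpret Gal: group Gal by (rule group_Gal)
  have "Fh u \<otimes>\<^bsub>Gal\<^esub> Fh u = Fh u" using F_hat_mult[OF KP_eq M_E[OF u] M_E[OF u]] uu' by simp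
  then show ?thesis using F_hat_carrier[OF KP_eq M_E[OF u]] Gal.l_cancel_one by simp
qed

end

section \<open>Alternation along Morley sequences\<close>

context monster_pair
begin

text \<open>Each base set contains the earlier terms and also the model \<open>C\<close>, so that
  conjugacy over a base set is Lascar conjugacy.\<close>

definition morley :: "('f, 'r, 'i + 'a) fm set \<Rightarrow> (nat \<Rightarrow> 'a set) \<Rightarrow> (nat \<Rightarrow> 'i \<Rightarrow> 'a) \<Rightarrow> bool" where
  "morley R A e \<longleftrightarrow> (\<forall>n. Dom C \<subseteq> A n \<and> A n \<subseteq> Dom C' \<and> |A n| <o \<kappa>' \<and> realizes R (A n) (e n) \<and>
     A n \<union> e n ` I \<subseteq> A (Suc n))"

lemma morley_exists:
  assumes R: "global_ext p R"
  shows "\<exists>A e. morley R A e"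
proof -
  define ch where "ch B = (SOME z. realizes R B z)" for B
  define A where "A = rec_nat (Dom C) (\<lambda>_ B. B \<union> ch B ` I)"
  have A0: "A 0 = Dom C" and AS: "A (Suc n) = A n \<union> ch (A n) ` I" for n by (simp_all add: A_def)
  have ch: "realizes R B (ch B)" if "B \<subseteq> Dom C'" "|B| <o \<kappa>'" for B
    unfolding ch_def by (rule someI_ex[OF realizes_exists[OF R that]])
  have A: "Dom C \<subseteq> A n \<and> A n \<subseteq> Dom C' \<and> |A n| <o \<kappa>'" for n
  proof (induction n)
    case 0
    then show ?case using sub small by (auto simp: A0)
  next
    case (Suc n)
    then have r: "realizes R (A n) (ch (A n))" by (intro ch) simp_all
    have "|A n \<union> ch (A n) ` I| <o \<kappa>'"
      by (rule card_Un_less[OF mC'(2) _ ordLeq_ordLess_trans[OF card_of_image card_I]]) (use Suc in simp)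
    then show ?case using Suc realizes_Dom[OF r] by (auto simp: AS)
  qed
  have "morley R A (\<lambda>n. ch (A n))" unfolding morley_def using A ch AS by simp
  then show ?thesis by (intro exI)
qed

lemma morleyD:
  assumes "morley R A e"
  shows "Dom C \<subseteq> A n" "A n \<subseteq> Dom C'" "|A n| <o \<kappa>'" "realizes R (A n) (e n)" "A n \<union> e n ` I \<subseteq> A (Suc n)"
  using assms by (simp_all add: morley_def)

lemma morley_mem:
  assumes m: "morley R A e" and "k < n" "i \<in> I"
  shows "e k i \<in> A n"
  using assms(2)
proof (induction n)
  case (Suc n)
  show ?case
  proof (cases "k = n")
    case True
    then show ?thesis using morleyD(5)[OF m, of n] assms(3) by auto
  next
    case False
    then have "e k i \<in> A n" using Suc by simp
    then show ?thesis using morleyD(5)[OF m, of n] by auto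
  qed
qed simp

lemma morley_Dom: "morley R A e \<Longrightarrow> i \<in> I \<Longrightarrow> e k i \<in> Dom C'"
  by (rule realizes_Dom[OF morleyD(4)])

text \<open>By invariance the image of \<open>e n\<close> under \<open>\<tau>\<close> also realizes
  \<open>R\<close> over the image of \<open>A n\<close>. That set contains a copy of
  \<open>C\<close>, so a Lascar strong automorphism fixing it corrects this image to
  \<open>z\<close> and leaves the images of the earlier terms alone.\<close>

lemma morley_extend:
  assumes R: "global_ext p R" and m: "morley R A e" and \<tau>: "\<tau> \<in> Autf_L L \<kappa>' C'" and z: "realizes R (\<tau> ` A n) z"
  shows "\<exists>\<tau>'\<in>Autf_L L \<kappa>' C'. (\<forall>k<n. \<forall>i\<in>I. \<tau>' (e k i) = \<tau> (e k i)) \<and> (\<forall>i\<in>I. \<tau>' (e n i) = z i)"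
proof -
  have \<tau>A: "\<tau> \<in> Aut L C'" by (rule Autf_L_closed(1)[OF mC'(3) \<tau>])
  note M = morleyD[OF m]
  have r: "realizes R (\<tau> ` A n) (compose I \<tau> (e n))" by (rule realizes_Autf_L[OF R M(2,4) \<tau>])
  have B: "\<tau> ` A n \<subseteq> Dom C'" "|\<tau> ` A n| <o \<kappa>'"
    using Aut_D(5)[OF \<tau>A] M(2)[of n] by (auto intro: ordLeq_ordLess_trans[OF card_of_image M(3)])
  have "\<exists>\<rho>\<in>Autf_L L \<kappa>' C'. (\<forall>x\<in>\<tau> ` A n. \<rho> x = x) \<and> (\<forall>i\<in>I. \<rho> (compose I \<tau> (e n) i) = z i)"
    by (rule move_realization[OF elem_image[OF elC \<tau>A] image_mono[OF M(1)] B r z])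
  then obtain \<rho> where \<rho>: "\<rho> \<in> Autf_L L \<kappa>' C'" "(\<forall>x\<in>\<tau> ` A n. \<rho> x = x) \<and> (\<forall>i\<in>I. \<rho> (compose I \<tau> (e n) i) = z i)" ..
  show ?thesis
  proof (intro bexI conjI allI impI ballI)
    show "compose (Dom C') \<rho> \<tau> \<in> Autf_L L \<kappa>' C'" by (rule Autf_L_closed(2)[OF mC'(3) \<rho>(1) \<tau>])
    fix i assume i: "i \<in> I"
    show "compose (Dom C') \<rho> \<tau> (e n i) = z i" using \<rho>(2) i morley_Dom[OF m i] by (simp add: compose_eq)
    fix k assume "k < n"
    then have "\<rho> (\<tau> (e k i)) = \<tau> (e k i)" using \<rho>(2) morley_mem[OF m _ i] by simp
    then show "compose (Dom C') \<rho> \<tau> (e k i) = \<tau> (e k i)" using morley_Dom[OF m i] by (simp add: compose_eq)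
  qed
qed

lemma id_Autf_L: "(\<lambda>x\<in>Dom C'. x) \<in> Autf_L L \<kappa>' C'"
  by (rule elementary_fix_Autf_L[OF id_Aut[OF mC'(3)] small elC]) (simp add: sub)

text \<open>In the induction step a realization \<open>z\<close> of \<open>R\<close> over both the
  image of \<open>A n\<close> and \<open>A (f n)\<close> is the link: \<open>morley_extend\<close>
  sends \<open>e n\<close> to \<open>z\<close>, and \<open>move_realization\<close> sends
  \<open>z\<close> to \<open>e (f n)\<close> over \<open>A (f n)\<close>, where the earlier targets
  lie.\<close>

lemma morley_indiscernible:
  assumes R: "global_ext p R" and m: "morley R A e" and f: "strict_mono f"
  shows "\<exists>\<tau>\<in>Autf_L L \<kappa>' C'. \<forall>k<n. \<forall>i\<in>I. \<tau> (e k i) = e (f k) i"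
proof (induction n)
  case 0
  then show ?case using id_Autf_L by (intro bexI[of _ "\<lambda>x\<in>Dom C'. x"]) simp_all
next
  case (Suc n)
  then obtain \<tau> where \<tau>: "\<tau> \<in> Autf_L L \<kappa>' C'" "\<forall>k<n. \<forall>i\<in>I. \<tau> (e k i) = e (f k) i" ..
  have \<tau>A: "\<tau> \<in> Aut L C'" by (rule Autf_L_closed(1)[OF mC'(3) \<tau>(1)])
  note M = morleyD[OF m]
  have B: "\<tau> ` A n \<union> A (f n) \<subseteq> Dom C'" using M(2)[of n] M(2)[of "f n"] Aut_D(5)[OF \<tau>A] by auto
  have "|\<tau> ` A n \<union> A (f n)| <o \<kappa>'"
    by (rule card_Un_less[OF mC'(2) ordLeq_ordLess_trans[OF card_of_image M(3)] M(3)])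
  from realizes_exists[OF R B this] obtain z where z: "realizes R (\<tau> ` A n \<union> A (f n)) z" ..
  have z1: "realizes R (\<tau> ` A n) z" by (rule realizes_mono[OF z Un_upper1])
  have z2: "realizes R (A (f n)) z" by (rule realizes_mono[OF z Un_upper2])
  from morley_extend[OF R m \<tau>(1) z1] obtain \<tau>1 where \<tau>1: "\<tau>1 \<in> Autf_L L \<kappa>' C'"
    "(\<forall>k<n. \<forall>i\<in>I. \<tau>1 (e k i) = \<tau> (e k i)) \<and> (\<forall>i\<in>I. \<tau>1 (e n i) = z i)" ..
  from move_realization[OF elC M(1) M(2,3) z2 M(4)]
  obtain \<rho> where \<rho>: "\<rho> \<in> Autf_L L \<kappa>' C'" "(\<forall>x\<in>A (f n). \<rho> x = x) \<and> (\<forall>i\<in>I. \<rho> (z i) = e (f n) i)" ..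
  show ?case
  proof (intro bexI allI impI ballI)
    show "compose (Dom C') \<rho> \<tau>1 \<in> Autf_L L \<kappa>' C'" by (rule Autf_L_closed(2)[OF mC'(3) \<rho>(1) \<tau>1(1)])
    fix k i assume k: "k < Suc n" and i: "i \<in> I"
    have "\<rho> (\<tau>1 (e k i)) = e (f k) i"
    proof (cases "k = n")
      case True
      then show ?thesis using \<rho>(2) \<tau>1(2) i by simp
    next
      case False
      then have kn: "k < n" using k by simp
      have "f k < f n" using f kn by (simp add: strict_mono_def)
      from morley_mem[OF m this i] show ?thesis using \<rho>(2) \<tau>1(2) \<tau>(2) kn i by simp
    qed
    then show "compose (Dom C') \<rho> \<tau>1 (e k i) = e (f k) i" using morley_Dom[OF m i] by (simp add: compose_eq)
  qed
qed

section \<open>Alternation of truth values\<close>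

definition tr :: "(nat \<Rightarrow> 'i \<Rightarrow> 'a) \<Rightarrow> ('f, 'r, 'i + 'a) fm \<Rightarrow> ('a \<Rightarrow> 'a) \<Rightarrow> nat \<Rightarrow> bool" where
  "tr e \<theta> \<tau> k \<longleftrightarrow> sat C' (case_sum (\<lambda>i. \<tau> (e k i)) id) [] \<theta>"

text \<open>\<open>n\<close> counts terms of the conjugated sequence, so there are
  \<open>n - 1\<close> changes of value, and \<open>\<epsilon>\<close> is the last value. For
  \<open>n = 0\<close> there is no last value and the condition is void.\<close>

definition alt :: "(nat \<Rightarrow> 'i \<Rightarrow> 'a) \<Rightarrow> ('f, 'r, 'i + 'a) fm \<Rightarrow> nat \<Rightarrow> bool \<Rightarrow> bool" where
  "alt e \<theta> n \<epsilon> \<longleftrightarrow> (\<exists>\<tau>\<in>Autf_L L \<kappa>' C'. (\<forall>k. Suc k < n \<longrightarrow> tr e \<theta> \<tau> (Suc k) \<noteq> tr e \<theta> \<tau> k) \<and>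
     (0 < n \<longrightarrow> tr e \<theta> \<tau> (n - 1) = \<epsilon>))"

lemma alt_0: "alt e \<theta> 0 \<epsilon>"
  unfolding alt_def using id_Autf_L by auto

text \<open>An alternation that does not end in the value prescribed by \<open>R\<close> can be prolonged by one more
  realization of \<open>R\<close>.\<close>

lemma alt_extend:
  assumes R: "global_ext p R" and m: "morley R A e" and \<theta>: "\<theta> \<in> Form L (I <+> Dom C')"
    and al: "alt e \<theta> n \<epsilon>" and ne: "0 < n \<Longrightarrow> \<epsilon> \<noteq> (\<theta> \<in> R)"
  shows "alt e \<theta> (Suc n) (\<theta> \<in> R)"
proof -
  from al[unfolded alt_def] obtain \<tau> where \<tau>: "\<tau> \<in> Autf_L L \<kappa>' C'"
    "(\<forall>k. Suc k < n \<longrightarrow> tr e \<theta> \<tau> (Suc k) \<noteq> tr e \<theta> \<tau> k) \<and> (0 < n \<longrightarrow> tr e \<theta> \<tau> (n - 1) = \<epsilon>)" ..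
  have \<tau>A: "\<tau> \<in> Aut L C'" by (rule Autf_L_closed(1)[OF mC'(3) \<tau>(1)])
  define P where "P = {x. Inr x \<in> fv \<theta>}"
  note P = params_Form[OF \<theta>, folded P_def] and M = morleyD[OF m]
  have B: "\<tau> ` A n \<union> P \<subseteq> Dom C'" using M(2)[of n] Aut_D(5)[OF \<tau>A] P(2) by auto
  have "|\<tau> ` A n \<union> P| <o \<kappa>'"
    by (rule card_Un_less[OF mC'(2) ordLeq_ordLess_trans[OF card_of_image M(3)] card_finite_less[OF mC'(2) P(3)]])
  from realizes_exists[OF R B this] obtain z where z: "realizes R (\<tau> ` A n \<union> P) z" ..
  have z1: "realizes R (\<tau> ` A n) z" by (rule realizes_mono[OF z Un_upper1])
  have z2: "realizes R P z" by (rule realizes_mono[OF z Un_upper2])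
  from morley_extend[OF R m \<tau>(1) z1] obtain \<tau>' where \<tau>': "\<tau>' \<in> Autf_L L \<kappa>' C'"
    "(\<forall>k<n. \<forall>i\<in>I. \<tau>' (e k i) = \<tau> (e k i)) \<and> (\<forall>i\<in>I. \<tau>' (e n i) = z i)" ..
  have old: "tr e \<theta> \<tau>' k = tr e \<theta> \<tau> k" if "k < n" for k
    unfolding tr_def by (rule sat_Form_cong[OF \<theta>]) (use \<tau>'(2) that in auto)
  have new: "tr e \<theta> \<tau>' n = (\<theta> \<in> R)"
  proof -
    have "tr e \<theta> \<tau>' n \<longleftrightarrow> sat C' (case_sum z id) [] \<theta>"
      unfolding tr_def by (rule sat_Form_cong[OF \<theta>]) (use \<tau>'(2) in auto)
    then show ?thesis using z2 P(1) unfolding realizes_def by simp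
  qed
  show ?thesis unfolding alt_def
  proof (intro bexI[OF _ \<tau>'(1)] conjI allI impI)
    show "tr e \<theta> \<tau>' (Suc n - 1) = (\<theta> \<in> R)" using new by simp
    fix k assume k: "Suc k < Suc n"
    show "tr e \<theta> \<tau>' (Suc k) \<noteq> tr e \<theta> \<tau>' k"
    proof (cases "Suc k = n")
      case True
      then have "tr e \<theta> \<tau> k = \<epsilon>" "\<epsilon> \<noteq> (\<theta> \<in> R)" using \<tau>(2) ne by auto
      then show ?thesis using new old[of k] k True by simp
    next
      case False
      then show ?thesis using k old \<tau>(2) by simp
    qed
  qed
qed

lemma card_nat: "|UNIV :: nat set| <o \<kappa>'"
  using iffD1[OF infinite_iff_card_of_nat complete_theory_card(1)[OF T]] mC'(6) by (rule ordLeq_ordLess_trans)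

text \<open>\<open>has_IP\<close> requires atoms of type \<open>nat + nat\<close> and total valuations, so the finitely many atoms of
  \<open>\<theta>\<close> are renumbered and all other numbers get a dummy value.\<close>

lemma has_IP_I:
  assumes \<theta>: "\<theta> \<in> Form L (I <+> Dom C')" and e: "\<And>k i. i \<in> I \<Longrightarrow> e k i \<in> Dom C'"
    and \<beta>: "\<And>X :: nat set. \<exists>\<beta>. (\<forall>x\<in>Dom C'. \<beta> x \<in> Dom C') \<and> (\<forall>k. sat C' (case_sum (e k) \<beta>) [] \<theta> \<longleftrightarrow> k \<in> X)"
  shows "\<exists>\<psi>\<in>Form L UNIV. has_IP C' \<psi>"
proof -
  define J where "J = {i. Inl i \<in> fv \<theta>}"
  define P where "P = {x. Inr x \<in> fv \<theta>}"
  have "finite (Inl -` fv \<theta>)" "finite (Inr -` fv \<theta>)" by (rule finite_vimageI[OF finite_fv], simp)+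
  then have "finite J" "finite P" by (simp_all add: J_def P_def vimage_def)
  then obtain hJ hP :: "_ \<Rightarrow> nat" where hJ: "inj_on hJ J" and hP: "inj_on hP P"
    using finite_imp_inj_to_nat_seg by metis
  have JI: "J \<subseteq> I" and PC: "P \<subseteq> Dom C'" using \<theta> by (auto simp: J_def P_def Form_def)
  define \<psi> where "\<psi> = map_fm (map_sum hJ hP) \<theta>"
  obtain d where d: "d \<in> Dom C'" using nonempty(2) by blast
  from choice[OF allI[OF \<beta>]] obtain b where
    b: "\<forall>X. (\<forall>x\<in>Dom C'. b X x \<in> Dom C') \<and> (\<forall>k. sat C' (case_sum (e k) (b X)) [] \<theta> \<longleftrightarrow> k \<in> X)" ..
  define a' where "a' k n = (if n \<in> hJ ` J then e k (inv_into J hJ n) else d)" for k n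
  define b' where "b' X n = (if n \<in> hP ` P then b X (inv_into P hP n) else d)" for X n
  have "has_IP C' \<psi>"
    unfolding has_IP_def
  proof (intro exI conjI allI)
    show "range (a' k) \<subseteq> Dom C'" for k
    proof (rule image_subsetI)
      fix n
      show "a' k n \<in> Dom C'"
      proof (cases "n \<in> hJ ` J")
        case True
        then have "inv_into J hJ n \<in> I" by (intro subsetD[OF JI inv_into_into])
        then show ?thesis unfolding a'_def using True by (simp only: if_True e)
      qed (simp add: a'_def d)
    qed
    show "range (b' X) \<subseteq> Dom C'" for X
    proof (rule image_subsetI)
      fix n
      show "b' X n \<in> Dom C'"
      proof (cases "n \<in> hP ` P")
        case True
        then have "inv_into P hP n \<in> Dom C'" by (intro subsetD[OF PC inv_into_into])
        then show ?thesis unfolding b'_def using True b by simp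
      qed (simp add: b'_def d)
    qed
    fix k X
    have "sat C' (case_sum (a' k) (b' X)) [] \<psi> \<longleftrightarrow> sat C' (case_sum (a' k) (b' X) \<circ> map_sum hJ hP) [] \<theta>"
      by (simp add: \<psi>_def sat_map_fm)
    also have "\<dots> \<longleftrightarrow> sat C' (case_sum (e k) (b X)) [] \<theta>"
    proof (rule sat_cong)
      fix z assume z: "z \<in> fv \<theta>"
      show "(case_sum (a' k) (b' X) \<circ> map_sum hJ hP) z = case_sum (e k) (b X) z"
      proof (cases z)
        case (Inl i)
        then have "i \<in> J" using z by (simp add: J_def)
        then show ?thesis using hJ by (simp add: Inl a'_def)
      next
        case (Inr x)
        then have "x \<in> P" using z by (simp add: P_def)
        then show ?thesis using hP by (simp add: Inr b'_def)
      qed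
    qed
    also have "\<dots> \<longleftrightarrow> k \<in> X" using b by simp
    finally show "sat C' (case_sum (a' k) (b' X)) [] \<psi> \<longleftrightarrow> k \<in> X" .
  qed
  moreover have "\<psi> \<in> Form L UNIV" unfolding \<psi>_def by (rule Form_map_fm[OF \<theta>]) simp
  ultimately show ?thesis by (intro bexI[of _ \<psi>])
qed

text \<open>Arbitrarily long alternations yield the independence property. For a given set
  \<open>X\<close> one selects terms of an alternation with the truth values prescribed by
  \<open>X\<close>; by indiscernibility the selection is conjugate to an initial segment of the
  sequence, and saturation finds parameters for all of \<open>X\<close> at once.\<close>

lemma alt_bounded:
  assumes R: "global_ext p R" and m: "morley R A e" and \<theta>: "\<theta> \<in> Form L (I <+> Dom C')"
    and nip: "NIP L T TYPE('a)"
  shows "\<exists>n. \<forall>\<epsilon>. \<not> alt e \<theta> n \<epsilon>"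
proof (rule ccontr)
  assume "\<not> ?thesis"
  then have al: "\<exists>\<epsilon>. alt e \<theta> n \<epsilon>" for n by simp
  have "\<exists>\<psi>\<in>Form L UNIV. has_IP C' \<psi>"
  proof (rule has_IP_I[OF \<theta> morley_Dom[OF m]])
    fix X :: "nat set"
    define J where "J = {i. Inl i \<in> fv \<theta>}"
    define P where "P = {x. Inr x \<in> fv \<theta>}"
    note P = params_Form[OF \<theta>, folded P_def]
    have "finite (Inl -` fv \<theta>)" by (rule finite_vimageI[OF finite_fv]) simp
    then have J: "finite J" "J \<subseteq> I" using \<theta> by (auto simp: J_def vimage_def Form_def)
    have \<theta>JP: "\<theta> \<in> Form L (J <+> P)" using \<theta> by (auto simp: Form_def J_def P_def)
    let ?U = "(UNIV \<times> J) <+> P :: (nat \<times> 'i + 'a) set" and ?W = "Inl ` (UNIV \<times> J) :: (nat \<times> 'i + 'a) set"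
    define f0 where "f0 k = map_fm (map_sum (Pair k) id) \<theta>" for k :: nat
    define g where "g k = (if k \<in> X then f0 k else Neg (f0 k))" for k
    have f0F: "f0 k \<in> Form L ?U" for k unfolding f0_def by (rule Form_map_fm[OF \<theta>JP]) auto
    have \<Gamma>: "range g \<subseteq> Form L ?U" using f0F by (auto simp: g_def)
    have s0: "sat C' w [] (f0 k) \<longleftrightarrow> sat C' (case_sum (\<lambda>i. w (Inl (k, i))) (\<lambda>x. w (Inr x))) [] \<theta>" for w k
    proof -
      have "w \<circ> map_sum (Pair k) id = case_sum (\<lambda>i. w (Inl (k, i))) (\<lambda>x. w (Inr x))"
        by (auto simp: fun_eq_iff split: sum.splits)
      then show ?thesis by (simp add: f0_def sat_map_fm)
    qed
    have U: "|?U| <o \<kappa>'"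
      by (rule card_Plus_less[OF mC'(2) card_Times_less[OF mC'(2) card_nat card_finite_less[OF mC'(2) J(1)]]
        card_finite_less[OF mC'(2) P(3)]])
    have WU: "?W \<subseteq> ?U" by auto
    have fs: "finsat C' ?U ?W (case_sum (\<lambda>(k, i). e k i) undefined) (range g)"
      unfolding finsat_def
    proof (intro allI impI)
      fix Q assume Q: "Q \<subseteq> range g" "finite Q"
      from finite_subset_image[OF Q(2,1)] obtain K where K: "K \<subseteq> UNIV \<and> finite K \<and> Q = g ` K" ..
      then obtain n where n: "\<And>k. k \<in> K \<Longrightarrow> k < n" using finite_nat_set_iff_bounded by metis
      \<comment> \<open>Of the positions \<open>2 * k\<close> and \<open>2 * k + 1\<close> exactly
        one has the value that \<open>X\<close> demands at \<open>k\<close>; hence the length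
        \<open>2 * n\<close>.\<close>
      from al[of "2 * n"] obtain \<epsilon> where "alt e \<theta> (2 * n) \<epsilon>" ..
      from this[unfolded alt_def] obtain \<tau> where \<tau>: "\<tau> \<in> Autf_L L \<kappa>' C'"
        "(\<forall>k. Suc k < 2 * n \<longrightarrow> tr e \<theta> \<tau> (Suc k) \<noteq> tr e \<theta> \<tau> k) \<and> (0 < 2 * n \<longrightarrow> tr e \<theta> \<tau> (2 * n - 1) = \<epsilon>)" ..
      define f where "f k = (if tr e \<theta> \<tau> (2 * k) = (k \<in> X) then 2 * k else Suc (2 * k))" for k
      have f: "tr e \<theta> \<tau> (f k) = (k \<in> X)" if "k < n" for k
      proof (cases "tr e \<theta> \<tau> (2 * k) = (k \<in> X)")
        case True
        then show ?thesis by (simp add: f_def)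
      next
        case False
        have "Suc (2 * k) < 2 * n" using that by simp
        then have "tr e \<theta> \<tau> (Suc (2 * k)) \<noteq> tr e \<theta> \<tau> (2 * k)" using \<tau>(2) by blast
        then show ?thesis using False by (auto simp: f_def)
      qed
      have "strict_mono f" by (simp add: strict_mono_Suc_iff f_def)
      from morley_indiscernible[OF R m this, of n]
      obtain \<mu> where \<mu>: "\<mu> \<in> Autf_L L \<kappa>' C'" "\<forall>k<n. \<forall>i\<in>I. \<mu> (e k i) = e (f k) i" ..
      \<comment> \<open>\<open>\<nu>\<close> sends the initial segment to the selected terms. Its
        inverse is applied to the parameters, so that the sequence itself does not depend on
        \<open>X\<close>.\<close>
      define \<nu> where "\<nu> = compose (Dom C') \<tau> \<mu>"
      have \<nu>: "\<nu> \<in> Aut L C'"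
        unfolding \<nu>_def by (rule Autf_L_closed(1)[OF mC'(3) Autf_L_closed(2)[OF mC'(3) \<tau>(1) \<mu>(1)]])
      have \<nu>e: "\<nu> (e k i) = \<tau> (e (f k) i)" if "k < n" "i \<in> I" for k i
        using \<mu>(2) that morley_Dom[OF m that(2)] by (simp add: \<nu>_def compose_eq)
      have key: "sat C' (case_sum (e k) (aut_inv C' \<nu>)) [] \<theta> \<longleftrightarrow> k \<in> X" if k: "k < n" for k
      proof -
        have q: "eqt L (I <+> Dom C') C' (case_sum (e k) (aut_inv C' \<nu>)) C' (case_sum (\<lambda>i. \<tau> (e (f k) i)) id)"
          by (rule eqt_Aut[OF mC'(3) \<nu>]) (use \<nu>e[OF k] morley_Dom[OF m] aut_inv[OF \<nu>] in auto)
        then show ?thesis using eqtD[OF q \<theta>] f[OF k] by (simp add: tr_def)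
      qed
      show "realizable C' ?U ?W (case_sum (\<lambda>(k, i). e k i) undefined) Q"
      proof (rule realizableI[of _ "case_sum (\<lambda>(k, i). e k i) (aut_inv C' \<nu>)"])
        fix x assume "x \<in> ?U"
        then show "case_sum (\<lambda>(k, i). e k i) (aut_inv C' \<nu>) x \<in> Dom C'"
          using morley_Dom[OF m] J(2) P(2) aut_inv(3)[OF \<nu>] by auto
      next
        fix \<phi> assume "\<phi> \<in> Q"
        then obtain k where k: "k \<in> K" "\<phi> = g k" using K by blast
        have "sat C' (case_sum (\<lambda>(k, i). e k i) (aut_inv C' \<nu>)) [] (f0 k) \<longleftrightarrow> k \<in> X"
          using key[OF n[OF k(1)]] by (simp add: s0)
        then show "sat C' (case_sum (\<lambda>(k, i). e k i) (aut_inv C' \<nu>)) [] \<phi>" by (simp add: k(2) g_def)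
      qed auto
    qed
    from saturated_realizes[OF mC'(4) U \<Gamma> WU nonempty(2) fs]
    obtain w where w: "(\<forall>x\<in>?U. w x \<in> Dom C') \<and> (\<forall>x\<in>?W. w x = case_sum (\<lambda>(k, i). e k i) undefined x) \<and>
      (\<forall>\<phi>\<in>range g. sat C' w [] \<phi>)" unfolding realizable_def ..
    obtain d where d: "d \<in> Dom C'" using nonempty(2) by blast
    define \<beta> where "\<beta> x = (if x \<in> P then w (Inr x) else d)" for x
    have wJ: "w (Inl (k, i)) = e k i" if "i \<in> J" for k i
    proof -
      have "Inl (k, i) \<in> ?W" using that by simp
      moreover have "\<forall>x\<in>?W. w x = case_sum (\<lambda>(k, i). e k i) undefined x" using w by simp
      ultimately show ?thesis by auto
    qed
    have "sat C' (case_sum (e k) \<beta>) [] \<theta> \<longleftrightarrow> k \<in> X" for k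
    proof -
      have "sat C' (case_sum (e k) \<beta>) [] \<theta> \<longleftrightarrow> sat C' w [] (f0 k)"
        unfolding s0 by (rule sat_Form_cong[OF \<theta>JP]) (use wJ in \<open>auto simp: \<beta>_def\<close>)
      moreover have "sat C' w [] (g k)" using w by blast
      ultimately show ?thesis by (cases "k \<in> X") (simp_all add: g_def)
    qed
    moreover have "\<beta> x \<in> Dom C'" for x using w d by (auto simp: \<beta>_def)
    ultimately show "\<exists>\<beta>. (\<forall>x\<in>Dom C'. \<beta> x \<in> Dom C') \<and> (\<forall>k. sat C' (case_sum (e k) \<beta>) [] \<theta> \<longleftrightarrow> k \<in> X)"
      by (intro exI[of _ \<beta>]) simp
  qed
  then show False using nip mC'(7) unfolding NIP_def by blast
qed

text \<open>The first length without an alternation. Initial parts of alternations alternate, so the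
  longest ones have \<open>alt_rank e \<theta> - 1\<close> terms.\<close>

definition alt_rank :: "(nat \<Rightarrow> 'i \<Rightarrow> 'a) \<Rightarrow> ('f, 'r, 'i + 'a) fm \<Rightarrow> nat" where
  "alt_rank e \<theta> = (LEAST n. \<forall>\<epsilon>. \<not> alt e \<theta> n \<epsilon>)"

text \<open>\<open>alt_extend\<close> prolongs the empty alternation as well as any alternation
  ending in the wrong value, so neither has maximal length.\<close>

lemma alt_rank:
  assumes R: "global_ext p R" and m: "morley R A e" and \<theta>: "\<theta> \<in> Form L (I <+> Dom C')"
    and nip: "NIP L T TYPE('a)"
  shows "\<not> alt e \<theta> (alt_rank e \<theta>) \<epsilon>" "alt e \<theta> (alt_rank e \<theta> - 1) (\<theta> \<in> R)"
    "\<not> alt e \<theta> (alt_rank e \<theta> - 1) (\<theta> \<notin> R)"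
proof -
  let ?n = "alt_rank e \<theta>"
  have no: "\<forall>\<epsilon>. \<not> alt e \<theta> ?n \<epsilon>"
    unfolding alt_rank_def by (rule LeastI_ex[OF alt_bounded[OF R m \<theta> nip]])
  then show "\<not> alt e \<theta> ?n \<epsilon>" by simp
  have "?n \<noteq> 0" using no alt_0 by metis
  then obtain n where n: "?n = Suc n" by (cases ?n) auto
  have "\<not> (\<forall>\<epsilon>. \<not> alt e \<theta> n \<epsilon>)" using not_less_Least[of n "\<lambda>n. \<forall>\<epsilon>. \<not> alt e \<theta> n \<epsilon>"] n by (simp add: alt_rank_def)
  then obtain \<epsilon> where \<epsilon>: "alt e \<theta> n \<epsilon>" by blast
  have n0: "n \<noteq> 0"
  proof
    assume "n = 0"
    then have "alt e \<theta> (Suc n) (\<theta> \<in> R)" by (intro alt_extend[OF R m \<theta> \<epsilon>]) simp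
    then show False using no n by simp
  qed
  have only: "\<epsilon>' = (\<theta> \<in> R)" if "alt e \<theta> n \<epsilon>'" for \<epsilon>'
  proof (rule ccontr)
    assume "\<epsilon>' \<noteq> (\<theta> \<in> R)"
    then have "alt e \<theta> (Suc n) (\<theta> \<in> R)" by (intro alt_extend[OF R m \<theta> that])
    then show False using no n by simp
  qed
  show "alt e \<theta> (?n - 1) (\<theta> \<in> R)" using \<epsilon> only[OF \<epsilon>] n by simp
  show "\<not> alt e \<theta> (?n - 1) (\<theta> \<notin> R)" using only[of "\<theta> \<notin> R"] n by auto
qed

lemma alt_rank_le: "(\<And>\<epsilon>. \<not> alt e \<theta> n \<epsilon>) \<Longrightarrow> alt_rank e \<theta> \<le> n"
  unfolding alt_rank_def by (rule Least_le) simp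

lemma cls_cancel:
  assumes \<alpha>: "\<alpha> \<in> Aut L C'" and \<gamma>: "\<gamma> \<in> Aut L C'" and eq: "cls \<gamma> = cls \<alpha>"
  shows "compose (Dom C') \<gamma> (aut_inv C' \<alpha>) \<in> Autf_L L \<kappa>' C'"
proof (rule cls_one_iff)
  have i: "aut_inv C' \<alpha> \<in> Aut L C'" by (rule Aut_inv[OF mC'(3) \<alpha>])
  show "compose (Dom C') \<gamma> (aut_inv C' \<alpha>) \<in> Aut L C'" by (rule Aut_compose[OF mC'(3) \<gamma> i])
  have "compose (Dom C') \<alpha> (aut_inv C' \<alpha>) = (\<lambda>x\<in>Dom C'. x)"
    by (rule ext) (simp add: compose_def aut_inv[OF \<alpha>])
  then show "cls (compose (Dom C') \<gamma> (aut_inv C' \<alpha>)) = \<one>\<^bsub>Gal\<^esub>"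
    using cls_mult[OF \<gamma> i] cls_mult[OF \<alpha> i] cls_Autf_L[OF id_Autf_L] eq by simp
qed

text \<open>\<open>D\<close> is copied into \<open>C\<close> and moved back by homogeneity of
  \<open>C'\<close>, which exhibits it inside the conjugate \<open>\<alpha> c\<close> of the
  enumeration; \<open>j\<close> gives the positions of its elements.\<close>

lemma lift_finite:
  assumes D: "finite D" "D \<subseteq> Dom C'"
  shows "\<exists>\<alpha>\<in>Aut L C'. \<exists>j. \<forall>x\<in>D. j x \<in> I \<and> \<alpha> (c (j x)) = x"
proof -
  from pull_parameters[OF D] obtain g where
    g: "(\<forall>x\<in>D. g x \<in> Dom C) \<and> (\<forall>x\<in>D \<inter> Dom C. g x = x) \<and> eqt L D C' id C g" ..
  then have gD: "g x \<in> Dom C" if "x \<in> D" for x using that by simp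
  have "eqt L D C g C' g" by (rule elem_eqt[OF el gD])
  from eqt_sym[OF eqt_trans[OF conjunct2[OF conjunct2[OF g]] this]] have gid: "eqt L D C' g C' id" .
  have "\<exists>\<alpha>\<in>Aut L C'. \<forall>x\<in>D. \<alpha> (g x) = id x"
    by (rule strongly_homogeneous_extends[OF mC'(5) card_finite_less[OF mC'(2) D(1)] sub[OF gD] _ gid]) (use D(2) in auto)
  then obtain \<alpha> where \<alpha>: "\<alpha> \<in> Aut L C'" "\<forall>x\<in>D. \<alpha> (g x) = id x" ..
  have "inv_into I c (g x) \<in> I \<and> \<alpha> (c (inv_into I c (g x))) = x" if "x \<in> D" for x
  proof -
    have "g x \<in> c ` I" using gD[OF that] c_Dom(3) by simp
    then show ?thesis using inv_into_into[of "g x" c I] f_inv_into_f[of "g x" c I] \<alpha>(2) that by simp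
  qed
  then show ?thesis using \<alpha>(1) by (intro bexI[of _ \<alpha>] exI[of _ "\<lambda>x. inv_into I c (g x)"]) simp_all
qed

text \<open>By \<open>Autf_L_of_model\<close>, the existence of an alternation is a type-definable condition on the sequence
  and the parameters. A finite part of the sequence is moved into \<open>C\<close> by an automorphism \<open>\<alpha>\<^sup>-\<^sup>1\<close>, so that the condition
  becomes a set of formulas of \<open>\<eta> q\<close> for \<open>q = tp(\<alpha> c/C)\<close>.\<close>

lemma alt_closed:
  assumes R: "global_ext p R" and m: "morley R A e" and \<theta>: "\<theta> \<in> Form L (I <+> Dom C)"
    and \<eta>: "\<eta> \<in> E" and \<sigma>: "\<sigma> \<in> Autf_L L \<kappa>' C'" "\<eta> p0 = tp L C' I (\<lambda>x. \<sigma> (c x)) (Dom C)"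
    and no: "\<not> alt e \<theta> n \<epsilon>"
  shows "\<exists>F\<in>FS. \<forall>\<rho>\<in>Aut L C. agree \<eta> \<rho> F \<longrightarrow> \<not> alt e (act (aut_inv C \<rho>) \<theta>) n \<epsilon>"
proof (rule ccontr)
  assume no_nbhd: "\<not> ?thesis"
  have near: "\<exists>\<rho>\<in>Aut L C. agree \<eta> \<rho> F \<and> alt e (act (aut_inv C \<rho>) \<theta>) n \<epsilon>" if F: "F \<in> FS" for F
  proof (rule ccontr)
    assume "\<not> ?thesis"
    then have "\<forall>\<rho>\<in>Aut L C. agree \<eta> \<rho> F \<longrightarrow> \<not> alt e (act (aut_inv C \<rho>) \<theta>) n \<epsilon>" by simp
    with F have "\<exists>F\<in>FS. \<forall>\<rho>\<in>Aut L C. agree \<eta> \<rho> F \<longrightarrow> \<not> alt e (act (aut_inv C \<rho>) \<theta>) n \<epsilon>"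
      by (intro bexI[of _ F])
    with no_nbhd show False ..
  qed
  define J where "J = {i. Inl i \<in> fv \<theta>}"
  define P where "P = {x. Inr x \<in> fv \<theta>}"
  note P = params_Form[OF \<theta>, folded P_def]
  have "finite (Inl -` fv \<theta>)" by (rule finite_vimageI[OF finite_fv]) simp
  then have J: "finite J" "J \<subseteq> I" using \<theta> by (auto simp: J_def vimage_def Form_def)
  have \<theta>JP: "\<theta> \<in> Form L (J <+> P)" using \<theta> by (auto simp: Form_def J_def P_def)
  \<comment> \<open>Positions of the finitely many entries of the first \<open>n\<close> terms that
    can influence \<open>\<theta>\<close>.\<close>
  define B where "B = {..<n} \<times> J"
  define y where "y = (\<lambda>(k, i). e k i)"
  have B: "finite B" unfolding B_def using J by simp
  have y: "y b \<in> Dom C'" if "b \<in> B" for b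
    using that J(2) morley_Dom[OF m] by (auto simp: B_def y_def)
  from lift_finite[OF finite_imageI[OF B] image_subsetI[of B y, OF y]] obtain \<alpha> where
    \<alpha>: "\<alpha> \<in> Aut L C'" "\<exists>j. \<forall>x\<in>y ` B. j x \<in> I \<and> \<alpha> (c (j x)) = x" ..
  from \<alpha>(2) obtain j where j: "\<forall>x\<in>y ` B. j x \<in> I \<and> \<alpha> (c (j x)) = x" ..
  define q where "q = tp L C' I (\<lambda>x. \<alpha> (c x)) (Dom C)"
  have qS: "q \<in> S" unfolding q_def by (rule tp_Aut_S[OF \<alpha>(1)])
  from EL_realized[OF \<eta> qS] obtain \<gamma> where \<gamma>: "\<gamma> \<in> Aut L C'" "tp L C' I (\<lambda>x. \<gamma> (c x)) (Dom C) = \<eta> q" ..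
  have \<sigma>A: "\<sigma> \<in> Aut L C'" by (rule Autf_L_closed(1)[OF mC'(3) \<sigma>(1)])
  \<comment> \<open>Because \<open>\<eta> p0\<close> is realized by a Lascar strong image of
    \<open>c\<close>, applying \<open>\<eta>\<close> does not change cosets. So realizations of
    \<open>q\<close> and of \<open>\<eta> q\<close> differ by a Lascar strong
    \<open>\<beta>\<close>.\<close>
  have "cls \<gamma> = cls \<sigma> \<otimes>\<^bsub>Gal\<^esub> cls \<alpha>"
    by (rule cls_EL[OF \<eta> \<alpha>(1) \<gamma>(1) \<sigma>A _ \<sigma>(2)]) (simp add: \<gamma>(2) q_def)
  then have eq: "cls \<gamma> = cls \<alpha>"
    unfolding cls_Autf_L[OF \<sigma>(1)] monoid.l_one[OF group.is_monoid[OF group_Gal] cls_carrier[OF \<alpha>(1)]] .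
  define \<beta> where "\<beta> = compose (Dom C') \<gamma> (aut_inv C' \<alpha>)"
  have \<beta>: "\<beta> \<in> Autf_L L \<kappa>' C'" unfolding \<beta>_def by (rule cls_cancel[OF \<alpha>(1) \<gamma>(1) eq])
  have \<beta>A: "\<beta> \<in> Aut L C'" by (rule Autf_L_closed(1)[OF mC'(3) \<beta>])
  have \<beta>y: "\<gamma> (c (j (y b))) = \<beta> (y b)" if "b \<in> B" for b
  proof -
    have jb: "j (y b) \<in> I" "\<alpha> (c (j (y b))) = y b" using j that by auto
    have "aut_inv C' \<alpha> (y b) = c (j (y b))"
      using aut_inv(1)[OF \<alpha>(1) c_Dom(2)[OF jb(1)]] by (simp add: jb(2))
    then show ?thesis using y[OF that] by (simp add: \<beta>_def compose_eq)
  qed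
  \<comment> \<open>Four groups of atoms: a copy \<open>z\<close> of \<open>c\<close>, the images
    \<open>a\<close> of the entries, the entries \<open>y\<close> themselves, and the parameters.
    \<open>\<Gamma>1\<close> makes \<open>z\<close> a copy of the model, \<open>\<Gamma>2\<close>
    gives \<open>y\<close> and \<open>a\<close> the same type over it, and \<open>\<Lambda>\<close>
    makes \<open>a\<close> alternate.\<close>
  define fk :: "nat \<Rightarrow> ('f, 'r, 'i + (nat \<times> 'i) + (nat \<times> 'i) + 'a) fm" where
    "fk k = map_fm (case_sum (\<lambda>i. Inr (Inl (k, i))) (\<lambda>x. Inr (Inr (Inr x)))) \<theta>" for k
  define \<Lambda> where "\<Lambda> = {Neg (Iff (fk (Suc k)) (fk k)) | k. Suc k < n} \<union>
    (if 0 < n then {if \<epsilon> then fk (n - 1) else Neg (fk (n - 1))} else {})"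
  define \<Gamma>1 :: "('f, 'r, 'i + (nat \<times> 'i) + (nat \<times> 'i) + 'a) fm set" where
    "\<Gamma>1 = map_fm Inl ` {\<phi> \<in> Form L I. sat C' c [] \<phi>}"
  define ev :: "('f, 'r, 'i + (nat \<times> 'i)) fm \<Rightarrow> ('f, 'r, 'i + (nat \<times> 'i) + (nat \<times> 'i) + 'a) fm" where "ev \<phi> = Iff (map_fm (case_sum Inl (\<lambda>b. Inr (Inl b))) \<phi>)
    (map_fm (case_sum Inl (\<lambda>b. Inr (Inr (Inl b)))) \<phi>)" for \<phi>
  define \<Gamma>2 :: "('f, 'r, 'i + (nat \<times> 'i) + (nat \<times> 'i) + 'a) fm set" where
    "\<Gamma>2 = ev ` Form L (I <+> B)"
  define \<Gamma> where "\<Gamma> = \<Gamma>1 \<union> \<Gamma>2 \<union> \<Lambda>"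
  define U :: "('i + (nat \<times> 'i) + (nat \<times> 'i) + 'a) set" where "U = I <+> (B <+> (B <+> P))"
  define W :: "('i + (nat \<times> 'i) + (nat \<times> 'i) + 'a) set" where "W = Inr ` Inr ` (B <+> P)"
  define val where "val z a x = case_sum z (case_sum a (case_sum y x))"
    for z :: "'i \<Rightarrow> 'a" and a :: "nat \<times> 'i \<Rightarrow> 'a" and x :: "'a \<Rightarrow> 'a"
  have fkF: "fk k \<in> Form L U" if "k < n" for k
    unfolding fk_def using that by (intro Form_map_fm[OF \<theta>JP]) (auto simp: U_def B_def)
  have \<Lambda>F: "\<Lambda> \<subseteq> Form L U" using fkF by (auto simp: \<Lambda>_def)
  have \<Gamma>1F: "\<Gamma>1 \<subseteq> Form L U"
  proof
    fix \<phi> assume "\<phi> \<in> \<Gamma>1"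
    then obtain \<psi> where \<psi>: "\<psi> \<in> Form L I" "\<phi> = map_fm Inl \<psi>" by (auto simp: \<Gamma>1_def)
    show "\<phi> \<in> Form L U" unfolding \<psi>(2) by (rule Form_map_fm[OF \<psi>(1)]) (auto simp: U_def)
  qed
  have \<Gamma>2F: "\<Gamma>2 \<subseteq> Form L U"
  proof
    fix \<phi> assume "\<phi> \<in> \<Gamma>2"
    then obtain \<psi> where \<psi>: "\<psi> \<in> Form L (I <+> B)" "\<phi> = ev \<psi>" by (auto simp: \<Gamma>2_def)
    show "\<phi> \<in> Form L U" unfolding \<psi>(2) ev_def Iff_Form
      by (rule conjI; rule Form_map_fm[OF \<psi>(1)]) (auto simp: U_def)
  qed
  have \<Gamma>F: "\<Gamma> \<subseteq> Form L U" unfolding \<Gamma>_def using \<Gamma>1F \<Gamma>2F \<Lambda>F by simp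
  have WU: "W \<subseteq> U" by (auto simp: W_def U_def)
  have Ucard: "|U| <o \<kappa>'" unfolding U_def
    by (intro card_Plus_less[OF mC'(2)] card_I card_finite_less[OF mC'(2)]) (use B P(3) in simp_all)
  have sk: "sat C' w [] (fk k) \<longleftrightarrow> sat C' (case_sum (\<lambda>i. w (Inr (Inl (k, i)))) (\<lambda>x. w (Inr (Inr (Inr x))))) [] \<theta>" for w k
    unfolding fk_def sat_map_fm by (rule sat_cong) (simp split: sum.splits)
  have sev: "sat C' w [] (ev \<phi>) \<longleftrightarrow> (sat C' (case_sum (\<lambda>i. w (Inl i)) (\<lambda>b. w (Inr (Inl b)))) [] \<phi> \<longleftrightarrow>
    sat C' (case_sum (\<lambda>i. w (Inl i)) (\<lambda>b. w (Inr (Inr (Inl b))))) [] \<phi>)" for w \<phi>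
    unfolding ev_def sat_Iff sat_map_fm
    by (intro arg_cong2[where f = "(=)"] sat_cong) (simp_all split: sum.splits)
  have s\<Lambda>: "(\<forall>\<phi>\<in>\<Lambda>. sat C' w [] \<phi>) \<longleftrightarrow> (\<forall>k. Suc k < n \<longrightarrow> sat C' w [] (fk (Suc k)) \<noteq> sat C' w [] (fk k)) \<and>
    (0 < n \<longrightarrow> sat C' w [] (fk (n - 1)) = \<epsilon>)" for w
    unfolding \<Lambda>_def by auto
  have near': "realizable C' U W (case_sum undefined (case_sum undefined (case_sum y (aut_inv C \<rho>)))) \<Gamma>"
    if \<rho>: "\<rho> \<in> Aut L C" and al: "alt e (act (aut_inv C \<rho>) \<theta>) n \<epsilon>" for \<rho>
  proof -
    from al[unfolded alt_def] obtain \<tau> where \<tau>: "\<tau> \<in> Autf_L L \<kappa>' C'"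
      "(\<forall>k. Suc k < n \<longrightarrow> tr e (act (aut_inv C \<rho>) \<theta>) \<tau> (Suc k) \<noteq> tr e (act (aut_inv C \<rho>) \<theta>) \<tau> k) \<and>
       (0 < n \<longrightarrow> tr e (act (aut_inv C \<rho>) \<theta>) \<tau> (n - 1) = \<epsilon>)" ..
    have \<tau>D: "\<tau> (y b) \<in> Dom C'" if "b \<in> B" for b
      by (rule Aut_D(5)[OF Autf_L_closed(1)[OF mC'(3) \<tau>(1)] y[OF that]])
    from model_of_Autf_L[OF R card_finite_less[OF mC'(2) B] y \<tau>D \<tau>(1) refl]
    obtain z where z: "(\<forall>x\<in>I. z x \<in> Dom C') \<and> eqt L I C' z C' c \<and>
      eqt L (I <+> B) C' (case_sum z y) C' (case_sum z (\<lambda>b. \<tau> (y b)))" ..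
    let ?w = "val z (\<lambda>b. \<tau> (y b)) (aut_inv C \<rho>)"
    have tr: "tr e (act (aut_inv C \<rho>) \<theta>) \<tau> k \<longleftrightarrow> sat C' ?w [] (fk k)" for k
      unfolding tr_def sat_act sk by (simp add: val_def y_def)
    have "\<forall>\<phi>\<in>\<Lambda>. sat C' ?w [] \<phi>" unfolding s\<Lambda> using \<tau>(2) unfolding tr .
    moreover have "sat C' ?w [] (ev \<phi>)" if "\<phi> \<in> Form L (I <+> B)" for \<phi>
      using eqtD[OF conjunct2[OF conjunct2[OF z]] that] by (simp add: sev val_def)
    moreover have "sat C' ?w [] (map_fm Inl \<phi>)" if "\<phi> \<in> Form L I" "sat C' c [] \<phi>" for \<phi>
    proof -
      have "sat C' ?w [] (map_fm Inl \<phi>) \<longleftrightarrow> sat C' z [] \<phi>"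
        unfolding sat_map_fm by (rule sat_cong) (simp add: val_def)
      then show ?thesis using z eqtD[OF _ that(1)] that(2) by blast
    qed
    ultimately have s: "sat C' ?w [] \<phi>" if "\<phi> \<in> \<Gamma>" for \<phi>
      using that by (auto simp: \<Gamma>_def \<Gamma>1_def \<Gamma>2_def)
    show ?thesis
    proof (rule realizableI[of _ ?w])
      show "?w x \<in> Dom C'" if "x \<in> U" for x
        using that z \<tau>D y sub[OF aut_inv(3)[OF \<rho>]] P(2) by (auto simp: U_def val_def)
    qed (use s in \<open>auto simp: W_def val_def\<close>)
  qed
  have fs: "finsat C' U W (case_sum undefined (case_sum undefined (case_sum y (aut_inv C' \<beta>)))) \<Gamma>"
    unfolding finsat_def
  proof (intro allI impI)
    fix Q assume Q: "Q \<subseteq> \<Gamma>" "finite Q"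
    from ex_conj[OF Q(2) order_trans[OF Q(1) \<Gamma>F] WU] obtain \<psi> where \<psi>: "\<psi> \<in> Form L W"
      "\<forall>(M :: ('f, 'r, 'a) struct) v. Dom M \<noteq> {} \<and> (\<forall>x\<in>W. v x \<in> Dom M) \<longrightarrow>
        (sat M v [] \<psi> \<longleftrightarrow> realizable M U W v Q)" ..
    \<comment> \<open>The value \<open>y b\<close> occurs in \<open>\<alpha> c\<close> at position
      \<open>j (y b)\<close>. With these positions as variables, realizability of \<open>Q\<close>
      becomes one formula over \<open>C\<close>, whose membership in \<open>q\<close> or
      \<open>\<eta> q\<close> can be tested.\<close>
    define \<chi> where "\<chi> = map_fm (case_sum undefined (case_sum undefined (case_sum (\<lambda>b. Inl (j (y b))) Inr))) \<psi>"
    have \<chi>F: "\<chi> \<in> Form L (I <+> Dom C)"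
      unfolding \<chi>_def by (rule Form_map_fm[OF \<psi>(1)]) (use j P(2) in \<open>auto simp: W_def\<close>)
    have s\<chi>: "sat C' (case_sum f x) [] \<chi> \<longleftrightarrow>
        realizable C' U W (case_sum undefined (case_sum undefined (case_sum (\<lambda>b. f (j (y b))) x))) Q"
      if "\<And>i. i \<in> I \<Longrightarrow> f i \<in> Dom C'" "\<And>t. t \<in> P \<Longrightarrow> x t \<in> Dom C'" for f x
    proof -
      let ?v = "case_sum undefined (case_sum undefined (case_sum (\<lambda>b. f (j (y b))) x))"
      have "sat C' (case_sum f x) [] \<chi> \<longleftrightarrow> sat C' ?v [] \<psi>"
        unfolding \<chi>_def sat_map_fm by (rule sat_Form_cong[OF \<psi>(1)]) (auto simp: W_def)
      moreover have "\<forall>t\<in>W. ?v t \<in> Dom C'" using that j by (auto simp: W_def)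
      ultimately show ?thesis using \<psi>(2)[rule_format, of C' ?v] nonempty(2) by simp
    qed
    have vcong: "realizable C' U W v Q = realizable C' U W v' Q" if "\<And>t. t \<in> W \<Longrightarrow> v t = v' t" for v v'
      unfolding realizable_def using that by simp
    \<comment> \<open>A neighbourhood given by a single pair suffices for the finite part
      \<open>Q\<close>.\<close>
    have "{(q, \<chi>)} \<in> FS" using qS \<chi>F by simp
    from near[OF this] obtain \<rho> where \<rho>: "\<rho> \<in> Aut L C" "agree \<eta> \<rho> {(q, \<chi>)} \<and> alt e (act (aut_inv C \<rho>) \<theta>) n \<epsilon>" ..
    have \<rho>P: "aut_inv C \<rho> t \<in> Dom C'" if "t \<in> P" for t using sub aut_inv(3)[OF \<rho>(1)] P(2) that by blast
    have "realizable C' U W (case_sum undefined (case_sum undefined (case_sum y (aut_inv C \<rho>)))) Q"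
      by (rule realizable_mono[OF near'[OF \<rho>(1)] Q(1)]) (use \<rho>(2) in simp)
    also have "realizable C' U W (case_sum undefined (case_sum undefined (case_sum y (aut_inv C \<rho>)))) Q =
        realizable C' U W (case_sum undefined (case_sum undefined (case_sum (\<lambda>b. \<alpha> (c (j (y b)))) (aut_inv C \<rho>)))) Q"
      by (rule vcong) (use j in \<open>auto simp: W_def\<close>)
    also have "\<dots> \<longleftrightarrow> sat C' (case_sum (\<lambda>i. \<alpha> (c i)) (aut_inv C \<rho>)) [] \<chi>"
      by (rule s\<chi>[symmetric, of "\<lambda>i. \<alpha> (c i)"]) (use Aut_D(5)[OF \<alpha>(1) c_Dom(2)] \<rho>P in simp_all)
    also have "\<dots> \<longleftrightarrow> act (aut_inv C \<rho>) \<chi> \<in> q"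
      unfolding q_def mem_tp sat_act using act_FormC[OF Aut_inv[OF mC(3) \<rho>(1)] \<chi>F] by simp
    also have "\<dots> \<longleftrightarrow> \<chi> \<in> \<eta> q"
      using agreeD[of \<eta> \<rho> "{(q, \<chi>)}" q \<chi>] \<rho>(2) type_act_mem[OF \<rho>(1) qS \<chi>F] by simp
    finally have "sat C' (case_sum (\<lambda>i. \<gamma> (c i)) id) [] \<chi>" unfolding \<gamma>(2)[symmetric] mem_tp ..
    then have r: "realizable C' U W (case_sum undefined (case_sum undefined (case_sum (\<lambda>b. \<gamma> (c (j (y b)))) id))) Q"
      by (subst (asm) s\<chi>) (use Aut_D(5)[OF \<gamma>(1) c_Dom(2)] P(2) sub in auto)
    \<comment> \<open>So far the statement is about the entries of \<open>\<gamma> c\<close>.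
      Applying the inverse of \<open>\<beta>\<close> returns them to \<open>y\<close> and shifts the
      parameters instead.\<close>
    let ?v = "case_sum undefined (case_sum undefined (case_sum y (aut_inv C' \<beta>))) :: _ \<Rightarrow> 'a"
      and ?v' = "case_sum undefined (case_sum undefined (case_sum (\<lambda>b. \<gamma> (c (j (y b)))) id)) :: _ \<Rightarrow> 'a"
    have P': "x \<in> Dom C'" if "x \<in> P" for x using that P(2) sub by blast
    have vD: "?v x \<in> Dom C'" if "x \<in> W" for x
      using that y aut_inv(3)[OF \<beta>A] P' by (auto simp: W_def)
    have vv': "?v' x = \<beta> (?v x)" if "x \<in> W" for x
      using that \<beta>y aut_inv(2)[OF \<beta>A] P' by (auto simp: W_def)
    have vD': "?v' x \<in> Dom C'" if "x \<in> W" for x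
      unfolding vv'[OF that] by (rule Aut_D(5)[OF \<beta>A vD[OF that]])
    have "eqt L W C' ?v C' ?v'" by (rule eqt_Aut[OF mC'(3) \<beta>A vD vv'])
    from realizable_transfer[OF eqt_sym[OF this] order_trans[OF Q(1) \<Gamma>F] Q(2) WU nonempty(2,2) vD' vD r]
    show "realizable C' U W ?v Q" .
  qed
  from saturated_realizes[OF mC'(4) Ucard \<Gamma>F WU nonempty(2) fs]
  obtain w where w: "(\<forall>x\<in>U. w x \<in> Dom C') \<and>
    (\<forall>x\<in>W. w x = case_sum undefined (case_sum undefined (case_sum y (aut_inv C' \<beta>))) x) \<and>
    (\<forall>\<phi>\<in>\<Gamma>. sat C' w [] \<phi>)" unfolding realizable_def ..
  define z where "z x = w (Inl x)" for x
  define a where "a b = w (Inr (Inl b))" for b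
  have zD: "z x \<in> Dom C'" if "x \<in> I" for x using w that by (simp add: z_def U_def InlI)
  have aD: "a b \<in> Dom C'" if "b \<in> B" for b using w that by (simp add: a_def U_def InlI InrI)
  have wy: "w (Inr (Inr (Inl b))) = y b" if "b \<in> B" for b
  proof -
    have "Inr (Inr (Inl b)) \<in> W" using that by (simp add: W_def InlI)
    with w show ?thesis by simp
  qed
  have wP: "w (Inr (Inr (Inr x))) = aut_inv C' \<beta> x" if "x \<in> P" for x
  proof -
    have "Inr (Inr (Inr x)) \<in> W" using that by (simp add: W_def InrI)
    with w show ?thesis by simp
  qed
  have "eqt L I C' c C' z"
  proof -
    have imp: "sat C' z [] \<phi>" if "\<phi> \<in> Form L I" "sat C' c [] \<phi>" for \<phi>
    proof -
      have "map_fm Inl \<phi> \<in> \<Gamma>" using that by (auto simp: \<Gamma>_def \<Gamma>1_def)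
      with w have "sat C' w [] (map_fm Inl \<phi>)" by simp
      then show ?thesis unfolding sat_map_fm by (simp add: comp_def z_def[symmetric])
    qed
    show ?thesis unfolding eqt_def
    proof
      fix \<phi> :: "('f, 'r, 'i) fm" assume \<phi>: "\<phi> \<in> Form L I"
      show "sat C' c [] \<phi> \<longleftrightarrow> sat C' z [] \<phi>" using imp[OF \<phi>] imp[of "Neg \<phi>"] \<phi> by auto
    qed
  qed
  note zc = eqt_sym[OF this]
  have za: "eqt L (I <+> B) C' (case_sum z y) C' (case_sum z a)"
    unfolding eqt_def
  proof
    fix \<phi> :: "('f, 'r, 'i + nat \<times> 'i) fm" assume \<phi>: "\<phi> \<in> Form L (I <+> B)"
    then have "ev \<phi> \<in> \<Gamma>" by (simp add: \<Gamma>_def \<Gamma>2_def)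
    with w have "sat C' w [] (ev \<phi>)" by simp
    moreover have "sat C' (case_sum z (\<lambda>b. w (Inr (Inr (Inl b))))) [] \<phi> \<longleftrightarrow> sat C' (case_sum z y) [] \<phi>"
      by (rule sat_Form_cong[OF \<phi>]) (auto simp: wy)
    ultimately show "sat C' (case_sum z y) [] \<phi> \<longleftrightarrow> sat C' (case_sum z a) [] \<phi>"
      unfolding sev by (simp add: z_def[symmetric] a_def[symmetric])
  qed
  from Autf_L_of_model[OF card_finite_less[OF mC'(2) B] y aD zD zc za]
  obtain \<tau> where \<tau>: "\<tau> \<in> Autf_L L \<kappa>' C'" "\<forall>b\<in>B. \<tau> (y b) = a b" ..
  \<comment> \<open>Composing with \<open>\<beta>\<close> restores the original parameters; as
    \<open>\<beta>\<close> is Lascar strong, the result is still an admissible conjugation.\<close>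
  define \<tau>' where "\<tau>' = compose (Dom C') \<beta> \<tau>"
  have \<tau>': "\<tau>' \<in> Autf_L L \<kappa>' C'" unfolding \<tau>'_def by (rule Autf_L_closed(2)[OF mC'(3) \<beta> \<tau>(1)])
  have tr: "tr e \<theta> \<tau>' k \<longleftrightarrow> sat C' w [] (fk k)" if k: "k < n" for k
  proof -
    have kB: "(k, i) \<in> B" if "i \<in> J" for i using that k by (simp add: B_def)
    let ?w = "case_sum (\<lambda>i. w (Inr (Inl (k, i)))) (\<lambda>x. w (Inr (Inr (Inr x))))"
    have q: "eqt L (J <+> P) C' ?w C' (case_sum (\<lambda>i. \<tau>' (e k i)) id)"
    proof (rule eqt_Aut[OF mC'(3) \<beta>A])
      fix x assume "x \<in> J <+> P"
      then consider i where "x = Inl i" "i \<in> J" | t where "x = Inr t" "t \<in> P" by auto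
      then have "?w x \<in> Dom C' \<and> case_sum (\<lambda>i. \<tau>' (e k i)) id x = \<beta> (?w x)"
      proof cases
        case 1
        have "\<tau> (e k i) = a (k, i)" using \<tau>(2) kB[OF 1(2)] by (auto simp: y_def)
        then have "\<tau>' (e k i) = \<beta> (a (k, i))"
          using morley_Dom[OF m] 1(2) J(2) by (simp add: \<tau>'_def compose_eq subset_eq)
        then show ?thesis using aD[OF kB[OF 1(2)]] by (simp add: 1(1) a_def)
      next
        case 2
        then have "t \<in> Dom C'" using P(2) sub by blast
        then show ?thesis using aut_inv[OF \<beta>A] by (simp add: 2 wP)
      qed
      then show "?w x \<in> Dom C'" "case_sum (\<lambda>i. \<tau>' (e k i)) id x = \<beta> (?w x)" by simp_all
    qed
    show ?thesis unfolding tr_def sk using eqtD[OF q \<theta>JP] by simp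
  qed
  have "\<forall>\<phi>\<in>\<Lambda>. sat C' w [] \<phi>" using w by (simp add: \<Gamma>_def)
  then have s: "(\<forall>k. Suc k < n \<longrightarrow> sat C' w [] (fk (Suc k)) \<noteq> sat C' w [] (fk k)) \<and>
    (0 < n \<longrightarrow> sat C' w [] (fk (n - 1)) = \<epsilon>)" unfolding s\<Lambda> .
  have "alt e \<theta> n \<epsilon>" unfolding alt_def
  proof (intro bexI[OF _ \<tau>'] conjI allI impI)
    show "tr e \<theta> \<tau>' (Suc k) \<noteq> tr e \<theta> \<tau>' k" if "Suc k < n" for k
      using tr[OF that] tr[of k] s that by simp
    show "tr e \<theta> \<tau>' (n - 1) = \<epsilon>" if "0 < n" using tr[of "n - 1"] s that by simp
  qed
  with no show False ..
qed

end

section \<open>The kernel of the natural epimorphism\<close>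

context monster_pair
begin

lemma agree_mono: "agree \<eta> \<rho> G \<Longrightarrow> F \<subseteq> G \<Longrightarrow> agree \<eta> \<rho> F"
  unfolding agree_def by blast

lemma act_aut_inv_compose:
  assumes \<sigma>: "\<sigma> \<in> Aut L C" and \<rho>: "\<rho> \<in> Aut L C" and \<phi>: "\<phi> \<in> Form L (I <+> Dom C)"
  shows "act (aut_inv C (compose (Dom C) \<sigma> \<rho>)) \<phi> = act (aut_inv C \<rho>) (act (aut_inv C \<sigma>) \<phi>)"
  unfolding act_act
proof (rule act_cong[OF \<phi>])
  fix x assume x: "x \<in> Dom C"
  define y where "y = aut_inv C \<rho> (aut_inv C \<sigma> x)"
  have y: "y \<in> Dom C" unfolding y_def by (intro aut_inv(3)[OF \<rho>] aut_inv(3)[OF \<sigma>] x)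
  have "compose (Dom C) \<sigma> \<rho> y = x"
    using y aut_inv(2)[OF \<rho> aut_inv(3)[OF \<sigma> x]] aut_inv(2)[OF \<sigma> x] by (simp add: compose_eq y_def)
  with aut_inv(1)[OF Aut_compose[OF mC(3) \<sigma> \<rho>] y]
  show "aut_inv C (compose (Dom C) \<sigma> \<rho>) x = aut_inv C \<rho> (aut_inv C \<sigma> x)" by (simp add: y_def)
qed

lemma global_ext_Form:
  assumes R: "global_ext p R" and \<theta>: "\<theta> \<in> Form L (I <+> Dom C)"
  shows "\<theta> \<in> R \<longleftrightarrow> \<theta> \<in> p"
proof -
  have p: "p \<in> S" "p \<subseteq> R" using R by (simp_all add: global_ext_def)
  have "Dom C \<subseteq> Dom C'" using sub by (rule subsetI)
  from realizes_exists[OF R this small] obtain z where z: "realizes R (Dom C) z" ..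
  have iff: "\<phi> \<in> R \<longleftrightarrow> sat C' (case_sum z id) [] \<phi>" if "\<phi> \<in> Form L (I <+> Dom C)" for \<phi>
    using z that by (simp add: realizes_def)
  show ?thesis
  proof
    assume t: "\<theta> \<in> R"
    show "\<theta> \<in> p"
    proof (rule ccontr)
      assume "\<theta> \<notin> p"
      then have "Neg \<theta> \<in> R" using S_Neg[OF p(1) \<theta>] p(2) by auto
      then show False using iff[OF \<theta>] iff[of "Neg \<theta>"] \<theta> t by simp
    qed
  qed (rule subsetD[OF p(2)])
qed

text \<open>By \<open>alt_closed\<close>, absence of an alternation persists near
  \<open>\<eta>\<close>. At length \<open>alt_rank e \<theta>\<close> it is used for both final
  values and bounds the new rank. One step below it is used for the wrong final value, which forces
  the right one when the rank does not drop.\<close>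

lemma alt_rank_upper_semicontinuous:
  assumes R: "global_ext p R" and m: "morley R A e" and \<theta>: "\<theta> \<in> Form L (I <+> Dom C)"
    and \<eta>: "\<eta> \<in> E" and \<sigma>: "\<sigma> \<in> Autf_L L \<kappa>' C'" "\<eta> p0 = tp L C' I (\<lambda>x. \<sigma> (c x)) (Dom C)"
    and nip: "NIP L T TYPE('a)"
  shows "\<exists>F\<in>FS. \<forall>\<rho>\<in>Aut L C. agree \<eta> \<rho> F \<longrightarrow>
    alt_rank e (act (aut_inv C \<rho>) \<theta>) \<le> alt_rank e \<theta> \<and>
    (alt_rank e (act (aut_inv C \<rho>) \<theta>) = alt_rank e \<theta> \<longrightarrow> (act (aut_inv C \<rho>) \<theta> \<in> R \<longleftrightarrow> \<theta> \<in> R))"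
proof -
  let ?n = "alt_rank e \<theta>"
  have CC: "\<phi> \<in> Form L (I <+> Dom C')" if "\<phi> \<in> Form L (I <+> Dom C)" for \<phi>
    by (rule Form_mono[OF that]) (use sub in auto)
  note rk = alt_rank[OF R m _ nip]
  note closed = alt_closed[OF R m \<theta> \<eta> \<sigma>]
  from closed[OF rk(1)[OF CC[OF \<theta>], of True]] obtain F1 where F1: "F1 \<in> FS"
    "\<forall>\<rho>\<in>Aut L C. agree \<eta> \<rho> F1 \<longrightarrow> \<not> alt e (act (aut_inv C \<rho>) \<theta>) ?n True" ..
  from closed[OF rk(1)[OF CC[OF \<theta>], of False]] obtain F2 where F2: "F2 \<in> FS"
    "\<forall>\<rho>\<in>Aut L C. agree \<eta> \<rho> F2 \<longrightarrow> \<not> alt e (act (aut_inv C \<rho>) \<theta>) ?n False" ..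
  from closed[OF rk(3)[OF CC[OF \<theta>]]] obtain F3 where F3: "F3 \<in> FS"
    "\<forall>\<rho>\<in>Aut L C. agree \<eta> \<rho> F3 \<longrightarrow> \<not> alt e (act (aut_inv C \<rho>) \<theta>) (?n - 1) (\<theta> \<notin> R)" ..
  show ?thesis
  proof (intro bexI ballI impI conjI)
    show "F1 \<union> F2 \<union> F3 \<in> FS" using F1(1) F2(1) F3(1) by simp
    fix \<rho> assume \<rho>: "\<rho> \<in> Aut L C" "agree \<eta> \<rho> (F1 \<union> F2 \<union> F3)"
    let ?\<theta> = "act (aut_inv C \<rho>) \<theta>"
    have t: "\<not> alt e ?\<theta> ?n True" by (rule F1(2)[rule_format, OF \<rho>(1) agree_mono[OF \<rho>(2)]]) auto
    have f: "\<not> alt e ?\<theta> ?n False" by (rule F2(2)[rule_format, OF \<rho>(1) agree_mono[OF \<rho>(2)]]) auto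
    have n: "\<not> alt e ?\<theta> (?n - 1) (\<theta> \<notin> R)" by (rule F3(2)[rule_format, OF \<rho>(1) agree_mono[OF \<rho>(2)]]) auto
    show "alt_rank e ?\<theta> \<le> ?n"
    proof (rule alt_rank_le)
      show "\<not> alt e ?\<theta> ?n \<epsilon>" for \<epsilon> using t f by (cases \<epsilon>) simp_all
    qed
    assume eq: "alt_rank e ?\<theta> = ?n"
    have "alt e ?\<theta> (?n - 1) (?\<theta> \<in> R)"
      using rk(2)[OF CC[OF act_FormC[OF Aut_inv[OF mC(3) \<rho>(1)] \<theta>]]] by (simp only: eq)
    then show "?\<theta> \<in> R \<longleftrightarrow> \<theta> \<in> R" using n by (cases "?\<theta> \<in> R"; cases "\<theta> \<in> R") simp_all
  qed
qed

end

context bounded_ideal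
begin

lemma kernel_Autf_L:
  assumes \<eta>: "\<eta> \<in> E" and one: "Fh \<eta> = \<one>\<^bsub>Gal\<^esub>"
  shows "\<exists>\<sigma>\<in>Autf_L L \<kappa>' C'. \<eta> p0 = tp L C' I (\<lambda>x. \<sigma> (c x)) (Dom C)"
proof -
  from EL_realized[OF \<eta> p0_S] obtain \<sigma> where \<sigma>: "\<sigma> \<in> Aut L C'" "tp L C' I (\<lambda>x. \<sigma> (c x)) (Dom C) = \<eta> p0" ..
  have "cls \<sigma> = \<one>\<^bsub>Gal\<^esub>" using F_hat_eq[where \<eta> = \<eta>, OF KP_eq \<sigma>(1) \<sigma>(2)[symmetric]] one by simp
  from cls_one_iff[OF \<sigma>(1) this] show ?thesis using \<sigma>(2) by (intro bexI[of _ \<sigma>]) simp_all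
qed

lemma kernel_approx:
  assumes \<eta>: "\<eta> \<in> M" and one: "Fh \<eta> = \<one>\<^bsub>Gal\<^esub>" and nip: "NIP L T TYPE('a)" and F: "F \<in> FS"
  shows "\<exists>\<sigma>\<in>Aut L C. \<forall>(q, \<phi>)\<in>F. \<phi> \<in> type_act \<sigma> (\<eta> q) \<longleftrightarrow> \<phi> \<in> type_act \<sigma> (u q)"
proof -
  from kernel_Autf_L[OF M_E[OF \<eta>] one] obtain \<tau> where
    \<tau>: "\<tau> \<in> Autf_L L \<kappa>' C'" "\<eta> p0 = tp L C' I (\<lambda>x. \<tau> (c x)) (Dom C)" ..
  have "\<forall>q\<in>S. \<exists>R. global_ext (u q) R" using ideal_global_ext[OF u] by simp
  from bchoice[OF this] obtain R where R: "\<forall>q\<in>S. global_ext (u q) (R q)" ..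
  have "\<forall>q\<in>S. \<exists>e A. morley (R q) A e"
    using morley_exists[OF bspec[OF R]] by (subst ex_comm) simp
  from bchoice[OF this] obtain e where e: "\<forall>q\<in>S. \<exists>A. morley (R q) A (e q)" ..
  define rk where "rk \<sigma> x = alt_rank (e (fst x)) (act (aut_inv C \<sigma>) (snd x))" for \<sigma> x
  \<comment> \<open>Ranks are natural numbers and \<open>F\<close> is finite, so the sum of ranks
    attains its minimum over all automorphisms.\<close>
  from ex_has_least_nat[of "\<lambda>\<sigma>. \<sigma> \<in> Aut L C", OF id_Aut[OF mC(3)], of "\<lambda>\<sigma>. sum (rk \<sigma>) F"]
  obtain \<sigma> where \<sigma>: "\<sigma> \<in> Aut L C \<and> (\<forall>\<rho>. \<rho> \<in> Aut L C \<longrightarrow> sum (rk \<sigma>) F \<le> sum (rk \<rho>) F)" ..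
  define \<theta> where "\<theta> x = act (aut_inv C \<sigma>) (snd x)" for x :: "('f, 'r, 'i + 'a) fm set \<times> ('f, 'r, 'i + 'a) fm"
  have xF: "fst x \<in> S" "snd x \<in> Form L (I <+> Dom C)" if "x \<in> F" for x using F that by auto
  have \<theta>F: "\<theta> x \<in> Form L (I <+> Dom C)" if "x \<in> F" for x
    unfolding \<theta>_def using \<sigma> by (intro act_FormC Aut_inv[OF mC(3)] xF[OF that]) simp
  have "\<forall>x\<in>F. \<exists>G. G \<in> FS \<and> (\<forall>\<rho>\<in>Aut L C. agree \<eta> \<rho> G \<longrightarrow>
    alt_rank (e (fst x)) (act (aut_inv C \<rho>) (\<theta> x)) \<le> alt_rank (e (fst x)) (\<theta> x) \<and>
    (alt_rank (e (fst x)) (act (aut_inv C \<rho>) (\<theta> x)) = alt_rank (e (fst x)) (\<theta> x) \<longrightarrow>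
      (act (aut_inv C \<rho>) (\<theta> x) \<in> R (fst x) \<longleftrightarrow> \<theta> x \<in> R (fst x))))"
  proof
    fix x assume x: "x \<in> F"
    from bspec[OF e xF(1)[OF x]] obtain A where A: "morley (R (fst x)) A (e (fst x))" ..
    from alt_rank_upper_semicontinuous[OF bspec[OF R xF(1)[OF x]] A \<theta>F[OF x] M_E[OF \<eta>] \<tau> nip]
    show "\<exists>G. G \<in> FS \<and> (\<forall>\<rho>\<in>Aut L C. agree \<eta> \<rho> G \<longrightarrow>
      alt_rank (e (fst x)) (act (aut_inv C \<rho>) (\<theta> x)) \<le> alt_rank (e (fst x)) (\<theta> x) \<and>
      (alt_rank (e (fst x)) (act (aut_inv C \<rho>) (\<theta> x)) = alt_rank (e (fst x)) (\<theta> x) \<longrightarrow>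
        (act (aut_inv C \<rho>) (\<theta> x) \<in> R (fst x) \<longleftrightarrow> \<theta> x \<in> R (fst x))))" unfolding Bex_def .
  qed
  from bchoice[OF this] obtain G where G: "\<forall>x\<in>F. G x \<in> FS \<and> (\<forall>\<rho>\<in>Aut L C. agree \<eta> \<rho> (G x) \<longrightarrow>
    alt_rank (e (fst x)) (act (aut_inv C \<rho>) (\<theta> x)) \<le> alt_rank (e (fst x)) (\<theta> x) \<and>
    (alt_rank (e (fst x)) (act (aut_inv C \<rho>) (\<theta> x)) = alt_rank (e (fst x)) (\<theta> x) \<longrightarrow>
      (act (aut_inv C \<rho>) (\<theta> x) \<in> R (fst x) \<longleftrightarrow> \<theta> x \<in> R (fst x))))" ..
  \<comment> \<open>Besides the neighbourhoods for the ranks, \<open>\<rho>\<close> must approximate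
    \<open>\<eta>\<close> at the points \<open>u q\<close>, where the invariant types decide
    membership.\<close>
  define H where "H = (\<Union>x\<in>F. G x) \<union> (\<lambda>x. (u (fst x), \<theta> x)) ` F"
  have uS: "u q \<in> S" "\<eta> q \<in> S" if "q \<in> S" for q using EL_S[OF M_E[OF u] that] EL_S[OF M_E[OF \<eta>] that] by simp_all
  have G1: "finite (G x)" "G x \<subseteq> S \<times> Form L (I <+> Dom C)" if "x \<in> F" for x using bspec[OF G that] by simp_all
  have "finite H" unfolding H_def using F G1(1) by simp
  moreover have "H \<subseteq> S \<times> Form L (I <+> Dom C)"
    unfolding H_def using G1(2) uS(1)[OF xF(1)] \<theta>F by (intro Un_least UN_least image_subsetI SigmaI) simp_all
  ultimately have "\<exists>\<rho>\<in>Aut L C. agree \<eta> \<rho> H" by (rule EL_approx[OF M_E[OF \<eta>]])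
  then obtain \<rho> where \<rho>: "\<rho> \<in> Aut L C" "agree \<eta> \<rho> H" ..
  have G2: "alt_rank (e (fst x)) (act (aut_inv C \<rho>) (\<theta> x)) \<le> alt_rank (e (fst x)) (\<theta> x)"
    "alt_rank (e (fst x)) (act (aut_inv C \<rho>) (\<theta> x)) = alt_rank (e (fst x)) (\<theta> x) \<Longrightarrow>
      act (aut_inv C \<rho>) (\<theta> x) \<in> R (fst x) \<longleftrightarrow> \<theta> x \<in> R (fst x)" if x: "x \<in> F" for x
  proof -
    have "agree \<eta> \<rho> (G x)" by (rule agree_mono[OF \<rho>(2)]) (use x in \<open>auto simp: H_def\<close>)
    from mp[OF bspec[OF conjunct2[OF bspec[OF G x]] \<rho>(1)] this]
    show "alt_rank (e (fst x)) (act (aut_inv C \<rho>) (\<theta> x)) \<le> alt_rank (e (fst x)) (\<theta> x)"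
      "alt_rank (e (fst x)) (act (aut_inv C \<rho>) (\<theta> x)) = alt_rank (e (fst x)) (\<theta> x) \<Longrightarrow>
        act (aut_inv C \<rho>) (\<theta> x) \<in> R (fst x) \<longleftrightarrow> \<theta> x \<in> R (fst x)" by simp_all
  qed
  define \<sigma>\<rho> where "\<sigma>\<rho> = compose (Dom C) \<sigma> \<rho>"
  have \<sigma>A: "\<sigma> \<in> Aut L C" using \<sigma> ..
  have rk\<rho>: "rk \<sigma>\<rho> x = alt_rank (e (fst x)) (act (aut_inv C \<rho>) (\<theta> x))" if "x \<in> F" for x
    unfolding rk_def \<sigma>\<rho>_def \<theta>_def by (simp only: act_aut_inv_compose[OF \<sigma>A \<rho>(1) xF(2)[OF that]])
  have rk\<sigma>: "rk \<sigma> x = alt_rank (e (fst x)) (\<theta> x)" for x by (simp add: rk_def \<theta>_def)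
  have le: "rk \<sigma>\<rho> x \<le> rk \<sigma> x" if "x \<in> F" for x using G2(1)[OF that] by (simp only: rk\<rho>[OF that] rk\<sigma>)
  \<comment> \<open>The product of \<open>\<sigma>\<close> and \<open>\<rho>\<close> competes with
    the minimizer. No rank increases, hence none decreases either.\<close>
  have "sum (rk \<sigma>) F \<le> sum (rk \<sigma>\<rho>) F"
    using \<sigma> Aut_compose[OF mC(3) \<sigma>A \<rho>(1)] by (simp add: \<sigma>\<rho>_def)
  then have "sum (rk \<sigma>\<rho>) F = sum (rk \<sigma>) F" using sum_mono[of F "rk \<sigma>\<rho>" "rk \<sigma>"] le by (intro antisym) simp_all
  then have eq: "rk \<sigma>\<rho> x = rk \<sigma> x" if "x \<in> F" for x
    using sum_mono_inv[of "rk \<sigma>\<rho>" F "rk \<sigma>" x] le that F by simp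
  have "\<phi> \<in> type_act \<sigma> (\<eta> q) \<longleftrightarrow> \<phi> \<in> type_act \<sigma> (u q)" if x: "(q, \<phi>) \<in> F" for q \<phi>
  proof -
    note q = xF(1)[OF x, simplified] and \<phi> = xF(2)[OF x, simplified]
    let ?\<theta> = "act (aut_inv C \<sigma>) \<phi>"
    have \<theta>x: "\<theta> (q, \<phi>) = ?\<theta>" by (simp add: \<theta>_def)
    have \<theta>C: "?\<theta> \<in> Form L (I <+> Dom C)" using \<theta>F[OF x] by (simp only: \<theta>x)
    have \<rho>\<theta>C: "act (aut_inv C \<rho>) ?\<theta> \<in> Form L (I <+> Dom C)" by (rule act_FormC[OF Aut_inv[OF mC(3) \<rho>(1)] \<theta>C])
    have "act (aut_inv C \<rho>) ?\<theta> \<in> R q \<longleftrightarrow> ?\<theta> \<in> R q"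
      using G2(2)[OF x] eq[OF x] unfolding rk\<rho>[OF x] rk\<sigma> by (simp add: \<theta>x)
    then have a: "act (aut_inv C \<rho>) ?\<theta> \<in> u q \<longleftrightarrow> ?\<theta> \<in> u q"
      using global_ext_Form[OF bspec[OF R q]] \<theta>C \<rho>\<theta>C by simp
    have "(u q, ?\<theta>) \<in> H" unfolding H_def using x by (intro UnI2 image_eqI[of _ _ "(q, \<phi>)"]) (simp_all add: \<theta>x)
    then have "?\<theta> \<in> \<eta> (u q) \<longleftrightarrow> ?\<theta> \<in> type_act \<rho> (u q)" by (rule agreeD[OF \<rho>(2)])
    also have "\<dots> \<longleftrightarrow> ?\<theta> \<in> u q" using type_act_mem[OF \<rho>(1) uS(1)[OF q] \<theta>C] a by simp
    \<comment> \<open>Here \<open>\<eta> \<in> M\<close> is essential: \<open>u\<close> is a right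
      identity of the ideal.\<close>
    also have "\<eta> (u q) = \<eta> q" using fun_cong[OF M_u[OF \<eta>], of q] q by (simp add: compose_eq)
    finally show ?thesis by (simp only: type_act_mem[OF \<sigma>A uS(2)[OF q] \<phi>] type_act_mem[OF \<sigma>A uS(1)[OF q] \<phi>])
  qed
  then show ?thesis using \<sigma>A by (intro bexI[of _ \<sigma>]) auto
qed

text \<open>Each pair of a type and a formula gives the set \<open>B\<close> of automorphisms that
  do not separate \<open>\<eta>\<close> from \<open>u\<close> there. \<open>kernel_approx\<close> is
  the finite intersection property of these sets, and \<open>EL_limit\<close> produces a limit
  respecting all of them.\<close>

lemma kernel_collapse:
  assumes \<eta>: "\<eta> \<in> M" and one: "Fh \<eta> = \<one>\<^bsub>Gal\<^esub>" and nip: "NIP L T TYPE('a)"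
  shows "\<exists>\<xi>\<in>E. compose S \<xi> \<eta> = compose S \<xi> u"
proof -
  define B where "B x = {\<sigma>. snd x \<in> type_act \<sigma> (\<eta> (fst x)) \<longleftrightarrow> snd x \<in> type_act \<sigma> (u (fst x))}" for x
  have "\<exists>\<xi>\<in>E. \<forall>A\<in>B ` (S \<times> Form L (I <+> Dom C)). \<forall>F\<in>FS. \<exists>\<sigma>\<in>Aut L C. \<sigma> \<in> A \<and> agree \<xi> \<sigma> F"
  proof (rule EL_limit)
    fix G assume G: "finite G" "G \<subseteq> B ` (S \<times> Form L (I <+> Dom C))"
    from finite_subset_image[OF this] obtain F where F: "F \<subseteq> S \<times> Form L (I <+> Dom C) \<and> finite F \<and> G = B ` F" ..
    then have "F \<in> FS" by simp
    from kernel_approx[OF \<eta> one nip this] obtain \<sigma> where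
      \<sigma>: "\<sigma> \<in> Aut L C" "\<forall>(q, \<phi>)\<in>F. \<phi> \<in> type_act \<sigma> (\<eta> q) \<longleftrightarrow> \<phi> \<in> type_act \<sigma> (u q)" ..
    have "\<sigma> \<in> A" if "A \<in> G" for A
    proof -
      from that F obtain x where x: "x \<in> F" "A = B x" by auto
      show ?thesis using bspec[OF \<sigma>(2) x(1)] by (cases x) (simp add: x(2) B_def)
    qed
    then show "\<exists>\<sigma>\<in>Aut L C. \<forall>A\<in>G. \<sigma> \<in> A" using \<sigma>(1) by (intro bexI[of _ \<sigma>]) simp_all
  qed
  then obtain \<xi> where \<xi>: "\<xi> \<in> E"
    "\<forall>A\<in>B ` (S \<times> Form L (I <+> Dom C)). \<forall>F\<in>FS. \<exists>\<sigma>\<in>Aut L C. \<sigma> \<in> A \<and> agree \<xi> \<sigma> F" ..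
  have "\<xi> (\<eta> q) = \<xi> (u q)" if q: "q \<in> S" for q
  proof -
    note uq = EL_S[OF M_E[OF u] q] and \<eta>q = EL_S[OF M_E[OF \<eta>] q]
    show ?thesis
    proof (rule S_ext[OF EL_S[OF \<xi>(1) \<eta>q] EL_S[OF \<xi>(1) uq]])
      fix \<phi> assume \<phi>: "\<phi> \<in> Form L (I <+> Dom C)"
      \<comment> \<open>The same \<open>\<sigma>\<close> has to approximate \<open>\<xi>\<close> at
        both \<open>\<eta> q\<close> and \<open>u q\<close> while lying in the set \<open>B\<close>
        for this pair.\<close>
      let ?F = "{(\<eta> q, \<phi>), (u q, \<phi>)}"
      have "B (q, \<phi>) \<in> B ` (S \<times> Form L (I <+> Dom C))" "?F \<in> FS" using q \<phi> uq \<eta>q by simp_all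
      from bspec[OF bspec[OF \<xi>(2) this(1)] this(2)] obtain \<sigma> where
        \<sigma>: "\<sigma> \<in> Aut L C" "\<sigma> \<in> B (q, \<phi>) \<and> agree \<xi> \<sigma> ?F" ..
      have "\<phi> \<in> \<xi> (\<eta> q) \<longleftrightarrow> \<phi> \<in> type_act \<sigma> (\<eta> q)" "\<phi> \<in> \<xi> (u q) \<longleftrightarrow> \<phi> \<in> type_act \<sigma> (u q)"
        by (rule agreeD[OF conjunct2[OF \<sigma>(2)]]; simp)+
      with \<sigma>(2) show "\<phi> \<in> \<xi> (\<eta> q) \<longleftrightarrow> \<phi> \<in> \<xi> (u q)" by (simp add: B_def)
    qed
  qed
  then have "compose S \<xi> \<eta> = compose S \<xi> u" by (intro ext) (simp add: compose_def)
  with \<xi>(1) show ?thesis by (intro bexI[of _ \<xi>])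
qed

lemma kernel_trivial:
  assumes \<eta>: "\<eta> \<in> uM" and one: "Fh \<eta> = \<one>\<^bsub>Gal\<^esub>" and nip: "NIP L T TYPE('a)"
  shows "\<eta> = u"
proof -
  from kernel_collapse[OF uM_M[OF \<eta>] one nip] obtain \<xi> where \<xi>: "\<xi> \<in> E" "compose S \<xi> \<eta> = compose S \<xi> u" ..
  note \<eta>E = uM_E[OF \<eta>] and uE = M_E[OF u]
  \<comment> \<open>\<open>\<xi>\<close> need not lie in the ideal; multiplied by \<open>u\<close>
    on both sides it becomes an element of the group that can be cancelled.\<close>
  define x where "x = compose S u (compose S \<xi> u)"
  have "x \<in> uM" unfolding x_def uM_def using M_ideal[OF \<xi>(1) u] by (rule imageI)
  from uM_left_inverse[OF this] obtain y where y: "y \<in> uM" "compose S y x = u" ..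
  have "compose S x \<eta> = compose S u (compose S \<xi> (compose S u \<eta>))"
    unfolding x_def using EL_assoc[OF \<eta>E, of u "compose S \<xi> u"] EL_assoc[OF \<eta>E, of \<xi> u] by simp
  then have x\<eta>: "compose S x \<eta> = x" by (simp only: uM_u[OF \<eta>] \<xi>(2) x_def)
  have "\<eta> = compose S (compose S y x) \<eta>" by (simp only: y(2) uM_u[OF \<eta>])
  also have "\<dots> = compose S y (compose S x \<eta>)" by (rule EL_assoc[OF \<eta>E, symmetric])
  also have "\<dots> = u" by (simp only: x\<eta> y(2))
  finally show ?thesis .
qed

lemma F_hat_inj_on:
  assumes nip: "NIP L T TYPE('a)"
  shows "inj_on Fh uM"
proof (rule inj_onI)
  fix x y assume x: "x \<in> uM" and y: "y \<in> uM" and eq: "Fh x = Fh y"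
  from uM_left_inverse[OF y] obtain y' where y': "y' \<in> uM" "compose S y' y = u" ..
  have "Fh (compose S y' x) = Fh (compose S y' y)"
    by (simp only: F_hat_mult[OF KP_eq uM_E[OF y'(1)]] uM_E[OF x] uM_E[OF y] eq)
  then have "Fh (compose S y' x) = \<one>\<^bsub>Gal\<^esub>" by (simp only: y'(2) F_hat_u)
  from kernel_trivial[OF uM_mult[OF y'(1) x] this nip] have y'x: "compose S y' x = u" .
  have "x = compose S (compose S y y') x" by (simp only: uM_right_cancel[OF y y'] uM_u[OF x])
  also have "\<dots> = compose S y u" unfolding EL_assoc[OF uM_E[OF x], symmetric] y'x ..
  also have "\<dots> = y" by (rule M_u[OF uM_M[OF y]])
  finally show "x = y" .
qed

lemma F_hat_image: "Fh ` uM = carrier Gal"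
proof
  show "Fh ` uM \<subseteq> carrier Gal" using F_hat_carrier[OF KP_eq uM_E] by (rule image_subsetI)
  show "carrier Gal \<subseteq> Fh ` uM"
  proof
    fix X assume X: "X \<in> carrier Gal"
    from F_hat_surj[OF KP_eq X] obtain \<eta> where \<eta>: "\<eta> \<in> E" "Fh \<eta> = X" ..
    note uE = M_E[OF u]
    \<comment> \<open>Multiplying by \<open>u\<close> on both sides moves \<open>\<eta>\<close> into
      the group and keeps its image, since \<open>u\<close> maps to the identity.\<close>
    have \<eta>u: "compose S \<eta> u \<in> E" by (rule EL_compose[OF \<eta>(1) uE])
    have "Fh (compose S u (compose S \<eta> u)) = \<one>\<^bsub>Gal\<^esub> \<otimes>\<^bsub>Gal\<^esub> (X \<otimes>\<^bsub>Gal\<^esub> \<one>\<^bsub>Gal\<^esub>)"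
      by (simp only: F_hat_mult[OF KP_eq uE \<eta>u] F_hat_mult[OF KP_eq \<eta>(1) uE] F_hat_u \<eta>(2))
    also have "\<dots> = X"
      using monoid.l_one[OF group.is_monoid[OF group_Gal]] monoid.r_one[OF group.is_monoid[OF group_Gal]] X by metis
    finally have "X = Fh (compose S u (compose S \<eta> u))" ..
    moreover have "compose S u (compose S \<eta> u) \<in> uM"
      unfolding uM_def by (rule imageI[OF M_ideal[OF \<eta>(1) u]])
    ultimately show "X \<in> Fh ` uM" by (rule image_eqI)
  qed
qed

lemma F_hat_iso:
  assumes nip: "NIP L T TYPE('a)"
  shows "restrict Fh (carrier (ideal_group (EL L C C' I c) M u))
    \<in> iso (ideal_group (EL L C C' I c) M u) (Gal_KP L \<kappa>' C')"
proof -
  have car: "carrier (ideal_group (EL L C C' I c) M u) = uM"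
    by (simp add: ideal_group_def EL_mult uM_def)
  have mul: "x \<otimes>\<^bsub>ideal_group (EL L C C' I c) M u\<^esub> y = compose S x y" for x y
    by (simp add: ideal_group_def EL_mult[symmetric])
  have gal: "Gal_KP L \<kappa>' C' = Gal" by (simp only: Gal_KP_def KP_eq)
  have "restrict Fh uM \<in> hom (ideal_group (EL L C C' I c) M u) Gal"
  proof (rule homI)
    fix x y assume "x \<in> carrier (ideal_group (EL L C C' I c) M u)" "y \<in> carrier (ideal_group (EL L C C' I c) M u)"
    then have xy: "x \<in> uM" "y \<in> uM" by (simp_all only: car)
    show "restrict Fh uM x \<in> carrier Gal" using F_hat_carrier[OF KP_eq uM_E[OF xy(1)]] xy(1) by simp
    show "restrict Fh uM (x \<otimes>\<^bsub>ideal_group (EL L C C' I c) M u\<^esub> y) = restrict Fh uM x \<otimes>\<^bsub>Gal\<^esub> restrict Fh uM y"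
      using F_hat_mult[OF KP_eq uM_E[OF xy(1)] uM_E[OF xy(2)]] uM_mult[OF xy] xy
      by (simp only: mul restrict_apply' if_True)
  qed
  moreover have "bij_betw (restrict Fh uM) uM (carrier Gal)"
    using F_hat_inj_on[OF nip] F_hat_image by (simp add: bij_betw_def)
  ultimately show ?thesis unfolding iso_def gal car by simp
qed

end

theorem theorem1p7:
  fixes L :: "('f, 'r) lang" and T :: "('f, 'r, nat) fm set"
    and C C' :: "('f, 'r, 'a) struct" and \<kappa> :: "'k rel" and \<kappa>' :: "'l rel"
    and I :: "'i set" and c :: "'i \<Rightarrow> 'a"
    and M :: "(('f, 'r, 'i + 'a) fm set \<Rightarrow> ('f, 'r, 'i + 'a) fm set) set"
    and u :: "('f, 'r, 'i + 'a) fm set \<Rightarrow> ('f, 'r, 'i + 'a) fm set"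
  assumes "complete_theory L T"
    and "NIP L T TYPE('a)"
    and "monster L T \<kappa> C"
    and "monster L T \<kappa>' C'" and "elementary_sub L C C'" and "|Dom C| <o \<kappa>'"
    and "bij_betw c I (Dom C)"
    and "minimal_left_ideal (EL L C C' I c) M"
    and "u \<in> M" and "u \<otimes>\<^bsub>EL L C C' I c\<^esub> u = u"
    and "|M| <o \<kappa>"
  shows "restrict (F_hat L \<kappa>' C C' I c) (carrier (ideal_group (EL L C C' I c) M u))
           \<in> iso (ideal_group (EL L C C' I c) M u) (Gal_KP L \<kappa>' C')
         \<and> G_compact L \<kappa>' C' \<and> Autf_L L \<kappa>' C' = Autf_KP L \<kappa>' C'"
proof -
  interpret bounded_ideal L T C C' \<kappa> \<kappa>' I c M u
    by unfold_locales (fact assms)+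
  have "G_compact L \<kappa>' C'" unfolding G_compact_def KP_eq by simp
  then show ?thesis using F_hat_iso[OF assms(2)] KP_eq by simp
qed

end
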